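(* Let $r>0$ and let $a_0:[0,r]\to\mathbb R$ and $b_0:[0,r]\to S^1=\mathbb R/(2\pi\mathbb Z)$ be smooth ($C^\infty$) functions. Then: (1) There exists a unique asymptotic line parametrized K-surface $F:\Omega(r)\to\mathbb R^3$ whose characteristic angle $\phi:\Omega(r)\to S^1$ satisfies $\partial_x\phi(x,0)=a_0(x)$, $\phi(0,y)=b_0(y)$ for $x,y\in[0,r]$. (2) For any $\epsilon$ there exists a unique asymptotic line parametrized discrete K-surface $F^\epsilon:\Omega^\epsilon(r)\to\mathbb R^3$ whose data $(a^\epsilon,b^\epsilon)$ satisfy $a^\epsilon(x,0)=a_0(x)$, $b^\epsilon(0,y)=b_0(y)$ for $x,y\in[0,r-\epsilon]^\epsilon$ (in terms of the characteristic angle $\phi^\epsilon$: $\phi^\epsilon(x+\epsilon,0)-\phi^\epsilon(x,0)=\epsilon a_0(x)$ and $\phi^\epsilon(0,y+\epsilon)+\phi^\epsilon(0,y)=2b_0(y)$). (3) There is $C$ independent of $\epsilon$ with $\sup_{\Omega^\epsilon(r)}|F^\epsilon-F|\le C\epsilon$. Moreover, for every pair $(m,n)$ of nonnegative integers, with $k=m+n$, $$\sup_{\Omega^\epsilon(r-k\epsilon)}\big|(\delta_x^\epsilon)^m(\delta_y^\epsilon)^nF^\epsilon-\partial_x^m\partial_y^nF\big|\to0\quad\text{as }\epsilon\to0.$$ (4) For any $\Lambda>1$, the estimates in (3) still hold, uniformly for $\lambda\in[\Lambda^{-1},\Lambda]$, with $F,F^\epsilon$ replaced by the members $F_\lambda,F^\epsilon_\lambda$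 of their associated families. (5) If $\theta_1,\dots,\theta_R\in S^1$ are parameters of a sequence of Bäcklund transformations, then for the successively transformed surfaces (obtained from $F$ and from $F^\epsilon$ with these same parameters) estimates analogous to those in (3) hold.
   Context: $\Omega(r)=[0,r]^2$, $[0,r]^\epsilon=[0,r]\cap\epsilon\mathbb Z$, $\Omega^\epsilon(r)=[0,r]^\epsilon\times[0,r]^\epsilon$; $\epsilon$ takes only values $2^{-k}$, $k$ a positive integer. $\delta^\epsilon_x,\delta^\epsilon_y$ are the forward difference quotients with step $\epsilon$. $\mathfrak{su}(2)$ is identified with $\mathbb R^3$ via $(x_1,x_2,x_3)\leftrightarrow -i\sum_jx_j\sigma_j$ ($\sigma_j$ the Pauli matrices). Continuous K-surfaces (Gauss curvature $-1$, asymptotic line parametrization with $|\partial_xF|=|\partial_yF|=1$): the angle $\phi$ between $\partial_xF$ and $\partial_yF$ (characteristic angle) satisfies the sine-Gordon equation $\partial_x\partial_y\phi=\sin\phi$, and the surface is determined by $\phi$ up to Euclidean motions; it is normalized here as follows. For a solution $\phi$ let $a=\partial_x\phi$, $b=\phi$ (so $\partial_ya=\sin b$, $\partial_xb=a$), $$U(a;\lambda)=\tfrac i2\begin{pmatrix}a&-\lambda\\-\lambda&-a\end{pmatrix},\qquad V(b;\lambda)=\tfrac i2\begin{pmatrix}0&\lambda^{-1}e^{ib}\\\lambda^{-1}e^{-ib}&0\end{pmatrix},$$ and let $\Phi(x,y;\lambda)\in SU(2)$ ($\lambda\in\mathbb R\setminus\{0\}$) be the solution of $\partial_x\Phi=U\Phi$,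 $\partial_y\Phi=V\Phi$, $\Phi(0,0;\lambda)=\mathbf 1$. The associated family is $F_\lambda=2\lambda\Phi^{-1}\partial_\lambda\Phi$ and the K-surface is $F=F_1$. "The K-surface with characteristic angle $\phi$" means this $F$. Discrete K-surfaces: they are encoded by functions $a^\epsilon$ (real-valued) and $b^\epsilon$ ($S^1$-valued) on the horizontal, resp. vertical, edges of $\Omega^\epsilon(r)$ ($a^\epsilon(x,y)$ on the edge from $(x,y)$ to $(x+\epsilon,y)$, $b^\epsilon(x,y)$ on the edge from $(x,y)$ to $(x,y+\epsilon)$) satisfying $$\delta^\epsilon_ya=\frac{2}{i\epsilon^2}\log\frac{1-(\epsilon^2/4)e^{-ib-i\epsilon a/2}}{1-(\epsilon^2/4)e^{ib+i\epsilon a/2}},\qquad \delta^\epsilon_xb=a+\frac\epsilon2\,\delta^\epsilon_ya$$ (principal branch of $\log$). In terms of the characteristic angle $\phi^\epsilon$: $a^\epsilon=\delta^\epsilon_x\phi^\epsilon$, $b^\epsilon(x,y)=\frac12(\phi^\epsilon(x,y+\epsilon)+\phi^\epsilon(x,y))$, and the system is equivalent to Hirota's equation $$\sin\tfrac14\big(\phi(x+\epsilon,y+\epsilon)-\phi(x+\epsilon,y)-\phi(x,y+\epsilon)+\phi(x,y)\big)=\tfrac{\epsilon^2}4\sin\tfrac14\big(\phi(x+\epsilon,y+\epsilon)+\phi(x+\epsilon,y)+\phi(x,y+\epsilon)+\phi(x,y)\big).$$ With $$\mathcal U^\epsilon=(1+\tfrac{\epsilon^2\lambda^2}4)^{-1/2}\begin{pmatrix}e^{i\epsilon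 a/2}&-i\epsilon\lambda/2\\-i\epsilon\lambda/2&e^{-i\epsilon a/2}\end{pmatrix},\quad \mathcal V^\epsilon=(1+\tfrac{\epsilon^2}{4\lambda^2})^{-1/2}\begin{pmatrix}1&\frac{i\epsilon}{2\lambda}e^{ib}\\\frac{i\epsilon}{2\lambda}e^{-ib}&1\end{pmatrix}$$ let $\Psi^\epsilon$ solve $\Psi^\epsilon(x+\epsilon,y;\lambda)=\mathcal U^\epsilon(x,y;\lambda)\Psi^\epsilon(x,y;\lambda)$, $\Psi^\epsilon(x,y+\epsilon;\lambda)=\mathcal V^\epsilon(x,y;\lambda)\Psi^\epsilon(x,y;\lambda)$, $\Psi^\epsilon(0,0;\lambda)=\mathbf 1$. The associated family is $F^\epsilon_\lambda=2\lambda(\Psi^\epsilon)^{-1}\partial_\lambda\Psi^\epsilon$ and the discrete K-surface is $F^\epsilon=F^\epsilon_1$. (Geometrically: $F^\epsilon(x,y),F^\epsilon(x\pm\epsilon,y),F^\epsilon(x,y\pm\epsilon)$ are coplanar and all edges have length $\epsilon(1+\epsilon^2/4)^{-1}$.) Bäcklund transformations: fix a parameter $\alpha>0$. Put $\mathcal W(\theta;\lambda)=(\alpha^2+\lambda^2)^{-1/2}\begin{pmatrix}\alpha e^{i\theta}&-i\lambda\\-i\lambda&\alpha e^{-i\theta}\end{pmatrix}$. Given $(a,b)$ as in the continuous case and an initial value $\theta(0,0)\in S^1$, let $\theta:\Omega(r)\to S^1$ solve $\partial_x\theta=-a+\alpha\sin\theta$, $\partial_y\theta=\frac1\alpha\sin(b+\theta)$;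 the transformed data are $\tilde a=a+2\partial_x\theta$, $\tilde b=b+2\theta$, the frame is $\tilde\Phi=\mathcal W(\theta;\lambda)\Phi$, and $\tilde F=2\lambda\tilde\Phi^{-1}\partial_\lambda\tilde\Phi|_{\lambda=1}$. In the discrete case (for $\epsilon$ small enough that $\epsilon\alpha<2$ and $\epsilon<2\alpha$), $\theta$ solves $$\delta^\epsilon_x\theta=-a+\frac1{i\epsilon}\log\frac{1-(\epsilon\alpha/2)e^{-i\theta+i\epsilon a/2}}{1-(\epsilon\alpha/2)e^{i\theta-i\epsilon a/2}},\qquad \delta^\epsilon_y\theta=\frac1{i\epsilon}\log\frac{1-(\epsilon/2\alpha)e^{-ib-i\theta}}{1-(\epsilon/2\alpha)e^{ib+i\theta}}$$ (principal branch; $\epsilon\,\delta^\epsilon\theta$ denotes the increment of $\theta$ in $S^1$), $\tilde a=a+2\delta^\epsilon_x\theta$, $\tilde b=b+2\theta+\epsilon\delta^\epsilon_y\theta$, $\tilde\Psi^\epsilon=\mathcal W(\theta;\lambda)\Psi^\epsilon$, $\tilde F^\epsilon=2\lambda(\tilde\Psi^\epsilon)^{-1}\partial_\lambda\tilde\Psi^\epsilon|_{\lambda=1}$. A sequence of Bäcklund transformations with parameters $\theta_1,\dots,\theta_R$ applies this construction iteratively, the $j$-th step using the initial value $\theta(0,0)=\theta_j$. *)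

theory Defs
  imports "HOL-Analysis.Analysis"
begin

text \<open>
  Conventions. The circle \<open>\<real>/2\<pi>\<int>\<close> is represented by the unit circle in \<^typ>\<open>complex\<close> through
  \<open>t \<mapsto> cis t\<close>: an angle \<open>b\<close> is stored as \<open>e\<^sup>i\<^sup>b\<close>, so \<open>sin b\<close> is \<open>Im b\<close>, sums of angles are
  products, \<open>-b\<close> is \<open>cnj b\<close>, and adding a real increment \<open>t\<close> is multiplication by \<open>cis t\<close>.
  Functions on \<open>[0,r]\<^sup>2\<close> or on a grid in it are total curried functions whose values
  outside the domain are irrelevant; existence and uniqueness are always meant on the domain.
\<close>

section \<open>Smooth functions on the closed interval and the closed square\<close>

text \<open>Derivatives are one-sided at boundary points.\<close>

definition smooth_on_interval :: "real \<Rightarrow> (real \<Rightarrow> 'a::real_normed_vector) \<Rightarrow> bool" where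
  "smooth_on_interval r f \<longleftrightarrow>
     (\<exists>g :: nat \<Rightarrow> real \<Rightarrow> 'a.
        (\<forall>x\<in>{0..r}. g 0 x = f x) \<and>
        (\<forall>n. \<forall>x\<in>{0..r}. (g n has_vector_derivative g (Suc n) x) (at x within {0..r})))"

definition smooth_on_square :: "real \<Rightarrow> (real \<Rightarrow> real \<Rightarrow> 'a::real_normed_vector) \<Rightarrow> bool" where
  "smooth_on_square r f \<longleftrightarrow>
     (\<exists>g :: nat \<Rightarrow> nat \<Rightarrow> real \<Rightarrow> real \<Rightarrow> 'a.
        (\<forall>x\<in>{0..r}. \<forall>y\<in>{0..r}. g 0 0 x y = f x y) \<and>
        (\<forall>m n. continuous_on ({0..r} \<times> {0..r}) (\<lambda>(x, y). g m n x y)) \<and>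
        (\<forall>m n. \<forall>x\<in>{0..r}. \<forall>y\<in>{0..r}.
           ((\<lambda>s. g m n s y) has_vector_derivative g (Suc m) n x y) (at x within {0..r}) \<and>
           ((\<lambda>s. g m n x s) has_vector_derivative g m (Suc n) x y) (at y within {0..r})))"

definition pdx :: "real \<Rightarrow> (real \<Rightarrow> real \<Rightarrow> 'a::real_normed_vector) \<Rightarrow> real \<Rightarrow> real \<Rightarrow> 'a" where
  "pdx r f x y = vector_derivative (\<lambda>s. f s y) (at x within {0..r})"

definition pdy :: "real \<Rightarrow> (real \<Rightarrow> real \<Rightarrow> 'a::real_normed_vector) \<Rightarrow> real \<Rightarrow> real \<Rightarrow> 'a" where
  "pdy r f x y = vector_derivative (\<lambda>s. f x s) (at y within {0..r})"

text \<open>Partial derivatives of a circle-valued function: \<open>\<partial>(e\<^sup>i\<^sup>\<phi>) = i (\<partial>\<phi>) e\<^sup>i\<^sup>\<phi>\<close>.\<close>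

definition angle_pdx :: "real \<Rightarrow> (real \<Rightarrow> real \<Rightarrow> complex) \<Rightarrow> real \<Rightarrow> real \<Rightarrow> real" where
  "angle_pdx r \<phi> x y = Im (cnj (\<phi> x y) * pdx r \<phi> x y)"

definition angle_pdy :: "real \<Rightarrow> (real \<Rightarrow> real \<Rightarrow> complex) \<Rightarrow> real \<Rightarrow> real \<Rightarrow> real" where
  "angle_pdy r \<phi> x y = Im (cnj (\<phi> x y) * pdy r \<phi> x y)"

definition smooth_angle :: "real \<Rightarrow> (real \<Rightarrow> real \<Rightarrow> complex) \<Rightarrow> bool" where
  "smooth_angle r \<phi> \<longleftrightarrow>
     smooth_on_square r \<phi> \<and> (\<forall>x\<in>{0..r}. \<forall>y\<in>{0..r}. norm (\<phi> x y) = 1)"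

definition sine_Gordon :: "real \<Rightarrow> (real \<Rightarrow> real \<Rightarrow> complex) \<Rightarrow> bool" where
  "sine_Gordon r \<phi> \<longleftrightarrow>
     smooth_angle r \<phi> \<and>
     (\<forall>x\<in>{0..r}. \<forall>y\<in>{0..r}. pdx r (angle_pdy r \<phi>) x y = Im (\<phi> x y))"

definition Goursat_data ::
    "real \<Rightarrow> (real \<Rightarrow> real) \<Rightarrow> (real \<Rightarrow> complex) \<Rightarrow> (real \<Rightarrow> real \<Rightarrow> complex) \<Rightarrow> bool" where
  "Goursat_data r a0 b0 \<phi> \<longleftrightarrow>
     (\<forall>x\<in>{0..r}. angle_pdx r \<phi> x 0 = a0 x) \<and> (\<forall>y\<in>{0..r}. \<phi> 0 y = b0 y)"


section \<open>Frames and their immersions\<close>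

definition mat2 :: "complex \<Rightarrow> complex \<Rightarrow> complex \<Rightarrow> complex \<Rightarrow> complex^2^2" where
  "mat2 p q u v = vector [vector [p, q], vector [u, v]]"

definition SU2 :: "(complex^2^2) set" where
  "SU2 = {A. A ** map_matrix cnj (transpose A) = mat 1 \<and> det A = 1}"

text \<open>\<open>(x\<^sub>1, x\<^sub>2, x\<^sub>3) \<mapsto> -i (x\<^sub>1 \<sigma>\<^sub>1 + x\<^sub>2 \<sigma>\<^sub>2 + x\<^sub>3 \<sigma>\<^sub>3)\<close>, an injection with range \<open>su(2)\<close>.\<close>

definition su2_of_vec :: "real^3 \<Rightarrow> complex^2^2" where
  "su2_of_vec v = mat2 (- \<i> * v$3) (- \<i> * v$1 - v$2) (- \<i> * v$1 + v$2) (\<i> * v$3)"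

text \<open>The point \<open>2\<lambda> G\<inverse> \<partial>\<^sub>\<lambda>G\<close> of \<open>\<real>\<^sup>3\<close>, where \<open>G\<close> is a frame at a fixed \<open>(x,y)\<close> as a function of \<open>\<lambda>\<close>.\<close>

definition immersion :: "real \<Rightarrow> (real \<Rightarrow> complex^2^2) \<Rightarrow> real^3" where
  "immersion l G =
     the_inv su2_of_vec ((2 * l) *\<^sub>R (matrix_inv (G l) ** vector_derivative G (at l)))"


section \<open>Continuous K-surfaces\<close>

definition U_mat :: "real \<Rightarrow> real \<Rightarrow> complex^2^2" where
  "U_mat a l = mat2 (\<i> / 2 * a) (- (\<i> / 2 * l)) (- (\<i> / 2 * l)) (- (\<i> / 2 * a))"

definition V_mat :: "complex \<Rightarrow> real \<Rightarrow> complex^2^2" where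
  "V_mat b l = mat2 0 (\<i> / 2 * (b / l)) (\<i> / 2 * (cnj b / l)) 0"

definition frame ::
    "real \<Rightarrow> (real \<Rightarrow> real \<Rightarrow> real) \<Rightarrow> (real \<Rightarrow> real \<Rightarrow> complex)
      \<Rightarrow> (real \<Rightarrow> real \<Rightarrow> real \<Rightarrow> complex^2^2) \<Rightarrow> bool" where
  "frame r a b \<Phi> \<longleftrightarrow>
     (\<forall>l. l \<noteq> 0 \<longrightarrow>
        \<Phi> 0 0 l = mat 1 \<and>
        (\<forall>x\<in>{0..r}. \<forall>y\<in>{0..r}.
           \<Phi> x y l \<in> SU2 \<and>
           ((\<lambda>s. \<Phi> s y l) has_vector_derivative U_mat (a x y) l ** \<Phi> x y l) (at x within {0..r}) \<and>
           ((\<lambda>s. \<Phi> x s l) has_vector_derivative V_mat (b x y) l ** \<Phi> x y l) (at y within {0..r})))"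

text \<open>Gauss curvature \<open>(LN - M\<^sup>2) / (EG - F\<^sup>2)\<close> of a parametrized surface with unit normal field.\<close>

definition Gauss_curvature ::
    "real \<Rightarrow> (real \<Rightarrow> real \<Rightarrow> real^3) \<Rightarrow> (real \<Rightarrow> real \<Rightarrow> real^3) \<Rightarrow> real \<Rightarrow> real \<Rightarrow> real" where
  "Gauss_curvature r F N x y =
     ((pdx r (pdx r F) x y \<bullet> N x y) * (pdy r (pdy r F) x y \<bullet> N x y)
        - (pdx r (pdy r F) x y \<bullet> N x y)\<^sup>2)
     / ((pdx r F x y \<bullet> pdx r F x y) * (pdy r F x y \<bullet> pdy r F x y)
        - (pdx r F x y \<bullet> pdy r F x y)\<^sup>2)"

text \<open>
  Surfaces of curvature \<open>-1\<close> in asymptotic lines with unit tangent vectors enclosing the oriented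
  angle \<open>\<phi>\<close>. Where \<open>sin \<phi> = 0\<close> the map is not an immersion and has no Gauss curvature.
\<close>

definition asymptotic_K_surface ::
    "real \<Rightarrow> (real \<Rightarrow> real \<Rightarrow> complex) \<Rightarrow> (real \<Rightarrow> real \<Rightarrow> real^3) \<Rightarrow> bool" where
  "asymptotic_K_surface r \<phi> F \<longleftrightarrow>
     smooth_on_square r F \<and>
     (\<exists>N. smooth_on_square r N \<and>
        (\<forall>x\<in>{0..r}. \<forall>y\<in>{0..r}.
           norm (pdx r F x y) = 1 \<and> norm (pdy r F x y) = 1 \<and>
           norm (N x y) = 1 \<and> N x y \<bullet> pdx r F x y = 0 \<and> N x y \<bullet> pdy r F x y = 0 \<and>
           pdx r F x y \<bullet> pdy r F x y = Re (\<phi> x y) \<and>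
           cross3 (pdx r F x y) (pdy r F x y) = Im (\<phi> x y) *\<^sub>R N x y \<and>
           pdx r (pdx r F) x y \<bullet> N x y = 0 \<and> pdy r (pdy r F) x y \<bullet> N x y = 0 \<and>
           (Im (\<phi> x y) \<noteq> 0 \<longrightarrow> Gauss_curvature r F N x y = -1)))"

text \<open>The Euclidean motion, and the surface at degenerate angles, are fixed by the frame.\<close>

definition K_surface ::
    "real \<Rightarrow> (real \<Rightarrow> real \<Rightarrow> complex) \<Rightarrow> (real \<Rightarrow> real \<Rightarrow> real^3) \<Rightarrow> bool" where
  "K_surface r \<phi> F \<longleftrightarrow>
     sine_Gordon r \<phi> \<and> asymptotic_K_surface r \<phi> F \<and>
     (\<exists>\<Phi>. frame r (angle_pdx r \<phi>) \<phi> \<Phi> \<and>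
        (\<forall>x\<in>{0..r}. \<forall>y\<in>{0..r}. F x y = immersion 1 (\<Phi> x y)))"


section \<open>Discrete K-surfaces\<close>

definition mesh_sizes :: "real set" where
  "mesh_sizes = {(1 / 2) ^ k | k :: nat. k \<ge> 1}"

definition grid :: "real \<Rightarrow> real \<Rightarrow> real set" where
  "grid e r = {0..r} \<inter> range (\<lambda>n :: int. e * of_int n)"

definition dqx :: "real \<Rightarrow> (real \<Rightarrow> real \<Rightarrow> 'a::real_vector) \<Rightarrow> real \<Rightarrow> real \<Rightarrow> 'a" where
  "dqx e f x y = (f (x + e) y - f x y) /\<^sub>R e"

definition dqy :: "real \<Rightarrow> (real \<Rightarrow> real \<Rightarrow> 'a::real_vector) \<Rightarrow> real \<Rightarrow> real \<Rightarrow> 'a" where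
  "dqy e f x y = (f x (y + e) - f x y) /\<^sub>R e"

text \<open>
  Horizontal edges are indexed by \<open>grid e (r - e) \<times> grid e r\<close>, vertical edges by
  \<open>grid e r \<times> grid e (r - e)\<close>, elementary squares by \<open>grid e (r - e) \<times> grid e (r - e)\<close>.
\<close>

definition discrete_data ::
    "real \<Rightarrow> real \<Rightarrow> (real \<Rightarrow> real \<Rightarrow> real) \<Rightarrow> (real \<Rightarrow> real \<Rightarrow> complex) \<Rightarrow> bool" where
  "discrete_data e r a b \<longleftrightarrow>
     (\<forall>x\<in>grid e r. \<forall>y\<in>grid e (r - e). norm (b x y) = 1) \<and>
     (\<forall>x\<in>grid e (r - e). \<forall>y\<in>grid e (r - e).
        complex_of_real (dqy e a x y) =
          2 / (\<i> * e\<^sup>2) * Ln ((1 - e\<^sup>2 / 4 * cnj (b x y * cis (e * a x y / 2)))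
                              / (1 - e\<^sup>2 / 4 * (b x y * cis (e * a x y / 2)))) \<and>
        b (x + e) y = b x y * cis (e * (a x y + e / 2 * dqy e a x y)))"

definition discrete_boundary ::
    "real \<Rightarrow> real \<Rightarrow> (real \<Rightarrow> real) \<Rightarrow> (real \<Rightarrow> complex)
      \<Rightarrow> (real \<Rightarrow> real \<Rightarrow> real) \<Rightarrow> (real \<Rightarrow> real \<Rightarrow> complex) \<Rightarrow> bool" where
  "discrete_boundary e r a0 b0 a b \<longleftrightarrow>
     (\<forall>x\<in>grid e (r - e). a x 0 = a0 x) \<and> (\<forall>y\<in>grid e (r - e). b 0 y = b0 y)"

text \<open>
  A discrete characteristic angle is taken real-valued, since the mean of two elements
  of \<open>\<real>/2\<pi>\<int>\<close> is not well defined.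
\<close>

definition discrete_angle ::
    "real \<Rightarrow> real \<Rightarrow> (real \<Rightarrow> real \<Rightarrow> real) \<Rightarrow> (real \<Rightarrow> real \<Rightarrow> complex)
      \<Rightarrow> (real \<Rightarrow> real \<Rightarrow> real) \<Rightarrow> bool" where
  "discrete_angle e r a b \<phi> \<longleftrightarrow>
     (\<forall>x\<in>grid e (r - e). \<forall>y\<in>grid e r. a x y = dqx e \<phi> x y) \<and>
     (\<forall>x\<in>grid e r. \<forall>y\<in>grid e (r - e). b x y = cis ((\<phi> x (y + e) + \<phi> x y) / 2))"

definition dU_mat :: "real \<Rightarrow> real \<Rightarrow> real \<Rightarrow> complex^2^2" where
  "dU_mat e a l = (1 / sqrt (1 + e\<^sup>2 * l\<^sup>2 / 4)) *\<^sub>R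
     mat2 (cis (e * a / 2)) (- (\<i> * e * l / 2)) (- (\<i> * e * l / 2)) (cis (- (e * a / 2)))"

definition dV_mat :: "real \<Rightarrow> complex \<Rightarrow> real \<Rightarrow> complex^2^2" where
  "dV_mat e b l = (1 / sqrt (1 + e\<^sup>2 / (4 * l\<^sup>2))) *\<^sub>R
     mat2 1 (\<i> * e / (2 * l) * b) (\<i> * e / (2 * l) * cnj b) 1"

definition discrete_frame ::
    "real \<Rightarrow> real \<Rightarrow> (real \<Rightarrow> real \<Rightarrow> real) \<Rightarrow> (real \<Rightarrow> real \<Rightarrow> complex)
      \<Rightarrow> (real \<Rightarrow> real \<Rightarrow> real \<Rightarrow> complex^2^2) \<Rightarrow> bool" where
  "discrete_frame e r a b \<Psi> \<longleftrightarrow>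
     (\<forall>l. l \<noteq> 0 \<longrightarrow>
        \<Psi> 0 0 l = mat 1 \<and>
        (\<forall>x\<in>grid e (r - e). \<forall>y\<in>grid e r. \<Psi> (x + e) y l = dU_mat e (a x y) l ** \<Psi> x y l) \<and>
        (\<forall>x\<in>grid e r. \<forall>y\<in>grid e (r - e). \<Psi> x (y + e) l = dV_mat e (b x y) l ** \<Psi> x y l))"

definition asymptotic_discrete_K_surface ::
    "real \<Rightarrow> real \<Rightarrow> (real \<Rightarrow> real \<Rightarrow> real^3) \<Rightarrow> bool" where
  "asymptotic_discrete_K_surface e r F \<longleftrightarrow>
     (\<forall>x\<in>grid e (r - e). \<forall>y\<in>grid e r. dist (F x y) (F (x + e) y) = e / (1 + e\<^sup>2 / 4)) \<and>
     (\<forall>x\<in>grid e r. \<forall>y\<in>grid e (r - e). dist (F x y) (F x (y + e)) = e / (1 + e\<^sup>2 / 4)) \<and>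
     (\<forall>x\<in>grid e r. \<forall>y\<in>grid e r.
        coplanar ((\<lambda>(s, t). F s t) `
          ({(x, y), (x + e, y), (x - e, y), (x, y + e), (x, y - e)} \<inter> grid e r \<times> grid e r)))"

definition discrete_K_surface ::
    "real \<Rightarrow> real \<Rightarrow> (real \<Rightarrow> real \<Rightarrow> real) \<Rightarrow> (real \<Rightarrow> real \<Rightarrow> complex)
      \<Rightarrow> (real \<Rightarrow> real \<Rightarrow> real^3) \<Rightarrow> bool" where
  "discrete_K_surface e r a b F \<longleftrightarrow>
     discrete_data e r a b \<and> asymptotic_discrete_K_surface e r F \<and>
     (\<exists>\<Psi>. discrete_frame e r a b \<Psi> \<and>
        (\<forall>x\<in>grid e r. \<forall>y\<in>grid e r. F x y = immersion 1 (\<Psi> x y)))"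


section \<open>Backlund transformations\<close>

definition W_mat :: "real \<Rightarrow> complex \<Rightarrow> real \<Rightarrow> complex^2^2" where
  "W_mat \<alpha> \<theta> l = (1 / sqrt (\<alpha>\<^sup>2 + l\<^sup>2)) *\<^sub>R mat2 (\<alpha> * \<theta>) (- (\<i> * l)) (- (\<i> * l)) (\<alpha> * cnj \<theta>)"

text \<open>Data \<open>(a, b)\<close> together with a frame.\<close>

type_synonym framed_data =
  "(real \<Rightarrow> real \<Rightarrow> real) \<times> (real \<Rightarrow> real \<Rightarrow> complex) \<times> (real \<Rightarrow> real \<Rightarrow> real \<Rightarrow> complex^2^2)"

fun Backlund :: "real \<Rightarrow> real \<Rightarrow> complex \<Rightarrow> framed_data \<Rightarrow> framed_data \<Rightarrow> bool" where
  "Backlund r \<alpha> \<theta>0 (a, b, \<Phi>) (a', b', \<Phi>') \<longleftrightarrow>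
     (\<exists>\<theta>. smooth_angle r \<theta> \<and> \<theta> 0 0 = \<theta>0 \<and>
        (\<forall>x\<in>{0..r}. \<forall>y\<in>{0..r}.
           angle_pdx r \<theta> x y = - a x y + \<alpha> * Im (\<theta> x y) \<and>
           angle_pdy r \<theta> x y = 1 / \<alpha> * Im (b x y * \<theta> x y) \<and>
           a' x y = a x y + 2 * angle_pdx r \<theta> x y \<and>
           b' x y = b x y * (\<theta> x y)\<^sup>2 \<and>
           (\<forall>l. \<Phi>' x y l = W_mat \<alpha> (\<theta> x y) l ** \<Phi> x y l)))"

text \<open>\<open>p\<close> and \<open>q\<close> are the real difference quotients of \<open>\<theta>\<close> in the two directions.\<close>

fun discrete_Backlund ::
    "real \<Rightarrow> real \<Rightarrow> real \<Rightarrow> complex \<Rightarrow> framed_data \<Rightarrow> framed_data \<Rightarrow> bool" where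
  "discrete_Backlund e r \<alpha> \<theta>0 (a, b, \<Psi>) (a', b', \<Psi>') \<longleftrightarrow>
     (\<exists>(\<theta> :: real \<Rightarrow> real \<Rightarrow> complex) (p :: real \<Rightarrow> real \<Rightarrow> real) (q :: real \<Rightarrow> real \<Rightarrow> real).
        \<theta> 0 0 = \<theta>0 \<and>
        (\<forall>x\<in>grid e (r - e). \<forall>y\<in>grid e r.
           complex_of_real (p x y) = - complex_of_real (a x y) +
             1 / (\<i> * e) * Ln ((1 - e * \<alpha> / 2 * (cnj (\<theta> x y) * cis (e * a x y / 2)))
                               / (1 - e * \<alpha> / 2 * (\<theta> x y * cis (- (e * a x y / 2))))) \<and>
           \<theta> (x + e) y = \<theta> x y * cis (e * p x y) \<and>
           a' x y = a x y + 2 * p x y) \<and>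
        (\<forall>x\<in>grid e r. \<forall>y\<in>grid e (r - e).
           complex_of_real (q x y) =
             1 / (\<i> * e) * Ln ((1 - e / (2 * \<alpha>) * cnj (b x y * \<theta> x y))
                               / (1 - e / (2 * \<alpha>) * (b x y * \<theta> x y))) \<and>
           \<theta> x (y + e) = \<theta> x y * cis (e * q x y) \<and>
           b' x y = b x y * (\<theta> x y)\<^sup>2 * cis (e * q x y)) \<and>
        (\<forall>x\<in>grid e r. \<forall>y\<in>grid e r.
           norm (\<theta> x y) = 1 \<and> (\<forall>l. \<Psi>' x y l = W_mat \<alpha> (\<theta> x y) l ** \<Psi> x y l)))"

text \<open>\<open>iterated T [\<theta>\<^sub>1, \<dots>, \<theta>\<^sub>R]\<close>: the \<open>j\<close>-th step uses the parameter \<open>\<theta>\<^sub>j\<close>.\<close>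

fun iterated :: "('p \<Rightarrow> 's \<Rightarrow> 's \<Rightarrow> bool) \<Rightarrow> 'p list \<Rightarrow> 's \<Rightarrow> 's \<Rightarrow> bool" where
  "iterated T [] s s' \<longleftrightarrow> s' = s"
| "iterated T (t # ts) s s' \<longleftrightarrow> (\<exists>u. T t s u \<and> iterated T ts u s')"

fun surface_of :: "real \<Rightarrow> framed_data \<Rightarrow> real \<Rightarrow> real \<Rightarrow> real^3" where
  "surface_of l (a, b, \<Phi>) = (\<lambda>x y. immersion l (\<Phi> x y))"

definition Backlund_mesh_sizes :: "real \<Rightarrow> real set" where
  "Backlund_mesh_sizes \<alpha> = {e \<in> mesh_sizes. e * \<alpha> < 2 \<and> e < 2 * \<alpha>}"


section \<open>Approximation\<close>

text \<open>
  The error estimates for a family of surfaces \<open>F i\<close> and approximants \<open>Fe e i\<close>, for the step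
  sizes \<open>e \<in> E\<close> and uniformly in \<open>i \<in> I\<close>; suprema over finite grids are spelled out pointwise.
\<close>

definition approximates ::
    "real \<Rightarrow> real set \<Rightarrow> 'i set \<Rightarrow> (real \<Rightarrow> 'i \<Rightarrow> real \<Rightarrow> real \<Rightarrow> real^3)
      \<Rightarrow> ('i \<Rightarrow> real \<Rightarrow> real \<Rightarrow> real^3) \<Rightarrow> bool" where
  "approximates r E I Fe F \<longleftrightarrow>
     (\<exists>C. \<forall>e\<in>E. \<forall>i\<in>I. \<forall>x\<in>grid e r. \<forall>y\<in>grid e r. norm (Fe e i x y - F i x y) \<le> C * e) \<and>
     (\<forall>m n. \<forall>\<eta>>0. \<exists>e0>0. \<forall>e\<in>E. e < e0 \<longrightarrow>
        (\<forall>i\<in>I. \<forall>x\<in>grid e (r - real (m + n) * e). \<forall>y\<in>grid e (r - real (m + n) * e).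
           norm ((dqx e ^^ m) ((dqy e ^^ n) (Fe e i)) x y
                 - (pdx r ^^ m) ((pdy r ^^ n) (F i)) x y) \<le> \<eta>))"

end

theory Submission
  imports Defs "HOL-Complex_Analysis.Great_Picard"
begin

text \<open>
  In the unimodular variables \<open>e\<^sup>i\<^sup>\<epsilon>\<^sup>a\<^sup>/\<^sup>2\<close>, \<open>e\<^sup>i\<^sup>b\<close>, \<open>e\<^sup>i\<^sup>\<theta>\<close> the discrete equations form rational systems with denominators
  bounded away from zero. Differencing such a system gives a linear one for the highest difference quotients, so the
  discrete Gronwall inequality bounds all difference quotients of the solutions uniformly in \<open>\<epsilon>\<close>. A subsequence
  then converges together with all its difference quotients, which yields the smooth solution of the Goursat problem.
  Comparing the discrete equations with the differential ones, Gronwall again gives an error \<open>O(\<epsilon>)\<close> along the full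
  family, and a uniformly small function with bounded second differences has small first differences, which gives
  convergence of all difference quotients. The immersion is treated in the same way: with \<open>\<Phi>\<close> acting on \<open>su(2)\<close> by
  rotations, \<open>F\<^sub>\<lambda>\<close> solves a linear system whose coefficients are algebraic in \<open>\<Phi>\<close>, so \<open>\<lambda>\<close>-derivatives need not be
  compared. A transformation step is another rational system, and the bounds and errors it needs are reproduced
  by its output, so it can be iterated.
\<close>

text \<open>The Goursat system is hyperbolic: \<open>a\<close> is propagated in y only and
  \<open>b\<close> in x only. The difference quotient of an unknown in its missing direction comes
  from differencing its own equation, whose source then contains what the other equation supplies;
  leftover terms of too high order carry a factor \<open>e\<close>, and multiplying by
  \<open>e\<close> undoes one difference. Since no single grid line carries a closed inequality,
  errors are propagated along antidiagonals. Subsequences give existence only. Uniqueness of the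
  continuous surface is not proved from the differential equations: two surfaces with the same data
  are limits of one discrete family and therefore agree. For the same reason a subsequence may
  depend on the spectral parameter. A continuous frame solves its equations for each spectral
  parameter separately, so regularity in the parameter has to be derived before the immersion can be
  computed. The quotient of two frames with nearby parameters solves a linear system with small
  coefficients, and integrating this system twice gives the first-order expansion.\<close>

text \<open>A grid function \<open>u e i x y\<close> lives at the point \<open>(e x, e y)\<close>; the index \<open>i\<close> is the spectral parameter.\<close>

type_synonym ('i, 'a) family = "real => 'i => nat => nat => 'a"
type_synonym ('i, 'a) field2 = "'i => real => real => 'a"

abbreviation (input) mesh_point :: "real => nat => real" (infixl "*." 70) where
 "e *. n == e * real n"

lemmas has_vector_derivative_linear = bounded_linear.has_vector_derivative

section \<open>Difference quotients, shifts and reflection of grid families\<close>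

definition dx :: "('i, 'a::real_vector) family => ('i, 'a) family" where
 "dx u e i x y = (u e i (Suc x) y - u e i x y) /\<^sub>R e"

definition dy :: "('i, 'a::real_vector) family => ('i, 'a) family" where
 "dy u e i x y = (u e i x (Suc y) - u e i x y) /\<^sub>R e"

definition sx :: "('i, 'a) family => ('i, 'a) family" where
 "sx u e i x y = u e i (Suc x) y"

definition sy :: "('i, 'a) family => ('i, 'a) family" where
 "sy u e i x y = u e i x (Suc y)"

definition transp :: "('i, 'a) family => ('i, 'a) family" where
 "transp u e i x y = u e i y x"

lemma transp_transp [simp]: "transp (transp u) = u"
 by (simp add: transp_def fun_eq_iff)

lemma dx_transp: "dx (transp u) = transp (dy u)" and dy_transp: "dy (transp u) = transp (dx u)"
 by (simp_all add: transp_def dx_def dy_def fun_eq_iff)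

lemma dx_sx: "dx (sx u) = sx (dx u)" and dy_sx: "dy (sx u) = sx (dy u)"
 and dx_sy: "dx (sy u) = sy (dx u)" and dy_sy: "dy (sy u) = sy (dy u)"
 by (simp_all add: sx_def sy_def dx_def dy_def fun_eq_iff)

lemma dx_dy: "dx (dy u) = dy (dx u)"
 by (simp add: dx_def dy_def fun_eq_iff algebra_simps)

definition steps :: "real => real => nat" where
 "steps r e = nat \<lfloor>r / e\<rfloor>"

lemma le_steps_iff:
 assumes "0 < e" "0 <= r" shows "n <= steps r e \<longleftrightarrow> e *. n <= r"
proof -
 have "n <= steps r e \<longleftrightarrow> int n <= \<lfloor>r / e\<rfloor>"
  using assms by (simp add: steps_def le_nat_iff)
 also have "\<dots> \<longleftrightarrow> real n <= r / e" by (simp add: le_floor_iff)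
 finally show ?thesis using assms by (simp add: field_simps)
qed

lemma mesh_sizes_bounds: "e : mesh_sizes ==> 0 < e & e <= 1/2"
proof -
 assume "e : mesh_sizes"
 then obtain k :: nat where k: "e = (1/2)^k" "k >= 1" by (auto simp: mesh_sizes_def)
 have "(1/2::real)^k <= (1/2)^1" using k by (intro power_decreasing) auto
 with k show ?thesis by simp
qed

text \<open>Only a homogeneous inequality is iterated. Where an inhomogeneous term occurs, a
  constant is added to the norm being estimated (1 for bounds, the step \<open>e\<close> for
  errors), so that the term is absorbed into the growth factor \<open>1 + e * L\<close>.\<close>

lemma gronwall_steps:
 fixes w :: "nat => real"
 assumes "e > 0" "L >= 0" "e *. n <= r" "w 0 <= c" "c >= 0"
  and step: "!!m. m < n ==> w (Suc m) <= (1 + e * L) * w m"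
 shows "w n <= exp (L * r) * c"
proof -
 have "w m <= (1 + e * L) ^ m * c" if "m <= n" for m
  using that
 proof (induction m)
  case (Suc m)
  then have "w (Suc m) <= (1 + e * L) * w m" by (intro step) simp
  also have "\<dots> <= (1 + e * L) * ((1 + e * L) ^ m * c)"
   using Suc assms(1,2) by (intro mult_left_mono) auto
  finally show ?case by (simp add: mult.assoc)
 qed (use assms(4) in simp)
 then have "w n <= (1 + e * L) ^ n * c" by simp
 also have "(1 + e * L) ^ n <= exp (e * L) ^ n"
  using assms(1,2) by (intro power_mono) auto
 also have "\<dots> = exp (L * (e *. n))" by (simp add: exp_of_nat_mult[symmetric] mult_ac)
 also have "\<dots> <= exp (L * r)" using assms(2,3) by (auto intro: mult_left_mono)
 finally show ?thesis using assms(5) by (simp add: mult_right_mono)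
qed

section \<open>Bounds on difference quotients, uniform in step and parameter\<close>

locale grid_families =
 fixes r :: real and E :: "real set" and I :: "'i set"
 assumes r_pos: "0 < r" and E_mesh: "E \<subseteq> mesh_sizes"
begin

abbreviation N :: "real => nat" where "N e == steps r e"

lemma E_bounds: "e : E ==> 0 < e" "e : E ==> e <= 1/2" "e : E ==> e <= 1" "e : E ==> e ~= 0"
 using E_mesh mesh_sizes_bounds by fastforce+

lemma N_iff: "e : E ==> n <= N e \<longleftrightarrow> e *. n <= r"
 using le_steps_iff r_pos E_bounds by (simp add: less_imp_le)

text \<open>The margins \<open>p\<close> and \<open>q\<close> are the numbers of grid lines lost on the right and at the top.\<close>

definition bdd :: "nat => nat => ('i, 'a::real_normed_vector) family => bool" where
 "bdd p q u \<longleftrightarrow> (EX C. ALL e:E. ALL i:I. ALL x y. x + p <= N e --> y + q <= N e --> norm (u e i x y) <= C)"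

text \<open>All mixed difference quotients of total order at most \<open>k\<close>. A difference
  needs one more grid line in its direction, hence the larger margin in the recursive call. The
  closure properties below follow by induction on \<open>k\<close> from one discrete differentiation
  rule each.\<close>

primrec bd :: "nat => nat => nat => ('i, 'a::real_normed_vector) family => bool" where
 "bd 0 p q u = bdd p q u"
| "bd (Suc k) p q u = (bdd p q u & bd k (Suc p) q (dx u) & bd k p (Suc q) (dy u))"

lemma bddI:
 assumes "!!e i x y. e : E ==> i : I ==> x + p <= N e ==> y + q <= N e ==> norm (u e i x y) <= C"
 shows "bdd p q u"
 using assms unfolding bdd_def by blast

lemma bddE:
 assumes "bdd p q u"
 obtains C where "C > 0" "!!e i x y. e : E ==> i : I ==> x + p <= N e ==> y + q <= N e ==> norm (u e i x y) <= C"
proof -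
 from assms obtain C where C: "!!e i x y. e : E ==> i : I ==> x + p <= N e ==> y + q <= N e ==> norm (u e i x y) <= C"
  unfolding bdd_def by blast
 show ?thesis
  by (rule that[of "max C 1"]) (auto intro: order_trans[OF C])
qed

lemma bd_bdd: "bd k p q u ==> bdd p q u"
 by (cases k) auto

lemma bd_Suc_D: "bd (Suc k) p q u ==> bd k p q u"
proof (induction k arbitrary: p q u)
 case (Suc k)
 then have "bd k (Suc p) q (dx u)" "bd k p (Suc q) (dy u)" "bdd p q u"
  by (simp_all only: bd.simps(2)[of "Suc k"])
 then show ?case by (simp only: bd.simps)
qed simp

lemma bdd_mono:
 assumes "bdd p q u" "p <= p'" "q <= q'" shows "bdd p' q' u"
proof -
 from assms(1) obtain C where C: "!!e i x y. e : E ==> i : I ==> x + p <= N e ==> y + q <= N e ==> norm (u e i x y) <= C"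
  by (rule bddE) blast
 show ?thesis by (rule bddI[of _ _ _ C], rule C) (use assms(2,3) in auto)
qed

lemma bd_mono: "bd k p q u ==> p <= p' ==> q <= q' ==> bd k p' q' u"
proof (induction k arbitrary: p q p' q' u)
 case (Suc k)
 have "bd k (Suc p') q' (dx u)" by (rule Suc.IH[of "Suc p" q]) (use Suc.prems in auto)
 moreover have "bd k p' (Suc q') (dy u)" by (rule Suc.IH[of p "Suc q"]) (use Suc.prems in auto)
 ultimately show ?case using Suc.prems bdd_mono by auto
qed (auto intro: bdd_mono)

lemma bdd_cong:
 assumes "bdd p q u"
  and eq: "!!e i x y. e : E ==> i : I ==> x + p <= N e ==> y + q <= N e ==> v e i x y = u e i x y"
 shows "bdd p q v"
proof -
 obtain C where C: "!!e i x y. e : E ==> i : I ==> x + p <= N e ==> y + q <= N e ==> norm (u e i x y) <= C"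
  using assms(1) unfolding bdd_def by blast
 show ?thesis by (rule bddI[of _ _ _ C]) (simp add: eq C)
qed

text \<open>The differences counted by \<open>bd\<close> never leave the margin, so agreement inside
  it suffices; outside, the values of a grid family are arbitrary.\<close>

lemma bd_cong:
 assumes "bd k p q u"
  and "!!e i x y. e : E ==> i : I ==> x + p <= N e ==> y + q <= N e ==> v e i x y = u e i x y"
 shows "bd k p q v"
 using assms
proof (induction k arbitrary: p q u v)
 case 0
 show ?case unfolding bd.simps by (rule bdd_cong[OF _ 0(2)]) (use 0(1) in simp)
next
 case (Suc k)
 have "bdd p q v" by (rule bdd_cong[OF _ Suc.prems(2)]) (use Suc.prems(1) in simp)
 moreover have "bd k (Suc p) q (dx v)"
 proof (rule Suc.IH)
  show "bd k (Suc p) q (dx u)" using Suc.prems(1) by simp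
 qed (simp add: dx_def Suc.prems(2))
 moreover have "bd k p (Suc q) (dy v)"
 proof (rule Suc.IH)
  show "bd k p (Suc q) (dy u)" using Suc.prems(1) by simp
 qed (simp add: dy_def Suc.prems(2))
 ultimately show ?case by simp
qed

lemma bdd_transp: "bdd p q u ==> bdd q p (transp u)"
 unfolding bdd_def transp_def by blast

lemma bd_transp: "bd k p q u ==> bd k q p (transp u)"
 by (induction k arbitrary: p q u) (auto simp: dx_transp dy_transp bdd_transp)

lemma bdd_add:
 assumes "bdd p q u" "bdd p q v" shows "bdd p q (%e i x y. u e i x y + v e i x y)"
proof -
 obtain C D where "!!e i x y. e : E ==> i : I ==> x + p <= N e ==> y + q <= N e ==> norm (u e i x y) <= C"
  "!!e i x y. e : E ==> i : I ==> x + p <= N e ==> y + q <= N e ==> norm (v e i x y) <= D"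
  using assms unfolding bdd_def by blast
 then show ?thesis by (intro bddI[of _ _ _ "C + D"] norm_triangle_mono)
qed

lemma bd_add: "bd k p q u ==> bd k p q v ==> bd k p q (%e i x y. u e i x y + v e i x y)"
proof (induction k arbitrary: p q u v)
 case (Suc k)
 have "dx (%e i x y. u e i x y + v e i x y) = (%e i x y. dx u e i x y + dx v e i x y)"
  "dy (%e i x y. u e i x y + v e i x y) = (%e i x y. dy u e i x y + dy v e i x y)"
  by (simp_all add: dx_def dy_def fun_eq_iff algebra_simps)
 with Suc show ?case by (simp add: bdd_add)
qed (simp add: bdd_add)

lemma bdd_linear:
 assumes "bounded_linear f" "bdd p q u"
 shows "bdd p q (%e i x y. f (u e i x y))"
proof -
 interpret bounded_linear f by fact
 obtain K where K: "K > 0" "!!x. norm (f x) <= norm x * K" using pos_bounded by blast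
 obtain C where C: "!!e i x y. e : E ==> i : I ==> x + p <= N e ==> y + q <= N e ==> norm (u e i x y) <= C"
  using assms(2) unfolding bdd_def by blast
 show ?thesis
  by (rule bddI[of _ _ _ "C * K"], rule order_trans[OF K(2)]) (use K C in \<open>auto intro: mult_right_mono\<close>)
qed

lemma bd_linear:
 assumes "bounded_linear f"
 shows "bd k p q u ==> bd k p q (%e i x y. f (u e i x y))"
proof (induction k arbitrary: p q u)
 case (Suc k)
 interpret bounded_linear f by fact
 have "dx (%e i x y. f (u e i x y)) = (%e i x y. f (dx u e i x y))"
  "dy (%e i x y. f (u e i x y)) = (%e i x y. f (dy u e i x y))"
  by (simp_all add: dx_def dy_def fun_eq_iff scaleR diff)
 with Suc bdd_linear[OF assms] show ?case by simp
qed (simp add: bdd_linear[OF assms])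

lemma bd_diff: "bd k p q u ==> bd k p q v ==> bd k p q (%e i x y. u e i x y - v e i x y)"
 using bd_add[of k p q u "%e i x y. - v e i x y"]
  bd_linear[OF bounded_linear_minus[OF bounded_linear_ident], of k p q v] by simp

lemma bdd_sx: "bdd p q u ==> bdd (Suc p) q (sx u)" and bdd_sy: "bdd p q u ==> bdd p (Suc q) (sy u)"
 unfolding bdd_def sx_def sy_def by (simp_all add: add_Suc[symmetric] del: add_Suc) blast+

lemma bd_sx: "bd k p q u ==> bd k (Suc p) q (sx u)"
proof (induction k arbitrary: p q u)
 case 0 then show ?case by (simp add: bdd_sx)
next
 case (Suc k)
 have "bdd (Suc p) q (sx u)" using Suc.prems by (simp add: bdd_sx)
 with Suc show ?case by (simp add: dx_sx dy_sx)
qed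

lemma bd_sy: "bd k p q u ==> bd k p (Suc q) (sy u)"
proof (induction k arbitrary: p q u)
 case 0 then show ?case by (simp add: bdd_sy)
next
 case (Suc k)
 have "bdd p (Suc q) (sy u)" using Suc.prems by (simp add: bdd_sy)
 with Suc show ?case by (simp add: dx_sy dy_sy)
qed

lemma bdd_bilinear:
 assumes "bounded_bilinear bl" "bdd p q u" "bdd p q v"
 shows "bdd p q (%e i x y. bl (u e i x y) (v e i x y))"
proof -
 interpret bounded_bilinear bl by fact
 obtain K where K: "K > 0" "!!a b. norm (bl a b) <= norm a * norm b * K"
  using pos_bounded by blast
 from assms(2) obtain C where C: "C > 0" "!!e i x y. e : E ==> i : I ==> x + p <= N e ==> y + q <= N e ==> norm (u e i x y) <= C"
  by (rule bddE) blast
 from assms(3) obtain D where D: "D > 0" "!!e i x y. e : E ==> i : I ==> x + p <= N e ==> y + q <= N e ==> norm (v e i x y) <= D"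
  by (rule bddE) blast
 show ?thesis
  by (rule bddI[of _ _ _ "C * D * K"], rule order_trans[OF K(2)])
   (use K C D in \<open>auto intro!: mult_mono simp: less_imp_le\<close>)
qed

text \<open>Discrete product rule: one factor appears shifted. The shift costs the same single grid
  line as the difference quotient, so both summands fit into the margin that the induction
  allows.\<close>

lemma bd_bilinear:
 assumes "bounded_bilinear bl"
 shows "bd k p q u ==> bd k p q v ==> bd k p q (%e i x y. bl (u e i x y) (v e i x y))"
proof (induction k arbitrary: p q u v)
 case 0
 then show ?case using bdd_bilinear[OF assms] by simp
next
 case (Suc k)
 interpret bounded_bilinear bl by fact
 let ?w = "%e i x y. bl (u e i x y) (v e i x y)"
 have x: "dx ?w = (%e i x y. bl (dx u e i x y) (v e i x y) + bl (sx u e i x y) (dx v e i x y))"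
  by (simp add: dx_def sx_def fun_eq_iff diff_left diff_right scaleR_left scaleR_right scaleR_diff_right)
 have y: "dy ?w = (%e i x y. bl (dy u e i x y) (v e i x y) + bl (sy u e i x y) (dy v e i x y))"
  by (simp add: dy_def sy_def fun_eq_iff diff_left diff_right scaleR_left scaleR_right scaleR_diff_right)
 have uv: "bd k p q u" "bd k p q v" using Suc.prems bd_Suc_D by blast+
 have "bd k (Suc p) q (dx ?w)" unfolding x
  using Suc.prems uv by (intro bd_add Suc.IH) (auto intro: bd_sx bd_mono)
 moreover have "bd k p (Suc q) (dy ?w)" unfolding y
  using Suc.prems uv by (intro bd_add Suc.IH) (auto intro: bd_sy bd_mono)
 ultimately show ?case using Suc.prems bdd_bilinear[OF assms] by simp
qed

lemmas bd_mult = bd_bilinear[OF bounded_bilinear_mult]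
lemmas bd_scaleR = bd_bilinear[OF bounded_bilinear_scaleR]
lemmas bd_cnj = bd_linear[OF bounded_linear_cnj]

lemma dx_const: "dx (%e i x y. c e i) = (%e i x y. 0)" and dy_const: "dy (%e i x y. c e i) = (%e i x y. 0)"
 by (simp_all add: fun_eq_iff dx_def dy_def)

lemma bd_param:
 assumes "!!e i. e : E ==> i : I ==> norm (c e i) <= C"
 shows "bd k p q (%e i x y. c e i)"
proof -
 have z: "bd k p q (%e i x y. 0::'a)" for k p q
  by (induction k arbitrary: p q) (auto simp: dx_const dy_const bdd_def)
 have "bdd p q (%e i x y. c e i)" for p q using assms by (auto simp: bdd_def)
 then show ?thesis by (cases k) (auto simp: dx_const dy_const z)
qed

lemma bd_const: "bd k p q (%e i x y. c)"
 by (rule bd_param[of _ "norm c"]) simp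

lemma bd_step: "bd k p q (%e i x y. complex_of_real e)"
 by (rule bd_param[of _ 1]) (use E_bounds in \<open>auto simp: less_imp_le\<close>)

text \<open>The difference quotient of \<open>1 / u\<close> is \<open>- dx u\<close> times the
  values of \<open>1 / u\<close> at the two end points, so the induction reduces it to products of
  families already bounded.\<close>

lemma bd_inverse:
 fixes u :: "('i, complex) family"
 assumes "c > 0"
 shows "bd k p q u ==>
   (!!e i x y. e : E ==> i : I ==> x + p <= N e ==> y + q <= N e ==> norm (u e i x y) >= c) ==>
   bd k p q (%e i x y. inverse (u e i x y))"
proof (induction k arbitrary: p q u)
 case 0
 then show ?case using assms
  by (simp, intro bddI[of _ _ _ "inverse c"]) (auto simp: norm_inverse intro!: le_imp_inverse_le)
next
 case (Suc k)
 let ?w = "%e i x y. inverse (u e i x y)"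
 have u: "bd k p q u" using Suc.prems(1) bd_Suc_D by blast
 have w: "bd k p q ?w" by (rule Suc.IH[OF u Suc.prems(2)])
 have nz: "u e i x y ~= 0" if "e : E" "i : I" "x + p <= N e" "y + q <= N e" for e i x y
  using Suc.prems(2)[OF that] assms by auto
 have "bd k (Suc p) q (%e i x y. - (dx u e i x y * (?w e i x y * sx ?w e i x y)))"
  using Suc.prems(1) w
  by (intro bd_linear[OF bounded_linear_minus[OF bounded_linear_ident]] bd_mult) (auto intro: bd_sx bd_mono)
 then have x: "bd k (Suc p) q (dx ?w)"
  by (rule bd_cong) (auto simp: dx_def sx_def nz inverse_diff_inverse scaleR_conv_of_real mult_ac)
 have "bd k p (Suc q) (%e i x y. - (dy u e i x y * (?w e i x y * sy ?w e i x y)))"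
  using Suc.prems(1) w
  by (intro bd_linear[OF bounded_linear_minus[OF bounded_linear_ident]] bd_mult) (auto intro: bd_sy bd_mono)
 then have y: "bd k p (Suc q) (dy ?w)"
  by (rule bd_cong) (auto simp: dy_def sy_def nz inverse_diff_inverse scaleR_conv_of_real mult_ac)
 show ?case using x y w bd_bdd by auto
qed

lemma bdd_linear_evolution:
 fixes u :: "('i, complex) family"
 assumes P: "bdd p (Suc q) P" and Q: "bdd p (Suc q) Q"
  and init: "bdd p 0 (%e i x y. u e i x 0)"
  and eq: "!!e i x y. e : E ==> i : I ==> x + p <= N e ==> y + Suc q <= N e ==>
    dy u e i x y = P e i x y * u e i x y + Q e i x y"
 shows "bdd p q u"
proof -
 from P obtain C where C: "C > 0" "!!e i x y. e : E ==> i : I ==> x + p <= N e ==> y + Suc q <= N e ==> norm (P e i x y) <= C"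
  by (rule bddE) blast
 from Q obtain D where D: "D > 0" "!!e i x y. e : E ==> i : I ==> x + p <= N e ==> y + Suc q <= N e ==> norm (Q e i x y) <= D"
  by (rule bddE) blast
 from init obtain B where B: "B > 0" "!!e i x y. e : E ==> i : I ==> x + p <= N e ==> y <= N e ==> norm (u e i x 0) <= B"
  by (rule bddE) auto
 show ?thesis
 proof (rule bddI)
  fix e i x y assume a: "e : E" "i : I" "x + p <= N e" "y + q <= N e"
  have e: "e > 0" using E_bounds a by auto
  \<comment> \<open>Adding 1 absorbs the source: \<open>C * norm u + D\<close> is at most
    \<open>(C + D) * (norm u + 1)\<close>.\<close>
  have "norm (u e i x y) + 1 <= exp ((C + D) * r) * (B + 1)"
  proof (rule gronwall_steps[where w = "%m. norm (u e i x m) + 1" and e = e])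
   show "e *. y <= r" using a N_iff[of e y] by auto
   show "norm (u e i x 0) + 1 <= B + 1" using B(2)[of e i x 0] a by auto
   fix m assume m: "m < y"
   have eq': "dy u e i x m = P e i x m * u e i x m + Q e i x m" by (rule eq) (use a m in auto)
   have "u e i x (Suc m) = u e i x m + e *\<^sub>R (P e i x m * u e i x m + Q e i x m)"
    unfolding eq'[symmetric] using e by (simp add: dy_def)
   then have "norm (u e i x (Suc m)) <= norm (u e i x m) + norm (e *\<^sub>R (P e i x m * u e i x m + Q e i x m))"
    by (simp only: norm_triangle_ineq)
   also have "norm (e *\<^sub>R (P e i x m * u e i x m + Q e i x m)) = e * norm (P e i x m * u e i x m + Q e i x m)"
    using e by simp
   also have "norm (P e i x m * u e i x m + Q e i x m) <= C * norm (u e i x m) + D"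
    using C(2)[of e i x m] D(2)[of e i x m] a m
    by (intro norm_triangle_le add_mono) (auto simp: norm_mult intro: mult_right_mono)
   also have "e * (C * norm (u e i x m) + D) <= e * ((C + D) * (norm (u e i x m) + 1))"
    using e C(1) D(1) by (intro mult_left_mono) (auto simp: algebra_simps)
   finally show "norm (u e i x (Suc m)) + 1 <= (1 + e * (C + D)) * (norm (u e i x m) + 1)"
    using e by (simp add: algebra_simps)
  qed (use e B(1) C(1) D(1) in auto)
  then show "norm (u e i x y) <= exp ((C + D) * r) * (B + 1)" by simp
 qed
qed

end

context grid_families begin

text \<open>\<open>dy u\<close> is bounded through the equation itself. \<open>dx u\<close> solves a
  linear equation of the same form, with coefficient \<open>sx P\<close> and source
  \<open>dx P * u + dx Q\<close>, so the induction hypothesis applies to it; for this reason the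
  coefficients are kept arbitrary in the induction.\<close>

lemma bd_linear_evolution:
 fixes u :: "('i, complex) family"
 shows "bd k p (Suc q) P ==> bd k p (Suc q) Q ==> bd k p 0 (%e i x y. u e i x 0) ==>
  (!!e i x y. e : E ==> i : I ==> x + p <= N e ==> y + Suc q <= N e ==>
    dy u e i x y = P e i x y * u e i x y + Q e i x y) ==> bd k p q u"
proof (induction k arbitrary: p q u P Q)
 case 0
 then show ?case unfolding bd.simps(1) by (rule bdd_linear_evolution)
next
 case (Suc k)
 note P = Suc.prems(1) and Q = Suc.prems(2) and init = Suc.prems(3) and eq = Suc.prems(4)
 have u: "bd k p q u"
 proof (rule Suc.IH[of p q P Q u])
  show "bd k p (Suc q) P" "bd k p (Suc q) Q" using P Q by (simp_all only: bd_Suc_D)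
  show "bd k p 0 (%e i x y. u e i x 0)" using init by (rule bd_Suc_D)
 qed (rule eq)
 have "bd k p (Suc q) (%e i x y. P e i x y * u e i x y + Q e i x y)"
  using P Q u by (intro bd_add bd_mult bd_Suc_D[OF P] bd_Suc_D[OF Q] bd_mono[OF u]) auto
 then have y: "bd k p (Suc q) (dy u)" by (rule bd_cong) (rule eq)
 have x: "bd k (Suc p) q (dx u)"
 proof (rule Suc.IH[of "Suc p" q "sx P" "%e i x y. dx P e i x y * u e i x y + dx Q e i x y" "dx u"])
  show "bd k (Suc p) (Suc q) (sx P)" using bd_Suc_D[OF P] by (rule bd_sx)
  show "bd k (Suc p) (Suc q) (%e i x y. dx P e i x y * u e i x y + dx Q e i x y)"
   using P Q by (intro bd_add bd_mult bd_mono[OF u]) auto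
  have "dx (%e i x y. u e i x 0) = (%e i x y. dx u e i x 0)" by (simp add: fun_eq_iff dx_def)
  then show "bd k (Suc p) 0 (%e i x y. dx u e i x 0)"
   using init by simp
  fix e i x y assume a: "e : E" "i : I" "x + Suc p <= N e" "y + Suc q <= N e"
  have "dy (dx u) e i x y = (dy u e i (Suc x) y - dy u e i x y) /\<^sub>R e"
   unfolding dx_dy[symmetric] by (simp add: dx_def)
  also have "\<dots> = (P e i (Suc x) y * u e i (Suc x) y + Q e i (Suc x) y - (P e i x y * u e i x y + Q e i x y)) /\<^sub>R e"
   using a eq[of e i "Suc x" y] eq[of e i x y] by simp
  also have "\<dots> = sx P e i x y * dx u e i x y + (dx P e i x y * u e i x y + dx Q e i x y)"
   by (simp add: sx_def dx_def scaleR_conv_of_real algebra_simps)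
  finally show "dy (dx u) e i x y = \<dots>" .
 qed
 show ?case using x y u bd_bdd by auto
qed

end


section \<open>Discrete Taylor expansion and Lipschitz estimates\<close>

lemma norm_telescope:
 fixes f :: "nat => 'a::real_normed_vector"
 assumes "!!k. min a b <= k ==> k < max a b ==> norm (f (Suc k) - f k) <= c"
 shows "norm (f b - f a) <= c * \<bar>real b - real a\<bar>"
proof -
 have *: "norm (f b - f a) <= c * (real b - real a)"
  if "a <= b" "!!k. a <= k ==> k < b ==> norm (f (Suc k) - f k) <= c" for a b :: nat
  using that
 proof (induction b)
  case (Suc b)
  show ?case
  proof (cases "a = Suc b")
   case False
   have "norm (f (Suc b) - f a) <= norm (f (Suc b) - f b) + norm (f b - f a)"
    using norm_triangle_ineq[of "f (Suc b) - f b" "f b - f a"] by simp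
   also have "\<dots> <= c + c * (real b - real a)"
    using Suc False by (intro add_mono) auto
   finally show ?thesis using False Suc.prems(1) by (simp add: algebra_simps)
  qed simp
 qed simp
 show ?thesis
 proof (cases "a <= b")
  case True then show ?thesis using *[of a b] assms by auto
 next
  case False then show ?thesis using *[of b a] assms by (auto simp: norm_minus_commute)
 qed
qed

text \<open>Subtracting the linear function with slope \<open>d a\<close> leaves increments
  \<open>e\<close> times \<open>d k - d a\<close>, and telescoping is applied twice. Both orders of
  \<open>a\<close> and \<open>b\<close> are covered, and \<open>b\<close> may lie one index beyond
  the last one that carries a difference quotient.\<close>

lemma discrete_taylor:
 fixes f d :: "nat => 'a::real_normed_vector"
 assumes e: "e > 0" and B: "B >= 0"
  and d: "!!k. k <= n ==> f (Suc k) - f k = e *\<^sub>R d k"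
  and d2: "!!k. k < n ==> norm (d (Suc k) - d k) <= e * B"
  and "a <= n" "b <= Suc n"
 shows "norm (f b - f a - (e *. b - e *. a) *\<^sub>R d a) <= B * (e *. b - e *. a)\<^sup>2"
proof -
 let ?h = "%k. f k - (e *. k) *\<^sub>R d a"
 have "norm (?h b - ?h a) <= (e * (e * B * \<bar>real b - real a\<bar>)) * \<bar>real b - real a\<bar>"
 proof (rule norm_telescope)
  fix k assume k: "min a b <= k" "k < max a b"
  have "?h (Suc k) - ?h k = e *\<^sub>R (d k - d a)"
   using d[of k] k assms(5,6) by (simp add: algebra_simps)
  moreover have "norm (d k - d a) <= e * B * \<bar>real k - real a\<bar>"
   by (rule norm_telescope) (use k assms(5,6) d2 in auto)
  moreover have "e * B * \<bar>real k - real a\<bar> <= e * B * \<bar>real b - real a\<bar>"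
   using k e B by (intro mult_left_mono) auto
  ultimately have "norm (d k - d a) <= e * B * \<bar>real b - real a\<bar>" by linarith
  with \<open>?h (Suc k) - ?h k = e *\<^sub>R (d k - d a)\<close>
  show "norm (?h (Suc k) - ?h k) <= e * (e * B * \<bar>real b - real a\<bar>)"
   using e mult_left_mono[of "norm (d k - d a)" _ e] by (simp only: norm_scaleR abs_of_pos less_imp_le)
 qed
 also have "\<dots> = B * (e *. b - e *. a)\<^sup>2"
  by (simp add: power2_eq_square abs_if algebra_simps)
 finally show ?thesis by (simp add: algebra_simps)
qed

lemma norm_dx: "0 < e ==> norm (dx w e i x y) <= A \<longleftrightarrow> norm (w e i (Suc x) y - w e i x y) <= e * A"
 and norm_dy: "0 < e ==> norm (dy w e i x y) <= A \<longleftrightarrow> norm (w e i x (Suc y) - w e i x y) <= e * A"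
 by (simp_all add: dx_def dy_def pos_divide_le_eq[symmetric] divide_inverse mult.commute del: norm_le_zero_iff)

context grid_families begin

abbreviation D :: "nat => nat => ('i, 'a::real_vector) family => ('i, 'a) family"
 where "D m n u == (dx ^^ m) ((dy ^^ n) u)"

lemma bd_dx: "bd (Suc k) p q u ==> bd k (Suc p) q (dx u)" and bd_dy: "bd (Suc k) p q u ==> bd k p (Suc q) (dy u)"
 by simp_all

lemma bd_D: "bd (m + n) p q u ==> bdd (p + m) (q + n) (D m n u)"
proof -
 have y: "bd (m + n) p q u ==> bd m p (q + n) ((dy ^^ n) u)" for m
 proof (induction n arbitrary: m)
  case (Suc n)
  from Suc.IH[of "Suc m"] Suc.prems show ?case by (simp del: bd.simps add: bd_dy)
 qed simp
 have x: "bd m p q v ==> bdd (p + m) q ((dx ^^ m) v)" for v q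
 proof (induction m arbitrary: p v)
  case (Suc m)
  from Suc.IH[of "Suc p" "dx v"] Suc.prems show ?case
   by (simp add: funpow_swap1)
 qed simp
 assume "bd (m + n) p q u" then show ?thesis using x y by blast
qed

lemma funpow_dx_dy: "(dx ^^ m) (dy v) = dy ((dx ^^ m) v)"
 by (induction m) (simp_all add: dx_dy)

lemma D_Suc: "D (Suc m) n u = dx (D m n u)" "D m (Suc n) u = dy (D m n u)"
 by (simp_all add: funpow_dx_dy)

definition hasx :: "('i, 'a::real_normed_vector) field2 => ('i, 'a) field2 => bool" where
 "hasx v v1 \<longleftrightarrow> (ALL i:I. ALL X:{0..r}. ALL Y:{0..r}.
   ((%s. v i s Y) has_vector_derivative v1 i X Y) (at X within {0..r}))"

definition hasy :: "('i, 'a::real_normed_vector) field2 => ('i, 'a) field2 => bool" where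
 "hasy v v2 \<longleftrightarrow> (ALL i:I. ALL X:{0..r}. ALL Y:{0..r}.
   ((%s. v i X s) has_vector_derivative v2 i X Y) (at Y within {0..r}))"

abbreviation derx :: "(real => real => 'a::real_normed_vector) => 'a => real => real => bool" where
 "derx f d X Y == ((%s. f s Y) has_vector_derivative d) (at X within {0..r})"

abbreviation dery :: "(real => real => 'a::real_normed_vector) => 'a => real => real => bool" where
 "dery f d X Y == ((%s. f X s) has_vector_derivative d) (at Y within {0..r})"

abbreviation cont2 :: "(real => real => 'a::topological_space) => bool" where
 "cont2 f == continuous_on ({0..r} \<times> {0..r}) (%(x, y). f x y)"

definition gidx :: "real => real => nat" where
 "gidx e X = nat \<lfloor>X / e\<rfloor>"

abbreviation along :: "(nat => real) => 'i => real => real => ('i, 'a) family => nat => 'a" where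
 "along es i X Y u == %j. u (es j) i (gidx (es j) X) (gidx (es j) Y)"

text \<open>The grid point just below \<open>X\<close> may lie too close to the right or top edge
  for \<open>a\<close> further steps. Clamping it to the last admissible index leaves it within
  \<open>a + 1\<close> steps of \<open>X\<close>, which makes limits available on the whole closed
  interval.\<close>

definition tidx :: "real => nat => real => nat" where
 "tidx e a X = min (gidx e X) (N e - a)"

lemma gidx_bounds:
 assumes "0 < e" "0 <= X"
 shows "e *. (gidx e X) <= X" "X < e *. (gidx e X) + e"
proof -
 have "real (gidx e X) = of_int \<lfloor>X / e\<rfloor>" using assms by (simp add: gidx_def)
 moreover have "of_int \<lfloor>X / e\<rfloor> <= X / e" "X / e < of_int \<lfloor>X / e\<rfloor> + 1" by linarith+
 ultimately have "real (gidx e X) <= X / e" "X / e < real (gidx e X) + 1" by simp_all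
 then show "e *. (gidx e X) <= X" "X < e *. (gidx e X) + e"
  using assms by (simp_all add: field_simps)
qed

lemma N_lower: "e : E ==> r < e *. (N e) + e"
 using gidx_bounds(2)[of e r] r_pos E_bounds by (simp add: gidx_def steps_def)

lemma tidx_le: "a <= N e ==> tidx e a X + a <= N e"
 by (simp add: tidx_def)

lemma tidx_bounds:
 assumes "e : E" "a <= N e" "0 <= X" "X <= r"
 shows "\<bar>e *. (tidx e a X) - X\<bar> <= real (Suc a) * e"
proof -
 note e = E_bounds(1)[OF assms(1)]
 note g = gidx_bounds[OF e assms(3)]
 have up: "e *. (tidx e a X) <= X"
  using g(1) e by (auto simp: tidx_def min_def intro: order_trans[rotated])
 have "X - real (Suc a) * e <= e *. (tidx e a X)"
 proof (cases "gidx e X <= N e - a")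
  case True
  have "0 <= real a * e" using e by simp
  then show ?thesis using True g(2) by (simp add: tidx_def algebra_simps)
 next
  case False
  then have "e *. (tidx e a X) = e *. (N e) - e *. a"
   using assms(2) by (simp add: tidx_def of_nat_diff algebra_simps)
  then show ?thesis using N_lower[OF assms(1)] assms(4) by (simp add: algebra_simps)
 qed
 with up show ?thesis by linarith
qed

lemma eventually_le_N:
 assumes "!!n. es n : E" "es \<longlonglongrightarrow> 0"
 shows "\<forall>\<^sub>F n in sequentially. a <= N (es n)"
proof -
 have "(%n. es n *. a) \<longlonglongrightarrow> 0 *. a" by (intro tendsto_intros assms)
 then have "\<forall>\<^sub>F n in sequentially. es n *. a < r"
  using r_pos by (auto dest: order_tendstoD(2))
 then show ?thesis by eventually_elim (simp add: N_iff[OF assms(1)])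
qed

lemma tidx_tendsto:
 assumes "!!n. es n : E" "es \<longlonglongrightarrow> 0" "X : {0..r}"
 shows "(%n. es n *. (tidx (es n) a X)) \<longlonglongrightarrow> X"
proof (rule LIM_zero_cancel, rule Lim_null_comparison)
 show "\<forall>\<^sub>F n in sequentially. norm (es n *. (tidx (es n) a X) - X) <= real (Suc a) * es n"
  using eventually_le_N[OF assms(1,2), of a]
  by eventually_elim (use tidx_bounds assms in auto)
 show "(%n. real (Suc a) * es n) \<longlonglongrightarrow> 0"
  using tendsto_mult_left[OF assms(2), of "real (Suc a)"] by simp
qed

lemma tidx_eventually:
 assumes "!!n. es n : E" "es \<longlonglongrightarrow> 0" "0 <= X" "X < r"
 shows "\<forall>\<^sub>F n in sequentially. tidx (es n) a X = gidx (es n) X & gidx (es n) X + a <= N (es n)"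
proof -
 have "(%n. X + es n *. a) \<longlonglongrightarrow> X + 0 *. a" by (intro tendsto_intros assms)
 then have "\<forall>\<^sub>F n in sequentially. X + es n *. a < r"
  using assms(4) by (auto dest: order_tendstoD(2))
 then show ?thesis
 proof eventually_elim
  case (elim n)
  have "gidx (es n) X + a <= N (es n)"
   unfolding N_iff[OF assms(1)]
   using gidx_bounds(1)[of "es n" X] E_bounds(1)[OF assms(1)[of n]] assms(3) elim
   by (simp add: algebra_simps)
  then show ?case by (auto simp: tidx_def)
 qed
qed

lemma grid_Lipschitz:
 fixes w :: "('i, 'a::real_normed_vector) family"
 assumes "e : E" "i : I"
  and "!!x y. x + Suc p <= N e ==> y + q <= N e ==> norm (dx w e i x y) <= A"
  and "!!x y. x + p <= N e ==> y + Suc q <= N e ==> norm (dy w e i x y) <= B"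
  and le: "x + p <= N e" "y + q <= N e" "x' + p <= N e" "y' + q <= N e"
 shows "norm (w e i x' y' - w e i x y) <= A * \<bar>e *. x' - e *. x\<bar> + B * \<bar>e *. y' - e *. y\<bar>"
proof -
 note e = E_bounds(1)[OF assms(1)]
 have "norm (w e i x' y' - w e i x y') <= e * A * \<bar>real x' - real x\<bar>"
 proof (rule norm_telescope)
  fix k assume "min x x' <= k" "k < max x x'"
  then have "norm (dx w e i k y') <= A" using le by (intro assms) auto
  then show "norm (w e i (Suc k) y' - w e i k y') <= e * A" using e by (simp add: norm_dx)
 qed
 moreover have "norm (w e i x y' - w e i x y) <= e * B * \<bar>real y' - real y\<bar>"
 proof (rule norm_telescope)
  fix k assume "min y y' <= k" "k < max y y'"
  then have "norm (dy w e i x k) <= B" using le by (intro assms) auto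
  then show "norm (w e i x (Suc k) - w e i x k) <= e * B" using e by (simp add: norm_dy)
 qed
 moreover have "norm (w e i x' y' - w e i x y) <= norm (w e i x' y' - w e i x y') + norm (w e i x y' - w e i x y)"
  using norm_triangle_ineq[of "w e i x' y' - w e i x y'" "w e i x y' - w e i x y"] by simp
 moreover have "\<bar>e *. x' - e *. x\<bar> = e * \<bar>real x' - real x\<bar>" "\<bar>e *. y' - e *. y\<bar> = e * \<bar>real y' - real y\<bar>"
  using e by (simp_all add: abs_mult right_diff_distrib[symmetric])
 ultimately show ?thesis by (simp add: algebra_simps)
qed

lemma grid_taylor_x:
 fixes w :: "('i, 'a::real_normed_vector) family"
 assumes "e : E" "i : I" "B >= 0"
  and B: "!!x y. x + Suc (Suc p) <= N e ==> y + q <= N e ==> norm (dx (dx w) e i x y) <= B"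
  and le: "x + Suc p <= N e" "y + q <= N e" "x' + p <= N e"
 shows "norm (w e i x' y - w e i x y - (e *. x' - e *. x) *\<^sub>R dx w e i x y) <= B * (e *. x' - e *. x)\<^sup>2"
proof (rule discrete_taylor[where n = "N e - Suc p" and f = "%x. w e i x y" and d = "%x. dx w e i x y"])
 note e = E_bounds(1)[OF assms(1)]
 show "w e i (Suc k) y - w e i k y = e *\<^sub>R dx w e i k y" for k using e by (simp add: dx_def)
 fix k assume "k < N e - Suc p"
 then have "norm (dx (dx w) e i k y) <= B" using le by (intro B) auto
 then show "norm (dx w e i (Suc k) y - dx w e i k y) <= e * B"
  using e by (simp add: norm_dx)
qed (use assms E_bounds in auto)

lemma grid_taylor_y:
 fixes w :: "('i, 'a::real_normed_vector) family"
 assumes "e : E" "i : I" "B >= 0"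
  and B: "!!x y. x + p <= N e ==> y + Suc (Suc q) <= N e ==> norm (dy (dy w) e i x y) <= B"
  and le: "x + p <= N e" "y + Suc q <= N e" "y' + q <= N e"
 shows "norm (w e i x y' - w e i x y - (e *. y' - e *. y) *\<^sub>R dy w e i x y) <= B * (e *. y' - e *. y)\<^sup>2"
 using grid_taylor_x[where w = "transp w" and e = e and i = i and B = B and p = q and q = p and x = y and y = x and x' = y'] assms
 by (simp add: dx_transp) (simp add: transp_def)

text \<open>A quadratic remainder survives pointwise limits, so limit functions are shown to be
  differentiable without interchanging limits and derivatives.\<close>

lemma Taylor_imp_derivative:
 fixes f :: "real => 'a::real_normed_vector"
 assumes "!!t. t : S ==> norm (f t - f s - (t - s) *\<^sub>R d) <= B * (t - s)\<^sup>2"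
 shows "(f has_vector_derivative d) (at s within S)"
 unfolding has_vector_derivative_def has_derivative_within_alt
proof (intro conjI allI impI bounded_linear_scaleR_left)
 fix eta :: real assume "eta > 0"
 show "EX \<delta>>0. ALL t:S. norm (t - s) < \<delta> --> norm (f t - f s - (t - s) *\<^sub>R d) <= eta * norm (t - s)"
 proof (intro exI[of _ "eta / (\<bar>B\<bar> + 1)"] conjI ballI impI)
  fix t assume t: "t : S" "norm (t - s) < eta / (\<bar>B\<bar> + 1)"
  have "B * (t - s)\<^sup>2 <= (\<bar>B\<bar> + 1) * \<bar>t - s\<bar> * \<bar>t - s\<bar>"
   by (simp add: power2_eq_square abs_mult_self_eq mult.assoc mult_right_mono)
  also have "\<dots> <= eta * \<bar>t - s\<bar>"
   using t(2) by (intro mult_right_mono) (auto simp: field_simps)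
  finally show "norm (f t - f s - (t - s) *\<^sub>R d) <= eta * norm (t - s)"
   using assms[OF t(1)] by simp
 qed (use \<open>eta > 0\<close> in auto)
qed

end

section \<open>Limits of grid families\<close>

lemma LIMSEQ_norm_le:
 fixes f :: "nat => 'a::real_normed_vector"
 assumes "f \<longlonglongrightarrow> l" "g \<longlonglongrightarrow> m" "\<forall>\<^sub>F n in sequentially. norm (f n) <= g n"
 shows "norm l <= m"
 by (rule tendsto_le[OF sequentially_bot assms(2) tendsto_norm[OF assms(1)] assms(3)])

lemma rational_near:
 assumes "X : {0..r}" "0 < r" "0 < \<delta>"
 shows "EX X':\<rat> \<inter> {0..r}. \<bar>X - X'\<bar> < (\<delta>::real)"
proof (cases "X = 0")
 case True
 then show ?thesis using assms by (intro bexI[of _ 0]) auto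
next
 case False
 then have "max 0 (X - \<delta>) < X" using assms by auto
 from Rats_dense_in_real[OF this] obtain X' where "X' : \<rat>" "max 0 (X - \<delta>) < X'" "X' < X" by blast
 then show ?thesis using assms by (intro bexI[of _ X']) auto
qed

context grid_families begin

lemma tidx_Lipschitz:
 fixes w :: "('i, 'a::real_normed_vector) family"
 assumes "e : E" "i : I" "a <= N e" "b <= N e"
  and "!!x y. x + Suc a <= N e ==> y + b <= N e ==> norm (dx w e i x y) <= A"
  and "!!x y. x + a <= N e ==> y + Suc b <= N e ==> norm (dy w e i x y) <= B"
 shows "norm (w e i (tidx e a X') (tidx e b Y') - w e i (tidx e a X) (tidx e b Y))
   <= A * \<bar>e *. (tidx e a X') - e *. (tidx e a X)\<bar> + B * \<bar>e *. (tidx e b Y') - e *. (tidx e b Y)\<bar>"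
 by (rule grid_Lipschitz[OF assms(1,2,5,6)]) (use assms(3,4) in \<open>auto simp: tidx_le\<close>)

text \<open>Arzela-Ascoli by diagonal extraction: one subsequence converges for all orders
  \<open>m\<close>, \<open>n\<close> and at all rational points, because that index set is
  countable. The bounds on the next difference quotients are an equi-Lipschitz condition and extend
  convergence to all real points.\<close>

lemma limit_aux:
 fixes u :: "('i, 'a::euclidean_space) family"
 assumes es: "!!n. es n : E" "es \<longlonglongrightarrow> 0" and i: "i : I"
  and B0: "!!m n. B m n > 0"
  and B: "!!m n e x y. e : E ==> x + (p + m) <= N e ==> y + (q + n) <= N e ==> norm (D m n u e i x y) <= B m n"
 obtains kappa where "strict_mono (kappa :: nat => nat)"
  "!!m n X Y. X : {0..r} ==> Y : {0..r} ==>
    convergent (%j. D m n u (es (kappa j)) i (tidx (es (kappa j)) (p + m) X) (tidx (es (kappa j)) (q + n) Y))"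
proof -
 define w where "w = (%j m n X Y. D m n u (es j) i (tidx (es j) (p + m) X) (tidx (es j) (q + n) Y))"
 define S where "S = (UNIV :: nat set) \<times> (UNIV :: nat set) \<times> (\<rat> \<inter> {0..r}) \<times> (\<rat> \<inter> {0..r})"
 \<comment> \<open>The extraction principle needs one bound for all indices, hence the normalization
   by \<open>B m n\<close>; the value 0 covers grids too small for the margin, which eventually do
   not occur.\<close>
 define f where "f = (%j (m, n, X, Y). if p + m <= N (es j) & q + n <= N (es j) then w j m n X Y /\<^sub>R B m n else 0)"
 have "countable S" unfolding S_def by (intro countable_SIGMA countable_Int1 countable_rat) auto
 moreover have "norm (f j z) <= 1" for j z
 proof (cases z)
  case (fields m n X Y)
  have "norm (w j m n X Y) <= B m n" if "p + m <= N (es j)" "q + n <= N (es j)"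
   unfolding w_def by (rule B[OF es(1)]) (use that in \<open>auto intro: tidx_le\<close>)
  then show ?thesis using B0[of m n] by (auto simp: f_def fields field_simps)
 qed
 ultimately obtain kappa where kappa: "strict_mono (kappa :: nat => nat)"
  and conv: "!!z. z : S ==> EX l. (%j. f (kappa j) z) \<longlonglongrightarrow> l"
  using function_convergent_subsequence[of S f 1] by blast
 have es': "!!j. es (kappa j) : E" "(%j. es (kappa j)) \<longlonglongrightarrow> 0"
  using es kappa LIMSEQ_subseq_LIMSEQ[of es 0 kappa] by (auto simp: o_def)
 have rat: "convergent (%j. w (kappa j) m n X Y)" if "X : \<rat> \<inter> {0..r}" "Y : \<rat> \<inter> {0..r}" for m n X Y
 proof -
  have "(m, n, X, Y) : S" using that by (simp add: S_def)
  then obtain l where l: "(%j. f (kappa j) (m, n, X, Y)) \<longlonglongrightarrow> l" using conv by blast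
  have "\<forall>\<^sub>F j in sequentially. B m n *\<^sub>R f (kappa j) (m, n, X, Y) = w (kappa j) m n X Y"
   using eventually_le_N[OF es', of "p + m"] eventually_le_N[OF es', of "q + n"]
   by eventually_elim (use B0[of m n] in \<open>simp add: f_def\<close>)
  then have "(%j. w (kappa j) m n X Y) \<longlonglongrightarrow> B m n *\<^sub>R l"
   using tendsto_scaleR[OF tendsto_const l] by (rule Lim_transform_eventually[rotated])
  then show ?thesis by (auto simp: convergent_def)
 qed
 have "convergent (%j. w (kappa j) m n X Y)" if X: "X : {0..r}" and Y: "Y : {0..r}" for m n X Y
 proof -
  define K where "K = B (Suc m) n + B m (Suc n)"
  have K: "K > 0" using B0 by (simp add: add_pos_pos K_def)
  have "Cauchy (%j. w (kappa j) m n X Y)"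
  proof (rule CauchyI)
   fix eta :: real assume eta: "eta > 0"
   \<comment> \<open>This gives \<open>eta / 6\<close> in the limit, strictly below
     \<open>eta / 3\<close>, so that the strict inequality holds eventually along the
     sequence.\<close>
   define \<delta> where "\<delta> = eta / (6 * K)"
   have \<delta>: "\<delta> > 0" using eta K by (simp add: \<delta>_def)
   obtain X' Y' where X': "X' : \<rat> \<inter> {0..r}" "\<bar>X - X'\<bar> < \<delta>" and Y': "Y' : \<rat> \<inter> {0..r}" "\<bar>Y - Y'\<bar> < \<delta>"
    using rational_near[OF X r_pos \<delta>] rational_near[OF Y r_pos \<delta>] by blast
   have near: "\<forall>\<^sub>F j in sequentially. norm (w (kappa j) m n X Y - w (kappa j) m n X' Y') < eta / 3"
   proof -
    let ?e = "%j. es (kappa j)"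
    let ?g = "%j. B (Suc m) n * \<bar>?e j *. (tidx (?e j) (p + m) X) - ?e j *. (tidx (?e j) (p + m) X')\<bar>
     + B m (Suc n) * \<bar>?e j *. (tidx (?e j) (q + n) Y) - ?e j *. (tidx (?e j) (q + n) Y')\<bar>"
    have "?g \<longlonglongrightarrow> B (Suc m) n * \<bar>X - X'\<bar> + B m (Suc n) * \<bar>Y - Y'\<bar>"
     using X Y X' Y' by (intro tendsto_intros tidx_tendsto[OF es']) auto
    moreover have "B (Suc m) n * \<bar>X - X'\<bar> + B m (Suc n) * \<bar>Y - Y'\<bar> < eta / 3"
    proof -
     have "B (Suc m) n * \<bar>X - X'\<bar> + B m (Suc n) * \<bar>Y - Y'\<bar> <= B (Suc m) n * \<delta> + B m (Suc n) * \<delta>"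
      using X' Y' B0 by (intro add_mono mult_left_mono) (auto intro: less_imp_le)
     also have "\<dots> = K * \<delta>" by (simp add: K_def distrib_right)
     also have "\<dots> = eta / 6" using K by (simp add: \<delta>_def)
     also have "\<dots> < eta / 3" using eta by simp
     finally show ?thesis .
    qed
    ultimately have "\<forall>\<^sub>F j in sequentially. ?g j < eta / 3" by (rule order_tendstoD(2))
    then show ?thesis using eventually_le_N[OF es', of "p + m"] eventually_le_N[OF es', of "q + n"]
    proof eventually_elim
     case (elim j)
     have "norm (w (kappa j) m n X Y - w (kappa j) m n X' Y') <= ?g j"
      unfolding w_def
      using B[OF es'(1), of _ "Suc m" j _ n] B[OF es'(1), of _ m j _ "Suc n"] elim
      by (intro tidx_Lipschitz es' i) (auto simp: D_Suc(2) simp del: funpow.simps(2) simp: D_Suc(1)[symmetric])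
     with elim show ?case by simp
    qed
   qed
   have "Cauchy (%j. w (kappa j) m n X' Y')" using rat[OF X'(1) Y'(1)] by (rule convergent_Cauchy)
   then obtain M1 where M1: "!!j k. j >= M1 ==> k >= M1 ==> norm (w (kappa j) m n X' Y' - w (kappa k) m n X' Y') < eta / 3"
    using eta by (metis CauchyD divide_pos_pos zero_less_numeral)
   obtain M2 where M2: "!!j. j >= M2 ==> norm (w (kappa j) m n X Y - w (kappa j) m n X' Y') < eta / 3"
    using near by (auto simp: eventually_sequentially)
   show "EX M. ALL j>=M. ALL k>=M. norm (w (kappa j) m n X Y - w (kappa k) m n X Y) < eta"
   proof (intro exI[of _ "max M1 M2"] allI impI)
    fix j k assume jk: "max M1 M2 <= j" "max M1 M2 <= k"
    have "norm (w (kappa j) m n X Y - w (kappa k) m n X Y)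
     <= norm (w (kappa j) m n X Y - w (kappa j) m n X' Y') + norm (w (kappa j) m n X' Y' - w (kappa k) m n X' Y')
      + norm (w (kappa k) m n X Y - w (kappa k) m n X' Y')"
     using norm_triangle_ineq[of "w (kappa j) m n X Y - w (kappa j) m n X' Y'" "w (kappa j) m n X' Y' - w (kappa k) m n X' Y'"]
      norm_triangle_ineq4[of "w (kappa j) m n X Y - w (kappa k) m n X' Y'" "w (kappa k) m n X Y - w (kappa k) m n X' Y'"]
     by (simp add: algebra_simps)
    with M1[of j k] M2[of j] M2[of k] jk show "norm (w (kappa j) m n X Y - w (kappa k) m n X Y) < eta" by simp
   qed
  qed
  then show ?thesis by (rule Cauchy_convergent)
 qed
 with kappa show ?thesis by (intro that[of kappa]) (auto simp: w_def)
qed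

text \<open>\<open>g m n\<close> plays the role of the mixed derivative of order \<open>m\<close>,
  \<open>n\<close> of \<open>g 0 0\<close>; carrying the whole array reduces smoothness to
  first-order conditions.\<close>

definition jet :: "(nat => nat => real => real => 'a::real_normed_vector) => bool" where
 "jet g \<longleftrightarrow> (ALL m n. cont2 (g m n)) &
   (ALL m n. ALL x:{0..r}. ALL y:{0..r}.
    derx (g m n) (g (Suc m) n x y) x y &
    dery (g m n) (g m (Suc n) x y) x y)"

text \<open>The Taylor remainders carry the same constants \<open>B\<close> as the discrete family.
  In \<open>smooth_approximation\<close> these constants do not depend on the parameter
  \<open>i\<close>, which keeps the interpolation argument uniform in \<open>i\<close>.\<close>

definition jet_bounds :: "(nat => nat => real) => (nat => nat => real => real => 'a::real_normed_vector) => bool" where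
 "jet_bounds B g \<longleftrightarrow> (ALL m n. ALL X:{0..r}. ALL Y:{0..r}. norm (g m n X Y) <= B m n) &
  (ALL m n. ALL X:{0..r}. ALL X':{0..r}. ALL Y:{0..r}.
    norm (g m n X' Y - g m n X Y - (X' - X) *\<^sub>R g (Suc m) n X Y) <= B (Suc (Suc m)) n * (X' - X)\<^sup>2) &
  (ALL m n. ALL X:{0..r}. ALL Y:{0..r}. ALL Y':{0..r}.
    norm (g m n X Y' - g m n X Y - (Y' - Y) *\<^sub>R g m (Suc n) X Y) <= B m (Suc (Suc n)) * (Y' - Y)\<^sup>2)"

text \<open>The discrete Taylor inequality of every order is passed to the limit, and the limiting
  quadratic remainder produces the derivatives. On the half-open square the clamped indices
  eventually coincide with the plain ones.\<close>

theorem limit_jet: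
 fixes u :: "('i, 'a::euclidean_space) family"
 assumes es: "!!n. es n : E" "es \<longlonglongrightarrow> 0" and i: "i : I"
  and B0: "!!m n. B m n > 0"
  and B: "!!m n e x y. e : E ==> x + (p + m) <= N e ==> y + (q + n) <= N e ==> norm (D m n u e i x y) <= B m n"
 shows "EX kappa g. strict_mono (kappa :: nat => nat) & jet g & jet_bounds B g &
  (ALL m n X Y. 0 <= X --> X < r --> 0 <= Y --> Y < r -->
    (%j. D m n u (es (kappa j)) i (gidx (es (kappa j)) X) (gidx (es (kappa j)) Y)) \<longlonglongrightarrow> g m n X Y)"
proof -
 obtain kappa where kappa: "strict_mono (kappa :: nat => nat)"
  and conv: "!!m n X Y. X : {0..r} ==> Y : {0..r} ==>
    convergent (%j. D m n u (es (kappa j)) i (tidx (es (kappa j)) (p + m) X) (tidx (es (kappa j)) (q + n) Y))"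
  using limit_aux[of es i B p q u] assms by blast
 define e where "e = (%j. es (kappa j))"
 have e: "!!j. e j : E" "e \<longlonglongrightarrow> 0"
  using es kappa LIMSEQ_subseq_LIMSEQ[of es 0 kappa] by (auto simp: o_def e_def)
 define g where "g = (%m n X Y. lim (%j. D m n u (e j) i (tidx (e j) (p + m) X) (tidx (e j) (q + n) Y)))"
 have g: "(%j. D m n u (e j) i (tidx (e j) (p + m) X) (tidx (e j) (q + n) Y)) \<longlonglongrightarrow> g m n X Y"
  if "X : {0..r}" "Y : {0..r}" for m n X Y
  using conv[OF that, of m n] by (simp add: g_def convergent_LIMSEQ_iff e_def)
 have ev: "\<forall>\<^sub>F j in sequentially. p + m <= N (e j) & q + n <= N (e j)" for m n
  using eventually_le_N[OF e, of "p + m"] eventually_le_N[OF e, of "q + n"] by eventually_elim simp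
 have Dx: "norm (dx (D m n u) (e j) i x y) <= B (Suc m) n"
  if "x + Suc (p + m) <= N (e j)" "y + (q + n) <= N (e j)" for m n j x y
  using B[OF e(1), of x "Suc m" j y n] that by simp
 have Dy: "norm (dy (D m n u) (e j) i x y) <= B m (Suc n)"
  if "x + (p + m) <= N (e j)" "y + Suc (q + n) <= N (e j)" for m n j x y
  using B[OF e(1), of x m j y "Suc n"] that by (simp add: D_Suc(2) del: funpow.simps)
 have bound: "norm (g m n X Y) <= B m n" if "X : {0..r}" "Y : {0..r}" for m n X Y
 proof (rule LIMSEQ_norm_le[OF g[OF that] tendsto_const])
  show "\<forall>\<^sub>F j in sequentially. norm (D m n u (e j) i (tidx (e j) (p + m) X) (tidx (e j) (q + n) Y)) <= B m n"
   using ev[of m n] by eventually_elim (auto intro: B e tidx_le)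
 qed
 have lip: "norm (g m n X' Y' - g m n X Y) <= B (Suc m) n * \<bar>X' - X\<bar> + B m (Suc n) * \<bar>Y' - Y\<bar>"
  if "X : {0..r}" "Y : {0..r}" "X' : {0..r}" "Y' : {0..r}" for m n X Y X' Y'
 proof (rule LIMSEQ_norm_le[OF tendsto_diff[OF g g]])
  let ?h = "%j. B (Suc m) n * \<bar>e j *. (tidx (e j) (p + m) X') - e j *. (tidx (e j) (p + m) X)\<bar>
     + B m (Suc n) * \<bar>e j *. (tidx (e j) (q + n) Y') - e j *. (tidx (e j) (q + n) Y)\<bar>"
  show "?h \<longlonglongrightarrow> B (Suc m) n * \<bar>X' - X\<bar> + B m (Suc n) * \<bar>Y' - Y\<bar>"
   using that by (intro tendsto_intros tidx_tendsto[OF e]) auto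
  show "\<forall>\<^sub>F j in sequentially. norm (D m n u (e j) i (tidx (e j) (p + m) X') (tidx (e j) (q + n) Y') -
     D m n u (e j) i (tidx (e j) (p + m) X) (tidx (e j) (q + n) Y)) <= ?h j"
   using ev[of m n] by eventually_elim (rule tidx_Lipschitz, auto intro: e i Dx Dy)
 qed (use that in auto)
 have tx: "norm (g m n X' Y - g m n X Y - (X' - X) *\<^sub>R g (Suc m) n X Y) <= B (Suc (Suc m)) n * (X' - X)\<^sup>2"
  if X: "X : {0..r}" "X' : {0..r}" "Y : {0..r}" for m n X X' Y
 proof (rule LIMSEQ_norm_le)
  \<comment> \<open>The quotient \<open>D (Suc m) n\<close> has a larger margin, so its base index
    \<open>?xb\<close> may differ from \<open>?x\<close>. The three terms of \<open>?h\<close> are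
    the Taylor remainder at \<open>?xb\<close>, the cost of moving the base point, and the change of
    the step length.\<close>
  let ?x = "%j. tidx (e j) (p + m) X" and ?x' = "%j. tidx (e j) (p + m) X'"
   and ?xb = "%j. tidx (e j) (p + Suc m) X" and ?y = "%j. tidx (e j) (q + n) Y"
  let ?h = "%j. B (Suc (Suc m)) n * (e j *. (?x' j) - e j *. (?xb j))\<^sup>2
   + B (Suc m) n * \<bar>e j *. (?x j) - e j *. (?xb j)\<bar>
   + \<bar>(e j *. (?x' j) - e j *. (?xb j)) - (X' - X)\<bar> * B (Suc m) n"
  have "?h \<longlonglongrightarrow> B (Suc (Suc m)) n * (X' - X)\<^sup>2 + B (Suc m) n * \<bar>X - X\<bar> + \<bar>(X' - X) - (X' - X)\<bar> * B (Suc m) n"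
   using X by (intro tendsto_intros tidx_tendsto[OF e]) auto
  then show "?h \<longlonglongrightarrow> B (Suc (Suc m)) n * (X' - X)\<^sup>2" by simp
  show "(%j. D m n u (e j) i (?x' j) (?y j) - D m n u (e j) i (?x j) (?y j) - (X' - X) *\<^sub>R D (Suc m) n u (e j) i (?xb j) (?y j))
   \<longlonglongrightarrow> g m n X' Y - g m n X Y - (X' - X) *\<^sub>R g (Suc m) n X Y"
   using X by (intro tendsto_diff tendsto_scaleR tendsto_const g[of X' Y m n] g[of X Y m n] g[of X Y "Suc m" n])
  show "\<forall>\<^sub>F j in sequentially. norm (D m n u (e j) i (?x' j) (?y j) - D m n u (e j) i (?x j) (?y j) -
      (X' - X) *\<^sub>R D (Suc m) n u (e j) i (?xb j) (?y j)) <= ?h j"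
   using ev[of "Suc m" n]
  proof eventually_elim
   case (elim j)
   let ?w = "D m n u (e j) i"
   have x0: "?xb j + Suc (p + m) <= N (e j)" using tidx_le[of "p + Suc m" "e j" X] elim by simp
   have le: "?x j + (p + m) <= N (e j)" "?x' j + (p + m) <= N (e j)" "?y j + (q + n) <= N (e j)"
    using elim by (auto intro: tidx_le)
   have 1: "norm (?w (?x' j) (?y j) - ?w (?xb j) (?y j) - (e j *. (?x' j) - e j *. (?xb j)) *\<^sub>R dx (D m n u) (e j) i (?xb j) (?y j))
     <= B (Suc (Suc m)) n * (e j *. (?x' j) - e j *. (?xb j))\<^sup>2"
    by (rule grid_taylor_x[OF e(1) i less_imp_le[OF B0] _ x0 le(3) le(2)])
     (use B[OF e(1), of _ "Suc (Suc m)" j _ n] in simp)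
   have 2: "norm (?w (?xb j) (?y j) - ?w (?x j) (?y j)) <= B (Suc m) n * \<bar>e j *. (?xb j) - e j *. (?x j)\<bar>
     + B m (Suc n) * \<bar>e j *. (?y j) - e j *. (?y j)\<bar>"
    using x0 by (intro grid_Lipschitz[OF e(1) i Dx Dy le(1,3) _ le(3)]) linarith+
   have 3: "norm (((e j *. (?x' j) - e j *. (?xb j)) - (X' - X)) *\<^sub>R dx (D m n u) (e j) i (?xb j) (?y j))
     <= \<bar>(e j *. (?x' j) - e j *. (?xb j)) - (X' - X)\<bar> * B (Suc m) n"
    unfolding norm_scaleR using Dx[OF x0 le(3)] by (simp add: mult_left_mono)
   let ?d = "dx (D m n u) (e j) i (?xb j) (?y j)"
   have eq: "?w (?x' j) (?y j) - ?w (?x j) (?y j) - (X' - X) *\<^sub>R D (Suc m) n u (e j) i (?xb j) (?y j)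
    = (?w (?x' j) (?y j) - ?w (?xb j) (?y j) - (e j *. (?x' j) - e j *. (?xb j)) *\<^sub>R ?d)
    + (?w (?xb j) (?y j) - ?w (?x j) (?y j)) + ((e j *. (?x' j) - e j *. (?xb j)) - (X' - X)) *\<^sub>R ?d"
    unfolding D_Suc(1) by (simp add: algebra_simps)
   show ?case unfolding eq using 1 2 3
    by (intro norm_triangle_le add_mono) (auto simp: abs_minus_commute)
  qed
 qed
 have ty: "norm (g m n X Y' - g m n X Y - (Y' - Y) *\<^sub>R g m (Suc n) X Y) <= B m (Suc (Suc n)) * (Y' - Y)\<^sup>2"
  if X: "X : {0..r}" "Y : {0..r}" "Y' : {0..r}" for m n X Y Y'
 proof (rule LIMSEQ_norm_le)
  let ?y = "%j. tidx (e j) (q + n) Y" and ?y' = "%j. tidx (e j) (q + n) Y'"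
   and ?yb = "%j. tidx (e j) (q + Suc n) Y" and ?x = "%j. tidx (e j) (p + m) X"
  let ?h = "%j. B m (Suc (Suc n)) * (e j *. (?y' j) - e j *. (?yb j))\<^sup>2
   + B m (Suc n) * \<bar>e j *. (?y j) - e j *. (?yb j)\<bar>
   + \<bar>(e j *. (?y' j) - e j *. (?yb j)) - (Y' - Y)\<bar> * B m (Suc n)"
  have "?h \<longlonglongrightarrow> B m (Suc (Suc n)) * (Y' - Y)\<^sup>2 + B m (Suc n) * \<bar>Y - Y\<bar> + \<bar>(Y' - Y) - (Y' - Y)\<bar> * B m (Suc n)"
   using X by (intro tendsto_intros tidx_tendsto[OF e]) auto
  then show "?h \<longlonglongrightarrow> B m (Suc (Suc n)) * (Y' - Y)\<^sup>2" by simp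
  show "(%j. D m n u (e j) i (?x j) (?y' j) - D m n u (e j) i (?x j) (?y j) - (Y' - Y) *\<^sub>R D m (Suc n) u (e j) i (?x j) (?yb j))
   \<longlonglongrightarrow> g m n X Y' - g m n X Y - (Y' - Y) *\<^sub>R g m (Suc n) X Y"
   using X by (intro tendsto_diff tendsto_scaleR tendsto_const g[of X Y' m n] g[of X Y m n] g[of X Y m "Suc n"])
  show "\<forall>\<^sub>F j in sequentially. norm (D m n u (e j) i (?x j) (?y' j) - D m n u (e j) i (?x j) (?y j) -
      (Y' - Y) *\<^sub>R D m (Suc n) u (e j) i (?x j) (?yb j)) <= ?h j"
   using ev[of m "Suc n"]
  proof eventually_elim
   case (elim j)
   let ?w = "D m n u (e j) i"
   have y0: "?yb j + Suc (q + n) <= N (e j)" using tidx_le[of "q + Suc n" "e j" Y] elim by simp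
   have le: "?y j + (q + n) <= N (e j)" "?y' j + (q + n) <= N (e j)" "?x j + (p + m) <= N (e j)"
    using elim by (auto intro: tidx_le)
   have 1: "norm (?w (?x j) (?y' j) - ?w (?x j) (?yb j) - (e j *. (?y' j) - e j *. (?yb j)) *\<^sub>R dy (D m n u) (e j) i (?x j) (?yb j))
     <= B m (Suc (Suc n)) * (e j *. (?y' j) - e j *. (?yb j))\<^sup>2"
    by (rule grid_taylor_y[OF e(1) i less_imp_le[OF B0] _ le(3) y0 le(2)])
     (use B[OF e(1), of _ m j _ "Suc (Suc n)"] in \<open>simp add: D_Suc(2) del: funpow.simps\<close>)
   have 2: "norm (?w (?x j) (?yb j) - ?w (?x j) (?y j)) <= B (Suc m) n * \<bar>e j *. (?x j) - e j *. (?x j)\<bar>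
     + B m (Suc n) * \<bar>e j *. (?yb j) - e j *. (?y j)\<bar>"
    using y0 by (intro grid_Lipschitz[OF e(1) i Dx Dy le(3) le(1) le(3)]) linarith+
   have 3: "norm (((e j *. (?y' j) - e j *. (?yb j)) - (Y' - Y)) *\<^sub>R dy (D m n u) (e j) i (?x j) (?yb j))
     <= \<bar>(e j *. (?y' j) - e j *. (?yb j)) - (Y' - Y)\<bar> * B m (Suc n)"
    unfolding norm_scaleR using Dy[OF le(3) y0] by (simp add: mult_left_mono)
   let ?d = "dy (D m n u) (e j) i (?x j) (?yb j)"
   have eq: "?w (?x j) (?y' j) - ?w (?x j) (?y j) - (Y' - Y) *\<^sub>R D m (Suc n) u (e j) i (?x j) (?yb j)
    = (?w (?x j) (?y' j) - ?w (?x j) (?yb j) - (e j *. (?y' j) - e j *. (?yb j)) *\<^sub>R ?d)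
    + (?w (?x j) (?yb j) - ?w (?x j) (?y j)) + ((e j *. (?y' j) - e j *. (?yb j)) - (Y' - Y)) *\<^sub>R ?d"
    unfolding D_Suc(2) by (simp add: algebra_simps)
   show ?case unfolding eq using 1 2 3
    by (intro norm_triangle_le add_mono) (auto simp: abs_minus_commute)
  qed
 qed
 show ?thesis
 proof (intro exI[of _ kappa] exI[of _ g] conjI allI impI)
  show "strict_mono kappa" by (rule kappa)
  show "jet_bounds B g" using bound tx ty by (simp add: jet_bounds_def)
  show "jet g" unfolding jet_def
  proof (intro conjI allI ballI)
   fix m n
   have "(B (Suc m) n + B m (Suc n))-lipschitz_on ({0..r} \<times> {0..r}) (%(x, y). g m n x y)"
   proof (rule lipschitz_onI)
    fix z z' assume "z : {0..r} \<times> {0..r}" "z' : {0..r} \<times> {0..r}"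
    then have "dist (case z of (x, y) => g m n x y) (case z' of (x, y) => g m n x y)
     <= B (Suc m) n * \<bar>fst z - fst z'\<bar> + B m (Suc n) * \<bar>snd z - snd z'\<bar>"
     using lip[of "fst z'" "snd z'" "fst z" "snd z" m n] by (auto simp: dist_norm split: prod.splits)
    also have "\<dots> <= B (Suc m) n * dist z z' + B m (Suc n) * dist z z'"
     using B0 dist_fst_le[of z z'] dist_snd_le[of z z']
     by (intro add_mono mult_left_mono) (auto simp: dist_real_def less_imp_le)
    finally show "dist (case z of (x, y) => g m n x y) (case z' of (x, y) => g m n x y) <= (B (Suc m) n + B m (Suc n)) * dist z z'"
     by (simp add: algebra_simps)
   qed (use B0 in \<open>simp add: add_nonneg_nonneg less_imp_le\<close>)
   then show "cont2 (g m n)" by (rule lipschitz_on_continuous_on)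
   fix X Y assume "X : {0..r}" "Y : {0..r}"
   then show "derx (g m n) (g (Suc m) n X Y) X Y"
    "dery (g m n) (g m (Suc n) X Y) X Y"
    by (auto intro!: Taylor_imp_derivative tx ty)
  qed
  fix m n X Y assume X: "0 <= X" "X < r" and Y: "0 <= Y" "Y < r"
  have "\<forall>\<^sub>F j in sequentially. D m n u (e j) i (tidx (e j) (p + m) X) (tidx (e j) (q + n) Y) =
     D m n u (e j) i (gidx (e j) X) (gidx (e j) Y)"
   using tidx_eventually[OF e X, of "p + m"] tidx_eventually[OF e Y, of "q + n"]
   by eventually_elim simp
  then show "(%j. D m n u (es (kappa j)) i (gidx (es (kappa j)) X) (gidx (es (kappa j)) Y)) \<longlonglongrightarrow> g m n X Y"
   unfolding e_def[symmetric] e_def[symmetric, THEN fun_cong]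
   by (rule Lim_transform_eventually[OF g, rotated 2]) (use X Y in auto)
 qed
qed

end

section \<open>Lipschitz fields on the closed square and their comparison with grid families\<close>

context grid_families begin

definition cbd :: "('i, 'a::real_normed_vector) field2 => bool" where
 "cbd v \<longleftrightarrow> (EX C. ALL i:I. ALL X:{0..r}. ALL Y:{0..r}. norm (v i X Y) <= C)"

definition lip :: "('i, 'a::real_normed_vector) field2 => bool" where
 "lip v \<longleftrightarrow> cbd v & (EX C. ALL i:I. ALL X:{0..r}. ALL Y:{0..r}. ALL X':{0..r}. ALL Y':{0..r}.
   norm (v i X' Y' - v i X Y) <= C * (\<bar>X' - X\<bar> + \<bar>Y' - Y\<bar>))"

lemma cbdE:
 assumes "cbd v"
 obtains C where "C > 0" "!!i X Y. i : I ==> X : {0..r} ==> Y : {0..r} ==> norm (v i X Y) <= C"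
proof -
 from assms obtain C where C: "!!i X Y. i : I ==> X : {0..r} ==> Y : {0..r} ==> norm (v i X Y) <= C"
  unfolding cbd_def by blast
 show ?thesis by (rule that[of "max C 1"]) (auto intro!: max.coboundedI1 C)
qed

lemma lipE:
 assumes "lip v"
 obtains C where "C > 0" "!!i X Y X' Y'. i : I ==> X : {0..r} ==> Y : {0..r} ==> X' : {0..r} ==> Y' : {0..r} ==>
   norm (v i X' Y' - v i X Y) <= C * (\<bar>X' - X\<bar> + \<bar>Y' - Y\<bar>)"
proof -
 from assms obtain C where C: "!!i X Y X' Y'. i : I ==> X : {0..r} ==> Y : {0..r} ==> X' : {0..r} ==> Y' : {0..r} ==>
   norm (v i X' Y' - v i X Y) <= C * (\<bar>X' - X\<bar> + \<bar>Y' - Y\<bar>)"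
  unfolding lip_def by blast
 show ?thesis
  by (rule that[of "max C 1"], simp, rule order_trans[OF C]) (auto intro!: mult_right_mono)
qed

lemma lip_cbd: "lip v ==> cbd v" by (simp add: lip_def)

lemma cbd_bilinear:
 assumes "bounded_bilinear bl" "cbd u" "cbd v" shows "cbd (%i X Y. bl (u i X Y) (v i X Y))"
proof -
 interpret bounded_bilinear bl by fact
 obtain K where K: "K > 0" "!!a b. norm (bl a b) <= norm a * norm b * K" using pos_bounded by blast
 obtain C where C: "C > 0" "!!i X Y. i : I ==> X : {0..r} ==> Y : {0..r} ==> norm (u i X Y) <= C" using assms(2) by (rule cbdE) blast
 obtain C' where C': "C' > 0" "!!i X Y. i : I ==> X : {0..r} ==> Y : {0..r} ==> norm (v i X Y) <= C'" using assms(3) by (rule cbdE) blast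
 show ?thesis unfolding cbd_def
  by (rule exI[of _ "C * C' * K"], intro ballI, rule order_trans[OF K(2)])
   (use K C C' in \<open>auto intro!: mult_mono simp: less_imp_le\<close>)
qed

lemma lip_bilinear:
 assumes "bounded_bilinear bl" "lip u" "lip v" shows "lip (%i X Y. bl (u i X Y) (v i X Y))"
proof -
 interpret bounded_bilinear bl by fact
 obtain K where K: "K > 0" "!!a b. norm (bl a b) <= norm a * norm b * K" using pos_bounded by blast
 obtain C where C: "C > 0" "!!i X Y. i : I ==> X : {0..r} ==> Y : {0..r} ==> norm (u i X Y) <= C"
  using lip_cbd[OF assms(2)] by (rule cbdE) blast
 obtain C' where C': "C' > 0" "!!i X Y. i : I ==> X : {0..r} ==> Y : {0..r} ==> norm (v i X Y) <= C'"
  using lip_cbd[OF assms(3)] by (rule cbdE) blast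
 obtain L where L: "L > 0" "!!i X Y X' Y'. i : I ==> X : {0..r} ==> Y : {0..r} ==> X' : {0..r} ==> Y' : {0..r} ==>
   norm (u i X' Y' - u i X Y) <= L * (\<bar>X' - X\<bar> + \<bar>Y' - Y\<bar>)" using assms(2) by (rule lipE) blast
 obtain L' where L': "L' > 0" "!!i X Y X' Y'. i : I ==> X : {0..r} ==> Y : {0..r} ==> X' : {0..r} ==> Y' : {0..r} ==>
   norm (v i X' Y' - v i X Y) <= L' * (\<bar>X' - X\<bar> + \<bar>Y' - Y\<bar>)" using assms(3) by (rule lipE) blast
 have "norm (bl (u i X' Y') (v i X' Y') - bl (u i X Y) (v i X Y)) <= (C * L' * K + L * C' * K) * (\<bar>X' - X\<bar> + \<bar>Y' - Y\<bar>)"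
  if "i : I" "X : {0..r}" "Y : {0..r}" "X' : {0..r}" "Y' : {0..r}" for i X Y X' Y'
 proof -
  let ?d = "\<bar>X' - X\<bar> + \<bar>Y' - Y\<bar>"
  have "bl (u i X' Y') (v i X' Y') - bl (u i X Y) (v i X Y) = bl (u i X' Y') (v i X' Y' - v i X Y) + bl (u i X' Y' - u i X Y) (v i X Y)"
   by (simp add: diff_left diff_right)
  also have "norm \<dots> <= C * (L' * ?d) * K + (L * ?d) * C' * K"
   by (intro norm_triangle_le add_mono order_trans[OF K(2)] mult_mono)
    (use that C C' L L' K in \<open>auto simp: less_imp_le intro!: mult_nonneg_nonneg\<close>)
  finally show ?thesis by (simp add: algebra_simps)
 qed
 then show ?thesis unfolding lip_def using cbd_bilinear[OF assms(1) assms(2,3)[THEN lip_cbd]] by blast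
qed

lemma lip_linear:
 assumes "bounded_linear f" "lip u" shows "lip (%i X Y. f (u i X Y))"
proof -
 interpret bounded_linear f by fact
 have one: "lip (%i X Y. 1::real)" by (auto simp: lip_def cbd_def intro!: exI[of _ 1])
 show ?thesis
  using lip_bilinear[OF bounded_bilinear.comp[OF bounded_bilinear_scaleR bounded_linear_ident assms(1)] one assms(2)] by simp
qed

lemma lip_add:
 assumes "lip u" "lip v" shows "lip (%i X Y. u i X Y + v i X Y)"
proof -
 obtain C where C: "C > 0" "!!i X Y. i : I ==> X : {0..r} ==> Y : {0..r} ==> norm (u i X Y) <= C"
  using lip_cbd[OF assms(1)] by (rule cbdE) blast
 obtain C' where C': "C' > 0" "!!i X Y. i : I ==> X : {0..r} ==> Y : {0..r} ==> norm (v i X Y) <= C'"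
  using lip_cbd[OF assms(2)] by (rule cbdE) blast
 obtain L where L: "L > 0" "!!i X Y X' Y'. i : I ==> X : {0..r} ==> Y : {0..r} ==> X' : {0..r} ==> Y' : {0..r} ==>
   norm (u i X' Y' - u i X Y) <= L * (\<bar>X' - X\<bar> + \<bar>Y' - Y\<bar>)" using assms(1) by (rule lipE) blast
 obtain L' where L': "L' > 0" "!!i X Y X' Y'. i : I ==> X : {0..r} ==> Y : {0..r} ==> X' : {0..r} ==> Y' : {0..r} ==>
   norm (v i X' Y' - v i X Y) <= L' * (\<bar>X' - X\<bar> + \<bar>Y' - Y\<bar>)" using assms(2) by (rule lipE) blast
 show ?thesis unfolding lip_def cbd_def
 proof (intro conjI exI ballI)
  fix i X Y assume *: "i : I" "X : {0..r}" "Y : {0..r}"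
  show "norm (u i X Y + v i X Y) <= C + C'"
   using * by (intro norm_triangle_mono C C')
  fix X' Y' assume **: "X' : {0..r}" "Y' : {0..r}"
  have "norm ((u i X' Y' - u i X Y) + (v i X' Y' - v i X Y)) <= L * (\<bar>X' - X\<bar> + \<bar>Y' - Y\<bar>) + L' * (\<bar>X' - X\<bar> + \<bar>Y' - Y\<bar>)"
   using * ** by (intro norm_triangle_mono L L')
  then show "norm (u i X' Y' + v i X' Y' - (u i X Y + v i X Y)) <= (L + L') * (\<bar>X' - X\<bar> + \<bar>Y' - Y\<bar>)"
   by (simp add: algebra_simps)
 qed
qed

lemma lip_diff: "lip u ==> lip v ==> lip (%i X Y. u i X Y - v i X Y)"
 using lip_add[of u "%i X Y. - v i X Y"] lip_linear[OF bounded_linear_minus[OF bounded_linear_ident], of v] by simp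

lemma lip_param: "(!!i. i : I ==> norm (c i) <= C) ==> lip (%i X Y. c i)"
 unfolding lip_def cbd_def by (intro conjI exI[of _ C] exI[of _ 0]) auto

lemma lip_const: "lip (%i X Y. c)"
 by (rule lip_param[of _ "norm c"]) simp

lemmas lip_mult = lip_bilinear[OF bounded_bilinear_mult]
lemmas lip_cnj = lip_linear[OF bounded_linear_cnj]

lemma lip_cong:
 assumes "lip u" and eq: "!!i X Y. i : I ==> X : {0..r} ==> Y : {0..r} ==> v i X Y = u i X Y"
 shows "lip v"
 using assms(1) unfolding lip_def cbd_def by (simp add: eq)

lemma hasx_bound:
 assumes "hasx v v1" "cbd v1"
 obtains C where "C > 0" "!!i X X' Y. i : I ==> X : {0..r} ==> X' : {0..r} ==> Y : {0..r} ==> norm (v i X' Y - v i X Y) <= C * \<bar>X' - X\<bar>"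
proof -
 obtain C where C: "C > 0" "!!i X Y. i : I ==> X : {0..r} ==> Y : {0..r} ==> norm (v1 i X Y) <= C" using assms(2) by (rule cbdE) blast
 show ?thesis
 proof (rule that[of C])
  fix i X X' Y assume *: "i : I" "X : {0..r}" "X' : {0..r}" "Y : {0..r}"
  have "norm (v i X' Y - v i X Y) <= C * norm (X' - X)"
  proof (rule differentiable_bound[of "{0..r}" "%s. v i s Y" "%s h. h *\<^sub>R v1 i s Y"])
   fix s assume s: "s : {0..r}"
   show "((%s. v i s Y) has_derivative (%h. h *\<^sub>R v1 i s Y)) (at s within {0..r})"
    using assms(1) s * by (auto simp: hasx_def has_vector_derivative_def)
   show "onorm (%h. h *\<^sub>R v1 i s Y) <= C"
    by (rule onorm_le) (use C(2)[OF *(1) s *(4)] in \<open>auto simp: mult.commute[of C] mult_left_mono\<close>)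
  qed (use * in auto)
  then show "norm (v i X' Y - v i X Y) <= C * \<bar>X' - X\<bar>" by simp
 qed (use C in auto)
qed

lemma hasy_iff_hasx: "hasy v v2 \<longleftrightarrow> hasx (%i X Y. v i Y X) (%i X Y. v2 i Y X)"
 unfolding hasx_def hasy_def by auto

lemma cbd_swap: "cbd v ==> cbd (%i X Y. v i Y X)"
 unfolding cbd_def by auto

lemma lip_swap: "lip v ==> lip (%i X Y. v i Y X)"
proof -
 assume v: "lip v"
 obtain L where L: "L > 0" "!!i X Y X' Y'. i : I ==> X : {0..r} ==> Y : {0..r} ==> X' : {0..r} ==> Y' : {0..r} ==>
   norm (v i X' Y' - v i X Y) <= L * (\<bar>X' - X\<bar> + \<bar>Y' - Y\<bar>)" using v by (rule lipE) blast
 show ?thesis unfolding lip_def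
 proof (intro conjI exI ballI)
  show "cbd (%i X Y. v i Y X)" by (rule cbd_swap[OF lip_cbd[OF v]])
  fix i X Y X' Y' assume "i : I" "X : {0..r}" "Y : {0..r}" "X' : {0..r}" "Y' : {0..r}"
  then show "norm (v i Y' X' - v i Y X) <= L * (\<bar>X' - X\<bar> + \<bar>Y' - Y\<bar>)" using L(2)[of i Y X Y' X'] by (simp add: add.commute)
 qed
qed

lemma lip_of_derivs:
 assumes "hasx v v1" "hasy v v2" "cbd v" "cbd v1" "cbd v2" shows "lip v"
proof -
 obtain C where C: "C > 0" "!!i X X' Y. i : I ==> X : {0..r} ==> X' : {0..r} ==> Y : {0..r} ==> norm (v i X' Y - v i X Y) <= C * \<bar>X' - X\<bar>"
  by (rule hasx_bound[OF assms(1,4)]) blast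
 obtain C' where C': "C' > 0" "!!i Y Y' X. i : I ==> Y : {0..r} ==> Y' : {0..r} ==> X : {0..r} ==> norm (v i X Y' - v i X Y) <= C' * \<bar>Y' - Y\<bar>"
  by (rule hasx_bound[OF assms(2)[unfolded hasy_iff_hasx] cbd_swap[OF assms(5)]]) blast
 have "norm (v i X' Y' - v i X Y) <= (C + C') * (\<bar>X' - X\<bar> + \<bar>Y' - Y\<bar>)"
  if "i : I" "X : {0..r}" "Y : {0..r}" "X' : {0..r}" "Y' : {0..r}" for i X Y X' Y'
 proof -
  have "norm (v i X' Y' - v i X Y) <= norm (v i X' Y' - v i X Y') + norm (v i X Y' - v i X Y)"
   using norm_triangle_ineq[of "v i X' Y' - v i X Y'" "v i X Y' - v i X Y"] by simp
  also have "\<dots> <= C * \<bar>X' - X\<bar> + C' * \<bar>Y' - Y\<bar>" using that by (intro add_mono C C')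
  also have "\<dots> <= (C + C') * (\<bar>X' - X\<bar> + \<bar>Y' - Y\<bar>)" using C(1) C'(1) by (simp add: algebra_simps)
  finally show ?thesis .
 qed
 with assms(3) show ?thesis unfolding lip_def by (intro conjI exI[of _ "C + C'"]) simp_all
qed

definition tayx :: "('i, 'a::real_normed_vector) field2 => ('i, 'a) field2 => bool" where
 "tayx v v1 \<longleftrightarrow> (EX C>0. ALL i:I. ALL X:{0..r}. ALL X':{0..r}. ALL Y:{0..r}.
   norm (v i X' Y - v i X Y - (X' - X) *\<^sub>R v1 i X Y) <= C * (X' - X)\<^sup>2)"

definition tayy :: "('i, 'a::real_normed_vector) field2 => ('i, 'a) field2 => bool" where
 "tayy v v2 \<longleftrightarrow> (EX C>0. ALL i:I. ALL X:{0..r}. ALL Y:{0..r}. ALL Y':{0..r}.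
   norm (v i X Y' - v i X Y - (Y' - Y) *\<^sub>R v2 i X Y) <= C * (Y' - Y)\<^sup>2)"

lemma tayxI:
 assumes "hasx v v1" "lip v1" shows "tayx v v1"
proof -
 obtain C where C: "C > 0" "!!i X Y X' Y'. i : I ==> X : {0..r} ==> Y : {0..r} ==> X' : {0..r} ==> Y' : {0..r} ==>
   norm (v1 i X' Y' - v1 i X Y) <= C * (\<bar>X' - X\<bar> + \<bar>Y' - Y\<bar>)" using assms(2) by (rule lipE) blast
 have "norm (v i X' Y - v i X Y - (X' - X) *\<^sub>R v1 i X Y) <= C * (X' - X)\<^sup>2"
  if *: "i : I" "X : {0..r}" "X' : {0..r}" "Y : {0..r}" for i X X' Y
 proof -
  have sub: "closed_segment X X' \<subseteq> {0..r}" using * by (simp add: closed_segment_eq_real_ivl)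
  have "norm (v i X' Y - v i X Y - (X' - X) *\<^sub>R v1 i X Y) <= norm (X' - X) * (C * \<bar>X' - X\<bar>)"
  proof (rule vector_differentiable_bound_linearization[where S = "closed_segment X X'" and f = "%s. v i s Y" and f' = "%s. v1 i s Y"])
   show "((%s. v i s Y) has_vector_derivative v1 i s Y) (at s within closed_segment X X')" if "s : closed_segment X X'" for s
    by (rule has_vector_derivative_within_subset[OF _ sub]) (use assms(1) * that sub in \<open>auto simp: hasx_def\<close>)
   show "norm (v1 i s Y - v1 i X Y) <= C * \<bar>X' - X\<bar>" if s: "s : closed_segment X X'" for s
   proof -
    from s have "norm (v1 i s Y - v1 i X Y) <= C * (\<bar>s - X\<bar> + \<bar>Y - Y\<bar>)" using * sub by (intro C) auto
    also have "\<dots> <= C * \<bar>X' - X\<bar>" using s C(1) by (intro mult_left_mono) (auto simp: closed_segment_eq_real_ivl split: if_splits)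
    finally show "norm (v1 i s Y - v1 i X Y) <= C * \<bar>X' - X\<bar>" .
   qed
  qed auto
  also have "\<dots> = C * (X' - X)\<^sup>2" by (simp add: power2_eq_square abs_mult_self_eq mult_ac)
  finally show ?thesis .
 qed
 with C(1) show ?thesis unfolding tayx_def by (intro exI[of _ C]) simp
qed

lemma tayyI:
 assumes "hasy v v2" "lip v2" shows "tayy v v2"
proof -
 have "tayx (%i X Y. v i Y X) (%i X Y. v2 i Y X)"
  by (rule tayxI[OF assms(1)[unfolded hasy_iff_hasx] lip_swap[OF assms(2)]])
 then obtain C where "C > 0" "!!i X X' Y. i : I ==> X : {0..r} ==> X' : {0..r} ==> Y : {0..r} ==>
   norm (v i Y X' - v i Y X - (X' - X) *\<^sub>R v2 i Y X) <= C * (X' - X)\<^sup>2"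
  unfolding tayx_def by auto
 then show ?thesis unfolding tayy_def by (intro exI[of _ C]) simp
qed

text \<open>A weight \<open>\<rho> \<ge> e\<close> measures errors: with \<open>\<rho> = e\<close> the relation below is the rate claimed in the
 theorem, with \<open>\<rho> = e + norm (u - v)\<close> it is the hypothesis of a Gronwall argument for \<open>u - v\<close>.\<close>

definition near :: "('i, real) family => nat => nat =>
  ('i, 'a::real_normed_vector) family => ('i, 'a) field2 => bool" where
 "near rho p q u v \<longleftrightarrow> (ALL e i x y. e <= rho e i x y) &
   (EX C. ALL e:E. ALL i:I. ALL x y. x + p <= N e --> y + q <= N e -->
    norm (u e i x y - v i (e *. x) (e *. y)) <= C * rho e i x y)"

abbreviation nearO :: "nat => nat => ('i, 'a::real_normed_vector) family => ('i, 'a) field2 => bool" where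
 "nearO == near (%e i x y. e)"

lemma nearI:
 assumes "!!e i x y. e <= rho e i x y"
  "!!e i x y. e : E ==> i : I ==> x + p <= N e ==> y + q <= N e ==>
    norm (u e i x y - v i (e *. x) (e *. y)) <= C * rho e i x y"
 shows "near rho p q u v"
 using assms unfolding near_def by blast

lemma near_wt: "near rho p q u v ==> e <= rho e i x y"
 by (simp add: near_def)

lemma nearE:
 assumes "near rho p q u v"
 obtains C where "C > 0" "!!e i x y. e : E ==> i : I ==> x + p <= N e ==> y + q <= N e ==>
    norm (u e i x y - v i (e *. x) (e *. y)) <= C * rho e i x y"
proof -
 from assms obtain C where C: "!!e i x y. e : E ==> i : I ==> x + p <= N e ==> y + q <= N e ==>
    norm (u e i x y - v i (e *. x) (e *. y)) <= C * rho e i x y"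
  unfolding near_def by blast
 show ?thesis
 proof (rule that[of "max C 1"])
  fix e i x y assume "e : E" "i : I" "x + p <= N e" "y + q <= N e"
  then show "norm (u e i x y - v i (e *. x) (e *. y)) <= max C 1 * rho e i x y"
   using E_bounds(1)[of e] near_wt[OF assms, of e i x y]
   by (intro order_trans[OF C] mult_right_mono) auto
 qed simp
qed

lemma near_wtD: "near rho p q u v ==> e : E ==> 0 <= rho e i x y"
 using near_wt[of rho p q u v e i x y] E_bounds(1)[of e] by simp

lemma grid_in: "e : E ==> x + p <= N e ==> e *. x : {0..r}"
 using N_iff[of e x] E_bounds(1)[of e] by auto

lemma near_mono:
 assumes "near rho p q u v" "p <= p'" "q <= q'" shows "near rho p' q' u v"
proof -
 obtain C where C: "!!e i x y. e : E ==> i : I ==> x + p <= N e ==> y + q <= N e ==>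
    norm (u e i x y - v i (e *. x) (e *. y)) <= C * rho e i x y" using assms(1) by (rule nearE) blast
 show ?thesis
  by (rule nearI[where C = C], rule near_wt[OF assms(1)], rule C) (use assms(2,3) in auto)
qed

lemma near_weaken:
 assumes "nearO p q u v" and rho: "!!e i x y. e <= rho e i x y"
 shows "near rho p q u v"
proof -
 obtain C where C: "C > 0" "!!e i x y. e : E ==> i : I ==> x + p <= N e ==> y + q <= N e ==>
    norm (u e i x y - v i (e *. x) (e *. y)) <= C * e" using assms(1) by (rule nearE) blast
 show ?thesis
  by (rule nearI[where C = C], rule rho, rule order_trans[OF C(2)])
   (use C(1) rho in \<open>auto intro: mult_left_mono\<close>)
qed

lemma near_cong:
 assumes "near rho p q u v"
  and "!!e i x y. e : E ==> i : I ==> x + p <= N e ==> y + q <= N e ==> u' e i x y = u e i x y"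
  and "!!i X Y. i : I ==> X : {0..r} ==> Y : {0..r} ==> v' i X Y = v i X Y"
 shows "near rho p q u' v'"
proof -
 obtain C where C: "!!e i x y. e : E ==> i : I ==> x + p <= N e ==> y + q <= N e ==>
    norm (u e i x y - v i (e *. x) (e *. y)) <= C * rho e i x y" using assms(1) by (rule nearE) blast
 show ?thesis
 proof (rule nearI[where C = C])
  fix e i x y assume *: "e : E" "i : I" "x + p <= N e" "y + q <= N e"
  then show "norm (u' e i x y - v' i (e *. x) (e *. y)) <= C * rho e i x y"
   unfolding assms(2)[OF *] assms(3)[OF *(2) grid_in[OF *(1,3)] grid_in[OF *(1,4)]] by (rule C)
 qed (rule near_wt[OF assms(1)])
qed

lemma near_add:
 assumes "near rho p q u v" "near rho p q u' v'"
 shows "near rho p q (%e i x y. u e i x y + u' e i x y) (%i X Y. v i X Y + v' i X Y)"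
proof -
 obtain C where C: "!!e i x y. e : E ==> i : I ==> x + p <= N e ==> y + q <= N e ==>
    norm (u e i x y - v i (e *. x) (e *. y)) <= C * rho e i x y" using assms(1) by (rule nearE) blast
 obtain C' where C': "!!e i x y. e : E ==> i : I ==> x + p <= N e ==> y + q <= N e ==>
    norm (u' e i x y - v' i (e *. x) (e *. y)) <= C' * rho e i x y" using assms(2) by (rule nearE) blast
 show ?thesis
 proof (rule nearI[where C = "C + C'"])
  fix e i x y assume *: "e : E" "i : I" "x + p <= N e" "y + q <= N e"
  show "norm (u e i x y + u' e i x y - (v i (e *. x) (e *. y) + v' i (e *. x) (e *. y))) <= (C + C') * rho e i x y"
   using norm_triangle_mono[OF C[OF *] C'[OF *]] by (simp add: algebra_simps)
 qed (rule near_wt[OF assms(1)])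
qed

lemma near_linear:
 assumes "bounded_linear f" "near rho p q u v"
 shows "near rho p q (%e i x y. f (u e i x y)) (%i X Y. f (v i X Y))"
proof -
 interpret bounded_linear f by fact
 obtain K where K: "K > 0" "!!x. norm (f x) <= norm x * K" using pos_bounded by blast
 obtain C where C: "!!e i x y. e : E ==> i : I ==> x + p <= N e ==> y + q <= N e ==>
    norm (u e i x y - v i (e *. x) (e *. y)) <= C * rho e i x y" using assms(2) by (rule nearE) blast
 show ?thesis
 proof (rule nearI[where C = "C * K"])
  fix e i x y assume *: "e : E" "i : I" "x + p <= N e" "y + q <= N e"
  show "norm (f (u e i x y) - f (v i (e *. x) (e *. y))) <= C * K * rho e i x y"
   unfolding diff[symmetric] using order_trans[OF K(2) mult_right_mono[OF C[OF *]]] K(1) by (simp add: mult_ac)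
 qed (rule near_wt[OF assms(2)])
qed

lemma near_diff:
 "near rho p q u v ==> near rho p q u' v' ==> near rho p q (%e i x y. u e i x y - u' e i x y) (%i X Y. v i X Y - v' i X Y)"
 using near_add[of rho p q u v "%e i x y. - u' e i x y" "%i X Y. - v' i X Y"]
  near_linear[OF bounded_linear_minus[OF bounded_linear_ident], of rho p q u' v'] by simp

text \<open>In \<open>u * u' - v * v' = u * (u' - v') + (u - v) * v'\<close> only one discrete and
  one continuous factor remain to be bounded. Both bounds are independent of the weight
  \<open>rho\<close>, which may itself contain the unknown error.\<close>

lemma near_bilinear:
 assumes "bounded_bilinear bl" "near rho p q u v" "near rho p q u' v'" "bdd p q u" "cbd v'"
 shows "near rho p q (%e i x y. bl (u e i x y) (u' e i x y)) (%i X Y. bl (v i X Y) (v' i X Y))"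
proof -
 interpret bounded_bilinear bl by fact
 obtain K where K: "K > 0" "!!a b. norm (bl a b) <= norm a * norm b * K" using pos_bounded by blast
 obtain C where C: "C > 0" "!!e i x y. e : E ==> i : I ==> x + p <= N e ==> y + q <= N e ==>
    norm (u e i x y - v i (e *. x) (e *. y)) <= C * rho e i x y" using assms(2) by (rule nearE) blast
 obtain C' where C': "C' > 0" "!!e i x y. e : E ==> i : I ==> x + p <= N e ==> y + q <= N e ==>
    norm (u' e i x y - v' i (e *. x) (e *. y)) <= C' * rho e i x y" using assms(3) by (rule nearE) blast
 obtain B where B: "B > 0" "!!e i x y. e : E ==> i : I ==> x + p <= N e ==> y + q <= N e ==> norm (u e i x y) <= B"
  using assms(4) by (rule bddE) blast
 obtain B' where B': "B' > 0" "!!i X Y. i : I ==> X : {0..r} ==> Y : {0..r} ==> norm (v' i X Y) <= B'" using assms(5) by (rule cbdE) blast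
 show ?thesis
 proof (rule nearI[where C = "B * C' * K + C * B' * K"])
  fix e i x y assume *: "e : E" "i : I" "x + p <= N e" "y + q <= N e"
  let ?X = "e *. x" and ?Y = "e *. y" and ?r = "rho e i x y"
  have r: "?r >= 0" using near_wtD[OF assms(2) *(1)] .
  have XY: "?X : {0..r}" "?Y : {0..r}" using grid_in * by blast+
  have "bl (u e i x y) (u' e i x y) - bl (v i ?X ?Y) (v' i ?X ?Y)
   = bl (u e i x y) (u' e i x y - v' i ?X ?Y) + bl (u e i x y - v i ?X ?Y) (v' i ?X ?Y)"
   by (simp add: diff_left diff_right)
  also have "norm \<dots> <= B * (C' * ?r) * K + (C * ?r) * B' * K"
   using K(1) C(1) C'(1) B(1) B'(1) r
   by (intro norm_triangle_le add_mono order_trans[OF K(2)] mult_mono B(2)[OF *] C(2)[OF *] C'(2)[OF *] B'(2)[OF *(2) XY])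
     auto
  finally show "norm (bl (u e i x y) (u' e i x y) - bl (v i ?X ?Y) (v' i ?X ?Y)) <= (B * C' * K + C * B' * K) * ?r"
   by (simp add: algebra_simps)
 qed (rule near_wt[OF assms(2)])
qed

lemmas near_mult = near_bilinear[OF bounded_bilinear_mult]
lemmas near_cnj = near_linear[OF bounded_linear_cnj]

lemma near_param: "(!!e i x y. e <= rho e i x y) ==> near rho p q (%e i x y. c i) (%i X Y. c i)"
 by (rule nearI[where C = 0]) auto

text \<open>Terms carrying a factor \<open>e\<close> are consistency errors: they are absent from
  the limit equations, and every weight admits them because it dominates the step.\<close>

lemma near_small:
 fixes w :: "('i, complex) family"
 assumes "bdd p q w" and rho: "!!e i x y. e <= rho e i x y"
 shows "near rho p q (%e i x y. complex_of_real e * w e i x y) (%i X Y. 0)"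
proof -
 obtain B where B: "B > 0" "!!e i x y. e : E ==> i : I ==> x + p <= N e ==> y + q <= N e ==> norm (w e i x y) <= B"
  using assms(1) by (rule bddE) blast
 show ?thesis
 proof (rule nearI[where C = B, OF rho])
  fix e i x y assume *: "e : E" "i : I" "x + p <= N e" "y + q <= N e"
  have "e * norm (w e i x y) <= rho e i x y * B"
   using B(2)[OF *] B(1) rho[of e i x y] E_bounds(1)[OF *(1)] by (intro mult_mono) auto
  then show "norm (complex_of_real e * w e i x y - 0) <= B * rho e i x y"
   using E_bounds(1)[OF *(1)] by (simp add: norm_mult mult.commute)
 qed
qed

lemma near_add_small:
 fixes w :: "('i, complex) family"
 assumes "near rho p q u v" "bdd p q w"
 shows "near rho p q (%e i x y. u e i x y + complex_of_real e * w e i x y) v"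
 using near_add[OF assms(1) near_small[OF assms(2) near_wt[OF assms(1)]]] by simp

lemma near_bdd:
 assumes "nearO p q u v" "cbd v" shows "bdd p q u"
proof -
 obtain C where C: "C > 0" "!!e i x y. e : E ==> i : I ==> x + p <= N e ==> y + q <= N e ==>
    norm (u e i x y - v i (e *. x) (e *. y)) <= C * e" using assms(1) by (rule nearE) blast
 obtain B where B: "B > 0" "!!i X Y. i : I ==> X : {0..r} ==> Y : {0..r} ==> norm (v i X Y) <= B" using assms(2) by (rule cbdE) blast
 show ?thesis
 proof (rule bddI)
  fix e i x y assume *: "e : E" "i : I" "x + p <= N e" "y + q <= N e"
  have "norm (u e i x y) <= norm (u e i x y - v i (e *. x) (e *. y)) + norm (v i (e *. x) (e *. y))"
   using norm_triangle_ineq[of "u e i x y - v i (e *. x) (e *. y)" "v i (e *. x) (e *. y)"] by simp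
  also have "\<dots> <= C * e + B" using * by (intro add_mono C B grid_in) auto
  also have "\<dots> <= C + B" using C(1) E_bounds(3)[OF *(1)] by simp
  finally show "norm (u e i x y) <= C + B" .
 qed
qed

end

section \<open>Errors of order of the mesh size\<close>

context grid_families begin

text \<open>Error growth over one step: the Taylor remainder of order \<open>e\<^sup>2\<close> is at
  most a multiple of \<open>e * rho\<close> because a weight dominates the step, and the error of
  the difference quotient contributes \<open>e * K * rho\<close>.\<close>

lemma near_step_x:
 fixes u :: "('i, 'a::real_normed_vector) family"
 assumes "tayx v v1" "near rho p q (dx u) v1"
 obtains L where "L > 0" "!!e i x y. e : E ==> i : I ==> x + p <= N e ==> Suc x <= N e ==> y + q <= N e ==>
   norm (u e i (Suc x) y - v i (e *. (Suc x)) (e *. y))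
   <= norm (u e i x y - v i (e *. x) (e *. y)) + e * L * rho e i x y"
proof -
 obtain C where C: "C > 0" "!!i X X' Y. i : I ==> X : {0..r} ==> X' : {0..r} ==> Y : {0..r} ==>
   norm (v i X' Y - v i X Y - (X' - X) *\<^sub>R v1 i X Y) <= C * (X' - X)\<^sup>2"
  using assms(1) unfolding tayx_def by auto
 obtain K where K: "K > 0" "!!e i x y. e : E ==> i : I ==> x + p <= N e ==> y + q <= N e ==>
    norm (dx u e i x y - v1 i (e *. x) (e *. y)) <= K * rho e i x y" using assms(2) by (rule nearE) blast
 show ?thesis
 proof (rule that[of "C + K"])
  fix e i x y assume *: "e : E" "i : I" "x + p <= N e" "Suc x <= N e" "y + q <= N e"
  note e = E_bounds(1)[OF *(1)]
  let ?X = "e *. x" and ?X' = "e *. (Suc x)" and ?Y = "e *. y"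
  have in_r: "?X : {0..r}" "?X' : {0..r}" "?Y : {0..r}"
   using grid_in[OF *(1), of x 0] grid_in[OF *(1), of "Suc x" 0] grid_in[OF *(1), of y 0] * by simp_all
  have d: "?X' - ?X = e" by (simp add: algebra_simps)
  have "u e i (Suc x) y = u e i x y + e *\<^sub>R dx u e i x y" using e by (simp add: dx_def)
  then have eq: "u e i (Suc x) y - v i ?X' ?Y = (u e i x y - v i ?X ?Y) + (e *\<^sub>R (dx u e i x y - v1 i ?X ?Y)
    - (v i ?X' ?Y - v i ?X ?Y - (?X' - ?X) *\<^sub>R v1 i ?X ?Y))"
   unfolding d by (simp add: algebra_simps)
  have tri: "norm (a + (b - c)) <= norm a + (norm b + norm c)" for a b c :: 'a
   using norm_triangle_ineq[of a "b - c"] norm_triangle_ineq4[of b c] by simp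
  have 1: "norm (e *\<^sub>R (dx u e i x y - v1 i ?X ?Y)) <= e * (K * rho e i x y)"
   using K(2)[OF *(1,2,3,5)] e by simp
  have 2: "norm (v i ?X' ?Y - v i ?X ?Y - (?X' - ?X) *\<^sub>R v1 i ?X ?Y) <= C * e\<^sup>2"
   using C(2)[OF *(2) in_r(1,2,3)] unfolding d .
  have 3: "C * e\<^sup>2 <= e * (C * rho e i x y)"
   using near_wt[OF assms(2), of e i x y] e C(1) by (simp add: power2_eq_square)
  have "norm (u e i (Suc x) y - v i ?X' ?Y) <= norm (u e i x y - v i ?X ?Y) + (e * (K * rho e i x y) + e * (C * rho e i x y))"
   unfolding eq by (rule order_trans[OF tri]) (use 1 2 3 in linarith)
  then show "norm (u e i (Suc x) y - v i ?X' ?Y) <= norm (u e i x y - v i ?X ?Y) + e * (C + K) * rho e i x y"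
   by (simp add: algebra_simps)
 qed (use C K in simp)
qed

lemma near_transp:
 assumes "near rho p q u v" shows "near (transp rho) q p (transp u) (%i X Y. v i Y X)"
proof -
 obtain C where C: "!!e i x y. e : E ==> i : I ==> x + p <= N e ==> y + q <= N e ==>
    norm (u e i x y - v i (e *. x) (e *. y)) <= C * rho e i x y" using assms by (rule nearE) blast
 show ?thesis by (rule nearI[where C = C]) (simp_all add: transp_def C near_wt[OF assms])
qed

lemma near_step_y:
 fixes u :: "('i, 'a::real_normed_vector) family"
 assumes "tayy v v2" "near rho p q (dy u) v2"
 obtains L where "L > 0" "!!e i x y. e : E ==> i : I ==> y + q <= N e ==> Suc y <= N e ==> x + p <= N e ==>
   norm (u e i x (Suc y) - v i (e *. x) (e *. (Suc y)))
   <= norm (u e i x y - v i (e *. x) (e *. y)) + e * L * rho e i x y"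
proof -
 have "tayx (%i X Y. v i Y X) (%i X Y. v2 i Y X)"
  using assms(1) unfolding tayx_def tayy_def by auto
 moreover have "near (transp rho) q p (dx (transp u)) (%i X Y. v2 i Y X)"
  using near_transp[OF assms(2)] by (simp add: dx_transp)
 ultimately obtain L where "L > 0" "!!e i x y. e : E ==> i : I ==> x + q <= N e ==> Suc x <= N e ==> y + p <= N e ==>
   norm (transp u e i (Suc x) y - v i (e *. y) (e *. (Suc x)))
   <= norm (transp u e i x y - v i (e *. y) (e *. x)) + e * L * transp rho e i x y"
  by (rule near_step_x) blast
 then show ?thesis by (intro that[of L]) (simp_all add: transp_def)
qed

text \<open>Both derivatives are prescribed, so the error is propagated along the bottom row and
  then up each column. With \<open>rho\<close> equal to step plus error, the one-step estimate is a
  Gronwall inequality for \<open>rho\<close> itself, starting from \<open>rho = e\<close> at the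
  corner.\<close>

theorem rate_total:
 fixes u :: "('i, 'a::real_normed_vector) family"
 assumes tay: "tayx v v1" "tayy v v2"
  and init: "!!e i. e : E ==> i : I ==> u e i 0 0 = v i 0 0"
  and rho: "rho = (%e i x y. e + norm (u e i x y - v i (e *. x) (e *. y)))"
  and nx: "near rho 1 0 (dx u) v1" and ny: "near rho 0 1 (dy u) v2"
 shows "nearO 0 0 u v"
proof -
 obtain L where L: "L > 0" "!!e i x y. e : E ==> i : I ==> x + 1 <= N e ==> Suc x <= N e ==> y + 0 <= N e ==>
   norm (u e i (Suc x) y - v i (e *. (Suc x)) (e *. y))
   <= norm (u e i x y - v i (e *. x) (e *. y)) + e * L * rho e i x y"
  using tay(1) nx by (rule near_step_x) blast
 obtain M where M: "M > 0" "!!e i x y. e : E ==> i : I ==> y + 1 <= N e ==> Suc y <= N e ==> x + 0 <= N e ==>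
   norm (u e i x (Suc y) - v i (e *. x) (e *. (Suc y)))
   <= norm (u e i x y - v i (e *. x) (e *. y)) + e * M * rho e i x y"
  using tay(2) ny by (rule near_step_y) blast
 show ?thesis
 proof (rule nearI[where C = "exp (M * r) * exp (L * r)"])
  fix e i x y assume *: "e : E" "i : I" "x + 0 <= N e" "y + 0 <= N e"
  note e = E_bounds(1)[OF *(1)]
  have 1: "rho e i x 0 <= exp (L * r) * e"
  proof (rule gronwall_steps[where e = e and w = "%x. rho e i x 0"])
   show "e *. x <= r" using N_iff[OF *(1), of x] * by simp
   show "rho e i 0 0 <= e" using init[OF *(1,2)] by (simp add: rho)
   fix m assume "m < x"
   then show "rho e i (Suc m) 0 <= (1 + e * L) * rho e i m 0"
    using L(2)[of e i m 0] * by (simp add: rho algebra_simps)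
  qed (use e L in auto)
  have "rho e i x y <= exp (M * r) * (exp (L * r) * e)"
  proof (rule gronwall_steps[where e = e and w = "%y. rho e i x y"])
   show "e *. y <= r" using N_iff[OF *(1), of y] * by simp
   fix m assume "m < y"
   then show "rho e i x (Suc m) <= (1 + e * M) * rho e i x m"
    using M(2)[of e i m x] * by (simp add: rho algebra_simps)
  qed (use e M 1 in auto)
  then show "norm (u e i x y - v i (e *. x) (e *. y)) <= exp (M * r) * exp (L * r) * e"
   using e by (simp add: rho mult.assoc)
 qed simp
qed

text \<open>\<open>u\<close> can only be propagated in y and \<open>w\<close> only in x, while each
  right-hand side contains both errors, so Gronwall closes on no line. The induction runs over
  \<open>x + y\<close>: the values needed for either unknown lie on the previous antidiagonal, and a
  majorant depending on \<open>x + y\<close> alone controls both.\<close>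

theorem rate_Goursat:
 fixes u :: "('i, 'a::real_normed_vector) family"
  and w :: "real => 'i => nat => nat => 'b::real_normed_vector"
 assumes tay: "tayy v v2" "tayx z z1"
  and u0: "nearO 1 0 (%e i x y. u e i x 0) (%i X Y. v i X 0)"
  and w0: "nearO 0 1 (%e i x y. w e i 0 y) (%i X Y. z i 0 Y)"
  and rho: "rho = (%e i x y. e + norm (u e i x y - v i (e *. x) (e *. y)) + norm (w e i x y - z i (e *. x) (e *. y)))"
  and ny: "near rho 1 1 (dy u) v2" and nx: "near rho 1 1 (dx w) z1"
 shows "nearO 1 0 u v" "nearO 0 1 w z"
proof -
 obtain L where L: "L > 0" "!!e i x y. e : E ==> i : I ==> x + 1 <= N e ==> Suc x <= N e ==> y + 1 <= N e ==>
   norm (w e i (Suc x) y - z i (e *. (Suc x)) (e *. y))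
   <= norm (w e i x y - z i (e *. x) (e *. y)) + e * L * rho e i x y"
  using tay(2) nx by (rule near_step_x) blast
 obtain M where M: "M > 0" "!!e i x y. e : E ==> i : I ==> y + 1 <= N e ==> Suc y <= N e ==> x + 1 <= N e ==>
   norm (u e i x (Suc y) - v i (e *. x) (e *. (Suc y)))
   <= norm (u e i x y - v i (e *. x) (e *. y)) + e * M * rho e i x y"
  using tay(1) ny by (rule near_step_y) blast
 obtain C where C: "C > 0" "!!e i x y. e : E ==> i : I ==> x + 1 <= N e ==> y + 0 <= N e ==>
   norm (u e i x 0 - v i (e *. x) 0) <= C * e" using u0 by (rule nearE) blast
 obtain C' where C': "C' > 0" "!!e i x y. e : E ==> i : I ==> x + 0 <= N e ==> y + 1 <= N e ==>
   norm (w e i 0 y - z i 0 (e *. y)) <= C' * e" using w0 by (rule nearE) blast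
 \<comment> \<open>\<open>P\<close> makes the majorant \<open>G\<close> dominate the step and both
   boundary errors; the factor 3 in \<open>K\<close> counts the three summands of
   \<open>rho\<close>, each at most \<open>G\<close>.\<close>
 define P where "P = C + C' + 1"
 define K where "K = 3 * (L + M)"
 define G where "G = (%e n. P * e * (1 + e * K) ^ n)"
 have PK: "P >= 1" "C <= P" "C' <= P" "K > 0" using C(1) C'(1) L(1) M(1) by (simp_all add: P_def K_def)
 have main: "(x + 1 <= N e --> y <= N e --> norm (u e i x y - v i (e *. x) (e *. y)) <= G e (x + y)) &
   (x <= N e --> y + 1 <= N e --> norm (w e i x y - z i (e *. x) (e *. y)) <= G e (x + y))"
  if e: "e : E" and i: "i : I" for e i x y
 proof (induction "x + y" arbitrary: x y rule: less_induct)
  case less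
  note e0 = E_bounds(1)[OF e]
  have Ge: "e <= G e n" for n
  proof -
   have "1 * e * 1 <= P * e * (1 + e * K) ^ n"
    using PK e0 by (intro mult_mono one_le_power) auto
   then show ?thesis by (simp add: G_def)
  qed
  have GS: "G e n + e * A * (3 * G e n) <= G e (Suc n)" if "A <= L + M" for A n
  proof -
   have "G e n + e * A * (3 * G e n) <= G e n + e * (L + M) * (3 * G e n)"
    using that e0 Ge[of n] by (intro add_left_mono mult_right_mono mult_left_mono) auto
   also have "\<dots> = G e (Suc n)" by (simp add: G_def K_def algebra_simps)
   finally show ?thesis .
  qed
  have rhoG: "rho e i x y <= 3 * G e (x + y)" if "x + 1 <= N e" "y + 1 <= N e"
   "norm (u e i x y - v i (e *. x) (e *. y)) <= G e (x + y)"
   "norm (w e i x y - z i (e *. x) (e *. y)) <= G e (x + y)" for x y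
   using that Ge[of "x + y"] by (simp add: rho)
  have pos: "C * e <= G e n" "C' * e <= G e n" for n
  proof -
   have "C * e * 1 <= P * e * (1 + e * K) ^ n" "C' * e * 1 <= P * e * (1 + e * K) ^ n"
    using PK e0 C(1) C'(1) by (intro mult_mono one_le_power; auto)+
   then show "C * e <= G e n" "C' * e <= G e n" by (simp_all add: G_def)
  qed
  show ?case
  proof (intro conjI impI)
   assume xy: "x + 1 <= N e" "y <= N e"
   show "norm (u e i x y - v i (e *. x) (e *. y)) <= G e (x + y)"
   proof (cases y)
    case 0
    then show ?thesis using C(2)[OF e i xy(1), of 0] pos(1)[of x] by simp
   next
    case (Suc y')
    have IH: "norm (u e i x y' - v i (e *. x) (e *. y')) <= G e (x + y')"
     "norm (w e i x y' - z i (e *. x) (e *. y')) <= G e (x + y')"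
     using less[of x y'] Suc xy by auto
    have "norm (u e i x (Suc y') - v i (e *. x) (e *. (Suc y'))) <=
      norm (u e i x y' - v i (e *. x) (e *. y')) + e * M * rho e i x y'"
     using Suc xy by (intro M(2)[OF e i]) auto
    also have "\<dots> <= G e (x + y') + e * M * (3 * G e (x + y'))"
     using IH rhoG[of x y'] Suc xy e0 M(1) by (intro add_mono mult_left_mono) auto
    also have "\<dots> <= G e (Suc (x + y'))" using L(1) by (intro GS) simp
    finally show ?thesis using Suc by simp
   qed
  next
   assume xy: "x <= N e" "y + 1 <= N e"
   show "norm (w e i x y - z i (e *. x) (e *. y)) <= G e (x + y)"
   proof (cases x)
    case 0
    then show ?thesis using C'(2)[OF e i _ xy(2), of 0] pos(2)[of y] by simp
   next
    case (Suc x')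
    have IH: "norm (u e i x' y - v i (e *. x') (e *. y)) <= G e (x' + y)"
     "norm (w e i x' y - z i (e *. x') (e *. y)) <= G e (x' + y)"
     using less[of x' y] Suc xy by auto
    have "norm (w e i (Suc x') y - z i (e *. (Suc x')) (e *. y)) <=
      norm (w e i x' y - z i (e *. x') (e *. y)) + e * L * rho e i x' y"
     using Suc xy by (intro L(2)[OF e i]) auto
    also have "\<dots> <= G e (x' + y) + e * L * (3 * G e (x' + y))"
     using IH rhoG[of x' y] Suc xy e0 L(1) by (intro add_mono mult_left_mono) auto
    also have "\<dots> <= G e (Suc (x' + y))" using M(1) by (intro GS) simp
    finally show ?thesis using Suc by simp
   qed
  qed
 qed
 have G_le: "G e (x + y) <= P * exp (K * (2 * r)) * e" if e: "e : E" and xy: "x <= N e" "y <= N e" for e x y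
 proof -
  note e0 = E_bounds(1)[OF e]
  have "(1 + e * K) ^ (x + y) <= exp (K * (2 * r)) * 1"
  proof (rule gronwall_steps[where e = e and w = "%n. (1 + e * K) ^ n"])
   show "e *. (x + y) <= 2 * r"
    using xy N_iff[OF e, of x] N_iff[OF e, of y] by (simp add: algebra_simps)
  qed (use e0 PK in auto)
  then have "P * e * (1 + e * K) ^ (x + y) <= P * e * exp (K * (2 * r))"
   using PK e0 by (intro mult_left_mono) auto
  then show ?thesis by (simp add: G_def mult_ac)
 qed
 show "nearO 1 0 u v"
 proof (rule nearI[where C = "P * exp (K * (2 * r))"])
  fix e i x y assume *: "e : E" "i : I" "x + 1 <= N e" "y + 0 <= N e"
  then show "norm (u e i x y - v i (e *. x) (e *. y)) <= P * exp (K * (2 * r)) * e"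
   using main[OF *(1,2), of x y] G_le[OF *(1), of x y] by auto
 qed simp
 show "nearO 0 1 w z"
 proof (rule nearI[where C = "P * exp (K * (2 * r))"])
  fix e i x y assume *: "e : E" "i : I" "x + 0 <= N e" "y + 1 <= N e"
  then show "norm (w e i x y - z i (e *. x) (e *. y)) <= P * exp (K * (2 * r)) * e"
   using main[OF *(1,2), of x y] G_le[OF *(1), of x y] by auto
 qed simp
qed

end

locale meshed = grid_families r E I for r E and I :: "'i set" +
 assumes E_null: "EX es. (ALL n. es n : E) & es \<longlonglongrightarrow> 0"
begin

text \<open>Limits along the indices \<open>gidx\<close> are available only away from the right and
  top edges; continuity supplies the rest of the closed square.\<close>

lemma eq_by_limit:
 fixes v v' :: "real => real => 'a::real_normed_vector"
 assumes "cont2 v" "cont2 v'"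
  and "!!X Y. 0 <= X ==> X < r ==> 0 <= Y ==> Y < r ==> v X Y = v' X Y"
  and XY: "X : {0..r}" "Y : {0..r}"
 shows "v X Y = v' X Y"
proof -
 have "closure ({0..<r} \<times> {0..<r}) = {0..r} \<times> {0..r}"
  using r_pos by (simp add: closure_Times)
 moreover have "ALL z:{0..<r} \<times> {0..<r}. (case z of (x, y) => v x y) - (case z of (x, y) => v' x y) = 0"
  using assms(3) by auto
 ultimately have "ALL z:{0..r} \<times> {0..r}. (case z of (x, y) => v x y) - (case z of (x, y) => v' x y) = 0"
  using continuous_constant_on_closure[of "{0..<r} \<times> {0..<r}" "%z. (case z of (x, y) => v x y) - (case z of (x, y) => v' x y)" 0]
   continuous_on_diff[OF assms(1,2)] by auto
 then show ?thesis using XY by auto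
qed

end

section \<open>Convergence of difference quotients\<close>

text \<open>Landau's interpolation trick: a difference quotient over a long step \<open>t\<close> is close to the derivative
 (second order bound \<open>B\<close>) and is controlled by the uniform distance \<open>\<eta>0\<close> of the functions.\<close>

lemma landau_step:
 fixes u0 u1 g0 g1 d d' :: "'a::real_normed_vector"
 assumes "norm (u1 - u0 - t *\<^sub>R d) <= B * t\<^sup>2" "norm (g1 - g0 - t *\<^sub>R d') <= B * t\<^sup>2"
  and "norm (u1 - g1) <= eta0" "norm (u0 - g0) <= eta0"
  and H: "H > 0" "H <= \<bar>t\<bar>" "\<bar>t\<bar> <= 2 * H" and "B >= 0" "8 * B * H <= eta" "eta0 = H * eta / 4" "eta >= 0"
 shows "norm (d - d') <= eta"
proof -
 have "t *\<^sub>R (d - d') = (g1 - g0 - t *\<^sub>R d') - (u1 - u0 - t *\<^sub>R d) + ((u1 - g1) - (u0 - g0))"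
  by (simp add: algebra_simps)
 also have "norm \<dots> <= (B * t\<^sup>2 + B * t\<^sup>2) + (eta0 + eta0)"
  by (intro norm_triangle_mono order_trans[OF norm_triangle_ineq4] add_mono assms)
 finally have "\<bar>t\<bar> * norm (d - d') <= \<bar>t\<bar> * (2 * B * \<bar>t\<bar>) + 2 * eta0"
  by (simp add: power2_eq_square abs_mult_self_eq mult_ac)
 also have "\<dots> <= \<bar>t\<bar> * (eta / 2) + \<bar>t\<bar> * (eta / 2)"
 proof (rule add_mono)
  have "2 * B * \<bar>t\<bar> <= 2 * B * (2 * H)" using H assms(8) by (intro mult_left_mono) auto
  also have "\<dots> <= eta / 2" using assms(9) by simp
  finally show "\<bar>t\<bar> * (2 * B * \<bar>t\<bar>) <= \<bar>t\<bar> * (eta / 2)" by (intro mult_left_mono) auto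
  have "H * eta <= \<bar>t\<bar> * eta" using H assms(11) by (intro mult_right_mono) auto
  then show "2 * eta0 <= \<bar>t\<bar> * (eta / 2)" using assms(10) by simp
 qed
 also have "\<dots> = \<bar>t\<bar> * eta" by simp
 finally show ?thesis using H by (simp add: mult_le_cancel_left)
qed

context meshed begin

text \<open>Interpolation needs a long step at every grid point, including those near the boundary.
  A step of \<open>K\<close> indices, of length between \<open>H\<close> and \<open>2 * H\<close>,
  is taken to the left if there is room; otherwise \<open>x < K\<close>, and the smallness of
  \<open>H\<close> and \<open>e\<close> leaves room on the right.\<close>

lemma far_index:
 assumes e: "e : E" and H: "0 < H" "H <= r / 8" "e <= H" "real (m + 2) * e <= r / 4" and x: "x + m <= N e"
 shows "EX x'. x' + m <= N e & H <= \<bar>e *. x' - e *. x\<bar> & \<bar>e *. x' - e *. x\<bar> <= 2 * H"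
proof -
 note e0 = E_bounds(1)[OF e]
 define K where "K = Suc (gidx e H)"
 have K: "H <= e *. K" "e *. K <= 2 * H"
  using gidx_bounds[OF e0, of H] H by (auto simp: K_def algebra_simps)
 show ?thesis
 proof (cases "K <= x")
  case True
  then have "\<bar>e *. (x - K) - e *. x\<bar> = e *. K" using e0 by (simp add: of_nat_diff algebra_simps)
  then show ?thesis using K x True by (intro exI[of _ "x - K"]) auto
 next
  case False
  then have "e *. (x + K + m) <= e *. (K + K + m)" using e0 by (intro mult_left_mono) auto
  also have "\<dots> = 2 * (e *. K) + real m * e" by (simp add: algebra_simps)
  also have "\<dots> <= 4 * H + real (m + 2) * e" using K e0 by (simp add: algebra_simps)
  also have "\<dots> <= r" using H r_pos by linarith
  finally have "x + K + m <= N e" using N_iff[OF e] by blast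
  moreover have "\<bar>e *. (x + K) - e *. x\<bar> = e *. K" using e0 by (simp add: algebra_simps)
  ultimately show ?thesis using K by (intro exI[of _ "x + K"]) auto
 qed
qed

lemma gidx_tendsto:
 assumes "!!n. es n : E" "es \<longlonglongrightarrow> 0" "0 <= X" "X < r"
 shows "(%n. es n *. (gidx (es n) X)) \<longlonglongrightarrow> X"
proof (rule Lim_transform_eventually)
 show "(%n. es n *. (tidx (es n) 0 X)) \<longlonglongrightarrow> X"
  using assms by (intro tidx_tendsto) auto
 show "\<forall>\<^sub>F n in sequentially. es n *. (tidx (es n) 0 X) = es n *. (gidx (es n) X)"
  using tidx_eventually[OF assms, of 0] by eventually_elim simp
qed

lemma near_tendsto:
 fixes u :: "('i, 'a::real_normed_vector) family"
 assumes es: "!!n. es n : E" "es \<longlonglongrightarrow> 0" and i: "i : I"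
  and near: "nearO p q u v" and cont: "cont2 (v i)"
  and X: "0 <= X" "X < r" and Y: "0 <= Y" "Y < r"
 shows "(%n. u (es n) i (gidx (es n) X) (gidx (es n) Y)) \<longlonglongrightarrow> v i X Y"
proof -
 obtain C where C: "C > 0" "!!e i x y. e : E ==> i : I ==> x + p <= N e ==> y + q <= N e ==>
    norm (u e i x y - v i (e *. x) (e *. y)) <= C * e" using near by (rule nearE) blast
 let ?X = "%n. es n *. (gidx (es n) X)" and ?Y = "%n. es n *. (gidx (es n) Y)"
 have ev: "\<forall>\<^sub>F n in sequentially. gidx (es n) X + p <= N (es n) & gidx (es n) Y + q <= N (es n)"
  using tidx_eventually[OF es X, of p] tidx_eventually[OF es Y, of q] by eventually_elim simp
 have "(%n. u (es n) i (gidx (es n) X) (gidx (es n) Y) - v i (?X n) (?Y n)) \<longlonglongrightarrow> 0"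
 proof (rule Lim_null_comparison)
  show "\<forall>\<^sub>F n in sequentially. norm (u (es n) i (gidx (es n) X) (gidx (es n) Y) - v i (?X n) (?Y n)) <= C * es n"
   using ev by eventually_elim (auto intro!: C es i)
  show "(%n. C * es n) \<longlonglongrightarrow> 0" using tendsto_mult_left[OF es(2), of C] by simp
 qed
 moreover have "(%n. v i (?X n) (?Y n)) \<longlonglongrightarrow> v i X Y"
 proof -
  have lim: "(%n. (?X n, ?Y n)) \<longlonglongrightarrow> (X, Y)"
   by (intro tendsto_Pair gidx_tendsto es X Y)
  have "\<forall>\<^sub>F n in sequentially. (?X n, ?Y n) : {0..r} \<times> {0..r}"
   using ev by eventually_elim (auto intro: grid_in[OF es(1)] simp del: atLeastAtMost_iff)
  from continuous_on_tendsto_compose[OF cont lim _ this] X Y show ?thesis by simp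
 qed
 ultimately show ?thesis using tendsto_add by fastforce
qed

definition uclose :: "nat => nat => ('i, 'a::real_normed_vector) family => ('i => nat => nat => real => real => 'a) => bool"
 where "uclose m n u g \<longleftrightarrow> (ALL eta>0. EX e0>0. ALL e:E. e < e0 --> (ALL i:I. ALL x y. x + m <= N e --> y + n <= N e -->
   norm (D m n u e i x y - g i m n (e *. x) (e *. y)) <= eta))"

lemma uclose_Suc_x:
 fixes u :: "('i, 'a::real_normed_vector) family"
 assumes "uclose m n u g" and B0: "B > 0"
  and B: "!!e i x y. e : E ==> i : I ==> x + Suc (Suc m) <= N e ==> y + n <= N e ==> norm (D (Suc (Suc m)) n u e i x y) <= B"
  and T: "!!i X X' Y. i : I ==> X : {0..r} ==> X' : {0..r} ==> Y : {0..r} ==>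
    norm (g i m n X' Y - g i m n X Y - (X' - X) *\<^sub>R g i (Suc m) n X Y) <= B * (X' - X)\<^sup>2"
 shows "uclose (Suc m) n u g"
 unfolding uclose_def
proof (intro allI impI)
 fix eta :: real assume eta: "eta > 0"
 \<comment> \<open>The first bound leaves room for the long step; the second makes the second-order
   error of that step at most half of \<open>eta\<close>. The accuracy \<open>eta0\<close> required
   one order lower is chosen so that division by a step of length at least \<open>H\<close> leaves
   the other half.\<close>
 define H where "H = min (r / 8) (eta / (8 * B))"
 have H: "H > 0" "H <= r / 8" "8 * B * H <= eta"
 proof -
  have "8 * B * H <= 8 * B * (eta / (8 * B))" using B0 by (intro mult_left_mono) (auto simp: H_def)
  then show "8 * B * H <= eta" using B0 by simp
 qed (use r_pos eta B0 in \<open>auto simp: H_def\<close>)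
 define eta0 where "eta0 = H * eta / 4"
 obtain e1 where e1: "e1 > 0" "!!e i x y. e : E ==> e < e1 ==> i : I ==> x + m <= N e ==> y + n <= N e ==>
   norm (D m n u e i x y - g i m n (e *. x) (e *. y)) <= eta0"
  using assms(1)[unfolded uclose_def, rule_format, of eta0] H eta by (auto simp: eta0_def)
 show "EX e0>0. ALL e:E. e < e0 --> (ALL i:I. ALL x y. x + Suc m <= N e --> y + n <= N e -->
   norm (D (Suc m) n u e i x y - g i (Suc m) n (e *. x) (e *. y)) <= eta)"
 proof (intro exI[of _ "min e1 (min H (r / 4 / real (m + 2)))"] conjI ballI impI allI)
  show "0 < min e1 (min H (r / 4 / real (m + 2)))" using e1(1) H r_pos by simp
  fix e i x y assume e: "e : E" "e < min e1 (min H (r / 4 / real (m + 2)))" and i: "i : I"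
   and x: "x + Suc m <= N e" and y: "y + n <= N e"
  have "real (m + 2) * e <= r / 4" using e(2) by (simp add: field_simps)
  then obtain x' where x': "x' + m <= N e" "H <= \<bar>e *. x' - e *. x\<bar>" "\<bar>e *. x' - e *. x\<bar> <= 2 * H"
   using far_index[OF e(1) H(1,2), of m x] e(2) x by auto
  have in_r: "e *. x : {0..r}" "e *. x' : {0..r}" "e *. y : {0..r}"
   using grid_in[OF e(1)] x x' y by blast+
  show "norm (D (Suc m) n u e i x y - g i (Suc m) n (e *. x) (e *. y)) <= eta"
  proof (rule landau_step[OF _ T[OF i in_r] _ _ H(1) x'(2,3) less_imp_le[OF B0] H(3) eta0_def less_imp_le[OF eta]])
   show "norm (D m n u e i x' y - D m n u e i x y - (e *. x' - e *. x) *\<^sub>R D (Suc m) n u e i x y) <= B * (e *. x' - e *. x)\<^sup>2"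
    unfolding D_Suc(1)
    by (rule grid_taylor_x[where p = m and q = n, OF e(1) i less_imp_le[OF B0] B[OF e(1) i, unfolded D_Suc(1)] x y x'(1)])
  qed (use e1(2)[OF e(1) _ i] e(2) x x' y in auto)
 qed
qed

lemma uclose_Suc_y:
 fixes u :: "('i, 'a::real_normed_vector) family"
 assumes "uclose m n u g" and B0: "B > 0"
  and B: "!!e i x y. e : E ==> i : I ==> x + m <= N e ==> y + Suc (Suc n) <= N e ==> norm (D m (Suc (Suc n)) u e i x y) <= B"
  and T: "!!i X Y Y'. i : I ==> X : {0..r} ==> Y : {0..r} ==> Y' : {0..r} ==>
    norm (g i m n X Y' - g i m n X Y - (Y' - Y) *\<^sub>R g i m (Suc n) X Y) <= B * (Y' - Y)\<^sup>2"
 shows "uclose m (Suc n) u g"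
proof -
 have tD: "D k l (transp w) = transp (D l k w)" for k l and w :: "('i, 'a) family"
 proof -
  have "(dy ^^ l) (transp w) = transp ((dx ^^ l) w)" for w :: "('i, 'a) family"
   by (induction l) (simp_all add: dy_transp)
  moreover have "(dx ^^ k) (transp w) = transp ((dy ^^ k) w)" for w :: "('i, 'a) family"
   by (induction k) (simp_all add: dx_transp)
  moreover have "(dy ^^ k) ((dx ^^ l) w) = D l k w"
   by (induction k) (simp_all add: funpow_dx_dy)
  ultimately show ?thesis by simp
 qed
 have sw: "uclose k l (transp w) (%i m n X Y. f i n m Y X)" if close: "uclose l k w f" for k l f and w :: "('i, 'a) family"
  unfolding uclose_def tD
 proof (intro allI impI)
  fix eta :: real assume "eta > 0"
  then obtain e0 where "e0 > 0" "!!e i x y. e : E ==> e < e0 ==> i : I ==> x + l <= N e ==> y + k <= N e ==>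
    norm (D l k w e i x y - f i l k (e *. x) (e *. y)) <= eta"
   using close unfolding uclose_def by auto
  then show "EX e0>0. ALL e:E. e < e0 --> (ALL i:I. ALL x y. x + k <= N e --> y + l <= N e -->
    norm (transp (D l k w) e i x y - f i l k (e *. y) (e *. x)) <= eta)"
   by (intro exI[of _ e0]) (simp add: transp_def)
 qed
 have "uclose (Suc n) m (transp u) (%i m n X Y. g i n m Y X)"
 proof (rule uclose_Suc_x[OF _ B0])
  show "uclose n m (transp u) (%i m n X Y. g i n m Y X)" by (rule sw[OF assms(1)])
  show "norm (D (Suc (Suc n)) m (transp u) e i x y) <= B"
   if "e : E" "i : I" "x + Suc (Suc n) <= N e" "y + m <= N e" for e i x y
   using B[OF that(1,2,4,3)] by (simp add: tD transp_def del: funpow.simps)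
 qed (rule T)
 from sw[OF this] show ?thesis by simp
qed

text \<open>Compactness is applied for each \<open>i\<close> separately and its subsequence may
  depend on \<open>i\<close>; the rate estimate forces every limit to be \<open>v i\<close>.
  Uniformity in \<open>i\<close> comes from the constants \<open>B\<close>, and interpolation then
  raises the order of closeness one difference at a time.\<close>

theorem smooth_approximation:
 fixes u :: "('i, 'a::euclidean_space) family"
 assumes bd: "!!k. bd k 0 0 u" and near: "nearO 0 0 u v"
  and cont: "!!i. i : I ==> cont2 (v i)"
 obtains g where "!!i. i : I ==> jet (g i)"
  "!!i X Y. i : I ==> X : {0..r} ==> Y : {0..r} ==> g i 0 0 X Y = v i X Y"
  "!!m n. uclose m n u g"
proof -
 have "EX C>0. ALL e:E. ALL i:I. ALL x y. x + m <= N e --> y + n <= N e --> norm (D m n u e i x y) <= C" for m n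
  using bd_D[OF bd[of "m + n"]] by (rule bddE) auto
 then obtain B where B: "!!m n. B m n > 0"
  "!!m n e i x y. e : E ==> i : I ==> x + m <= N e ==> y + n <= N e ==> norm (D m n u e i x y) <= B m n"
  by metis
 obtain es where es: "!!n. es n : E" "es \<longlonglongrightarrow> 0" using E_null by blast
 define P where "P = (%i (g :: nat => nat => real => real => 'a). jet g & jet_bounds B g &
  (ALL X:{0..r}. ALL Y:{0..r}. g 0 0 X Y = v i X Y))"
 have "EX g. P i g"
  if i: "i : I" for i
 proof -
  have prem: "norm (D m n u e i x y) <= B m n" if "e : E" "x + (0 + m) <= N e" "y + (0 + n) <= N e" for m n e x y
   using B(2)[OF that(1) i] that by simp
  have "EX kappa g. strict_mono (kappa :: nat => nat) & jet g & jet_bounds B g &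
   (ALL m n X Y. 0 <= X --> X < r --> 0 <= Y --> Y < r -->
    (%j. D m n u (es (kappa j)) i (gidx (es (kappa j)) X) (gidx (es (kappa j)) Y)) \<longlonglongrightarrow> g m n X Y)"
   by (rule limit_jet[OF es i B(1)]) (rule prem)
  then obtain kappa g where lim0: "strict_mono (kappa :: nat => nat) & jet g & jet_bounds B g &
   (ALL m n X Y. 0 <= X --> X < r --> 0 <= Y --> Y < r -->
    (%j. D m n u (es (kappa j)) i (gidx (es (kappa j)) X) (gidx (es (kappa j)) Y)) \<longlonglongrightarrow> g m n X Y)"
   by (elim exE) (rule that)
  then have kappa: "strict_mono kappa" and g: "jet g" and gb: "jet_bounds B g"
   and lim: "!!m n X Y. 0 <= X ==> X < r ==> 0 <= Y ==> Y < r ==>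
    (%j. D m n u (es (kappa j)) i (gidx (es (kappa j)) X) (gidx (es (kappa j)) Y)) \<longlonglongrightarrow> g m n X Y"
   by simp_all
  have es': "!!j. es (kappa j) : E" "(%j. es (kappa j)) \<longlonglongrightarrow> 0"
   using es kappa LIMSEQ_subseq_LIMSEQ[of es 0 kappa] by (auto simp: o_def)
  have "g 0 0 X Y = v i X Y" if "X : {0..r}" "Y : {0..r}" for X Y
  proof (rule eq_by_limit[OF _ cont[OF i] _ that])
   show "cont2 (g 0 0)" using g by (simp add: jet_def)
   fix X Y assume *: "0 <= X" "X < r" "0 <= Y" "Y < r"
   show "g 0 0 X Y = v i X Y"
    using LIMSEQ_unique[OF lim[OF *, of 0 0]] near_tendsto[OF es' i near cont[OF i] *] by simp
  qed
  with g gb have "P i g" unfolding P_def by blast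
  then show ?thesis by (rule exI[of _ g])
 qed
 then obtain g where P: "!!i. i : I ==> P i (g i)" by metis
 have g: "!!i. i : I ==> jet (g i)"
  "!!i X Y. i : I ==> X : {0..r} ==> Y : {0..r} ==> g i 0 0 X Y = v i X Y"
  "!!m n i X X' Y. i : I ==> X : {0..r} ==> X' : {0..r} ==> Y : {0..r} ==>
    norm (g i m n X' Y - g i m n X Y - (X' - X) *\<^sub>R g i (Suc m) n X Y) <= B (Suc (Suc m)) n * (X' - X)\<^sup>2"
  "!!m n i X Y Y'. i : I ==> X : {0..r} ==> Y : {0..r} ==> Y' : {0..r} ==>
    norm (g i m n X Y' - g i m n X Y - (Y' - Y) *\<^sub>R g i m (Suc n) X Y) <= B m (Suc (Suc n)) * (Y' - Y)\<^sup>2"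
  using P by (simp_all add: P_def jet_bounds_def)
 have base: "uclose 0 0 u g"
  unfolding uclose_def
 proof (intro allI impI)
  fix eta :: real assume eta: "eta > 0"
  obtain C where C: "C > 0" "!!e i x y. e : E ==> i : I ==> x + 0 <= N e ==> y + 0 <= N e ==>
    norm (u e i x y - v i (e *. x) (e *. y)) <= C * e" using near by (rule nearE) blast
  show "EX e0>0. ALL e:E. e < e0 --> (ALL i:I. ALL x y. x + 0 <= N e --> y + 0 <= N e -->
    norm (D 0 0 u e i x y - g i 0 0 (e *. x) (e *. y)) <= eta)"
  proof (intro exI[of _ "eta / C"] conjI ballI impI allI)
   fix e i x y assume e: "e : E" "e < eta / C" and *: "i : I" "x + 0 <= N e" "y + 0 <= N e"
   have "g i 0 0 (e *. x) (e *. y) = v i (e *. x) (e *. y)"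
    by (rule g(2)[OF *(1) grid_in[OF e(1) *(2)] grid_in[OF e(1) *(3)]])
   then have "norm (D 0 0 u e i x y - g i 0 0 (e *. x) (e *. y)) <= C * e"
    using C(2)[OF e(1) *] by simp
   also have "\<dots> <= eta" using e(2) C(1) by (simp add: field_simps)
   finally show "norm (D 0 0 u e i x y - g i 0 0 (e *. x) (e *. y)) <= eta" .
  qed (use eta C in simp)
 qed
 have "uclose 0 n u g" for n
 proof (induction n)
  case (Suc n)
  show ?case by (rule uclose_Suc_y[OF Suc B(1) _ g(4)]) (rule B(2))
 qed (rule base)
 then have "uclose m n u g" for m n
 proof (induction m)
  case (Suc m)
  show ?case by (rule uclose_Suc_x[OF Suc.IH[OF Suc.prems] B(1) _ g(3)]) (rule B(2))
 qed
 with g(1,2) show ?thesis using that by blast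
qed

lemma jet_imp_smooth:
 assumes "jet g" "!!X Y. X : {0..r} ==> Y : {0..r} ==> g 0 0 X Y = f X Y"
 shows "smooth_on_square r f"
 using assms unfolding jet_def smooth_on_square_def by blast

lemma smooth_imp_jet:
 assumes "smooth_on_square r f"
 obtains g where "jet g" "!!X Y. X : {0..r} ==> Y : {0..r} ==> g 0 0 X Y = f X Y"
 using assms unfolding jet_def smooth_on_square_def by blast

lemma pdx_eq:
 assumes "derx g d X Y" "X : {0..r}"
  "!!s. s : {0..r} ==> f s Y = g s Y"
 shows "pdx r f X Y = d"
proof -
 have "derx f d X Y"
  by (rule has_vector_derivative_transform[OF assms(2) assms(3) assms(1)])
 then show ?thesis unfolding pdx_def
  using vector_derivative_within_cbox[of 0 r, unfolded box_real, OF r_pos assms(2)] by blast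
qed

lemma pdy_eq:
 assumes "dery g d X Y" "Y : {0..r}"
  "!!s. s : {0..r} ==> f X s = g X s"
 shows "pdy r f X Y = d"
proof -
 have "dery f d X Y"
  by (rule has_vector_derivative_transform[OF assms(2) assms(3) assms(1)])
 then show ?thesis unfolding pdy_def
  using vector_derivative_within_cbox[of 0 r, unfolded box_real, OF r_pos assms(2)] by blast
qed

lemma jet_pd:
 assumes "jet g" "!!X Y. X : {0..r} ==> Y : {0..r} ==> f X Y = g 0 0 X Y"
  and "X : {0..r}" "Y : {0..r}"
 shows "(pdx r ^^ m) ((pdy r ^^ n) f) X Y = g m n X Y"
proof -
 have y: "(pdy r ^^ n) f X Y = g 0 n X Y" if "X : {0..r}" "Y : {0..r}" for X Y n
  using that
 proof (induction n arbitrary: X Y)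
  case (Suc n)
  show ?case unfolding funpow.simps o_def
   by (rule pdy_eq[where g = "g 0 n"]) (use assms(1) Suc in \<open>auto simp: jet_def\<close>)
 qed (use assms(2) in auto)
 show ?thesis using assms(3,4)
 proof (induction m arbitrary: X Y)
  case (Suc m)
  show ?case unfolding funpow.simps o_def
   by (rule pdx_eq[where g = "g m n"]) (use assms(1) Suc in \<open>auto simp: jet_def\<close>)
 qed (use y in auto)
qed

lemma grid_cases:
 assumes "e : E" "X : grid e (r - real k * e)"
 obtains x where "X = e *. x" "x + k <= N e"
proof -
 note e = E_bounds(1)[OF assms(1)]
 from assms(2) obtain z :: int where z: "X = e * of_int z" "0 <= X" "X <= r - real k * e"
  by (auto simp: grid_def)
 then have "0 <= z" using e by (simp add: zero_le_mult_iff)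
 then obtain x where x: "z = int x" using nonneg_eq_int by blast
 have "e *. (x + k) <= r" using z x by (simp add: algebra_simps)
 then show ?thesis using that[of x] z x N_iff[OF assms(1)] by simp
qed

lemma grid_mem: "e : E ==> x + k <= N e ==> e *. x : grid e (r - real k * e)"
 using N_iff[of e "x + k"] E_bounds(1)[of e]
 by (auto simp: grid_def algebra_simps intro!: range_eqI[of _ _ "int x"])

lemma dq_D:
 assumes "e > 0"
 shows "(dqx e ^^ m) ((dqy e ^^ n) f) (e *. x) (e *. y) = D m n (%e i x y. f (e *. x) (e *. y)) e i x y"
proof -
 have s: "e *. x + e = e *. (Suc x)" for x by (simp add: algebra_simps)
 have y: "(dqy e ^^ n) f (e *. x) (e *. y) = (dy ^^ n) (%e i x y. f (e *. x) (e *. y)) e i x y" for n x y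
  by (induction n arbitrary: x y) (simp_all add: dqy_def dy_def s del: of_nat_Suc)
 show ?thesis
  by (induction m arbitrary: x y) (simp_all add: dqx_def dx_def s y del: of_nat_Suc)
qed

end

section \<open>SU(2) and the frame immersion\<close>

lemmas complex_scaleR = scaleR_conv_of_real[where 'a = complex]

lemma mat2_nth [simp]:
 "mat2 p q u v $ 1 $ 1 = p" "mat2 p q u v $ 1 $ 2 = q" "mat2 p q u v $ 2 $ 1 = u" "mat2 p q u v $ 2 $ 2 = v"
 by (simp_all add: mat2_def)

lemma mat2_eqI:
 fixes A B :: "complex^2^2"
 assumes "A $ 1 $ 1 = B $ 1 $ 1" "A $ 1 $ 2 = B $ 1 $ 2" "A $ 2 $ 1 = B $ 2 $ 1" "A $ 2 $ 2 = B $ 2 $ 2"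
 shows "A = B"
 using assms by (simp add: vec_eq_iff forall_2)

lemma mat2_eq_iff [simp]: "mat2 p q u v = mat2 p' q' u' v' \<longleftrightarrow> p = p' & q = q' & u = u' & v = v'"
 by (metis mat2_nth)

lemma mat2_cases: obtains p q u v where "A = mat2 p q u v"
 by (rule that[of "A $ 1 $ 1" "A $ 1 $ 2" "A $ 2 $ 1" "A $ 2 $ 2"], rule mat2_eqI) simp_all

definition adj :: "complex^2^2 => complex^2^2" where
 "adj A = map_matrix cnj (transpose A)"

lemma mat2_mult [simp]: "mat2 p q u v ** mat2 p' q' u' v' = mat2 (p * p' + q * u') (p * q' + q * v') (u * p' + v * u') (u * q' + v * v')"
 by (rule mat2_eqI) (simp_all add: matrix_matrix_mult_def sum_2)

lemma adj_mat2 [simp]: "adj (mat2 p q u v) = mat2 (cnj p) (cnj u) (cnj q) (cnj v)"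
 by (rule mat2_eqI) (simp_all add: adj_def transpose_def)

lemma mat_1_mat2: "(mat 1 :: complex^2^2) = mat2 1 0 0 1"
 by (rule mat2_eqI) (simp_all add: mat_def)

lemma det_mat2 [simp]: "det (mat2 p q u v) = p * v - q * u"
 by (simp add: det_2)

lemma mat2_add [simp]: "mat2 p q u v + mat2 p' q' u' v' = mat2 (p + p') (q + q') (u + u') (v + v')"
 and mat2_diff [simp]: "mat2 p q u v - mat2 p' q' u' v' = mat2 (p - p') (q - q') (u - u') (v - v')"
 and mat2_scaleR [simp]: "c *\<^sub>R mat2 p q u v = mat2 (of_real c * p) (of_real c * q) (of_real c * u) (of_real c * v)"
 by (rule mat2_eqI; simp add: complex_scaleR)+

lemma bilinear_matmult: "bounded_bilinear ((**) :: complex^2^2 => complex^2^2 => complex^2^2)"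
 unfolding bilinear_conv_bounded_bilinear[symmetric] bilinear_def
 by (intro conjI allI linearI; rule mat2_eqI; simp add: matrix_matrix_mult_def sum_2 algebra_simps complex_scaleR)

lemma bounded_linear_adj: "bounded_linear adj"
 unfolding linear_conv_bounded_linear[symmetric]
 by (rule linearI; rule mat2_eqI) (simp_all add: adj_def transpose_def complex_scaleR)

lemma bounded_linear_mat2:
 "bounded_linear (%p. mat2 p 0 0 0)" "bounded_linear (%p. mat2 0 p 0 0)"
 "bounded_linear (%p. mat2 0 0 p 0)" "bounded_linear (%p. mat2 0 0 0 p)"
 unfolding linear_conv_bounded_linear[symmetric] by (auto intro!: linearI simp: complex_scaleR)

lemma mat2_split: "mat2 p q u v = mat2 p 0 0 0 + mat2 0 q 0 0 + mat2 0 0 u 0 + mat2 0 0 0 v"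
 by simp

lemma adj_mult: "adj (A ** B) = adj B ** adj A"
 by (cases A rule: mat2_cases, cases B rule: mat2_cases) (simp add: mult.commute)

lemma SU2_iff: "A : SU2 \<longleftrightarrow> (EX p q. A = mat2 p q (- cnj q) (cnj p) & p * cnj p + q * cnj q = 1)"
proof (cases A rule: mat2_cases)
 case (1 p q u v)
 have "A : SU2 \<longleftrightarrow> A ** adj A = mat 1 & det A = 1" by (simp add: SU2_def adj_def)
 also have "\<dots> \<longleftrightarrow> v = cnj p & u = - cnj q & p * cnj p + q * cnj q = 1"
 proof
  assume "A ** adj A = mat 1 & det A = 1"
  then have h: "p * cnj p + q * cnj q = 1" "p * cnj u + q * cnj v = 0" "u * cnj p + v * cnj q = 0"
   "u * cnj u + v * cnj v = 1" "p * v - q * u = 1" by (simp_all add: 1 mat_1_mat2)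
  have "v = v * (p * cnj p + q * cnj q) - q * (u * cnj p + v * cnj q)" using h by simp
  also have "\<dots> = cnj p * (p * v - q * u)" by (simp add: algebra_simps)
  finally have v: "v = cnj p" using h by simp
  have "u = u * (p * cnj p + q * cnj q) - p * (u * cnj p + v * cnj q)" using h by simp
  also have "\<dots> = - cnj q * (p * v - q * u)" by (simp add: algebra_simps)
  finally have "u = - cnj q" using h by simp
  with v h show "v = cnj p & u = - cnj q & p * cnj p + q * cnj q = 1" by simp
 qed (auto simp: 1 mat_1_mat2 algebra_simps)
 finally show ?thesis by (auto simp: 1)
qed

lemma SU2_adj_mult: "A : SU2 ==> adj A ** A = mat 1" and SU2_mult_adj: "A : SU2 ==> A ** adj A = mat 1"
 by (auto simp: SU2_iff mat_1_mat2 algebra_simps)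

lemma SU2_mult: "A : SU2 ==> B : SU2 ==> A ** B : SU2"
proof -
 assume A: "A : SU2" and B: "B : SU2"
 have "(A ** B) ** adj (A ** B) = A ** (B ** adj B) ** adj A" by (simp add: adj_mult matrix_mul_assoc)
 also have "\<dots> = mat 1" using A B by (simp add: SU2_mult_adj)
 finally show ?thesis using A B by (simp add: SU2_def adj_def[symmetric] det_mul)
qed

lemma SU2_one: "mat 1 : SU2"
 by (auto simp: SU2_iff mat_1_mat2)

lemma SU2_inv: "A : SU2 ==> matrix_inv A = adj A"
proof -
 assume A: "A : SU2"
 show ?thesis unfolding matrix_inv_def
 proof (rule some_equality)
  fix B assume "A ** B = mat 1 & B ** A = mat 1"
  then have "(adj A ** A) ** B = adj A" by (simp add: matrix_mul_assoc[symmetric])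
  then show "B = adj A" by (simp add: SU2_adj_mult[OF A])
 qed (simp add: SU2_adj_mult[OF A] SU2_mult_adj[OF A])
qed

lemma norm_SU2: "A : SU2 ==> norm A <= 4"
proof -
 assume "A : SU2"
 then obtain p q where A: "A = mat2 p q (- cnj q) (cnj p)" and pq: "p * cnj p + q * cnj q = 1" by (auto simp: SU2_iff)
 have "complex_of_real ((norm p)\<^sup>2 + (norm q)\<^sup>2) = 1" using pq by (simp only: of_real_add complex_norm_square)
 then have "(norm p)\<^sup>2 + (norm q)\<^sup>2 = 1" using of_real_eq_1_iff by blast
 then have "(norm p)\<^sup>2 <= 1\<^sup>2" "(norm q)\<^sup>2 <= 1\<^sup>2"
  unfolding one_power2 using zero_le_power2[of "norm p"] zero_le_power2[of "norm q"] by linarith+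
 then have n: "norm p <= 1" "norm q <= 1" by (simp_all only: power2_le_imp_le zero_le_one)
 have "norm (A $ i) <= norm (A $ i $ 1) + norm (A $ i $ 2)" for i
  using L2_set_le_sum[of UNIV "%j. norm (A $ i $ j)"] by (simp add: norm_vec_def sum_2)
 moreover have "norm A <= norm (A $ 1) + norm (A $ 2)"
  using L2_set_le_sum[of UNIV "%j. norm (A $ j)"] by (simp add: norm_vec_def sum_2)
 ultimately have "norm A <= (norm (A$1$1) + norm (A$1$2)) + (norm (A$2$1) + norm (A$2$2))" by (meson add_mono order_trans)
 then show ?thesis using n by (simp add: A)
qed

text \<open>A left inverse of \<open>su2_of_vec\<close>, extended real-linearly to all matrices so
  that it composes with the estimates for arbitrary matrix families.\<close>

definition vec_of_su2 :: "complex^2^2 => real^3" where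
 "vec_of_su2 A = vector [- Im (A $ 1 $ 2), - Re (A $ 1 $ 2), - Im (A $ 1 $ 1)]"

lemma bounded_linear_vec_of_su2: "bounded_linear vec_of_su2"
 unfolding linear_conv_bounded_linear[symmetric]
 by (rule linearI) (simp_all add: vec_of_su2_def vec_eq_iff forall_3)

lemma bounded_linear_su2_of_vec: "bounded_linear su2_of_vec"
 unfolding linear_conv_bounded_linear[symmetric]
 by (rule linearI) (simp_all add: su2_of_vec_def algebra_simps)

lemma vec_of_su2_of_vec [simp]: "vec_of_su2 (su2_of_vec v) = v"
 by (simp add: vec_of_su2_def su2_of_vec_def vec_eq_iff forall_3)

lemma inj_su2_of_vec: "inj su2_of_vec"
 by (rule inj_on_inverseI[of _ vec_of_su2]) simp

text \<open>Quaternion multiplication: under \<open>su2_of_vec\<close> the coordinate vectors become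
  the three imaginary units.\<close>

lemma su2_mult: "su2_of_vec v ** su2_of_vec w = (- (v \<bullet> w)) *\<^sub>R mat 1 + su2_of_vec (cross3 v w)"
 by (simp add: su2_of_vec_def mat_1_mat2 cross3_simps inner_vec_def sum_3 complex_eq_iff algebra_simps)

lemma su2_range: "M : range su2_of_vec \<longleftrightarrow> (EX t z. M = mat2 (\<i> * of_real t) z (- cnj z) (- \<i> * of_real t))"
proof
 assume "M : range su2_of_vec"
 then obtain v where v: "M = su2_of_vec v" by blast
 show "EX t z. M = mat2 (\<i> * of_real t) z (- cnj z) (- \<i> * of_real t)"
  by (intro exI[of _ "- v$3"] exI[of _ "- \<i> * v$1 - v$2"]) (simp add: v su2_of_vec_def)
next
 assume "EX t z. M = mat2 (\<i> * of_real t) z (- cnj z) (- \<i> * of_real t)"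
 then obtain t z where M: "M = mat2 (\<i> * of_real t) z (- cnj z) (- \<i> * of_real t)" by blast
 have "M = su2_of_vec (vec_of_su2 M)"
  by (simp add: M su2_of_vec_def vec_of_su2_def complex_eq_iff)
 then show "M : range su2_of_vec" by blast
qed

text \<open>For \<open>A\<close> in \<open>SU2\<close> this is the adjoint action of the inverse of
  \<open>A\<close>. Writing the inverse as \<open>adj A\<close> makes it polynomial in the entries
  of \<open>A\<close> and their conjugates, so the calculus of bounds and errors applies
  directly.\<close>

definition Rot :: "complex^2^2 => real^3 => real^3" where
 "Rot A v = vec_of_su2 (adj A ** su2_of_vec v ** A)"

lemma su2_Rot:
 assumes "A : SU2" shows "su2_of_vec (Rot A v) = adj A ** su2_of_vec v ** A"
proof -
 obtain p q where A: "A = mat2 p q (- cnj q) (cnj p)" using assms by (auto simp: SU2_iff)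
 obtain t z where v: "su2_of_vec v = mat2 (\<i> * of_real t) z (- cnj z) (- \<i> * of_real t)"
  using su2_range[of "su2_of_vec v"] by blast
 have "adj A ** su2_of_vec v ** A : range su2_of_vec"
  unfolding su2_range
  apply (rule exI[of _ "Im ((adj A ** su2_of_vec v ** A) $ 1 $ 1)"], rule exI[of _ "(adj A ** su2_of_vec v ** A) $ 1 $ 2"])
  by (simp add: A v complex_eq_iff algebra_simps)
 then obtain u where "adj A ** su2_of_vec v ** A = su2_of_vec u" by blast
 then show ?thesis by (simp add: Rot_def)
qed

lemma mat_1_su2_indep:
 assumes "c *\<^sub>R mat 1 + su2_of_vec v = d *\<^sub>R mat 1 + su2_of_vec w" shows "c = d" "v = w"
proof -
 have "complex_of_real c + - \<i> * v$3 = complex_of_real d + - \<i> * w$3"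
  using assms by (simp add: mat_1_mat2 su2_of_vec_def)
 then show "c = d" by (simp add: complex_eq_iff)
 with assms have "su2_of_vec v = su2_of_vec w" by simp
 then show "v = w" using inj_su2_of_vec by (simp add: inj_eq)
qed

text \<open>Since \<open>Rot\<close> preserves the products of \<open>su(2)\<close> matrices, it preserves both the inner and the cross product.\<close>

lemma
 assumes "A : SU2"
 shows inner_Rot: "Rot A v \<bullet> Rot A w = v \<bullet> w" and cross_Rot: "cross3 (Rot A v) (Rot A w) = Rot A (cross3 v w)"
proof -
 have "su2_of_vec (Rot A v) ** su2_of_vec (Rot A w) = adj A ** su2_of_vec v ** (A ** adj A) ** su2_of_vec w ** A"
  by (simp add: su2_Rot[OF assms] matrix_mul_assoc)
 also have "\<dots> = adj A ** (su2_of_vec v ** su2_of_vec w) ** A"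
  by (simp add: SU2_mult_adj[OF assms] matrix_mul_assoc)
 also have "\<dots> = (- (v \<bullet> w)) *\<^sub>R (adj A ** A) + su2_of_vec (Rot A (cross3 v w))"
  unfolding su2_mult su2_Rot[OF assms]
  by (simp add: bounded_bilinear.add_left[OF bilinear_matmult] bounded_bilinear.add_right[OF bilinear_matmult]
    bounded_bilinear.scaleR_left[OF bilinear_matmult] bounded_bilinear.scaleR_right[OF bilinear_matmult]
    bounded_bilinear.diff_left[OF bilinear_matmult] bounded_bilinear.diff_right[OF bilinear_matmult]
    bounded_bilinear.minus_left[OF bilinear_matmult] bounded_bilinear.minus_right[OF bilinear_matmult])
 finally have "(- (Rot A v \<bullet> Rot A w)) *\<^sub>R mat 1 + su2_of_vec (cross3 (Rot A v) (Rot A w)) = (- (v \<bullet> w)) *\<^sub>R mat 1 + su2_of_vec (Rot A (cross3 v w))"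
  unfolding su2_mult SU2_adj_mult[OF assms] .
 from mat_1_su2_indep[OF this] show "Rot A v \<bullet> Rot A w = v \<bullet> w" "cross3 (Rot A v) (Rot A w) = Rot A (cross3 v w)" by simp_all
qed

lemma norm_Rot: "A : SU2 ==> norm (Rot A v) = norm v"
 by (simp add: norm_eq_sqrt_inner inner_Rot)

lemma bounded_linear_Rot: "bounded_linear (Rot A)"
 unfolding Rot_def
 by (intro bounded_linear_compose[OF bounded_linear_vec_of_su2] bounded_linear_compose[OF bounded_bilinear.bounded_linear_left[OF bilinear_matmult]]
  bounded_linear_compose[OF bounded_bilinear.bounded_linear_right[OF bilinear_matmult]] bounded_linear_su2_of_vec)

text \<open>\<open>K\<close> is the vector of \<open>G\<inverse> \<partial>\<^sub>\<lambda>G\<close> at \<open>\<lambda> = l\<close>.\<close>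

definition log_deriv :: "real => (real => complex^2^2) => real^3 => bool" where
 "log_deriv l G K \<longleftrightarrow> (\<forall>\<^sub>F m in nhds l. G m : SU2) & (G has_vector_derivative (G l ** su2_of_vec K)) (at l)"

lemma log_deriv_SU2: "log_deriv l G K ==> G l : SU2"
 by (auto simp: log_deriv_def dest: eventually_nhds_x_imp_x)

lemma immersion_eq:
 assumes "log_deriv l G K" shows "immersion l G = (2 * l) *\<^sub>R K"
proof -
 note S = log_deriv_SU2[OF assms]
 have "vector_derivative G (at l) = G l ** su2_of_vec K"
  using assms by (auto simp: log_deriv_def intro: vector_derivative_at)
 then have "(2 * l) *\<^sub>R (matrix_inv (G l) ** vector_derivative G (at l)) = (2 * l) *\<^sub>R su2_of_vec K"
  by (simp add: SU2_inv[OF S] matrix_mul_assoc SU2_adj_mult[OF S])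
 also have "\<dots> = su2_of_vec ((2 * l) *\<^sub>R K)"
  by (simp add: linear_scale[OF bounded_linear.linear[OF bounded_linear_su2_of_vec]])
 finally show ?thesis unfolding immersion_def by (simp add: the_inv_f_f[OF inj_su2_of_vec])
qed

text \<open>From \<open>(P Q)\<inverse> (P Q)' = Q\<inverse> (P\<inverse> P') Q + Q\<inverse>
  Q'\<close>; conjugation by \<open>Q\<close> is the rotation.\<close>

lemma log_deriv_mult:
 assumes "log_deriv l P K" "log_deriv l Q L"
 shows "log_deriv l (%m. P m ** Q m) (Rot (Q l) K + L)"
 unfolding log_deriv_def
proof
 show "\<forall>\<^sub>F m in nhds l. P m ** Q m : SU2"
  using assms unfolding log_deriv_def by (auto elim: eventually_elim2 intro: SU2_mult)
 have S: "Q l : SU2" using log_deriv_SU2[OF assms(2)] .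
 have "((%m. P m ** Q m) has_vector_derivative (P l ** (Q l ** su2_of_vec L) + (P l ** su2_of_vec K) ** Q l)) (at l)"
  using assms unfolding log_deriv_def
  by (intro bounded_bilinear.has_vector_derivative[OF bilinear_matmult]) auto
 moreover have "P l ** Q l ** su2_of_vec (Rot (Q l) K + L) = P l ** (Q l ** su2_of_vec L) + (P l ** su2_of_vec K) ** Q l"
 proof -
  have "P l ** Q l ** su2_of_vec (Rot (Q l) K) = P l ** (Q l ** adj (Q l)) ** su2_of_vec K ** Q l"
   by (simp add: su2_Rot[OF S] matrix_mul_assoc)
  then show ?thesis
   by (simp add: linear_add[OF bounded_linear.linear[OF bounded_linear_su2_of_vec]] SU2_mult_adj[OF S]
    matrix_add_ldistrib matrix_mul_assoc add.commute)
 qed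
 ultimately show "((%m. P m ** Q m) has_vector_derivative P l ** Q l ** su2_of_vec (Rot (Q l) K + L)) (at l)" by simp
qed

lemma log_deriv_cong:
 assumes "log_deriv l G K" "l ~= 0" "!!m. m ~= 0 ==> G' m = G m"
 shows "log_deriv l G' K"
proof -
 have ev: "\<forall>\<^sub>F m in nhds l. G' m = G m"
  using t1_space_nhds[OF \<open>l ~= 0\<close>] by eventually_elim (rule assms(3))
 show ?thesis unfolding log_deriv_def
 proof
  show "\<forall>\<^sub>F m in nhds l. G' m : SU2" using assms(1) ev unfolding log_deriv_def by (auto elim: eventually_elim2)
  have "(G' has_vector_derivative d) (at l) \<longleftrightarrow> (G has_vector_derivative d) (at l)" for d
   by (rule has_vector_derivative_cong_ev) (use ev assms(2,3) in \<open>auto elim: eventually_mono\<close>)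
  then show "(G' has_vector_derivative G' l ** su2_of_vec K) (at l)"
   using assms(1) by (simp add: log_deriv_def assms(3)[OF \<open>l ~= 0\<close>])
 qed
qed

text \<open>The horizontal plane as a copy of the complex numbers, with the sign chosen so that the
  matrix of \<open>hvec w\<close> has upper right entry \<open>- \<i> * w\<close>.\<close>

definition hvec :: "complex => real^3" where
 "hvec w = vector [Re w, - Im w, 0]"

lemma bounded_linear_hvec: "bounded_linear hvec"
 unfolding linear_conv_bounded_linear[symmetric]
 by (rule linearI) (simp_all add: hvec_def vec_eq_iff forall_3)

lemma norm_hvec [simp]: "norm (hvec w) = norm w"
 by (simp add: norm_eq_sqrt_inner inner_vec_def sum_3 hvec_def cmod_def power2_eq_square inner_complex_def)

text \<open>The common shape of the transfer matrices: \<open>dU_mat\<close>, \<open>dV_mat\<close>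
  and \<open>W_mat\<close> are all of this form, and the spectral parameter enters through
  \<open>s\<close> alone.\<close>

definition rotm :: "complex => complex => real => complex^2^2" where
 "rotm A B s = (1 / sqrt (1 + s\<^sup>2)) *\<^sub>R mat2 A (- \<i> * s * B) (- \<i> * s * cnj B) (cnj A)"

lemma rotm_SU2:
 assumes "norm A = 1" "norm B = 1" shows "rotm A B s : SU2"
proof -
 define c where "c = 1 / sqrt (1 + s\<^sup>2)"
 have s: "1 + s\<^sup>2 > 0" by (rule add_pos_nonneg) auto
 have c: "c * c * (1 + s * s) = 1" using s by (simp add: c_def power2_eq_square real_sqrt_mult_self)
 have AB: "A * cnj A = 1" "B * cnj B = 1" using assms by (simp_all add: complex_norm_square[symmetric])
 have "of_real c * A * cnj (of_real c * A) + of_real c * (- \<i> * s * B) * cnj (of_real c * (- \<i> * s * B))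
  = of_real (c * c) * (A * cnj A) + of_real (c * c) * of_real (s * s) * (B * cnj B)"
  by (simp add: mult_ac)
 also have "\<dots> = of_real (c * c * (1 + s * s))" unfolding AB by (simp add: algebra_simps)
 finally have 1: "of_real c * A * cnj (of_real c * A) + of_real c * (- \<i> * s * B) * cnj (of_real c * (- \<i> * s * B)) = 1"
  unfolding c by simp
 show ?thesis unfolding SU2_iff
  by (rule exI[of _ "of_real c * A"], rule exI[of _ "of_real c * (- \<i> * s * B)"]) (use 1 in \<open>simp add: rotm_def c_def\<close>)
qed

text \<open>With \<open>s = tan t\<close> the normalized matrix has entries of modulus
  \<open>cos t\<close> and \<open>sin t\<close>, and the coefficient
  \<open>s' / (1 + s\<^sup>2)\<close> is the derivative of \<open>t\<close>. The derivative of the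
  normalizing root cancels the multiple of the identity that the unnormalized matrix would
  contribute.\<close>

lemma log_deriv_rotm:
 assumes A: "norm A = 1" and B: "norm B = 1" and s: "(s has_real_derivative s') (at l)"
 shows "log_deriv l (%m. rotm A B (s m)) ((s' / (1 + (s l)\<^sup>2)) *\<^sub>R hvec (cnj A * B))"
proof -
 define d where "d = 1 + (s l)\<^sup>2"
 have d: "d > 0" unfolding d_def by (rule add_pos_nonneg) auto
 define c where "c = 1 / sqrt d"
 have c: "c > 0" "c * c = 1 / d" "sqrt d = d * c" using d by (simp_all add: c_def real_sqrt_mult_self real_div_sqrt)
 have AB: "A * cnj A = 1" "B * cnj B = 1" using A B by (simp_all add: complex_norm_square[symmetric])
 have "((%m. 1 / sqrt (1 + (s m)\<^sup>2)) has_real_derivative (- (2 * s l * s') * (inverse (sqrt d) / 2) / (sqrt d * sqrt d))) (at l)"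
  unfolding d_def using d s by (auto intro!: derivative_eq_intros simp: d_def power2_eq_square)
 also have "- (2 * s l * s') * (inverse (sqrt d) / 2) / (sqrt d * sqrt d) = - c * (s l * s' / d)"
  using d by (simp add: c_def inverse_eq_divide)
 finally have dc: "((%m. 1 / sqrt (1 + (s m)\<^sup>2)) has_real_derivative (- c * (s l * s' / d))) (at l)" .
 let ?M = "%m. mat2 A (- \<i> * s m * B) (- \<i> * s m * cnj B) (cnj A)"
 let ?M' = "mat2 0 (- \<i> * s' * B) (- \<i> * s' * cnj B) 0"
 have "?M = (%m. mat2 A 0 0 (cnj A) + s m *\<^sub>R mat2 0 (- \<i> * B) (- \<i> * cnj B) 0)"
  by (simp add: fun_eq_iff)
 moreover have "((%m. mat2 A 0 0 (cnj A) + s m *\<^sub>R mat2 0 (- \<i> * B) (- \<i> * cnj B) 0) has_vector_derivative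
   (0 + s' *\<^sub>R mat2 0 (- \<i> * B) (- \<i> * cnj B) 0)) (at l)"
  by (intro has_vector_derivative_add has_vector_derivative_const)
    (use has_vector_derivative_scaleR[OF s has_vector_derivative_const[of "mat2 0 (- \<i> * B) (- \<i> * cnj B) 0"]] in simp)
 ultimately have dM: "(?M has_vector_derivative ?M') (at l)" by (simp add: mult_ac)
 have "((%m. rotm A B (s m)) has_vector_derivative (c *\<^sub>R ?M' + (- c * (s l * s' / d)) *\<^sub>R ?M l)) (at l)"
  unfolding rotm_def using has_vector_derivative_scaleR[OF dc dM] by (simp add: c_def d_def)
 moreover have "c *\<^sub>R ?M' + (- c * (s l * s' / d)) *\<^sub>R ?M l = rotm A B (s l) ** su2_of_vec ((s' / (1 + (s l)\<^sup>2)) *\<^sub>R hvec (cnj A * B))"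
 proof -
  define k where "k = s' / d"
  have s'k: "s' = k * d" using d by (simp add: k_def)
  have r: "rotm A B (s l) = c *\<^sub>R ?M l" by (simp add: rotm_def c_def d_def)
  have "su2_of_vec (k *\<^sub>R hvec (cnj A * B)) = k *\<^sub>R mat2 0 (- \<i> * (cnj A * B)) (- \<i> * (A * cnj B)) 0"
   by (simp add: su2_of_vec_def hvec_def) (simp add: complex_eq_iff algebra_simps)
  moreover have "?M' - (s l * k) *\<^sub>R ?M l = k *\<^sub>R (?M l ** mat2 0 (- \<i> * (cnj A * B)) (- \<i> * (A * cnj B)) 0)"
  proof -
   have i2: "\<i> * \<i> = -1" by simp
   have s'': "complex_of_real s' = of_real k * (1 + of_real (s l) * of_real (s l))"
    by (simp add: s'k d_def power2_eq_square)
   show ?thesis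
    unfolding mat2_mult mat2_diff mat2_scaleR mat2_eq_iff s'' of_real_mult
    using AB i2 by (intro conjI; algebra)
  qed
  moreover have "c *\<^sub>R ?M' + (- c * (s l * k)) *\<^sub>R ?M l = c *\<^sub>R (?M' - (s l * k) *\<^sub>R ?M l)"
   by (simp add: scaleR_add_right scaleR_diff_right del: mat2_add mat2_diff mat2_scaleR)
  ultimately have "c *\<^sub>R ?M' + (- c * (s l * k)) *\<^sub>R ?M l = (c *\<^sub>R ?M l) ** su2_of_vec (k *\<^sub>R hvec (cnj A * B))"
   by (simp only: bounded_bilinear.scaleR_left[OF bilinear_matmult] bounded_bilinear.scaleR_right[OF bilinear_matmult] scaleR_scaleR mult.commute[of c k])
  then show ?thesis unfolding r k_def d_def by (simp only: times_divide_eq_right)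
 qed
 ultimately have "((%m. rotm A B (s m)) has_vector_derivative (rotm A B (s l) ** su2_of_vec ((s' / (1 + (s l)\<^sup>2)) *\<^sub>R hvec (cnj A * B)))) (at l)" by simp
 then show ?thesis unfolding log_deriv_def using rotm_SU2[OF A B] by simp
qed

section \<open>The discrete sine-Gordon system and its transformation\<close>

text \<open>The argument of the logarithm in each discrete equation. For unimodular \<open>z\<close>
  and \<open>0 <= k < 1\<close> it is unimodular, so its principal logarithm is imaginary and
  \<open>cis\<close> recovers the quotient.\<close>

definition mob :: "real => complex => complex" where
 "mob k z = (1 - of_real k * cnj z) / (1 - of_real k * z)"

lemma one_minus_ge:
 assumes "norm z = 1" "0 <= k" shows "1 - k <= norm (1 - complex_of_real k * z)"
 using norm_triangle_ineq2[of 1 "complex_of_real k * z"] assms by (simp add: norm_mult)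

lemma one_minus_nz:
 assumes "norm z = 1" "0 <= k" "k < 1" shows "1 - complex_of_real k * z ~= 0"
 using one_minus_ge[OF assms(1,2)] assms(3) by auto

lemma cnj_unit: "norm z = 1 ==> z * cnj z = 1"
 by (simp add: complex_norm_square[symmetric])

lemma cnj_unit': "norm z = 1 ==> cnj z = inverse z"
 using cnj_unit[of z] by (metis inverse_unique)

lemma mob_unit:
 assumes "norm z = 1" "0 <= k" "k < 1" shows "norm (mob k z) = 1"
proof -
 have "1 - of_real k * cnj z = cnj (1 - of_real k * z)" by simp
 then have "norm (1 - of_real k * cnj z) = norm (1 - of_real k * z)" by (metis complex_mod_cnj)
 then show ?thesis using one_minus_nz[OF assms] by (simp add: mob_def norm_divide)
qed

lemma mob_minus_one:
 assumes "norm z = 1" "0 <= k" "k < 1"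
 shows "mob k z - 1 = of_real k * (z - cnj z) * inverse (1 - of_real k * z)"
 using one_minus_nz[OF assms] by (simp add: mob_def field_simps)

lemma Ln_unit: "norm w = 1 ==> Ln w = \<i> * of_real (Im (Ln w))"
proof -
 assume "norm w = 1"
 moreover from this have "w ~= 0" by auto
 ultimately show ?thesis by (intro complex_eqI) (simp_all add: Re_Ln)
qed

lemma cis_Ln_unit: "norm w = 1 ==> cis (Im (Ln w)) = w"
proof -
 assume w: "norm w = 1"
 have "cis (Im (Ln w)) = exp (Ln w)" by (subst Ln_unit[OF w]) (simp add: cis_conv_exp)
 also have "\<dots> = w" using w by (intro exp_Ln) auto
 finally show ?thesis .
qed

context meshed begin

text \<open>A half step between \<open>bd k\<close> and \<open>bd (Suc k)\<close>. The induction for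
  the sine-Gordon system needs it because an equation is differenced in one direction at a time,
  while the extra difference in the other direction is not yet under control.\<close>

definition bx :: "nat => nat => nat => ('i, complex) family => bool" where
 "bx k p q u \<longleftrightarrow> bd k p q u & bd k (Suc p) q (dx u)"

lemma bx_mult: "bx k p q u ==> bx k p q v ==> bx k p q (%e i x y. u e i x y * v e i x y)"
proof -
 assume u: "bx k p q u" and v: "bx k p q v"
 have "bd k (Suc p) q (%e i x y. dx u e i x y * v e i x y + sx u e i x y * dx v e i x y)"
  using u v by (intro bd_add bd_mult) (auto simp: bx_def intro: bd_sx bd_mono)
 then have "bd k (Suc p) q (dx (%e i x y. u e i x y * v e i x y))"
  by (rule bd_cong) (simp add: dx_def sx_def complex_scaleR algebra_simps)
 with u v show ?thesis by (simp add: bx_def bd_mult)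
qed

lemma bx_add: "bx k p q u ==> bx k p q v ==> bx k p q (%e i x y. u e i x y + v e i x y)"
proof -
 assume u: "bx k p q u" and v: "bx k p q v"
 have "bd k (Suc p) q (%e i x y. dx u e i x y + dx v e i x y)"
  using u v by (intro bd_add) (auto simp: bx_def)
 then have "bd k (Suc p) q (dx (%e i x y. u e i x y + v e i x y))"
  by (rule bd_cong) (simp add: dx_def complex_scaleR algebra_simps)
 with u v show ?thesis by (simp add: bx_def bd_add)
qed

lemma bx_param:
 assumes "!!e i. e : E ==> i : I ==> norm (c e i) <= C"
 shows "bx k p q (%e i x y. c e i)"
 unfolding bx_def dx_const by (intro conjI bd_const) (rule bd_param, rule assms)

lemma bx_const: "bx k p q (%e i x y. c)" by (rule bx_param[of _ "norm c"]) simp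

lemma bx_cnj: "bx k p q u ==> bx k p q (%e i x y. cnj (u e i x y))"
proof -
 assume u: "bx k p q u"
 have "dx (%e i x y. cnj (u e i x y)) = (%e i x y. cnj (dx u e i x y))"
  by (simp add: dx_def fun_eq_iff complex_scaleR)
 with u show ?thesis by (simp add: bx_def bd_cnj)
qed

lemma bx_diff:
 assumes "bx k p q u" "bx k p q v" shows "bx k p q (%e i x y. u e i x y - v e i x y)"
proof -
 have "bx k p q (%e i x y. (-1) * v e i x y)" by (rule bx_mult[OF bx_const assms(2)])
 from bx_add[OF assms(1) this] show ?thesis by simp
qed

lemma bx_inverse:
 assumes u: "bx k p q u" and c: "c > 0" "!!e i x y. e : E ==> i : I ==> x + p <= N e ==> y + q <= N e ==> norm (u e i x y) >= c"
 shows "bx k p q (%e i x y. inverse (u e i x y))"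
proof -
 let ?w = "%e i x y. inverse (u e i x y)"
 have w: "bd k p q ?w" using u c by (intro bd_inverse) (auto simp: bx_def)
 have nz: "u e i x y ~= 0" if "e : E" "i : I" "x + p <= N e" "y + q <= N e" for e i x y
  using c(2)[OF that] c(1) by auto
 have "bd k (Suc p) q (%e i x y. (-1) * (dx u e i x y * (?w e i x y * sx ?w e i x y)))"
  using u w by (intro bd_mult bd_const) (auto simp: bx_def intro: bd_sx bd_mono)
 then have "bd k (Suc p) q (dx ?w)"
  by (rule bd_cong) (auto simp: dx_def sx_def nz inverse_diff_inverse complex_scaleR mult_ac)
 with w show ?thesis by (simp add: bx_def)
qed

text \<open>Multiplying by the step saves one difference.\<close>

lemma bx_step: "bd k p q u ==> bx k p q (%e i x y. of_real e * u e i x y)"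
proof -
 assume u: "bd k p q u"
 have "bd k (Suc p) q (%e i x y. sx u e i x y - u e i x y)"
  using u by (intro bd_diff) (auto intro: bd_sx bd_mono)
 then have "bd k (Suc p) q (dx (%e i x y. of_real e * u e i x y))"
  by (rule bd_cong) (auto simp: dx_def sx_def complex_scaleR E_bounds(4) field_simps)
 moreover have "bd k p q (%e i x y. of_real e * u e i x y)" by (intro bd_mult bd_step u)
 ultimately show ?thesis by (simp add: bx_def)
qed

definition unimod :: "nat => nat => ('i, complex) family => bool" where
 "unimod p q u \<longleftrightarrow> (ALL e:E. ALL i:I. ALL x y. x + p <= N e --> y + q <= N e --> norm (u e i x y) = 1)"

lemma unimodD: "unimod p q u ==> e : E ==> i : I ==> x + p <= N e ==> y + q <= N e ==> norm (u e i x y) = 1"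
 by (simp add: unimod_def)

lemma unimod_mono: "unimod p q u ==> p <= p' ==> q <= q' ==> unimod p' q' u"
 unfolding unimod_def by (meson add_left_mono order_trans)

lemma unimod_mult: "unimod p q u ==> unimod p q v ==> unimod p q (%e i x y. u e i x y * v e i x y)"
 by (simp add: unimod_def norm_mult)

lemma unimod_cnj: "unimod p q u ==> unimod p q (%e i x y. cnj (u e i x y))"
 by (simp add: unimod_def)

lemma unimod_bdd: "unimod p q u ==> bdd p q u"
 by (rule bddI[of _ _ _ 1]) (simp add: unimodD)

text \<open>With \<open>A = cis (e * a / 2)\<close> this approximates \<open>\<i> * a / 2\<close>;
  while \<open>A\<close> tends to 1, the quotient retains \<open>a\<close> in the limit.\<close>

definition al :: "('i, complex) family => ('i, complex) family" where
 "al A e i x y = (A e i x y - 1) / of_real e"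

lemma al_A: "e : E ==> A e i x y = 1 + of_real e * al A e i x y"
 using E_bounds by (simp add: al_def)

text \<open>The discrete sine-Gordon system for \<open>A = cis (e * a / 2)\<close> and the
  unimodular \<open>b\<close>. The factors \<open>A\<close> at two levels arise because
  \<open>a + (e / 2) * dy a\<close> is the mean of \<open>a\<close> at the two ends of a vertical
  edge.\<close>

definition dsys :: "('i, complex) family => ('i, complex) family => bool" where
 "dsys A b \<longleftrightarrow> unimod 1 0 A & unimod 0 1 b &
  (ALL e:E. ALL i:I. ALL x y. x + 1 <= N e --> y + 1 <= N e -->
   A e i x (Suc y) = A e i x y * mob (e\<^sup>2 / 4) (b e i x y * A e i x y) &
   b e i (Suc x) y = b e i x y * A e i x y * A e i x (Suc y))"

definition inv1 :: "(real => real) => ('i, complex) family => ('i, complex) family" where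
 "inv1 k z e i x y = inverse (1 - of_real (k e) * z e i x y)"

text \<open>The right-hand sides after division by the step: \<open>fdy\<close> tends to a quarter
  of \<open>b - cnj b\<close>, which is \<open>\<i> / 2\<close> times the sine, and
  \<open>gdx\<close> tends to twice the limit of \<open>al A\<close>. The corrections in
  \<open>gdx\<close> are kept as exact multiples of \<open>e\<close>.\<close>

definition fdy :: "('i, complex) family => ('i, complex) family => ('i, complex) family" where
 "fdy A b e i x y = (1 / 4) * (A e i x y * ((b e i x y * A e i x y - cnj (b e i x y * A e i x y)) * inv1 (%e. e\<^sup>2 / 4) (%e i x y. b e i x y * A e i x y) e i x y))"

definition gdx :: "('i, complex) family => ('i, complex) family => ('i, complex) family" where
 "gdx A b e i x y = 2 * al A e i x y + (of_real e * al A e i x y) * al A e i x y + A e i x y * (of_real e * fdy A b e i x y)"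

lemma kap_bounds: "e : E ==> 0 <= e\<^sup>2 / 4" "e : E ==> e\<^sup>2 / 4 <= 1/2" "e : E ==> e\<^sup>2 / 4 < 1"
 using E_bounds(1,3)[of e] power_le_one[of e 2] by auto

lemma dsys_bA: "dsys A b ==> unimod 1 1 (%e i x y. b e i x y * A e i x y)"
 unfolding dsys_def by (intro unimod_mult) (auto intro: unimod_mono)

lemma dsys_dy:
 assumes "dsys A b" and *: "e : E" "i : I" "x + 1 <= N e" "y + 1 <= N e"
 shows "dy (al A) e i x y = fdy A b e i x y"
proof -
 let ?A = "A e i x y" and ?z = "b e i x y * A e i x y"
 have A1: "A e i x (Suc y) = ?A * mob (e\<^sup>2 / 4) ?z" using assms unfolding dsys_def by blast
 have z: "norm ?z = 1" using unimodD[OF dsys_bA[OF assms(1)] *] .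
 have e: "e ~= 0" using E_bounds * by auto
 have "dy (al A) e i x y = (A e i x (Suc y) - ?A) / of_real (e * e)"
  using e by (simp add: dy_def al_def complex_scaleR field_simps)
 also have "A e i x (Suc y) - ?A = ?A * (mob (e\<^sup>2 / 4) ?z - 1)" by (simp add: A1 algebra_simps)
 also have "\<dots> / of_real (e * e) = fdy A b e i x y"
  unfolding mob_minus_one[OF z kap_bounds(1,3)[OF *(1)]] using e
  by (simp add: fdy_def inv1_def power2_eq_square)
 finally show ?thesis .
qed

lemma dsys_dx:
 assumes "dsys A b" and *: "e : E" "i : I" "x + 1 <= N e" "y + 1 <= N e"
 shows "dx b e i x y = b e i x y * gdx A b e i x y"
proof -
 have b1: "b e i (Suc x) y = b e i x y * A e i x y * A e i x (Suc y)" using assms unfolding dsys_def by blast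
 have e: "e ~= 0" using E_bounds * by auto
 have A1: "A e i x (Suc y) = A e i x y + of_real (e * e) * fdy A b e i x y"
  using dsys_dy[OF assms] e by (simp add: dy_def al_def complex_scaleR field_simps)
 have poly: "\<beta> * X * (X + \<epsilon> * \<epsilon> * f) - \<beta> = \<epsilon> * (\<beta> * (2 * a + \<epsilon> * a * a + X * (\<epsilon> * f)))"
  if "X = 1 + \<epsilon> * a" for \<beta> X \<epsilon> f a :: complex
  unfolding that by (simp add: algebra_simps)
 show ?thesis unfolding dx_def b1 A1 gdx_def of_real_mult poly[OF al_A[OF *(1)]]
  using e by (simp add: complex_scaleR)
qed

lemma inv1_lower:
 assumes "unimod p q z" "e : E" "i : I" "x + p <= N e" "y + q <= N e" "0 <= k e" "k e <= c"
 shows "1 - c <= norm (1 - complex_of_real (k e) * z e i x y)"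
 using one_minus_ge[OF unimodD[OF assms(1-5)] assms(6)] assms(7) by simp

lemma bx_inv1:
 assumes "bx k p q z" "unimod p q z" "!!e. e : E ==> 0 <= kappa e" "!!e. e : E ==> kappa e <= c" "c < 1"
 shows "bx k p q (inv1 kappa z)"
 unfolding inv1_def
proof (rule bx_inverse)
 show "bx k p q (%e i x y. 1 - complex_of_real (kappa e) * z e i x y)"
  using assms by (intro bx_diff bx_const bx_mult bx_param[of _ c]) auto
 show "1 - c <= norm (1 - complex_of_real (kappa e) * z e i x y)"
  if "e : E" "i : I" "x + p <= N e" "y + q <= N e" for e i x y
  using inv1_lower[OF assms(2) that] assms that by auto
qed (use assms in simp)

lemma bd_inv1:
 assumes "bd k p q z" "unimod p q z" "!!e. e : E ==> 0 <= kappa e" "!!e. e : E ==> kappa e <= c" "c < 1"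
 shows "bd k p q (inv1 kappa z)"
 unfolding inv1_def
proof (rule bd_inverse)
 show "bd k p q (%e i x y. 1 - complex_of_real (kappa e) * z e i x y)"
  using assms by (intro bd_diff bd_const bd_mult bd_param[of _ c]) auto
 show "1 - c <= norm (1 - complex_of_real (kappa e) * z e i x y)"
  if "e : E" "i : I" "x + p <= N e" "y + q <= N e" for e i x y
  using inv1_lower[OF assms(2) that] assms that by auto
qed (use assms in simp)

lemma bd_A: "bd k p q (al A) ==> bd k p q A"
proof -
 assume a: "bd k p q (al A)"
 have "bd k p q (%e i x y. 1 + of_real e * al A e i x y)" by (intro bd_add bd_const bd_mult bd_step a)
 then show ?thesis by (rule bd_cong) (rule al_A)
qed

lemma bx_A: "bd k p q (al A) ==> bx k p q A"
proof -
 assume a: "bd k p q (al A)"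
 have "bx k p q (%e i x y. 1 + of_real e * al A e i x y)" by (intro bx_add bx_const bx_step a)
 moreover have "bd k (Suc p) q (dx A)" if "bd k (Suc p) q (dx (%e i x y. 1 + of_real e * al A e i x y))"
  using that by (rule bd_cong) (simp add: dx_def al_A[symmetric])
 ultimately show ?thesis using bd_A[OF a] by (simp add: bx_def)
qed

lemma bd_fdy:
 assumes "dsys A b" "bd k 1 1 (al A)" "bd k 1 1 b" shows "bd k 1 1 (fdy A b)"
 unfolding fdy_def
 using assms dsys_bA[OF assms(1)] kap_bounds
 by (intro bd_mult bd_const bd_diff bd_cnj bd_inv1[where c = "1/2"] bd_A[OF assms(2)]) auto

lemma bx_fdy:
 assumes "dsys A b" "bd k 1 1 (al A)" "bx k 1 1 b" shows "bx k 1 1 (fdy A b)"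
 unfolding fdy_def
 using assms dsys_bA[OF assms(1)] kap_bounds
 by (intro bx_mult bx_const bx_diff bx_cnj bx_inv1[where c = "1/2"] bx_A[OF assms(2)]) auto

text \<open>Given order \<open>k\<close> for both unknowns, \<open>dx b\<close> has order
  \<open>k\<close> by its equation. Hence the x-difference of \<open>fdy\<close> has order
  \<open>k\<close>, and \<open>dx (al A)\<close> solves a linear equation in y with this source.
  Differencing the equation of \<open>b\<close> in y gives a linear equation in x for
  \<open>dy b\<close>; the one term of too high order, the y-difference of \<open>fdy\<close>,
  carries a factor \<open>e\<close>.\<close>

theorem dsys_bd:
 assumes ds: "dsys A b"
  and A0: "!!k. bd k 1 0 (%e i x y. al A e i x 0)" and b0: "!!k. bd k 0 1 (%e i x y. b e i 0 y)"
 shows "bd k 1 0 (al A) & bd k 0 1 b"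
proof (induction k)
 case 0
 have ub: "unimod 0 1 b" "unimod 1 0 A" using ds by (simp_all add: dsys_def)
 have A: "bdd 1 1 A" using unimod_bdd[OF ub(2)] bdd_mono by (metis le0 le_refl)
 have b: "bdd 1 1 b" using unimod_bdd[OF ub(1)] bdd_mono by (metis le0 le_refl)
 have A': "bd 0 1 1 A" and b': "bd 0 1 1 b" using A b by simp_all
 have "bd 0 1 1 (fdy A b)"
  unfolding fdy_def
  by (intro bd_mult bd_const bd_diff bd_cnj bd_inv1[where c = "1/2"] A' b' dsys_bA[OF ds] kap_bounds) auto
 then have f: "bdd 1 (Suc 0) (fdy A b)" by simp
 have "bdd 1 0 (al A)"
 proof (rule bdd_linear_evolution[where P = "%e i x y. 0" and Q = "fdy A b", OF _ f])
  show "bdd 1 (Suc 0) (%e i x y. 0 :: complex)" by (rule bddI[of _ _ _ 0]) simp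
  show "bdd 1 0 (%e i x y. al A e i x 0)" using A0[of 0] by simp
 qed (simp add: dsys_dy[OF ds])
 then show ?case using unimod_bdd[OF ub(1)] by simp
next
 case (Suc k)
 then have a: "bd k 1 0 (al A)" and b: "bd k 0 1 b" by auto
 have a1: "bd k 1 1 (al A)" and b1: "bd k 1 1 b" using a b by (auto intro: bd_mono)
 have A1: "bd k 1 1 A" by (rule bd_A[OF a1])
 have f: "bd k 1 1 (fdy A b)" by (rule bd_fdy[OF ds a1 b1])
 have g: "bd k 1 1 (gdx A b)" unfolding gdx_def
  using a1 f A1 by (intro bd_add bd_mult bd_const bd_step) auto
 have dyA: "bd k 1 1 (dy (al A))" using f by (rule bd_cong) (rule dsys_dy[OF ds])
 have dxb: "bd k 1 1 (dx b)"
  using bd_mult[OF b1 g] by (rule bd_cong) (rule dsys_dx[OF ds])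
 have "bx k 1 1 b" using b1 dxb by (auto simp: bx_def intro: bd_mono)
 from bx_fdy[OF ds a1 this] have fx: "bd k 2 1 (dx (fdy A b))" by (simp add: bx_def numeral_2_eq_2)
 have dxA: "bd k 2 0 (dx (al A))"
 proof (rule bd_linear_evolution[where P = "%e i x y. 0" and Q = "dx (fdy A b)"])
  show "bd k 2 (Suc 0) (dx (fdy A b))" using fx by simp
  have "dx (%e i x y. al A e i x 0) = (%e i x y. dx (al A) e i x 0)" by (simp add: fun_eq_iff dx_def)
  then show "bd k 2 0 (%e i x y. dx (al A) e i x 0)" using A0[of "Suc k"] by (simp add: numeral_2_eq_2)
  fix e i x y assume *: "e : E" "i : I" "x + 2 <= N e" "y + Suc 0 <= N e"
  have "dy (dx (al A)) e i x y = dx (dy (al A)) e i x y" by (simp add: dx_dy)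
  also have "\<dots> = dx (fdy A b) e i x y"
   using * dsys_dy[OF ds *(1,2), of x y] dsys_dy[OF ds *(1,2), of "Suc x" y] by (simp add: dx_def)
  finally show "dy (dx (al A)) e i x y = 0 * dx (al A) e i x y + dx (fdy A b) e i x y" by simp
 qed (rule bd_const)
 \<comment> \<open>The y-difference of \<open>al A\<close> is \<open>fdy\<close>, already of order
   \<open>k\<close>. Reflection lets the class \<open>bx\<close>, which is about x-differences,
   express a y-difference.\<close>
 have byA: "bx k 1 1 (transp (al A))"
  using a1 dyA by (auto simp: bx_def dx_transp intro!: bd_transp intro: bd_mono)
 have byf: "bx k 1 1 (%e i x y. of_real e * transp (fdy A b) e i x y)"
  by (intro bx_step bd_transp f)
 have byAA: "bx k 1 1 (transp A)"
 proof -
  have "al (transp A) = transp (al A)" by (simp add: al_def transp_def fun_eq_iff)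
  then show ?thesis using bx_A[of k 1 1 "transp A"] bd_transp[OF a1] by simp
 qed
 have "transp (gdx A b) = (%e i x y. 2 * transp (al A) e i x y + (of_real e * transp (al A) e i x y) * transp (al A) e i x y
   + transp A e i x y * (of_real e * transp (fdy A b) e i x y))"
  by (simp add: gdx_def transp_def fun_eq_iff)
 moreover have "bx k 1 1 (%e i x y. 2 * transp (al A) e i x y + (of_real e * transp (al A) e i x y) * transp (al A) e i x y
   + transp A e i x y * (of_real e * transp (fdy A b) e i x y))"
  by (intro bx_add bx_mult bx_const bx_step byA byf byAA bd_transp a1)
 ultimately have gy: "bd k 2 1 (dx (transp (gdx A b)))" by (simp add: bx_def numeral_2_eq_2)
 have "bd k 2 0 (transp (dy b))"
 proof (rule bd_linear_evolution[where P = "transp (sy (gdx A b))" and Q = "%e i x y. transp b e i x y * dx (transp (gdx A b)) e i x y"])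
  show "bd k 2 (Suc 0) (transp (sy (gdx A b)))" using bd_transp[OF bd_sy[OF g]] by (simp add: numeral_2_eq_2)
  show "bd k 2 (Suc 0) (%e i x y. transp b e i x y * dx (transp (gdx A b)) e i x y)"
   using gy bd_mono[OF bd_transp[OF b]] by (intro bd_mult) (auto simp: numeral_2_eq_2)
  have "transp (dy (%e i x y. b e i 0 y)) = (%e i x y. transp (dy b) e i x 0)" by (simp add: fun_eq_iff dy_def transp_def)
  then show "bd k 2 0 (%e i x y. transp (dy b) e i x 0)"
   using bd_transp[OF bd_dy[OF b0[of "Suc k"]]] by (simp add: numeral_2_eq_2)
  fix e i x y assume *: "e : E" "i : I" "x + 2 <= N e" "y + Suc 0 <= N e"
  have "dy (transp (dy b)) e i x y = dy (dx b) e i y x"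
   by (simp add: dy_transp transp_def dx_dy)
  also have "\<dots> = (b e i y (Suc x) * gdx A b e i y (Suc x) - b e i y x * gdx A b e i y x) /\<^sub>R e"
   using * dsys_dx[OF ds *(1,2), of y x] dsys_dx[OF ds *(1,2), of y "Suc x"] by (simp add: dy_def)
  also have "\<dots> = transp (sy (gdx A b)) e i x y * transp (dy b) e i x y + transp b e i x y * dx (transp (gdx A b)) e i x y"
   by (simp add: transp_def sy_def dx_def dy_def complex_scaleR algebra_simps)
  finally show "dy (transp (dy b)) e i x y = \<dots>" .
 qed
 from bd_transp[OF this] have dyb: "bd k 0 2 (dy b)" by simp
 show ?case using a b dxA dyA dxb dyb bd_bdd by (auto simp: numeral_2_eq_2)
qed

theorem dsys_near:
 assumes ds: "dsys A b" and bds: "bdd 1 0 (al A)"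
  and hv: "hasy v (%i X Y. (1 / 4) * (z i X Y - cnj (z i X Y)))" and hz: "hasx z (%i X Y. z i X Y * (2 * v i X Y))"
  and lip: "lip v" "lip z"
  and A0: "nearO 1 0 (%e i x y. al A e i x 0) (%i X Y. v i X 0)"
  and b0: "nearO 0 1 (%e i x y. b e i 0 y) (%i X Y. z i 0 Y)"
 shows "nearO 1 0 (al A) v" "nearO 0 1 b z"
proof -
 define rho where "rho = (%e i x y. e + norm (al A e i x y - v i (e *. x) (e *. y)) + norm (b e i x y - z i (e *. x) (e *. y)))"
 have wt: "!!e i x y. e <= rho e i x y" by (simp add: rho_def)
 have ub: "unimod 0 1 b" "unimod 1 0 A" using ds by (simp_all add: dsys_def)
 have A: "bdd 1 1 A" using unimod_bdd[OF ub(2)] bdd_mono by (metis le0 le_refl)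
 have b: "bdd 1 1 b" using unimod_bdd[OF ub(1)] bdd_mono by (metis le0 le_refl)
 have a: "bdd 1 1 (al A)" using bds bdd_mono by (metis le0 le_refl)
 have na: "near rho 1 1 (al A) v"
 proof (rule nearI[where C = 1, OF wt])
  fix e i x y assume "e : E"
  then show "norm (al A e i x y - v i (e *. x) (e *. y)) <= 1 * rho e i x y"
   using E_bounds(1)[of e] by (simp add: rho_def)
 qed
 have nb: "near rho 1 1 b z"
 proof (rule nearI[where C = 1, OF wt])
  fix e i x y assume "e : E"
  then show "norm (b e i x y - z i (e *. x) (e *. y)) <= 1 * rho e i x y"
   using E_bounds(1)[of e] by (simp add: rho_def)
 qed
 have cb: "cbd v" "cbd z" using lip by (auto intro: lip_cbd)
 have c1: "cbd (%i X Y. 1 :: complex)" by (rule lip_cbd[OF lip_const])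
 have n1: "near rho 1 1 (%e i x y. 1) (%i X Y. 1 :: complex)" by (rule near_param[OF wt])
 have nA: "near rho 1 1 A (%i X Y. 1)"
  by (rule near_cong[OF near_add_small[OF n1 a]]) (auto intro: al_A)
 have nz: "near rho 1 1 (%e i x y. b e i x y * A e i x y) (%i X Y. z i X Y * 1)"
  by (rule near_mult[OF nb nA b c1])
 have bz: "bdd 1 1 (%e i x y. b e i x y * A e i x y)" by (rule unimod_bdd[OF dsys_bA[OF ds]])
 have binv: "bdd 1 1 (inv1 (%e. e\<^sup>2 / 4) (%e i x y. b e i x y * A e i x y))"
  using bd_inv1[where k = 0 and c = "1/2", OF _ dsys_bA[OF ds] kap_bounds(1,2)] bz by simp
 \<comment> \<open>From \<open>1 / (1 - k * z) = 1 + k * z / (1 - k * z)\<close> with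
   \<open>k = e\<^sup>2 / 4\<close>: the deviation from 1 is \<open>e\<close> times a bounded
   family.\<close>
 have ninv: "near rho 1 1 (inv1 (%e. e\<^sup>2 / 4) (%e i x y. b e i x y * A e i x y)) (%i X Y. 1)"
 proof (rule near_cong[OF near_add_small[OF n1]])
  show "bdd 1 1 (%e i x y. of_real e * (1 / 4) * (b e i x y * A e i x y) * inv1 (%e. e\<^sup>2 / 4) (%e i x y. b e i x y * A e i x y) e i x y)"
  proof -
   have "bd 0 1 1 (%e i x y. of_real e * (1 / 4) * (b e i x y * A e i x y) * inv1 (%e. e\<^sup>2 / 4) (%e i x y. b e i x y * A e i x y) e i x y)"
    by (intro bd_mult bd_const bd_step) (use A b binv in simp_all)
   then show ?thesis by simp
  qed
  fix e i x y assume *: "e : E" "i : I" "x + 1 <= N e" "y + 1 <= N e"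
  have "1 - complex_of_real (e\<^sup>2 / 4) * (b e i x y * A e i x y) ~= 0"
   by (rule one_minus_nz[OF unimodD[OF dsys_bA[OF ds] *] kap_bounds(1,3)[OF *(1)]])
  then show "inv1 (%e. e\<^sup>2 / 4) (%e i x y. b e i x y * A e i x y) e i x y =
   1 + of_real e * (of_real e * (1 / 4) * (b e i x y * A e i x y) * inv1 (%e. e\<^sup>2 / 4) (%e i x y. b e i x y * A e i x y) e i x y)"
   by (simp add: inv1_def field_simps power2_eq_square)
 qed simp
 have nd: "near rho 1 1 (%e i x y. b e i x y * A e i x y - cnj (b e i x y * A e i x y)) (%i X Y. z i X Y * 1 - cnj (z i X Y * 1))"
  by (intro near_diff near_cnj nz)
 have bdiff: "bdd 1 1 (%e i x y. b e i x y * A e i x y - cnj (b e i x y * A e i x y))"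
 proof -
  have "bd 0 1 1 (%e i x y. b e i x y * A e i x y - cnj (b e i x y * A e i x y))"
   by (intro bd_diff bd_cnj) (use bz in simp_all)
  then show ?thesis by simp
 qed
 have cdiff: "cbd (%i X Y. (z i X Y * 1 - cnj (z i X Y * 1)) * 1)"
  by (intro lip_cbd lip_mult lip_diff lip_cnj lip lip_const)
 have nf: "near rho 1 1 (fdy A b) (%i X Y. (1 / 4) * (1 * ((z i X Y * 1 - cnj (z i X Y * 1)) * 1)))"
  unfolding fdy_def
  by (intro near_mult near_param[OF wt] nA nd ninv A bdiff c1 cdiff cbd_bilinear[OF bounded_bilinear_mult]
    bd_const[of 0, unfolded bd.simps])
 have ny: "near rho 1 1 (dy (al A)) (%i X Y. (1 / 4) * (z i X Y - cnj (z i X Y)))"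
  by (rule near_cong[OF nf]) (auto intro: dsys_dy[OF ds])
 have bf: "bd 0 1 1 (fdy A b)" by (rule bd_fdy[OF ds]) (use a b in auto)
 have ng: "near rho 1 1 (gdx A b) (%i X Y. 2 * v i X Y)"
 proof (rule near_cong[OF near_add_small])
  show "near rho 1 1 (%e i x y. 2 * al A e i x y) (%i X Y. 2 * v i X Y)"
   by (intro near_mult near_param[OF wt] na cb bd_const[of 0, unfolded bd.simps])
  show "bdd 1 1 (%e i x y. al A e i x y * al A e i x y + A e i x y * fdy A b e i x y)"
   using bd_add[of 0, OF bd_mult[of 0] bd_mult[of 0]] a A bf by simp
 qed (simp_all add: gdx_def algebra_simps)
 have nx: "near rho 1 1 (dx b) (%i X Y. z i X Y * (2 * v i X Y))"
  by (rule near_cong[OF near_mult[OF nb ng b]])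
   (auto intro: dsys_dx[OF ds] cbd_bilinear[OF bounded_bilinear_mult lip_cbd[OF lip_const] cb(1)])
 have ty: "tayy v (%i X Y. (1 / 4) * (z i X Y - cnj (z i X Y)))"
  by (intro tayyI[OF hv] lip_mult lip_const lip_diff lip_cnj lip)
 have tx: "tayx z (%i X Y. z i X Y * (2 * v i X Y))"
  by (intro tayxI[OF hz] lip_mult lip_const lip)
 show "nearO 1 0 (al A) v" "nearO 0 1 b z"
  by (rule rate_Goursat[OF ty tx A0 b0 rho_def ny nx])+
qed

end


text \<open>Eliminates the conjugate, which turns compatibility around a square into an identity of
  rational functions.\<close>

lemma mob_unit_eq: "norm z = 1 ==> mob k z = (z - of_real k) / (z * (1 - of_real k * z))"
proof -
 assume z: "norm z = 1"
 then have "z ~= 0" by auto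
 then show ?thesis by (cases "1 - of_real k * z = 0") (simp_all add: mob_def cnj_unit'[OF z] field_simps)
qed

text \<open>In the variables \<open>e\<^sup>i\<^sup>\<theta>\<close>, \<open>e\<^sup>i\<^sup>\<epsilon>\<^sup>a\<^sup>/\<^sup>2\<close>, \<open>e\<^sup>i\<^sup>b\<close> the evolution around an elementary square is rational; both ways
 around the square produce the same quotient \<open>Z1 / Z2\<close>.\<close>

lemma square_identities:
 fixes A b t tx ty A1 b1 :: complex and k m :: real
 assumes unit: "norm A = 1" "norm b = 1" "norm t = 1" and km: "0 <= k" "k < 1" "0 <= m" "m < 1"
  and A1: "A1 = A * mob (k * m) (b * A)" and b1: "b1 = b * A * A1"
  and tx: "tx = t * (cnj A)\<^sup>2 * mob k (t * cnj A)" and ty: "ty = t * mob m (b * t)"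
 shows "tx * mob m (b1 * tx) = ty * (cnj A1)\<^sup>2 * mob k (ty * cnj A1)" (is "?lhs = ?rhs")
  and "A1 * (tx * mob m (b1 * tx)) * cnj ty = (A * tx * cnj t) * mob (k * m) ((b * t * ty) * (A * tx * cnj t))"
proof -
 have km1: "k * m < 1" "0 <= k * m"
  using km mult_strict_mono[of k 1 m 1] by (cases "m = 0"; auto)+
 have nz: "A ~= 0" "b ~= 0" "t ~= 0" using unit by auto
 have uA1: "norm A1 = 1" unfolding A1 using unit mob_unit[of "b * A" "k * m"] km1 by (simp add: norm_mult)
 have utx: "norm tx = 1" unfolding tx using unit mob_unit[of "t * cnj A" k] km by (simp add: norm_mult norm_power)
 have uty: "norm ty = 1" unfolding ty using unit mob_unit[of "b * t" m] km by (simp add: norm_mult)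
 have ub1: "norm b1 = 1" unfolding b1 using unit uA1 by (simp add: norm_mult)
 define K M where KM: "K = complex_of_real k" "M = complex_of_real m"
 define N D P Q R S Z1 Z2 where defs: "N = b * A - K * M" "D = 1 - K * M * b * A" "P = t - K * A" "Q = A - K * t"
  "R = b * t - M" "S = 1 - M * b * t"
  "Z1 = b * t * (1 - K * K * M * M) - K * b * A * (1 - M * M) - M * (1 - K * K)"
  "Z2 = A * (1 - K * K * M * M) - K * t * (1 - M * M) - M * b * A * t * (1 - K * K)"
 \<comment> \<open>Two identities for each of the three quotients formed after a first step: the
   first and fourth for \<open>b1 * tx\<close>, the second and third for \<open>ty / A1\<close>, the
   last two for the transformed data. The same \<open>Z1\<close> and \<open>Z2\<close> occur in
   every pair, which is why the two ways around the square agree.\<close>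
 have ids: "N * P - M * D * Q = A * Z1" "R * D - K * N * S = Z1" "N * S - K * R * D = b * Z2"
  "D * Q - M * N * P = Z2" "R * P - K * M * Q * S = t * Z1" "S * Q - K * M * R * P = Z2"
  unfolding defs by (simp_all add: algebra_simps)
 have mk: "mob k z = (z - K) / (z * (1 - K * z))" and mm: "mob m z = (z - M) / (z * (1 - M * z))"
  and mkm: "mob (k * m) z = (z - K * M) / (z * (1 - K * M * z))" if "norm z = 1" for z
  using mob_unit_eq[OF that] by (simp_all add: KM)
 have nk: "1 - K * z ~= 0" and nm: "1 - M * z ~= 0" and nkm: "1 - K * M * z ~= 0" if "norm z = 1" for z
  using one_minus_nz[OF that] km km1 by (auto simp: KM simp flip: of_real_mult)
 have D: "D ~= 0" using nkm[of "b * A"] unit by (simp add: defs norm_mult mult_ac)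
 have S: "S ~= 0" using nm[of "b * t"] unit by (simp add: defs norm_mult mult_ac)
 have cA: "cnj A = inverse A" by (rule cnj_unit'[OF unit(1)])
 have utA: "norm (t / A) = 1" using unit by (simp add: norm_divide)
 have Q: "Q ~= 0"
 proof -
  have "Q = A * (1 - K * (t / A))" using nz by (simp add: defs field_simps)
  then show ?thesis using nk[OF utA] nz by simp
 qed
 have A1': "A1 = N / (b * D)"
  unfolding A1 using mkm[of "b * A"] unit nz by (simp add: defs norm_mult mult_ac)
 have N: "N ~= 0" using A1' uA1 by auto
 have b1': "b1 = A * N / D" unfolding b1 A1' using nz by simp
 have tx': "tx = P / (A * Q)"
 proof -
  have "mob k (t * cnj A) = (t / A - K) / ((t / A) * (1 - K * (t / A)))"
   using mk[OF utA] by (simp add: cA divide_inverse)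
  also have "\<dots> = P * A / (t * Q)" using nz Q by (simp add: defs field_simps)
  finally show ?thesis unfolding tx cA using nz by (simp add: power2_eq_square field_simps)
 qed
 have P: "P ~= 0" using tx' utx by auto
 have ty': "ty = R / (b * S)"
  unfolding ty using mm[of "b * t"] unit nz by (simp add: defs norm_mult mult_ac)
 have R: "R ~= 0" using ty' uty by auto
 have frac: "1 - c * (p / q) = (q - c * p) / q" "p / q - c = (p - c * q) / q" if "q ~= 0" for c p q :: complex
  using that by (simp_all add: field_simps)
 have ub: "norm (b1 * tx) = 1" using ub1 utx by (simp add: norm_mult)
 have bt: "b1 * tx = (N * P) / (D * Q)" unfolding b1' tx' using nz by simp
 have DQ: "D * Q ~= 0" and NS: "N * S ~= 0" and SQ: "S * Q ~= 0" using D Q N S by simp_all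
 have m1: "1 - M * (b1 * tx) = Z2 / (D * Q)"
  using ids(4) unfolding bt frac(1)[OF DQ] by (simp only: mult.assoc)
 have m2: "b1 * tx - M = A * Z1 / (D * Q)"
  using ids(1) unfolding bt frac(2)[OF DQ] by (simp only: mult.assoc)
 have Z2: "Z2 ~= 0" using nm[OF ub] m1 by auto
 have L: "tx * mob m (b1 * tx) = D * Z1 / (N * Z2)"
 proof -
  have "tx * mob m (b1 * tx) = (b1 * tx - M) / (b1 * (1 - M * (b1 * tx)))" unfolding mm[OF ub] using utx by auto
  also have "\<dots> = A * Z1 / (b1 * Z2)" unfolding m1 m2 using D Q by simp
  finally show ?thesis unfolding b1' using nz by simp
 qed
 have cA1: "cnj A1 = inverse A1" by (rule cnj_unit'[OF uA1])
 have nA1: "A1 ~= 0" "ty ~= 0" using uA1 uty by auto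
 have uyA: "norm (ty / A1) = 1" using uA1 uty by (simp add: norm_divide)
 have yA: "ty / A1 = (R * D) / (N * S)" unfolding A1' ty' using nz by simp
 have k1: "1 - K * (ty / A1) = b * Z2 / (N * S)"
  using ids(3) unfolding yA frac(1)[OF NS] by (simp only: mult.assoc)
 have k2: "ty / A1 - K = Z1 / (N * S)"
  using ids(2) unfolding yA frac(2)[OF NS] by (simp only: mult.assoc)
 have "ty * (cnj A1)\<^sup>2 * mob k (ty * cnj A1) = (ty / A1 - K) / (A1 * (1 - K * (ty / A1)))"
 proof -
  have w: "w / A1 * ((w - K) / (w * q)) = (w - K) / (A1 * q)" if "w ~= 0" for w q
   using that by simp
  have "ty * (inverse A1)\<^sup>2 = ty / A1 / A1" by (simp add: power2_eq_square divide_inverse)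
  then show ?thesis unfolding cA1 divide_inverse[of ty, symmetric] mk[OF uyA] using w[of "ty / A1"] nA1 by simp
 qed
 also have "\<dots> = Z1 / (A1 * b * Z2)" unfolding k1 k2 using N S by simp
 also have "\<dots> = D * Z1 / (N * Z2)" unfolding A1' using nz by simp
 finally show "tx * mob m (b1 * tx) = ty * (cnj A1)\<^sup>2 * mob k (ty * cnj A1)" using L by simp
 have z: "(b * t * ty) * (A * tx * cnj t) = R * P / (S * Q)"
  unfolding tx' ty' cnj_unit'[OF unit(3)] using nz by simp
 have uz: "norm ((b * t * ty) * (A * tx * cnj t)) = 1" using unit utx uty by (simp add: norm_mult)
 have "mob (k * m) ((b * t * ty) * (A * tx * cnj t)) = (t * Z1 / (S * Q)) / (R * P / (S * Q) * (Z2 / (S * Q)))"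
 proof -
  have "R * P / (S * Q) - K * M = t * Z1 / (S * Q)" "1 - K * M * (R * P / (S * Q)) = Z2 / (S * Q)"
   using ids(5,6) unfolding frac(1)[OF SQ] frac(2)[OF SQ] by (simp_all only: mult_ac)
  then show ?thesis using mkm[OF uz] unfolding z by simp
 qed
 also have "(A * tx * cnj t) * \<dots> = Z1 * S / (R * Z2)"
  unfolding tx' cnj_unit'[OF unit(3)] using nz S Q P by (simp add: field_simps)
 finally have M: "(A * tx * cnj t) * mob (k * m) ((b * t * ty) * (A * tx * cnj t)) = Z1 * S / (R * Z2)" .
 have "A1 * (tx * mob m (b1 * tx)) * cnj ty = Z1 * S / (R * Z2)"
 proof -
  have "cnj ty = b * S / R" unfolding cnj_unit'[OF uty] by (simp add: ty')
  then show ?thesis unfolding L A1' using nz N D by (simp add: field_simps)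
 qed
 with M show "A1 * (tx * mob m (b1 * tx)) * cnj ty = (A * tx * cnj t) * mob (k * m) ((b * t * ty) * (A * tx * cnj t))" by simp
qed

text \<open>The values are built along the bottom row and then up each column, so by construction
  the x-equation holds only on the bottom row; compatibility carries it upwards. The invariant
  \<open>P\<close> accompanies the construction because compatibility is available only under
  it.\<close>

lemma grid_system:
 assumes P: "P z0" "!!x y s. x < n ==> y <= n ==> P s ==> P (f x y s)" "!!x y s. x <= n ==> y < n ==> P s ==> P (g x y s)"
  and compat: "!!x y s. x < n ==> y < n ==> P s ==> g (Suc x) y (f x y s) = f x (Suc y) (g x y s)"
 shows "EX z. z 0 0 = z0 & (ALL x<=n. ALL y<=n. P (z x y)) &
  (ALL x<n. ALL y<=n. z (Suc x) y = f x y (z x y)) & (ALL x<=n. ALL y<n. z x (Suc y) = g x y (z x y))"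
proof -
 define w where "w = rec_nat z0 (%x s. f x 0 s)"
 define z where "z = (%x. rec_nat (w x) (%y s. g x y s))"
 have w: "w 0 = z0" "w (Suc x) = f x 0 (w x)" for x by (simp_all add: w_def)
 have z: "z x 0 = w x" "z x (Suc y) = g x y (z x y)" for x y by (simp_all add: z_def)
 have Pw: "x <= n ==> P (w x)" for x by (induction x) (auto simp: w intro!: P)
 have Pz: "x <= n ==> y <= n ==> P (z x y)" for x y by (induction y) (auto simp: z Pw intro!: P)
 have "x < n ==> y <= n ==> z (Suc x) y = f x y (z x y)" for x y
  by (induction y) (auto simp: z w compat Pz)
 then show ?thesis using Pz by (intro exI[of _ z]) (auto simp: z w)
qed

lemma mesh_gap:
 assumes "e : mesh_sizes" "e' : mesh_sizes" "e < e'" shows "2 * e <= e'"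
proof -
 obtain k l :: nat where kl: "e = (1/2)^k" "e' = (1/2)^l" using assms by (auto simp: mesh_sizes_def)
 then have "l < k" using assms(3) by (simp add: power_strict_decreasing_iff)
 then have "(1/2::real)^k <= (1/2)^(Suc l)" by (intro power_decreasing) auto
 then show ?thesis by (simp add: kl)
qed

text \<open>A strict inequality for each admissible step becomes uniform, which keeps the
  denominators of the transformation away from zero. This rests on the steps being powers of two: if
  some product lies between 1/2 and 1, its step is the largest admissible one, since any larger step
  is at least twice as big.\<close>

lemma mesh_uniform:
 assumes "t > 0" shows "EX c<1. ALL e:mesh_sizes. e * t < 1 --> e * t <= (c::real)"
proof (cases "EX e:mesh_sizes. 1/2 < e * t & e * t < 1")
 case True
 then obtain e1 where e1: "e1 : mesh_sizes" "1/2 < e1 * t" "e1 * t < 1" by blast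
 show ?thesis
 proof (intro exI[of _ "e1 * t"] conjI ballI impI)
  fix e assume e: "e : mesh_sizes" "e * t < 1"
  have "\<not> e1 < e"
  proof
   assume "e1 < e"
   then have "2 * e1 * t <= e * t" using mesh_gap[OF e1(1) e(1)] assms by (intro mult_right_mono) auto
   then show False using e e1 by simp
  qed
  then show "e * t <= e1 * t" using assms by (intro mult_right_mono) auto
 qed (rule e1)
next
 case False
 then show ?thesis by (intro exI[of _ "1/2"]) force
qed

locale backlund = meshed r E I for r E and I :: "'i set" +
 fixes \<beta> :: real
 assumes beta: "0 < \<beta>" and E_beta: "E \<subseteq> Backlund_mesh_sizes \<beta>"
begin

definition ka :: "real => real" where "ka e = e * \<beta> / 2"
definition mu :: "real => real" where "mu e = e / (2 * \<beta>)"

text \<open>The product of the two transformation parameters is the parameter of the sine-Gordon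
  system and no longer contains \<open>\<beta>\<close>; this makes \<open>square_identities\<close>
  applicable.\<close>

lemma ka_mu: "ka e * mu e = e\<^sup>2 / 4"
 using beta by (simp add: ka_def mu_def power2_eq_square)

lemma ka_bounds: "e : E ==> 0 <= ka e" "e : E ==> ka e < 1"
 and mu_bounds: "e : E ==> 0 <= mu e" "e : E ==> mu e < 1"
 using E_beta E_bounds(1) beta by (auto simp: ka_def mu_def Backlund_mesh_sizes_def less_imp_le)

lemma uniform_bounds: obtains c where "c < 1" "!!e. e : E ==> ka e <= c" "!!e. e : E ==> mu e <= c"
proof -
 obtain c where c: "c < 1" "!!e. e : mesh_sizes ==> e * (\<beta> / 2) < 1 ==> e * (\<beta> / 2) <= c"
  using mesh_uniform[of "\<beta> / 2"] beta by auto
 obtain d where d: "d < 1" "!!e. e : mesh_sizes ==> e * (1 / (2 * \<beta>)) < 1 ==> e * (1 / (2 * \<beta>)) <= d"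
  using mesh_uniform[of "1 / (2 * \<beta>)"] beta by auto
 have "ka e <= max c d" "mu e <= max c d" if "e : E" for e
  using c(2)[of e] d(2)[of e] ka_bounds(2)[OF that] mu_bounds(2)[OF that] E_mesh that by (auto simp: ka_def mu_def)
 then show ?thesis using that[of "max c d"] c d by auto
qed

definition bsys :: "('i, complex) family => ('i, complex) family => ('i, complex) family => bool" where
 "bsys A b t \<longleftrightarrow> unimod 0 0 t &
  (ALL e:E. ALL i:I. ALL x y. x + 1 <= N e --> y <= N e -->
   t e i (Suc x) y = t e i x y * (cnj (A e i x y))\<^sup>2 * mob (ka e) (t e i x y * cnj (A e i x y))) &
  (ALL e:E. ALL i:I. ALL x y. x <= N e --> y + 1 <= N e -->
   t e i x (Suc y) = t e i x y * mob (mu e) (b e i x y * t e i x y))"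

lemma bsys_exists:
 assumes ds: "dsys A b" and t0: "!!e i. e : E ==> i : I ==> norm (t0 e i) = 1"
 shows "EX t. bsys A b t & (ALL e:E. ALL i:I. t e i 0 0 = t0 e i)"
proof -
 have uA: "unimod 1 0 A" and ub: "unimod 0 1 b" using ds by (simp_all add: dsys_def)
 define Q where "Q = (%e i z. z 0 0 = t0 e i & (ALL x<=N e. ALL y<=N e. norm (z x y) = 1) &
  (ALL x<N e. ALL y<=N e. z (Suc x) y = z x y * (cnj (A e i x y))\<^sup>2 * mob (ka e) (z x y * cnj (A e i x y))) &
  (ALL x<=N e. ALL y<N e. z x (Suc y) = z x y * mob (mu e) (b e i x y * z x y)))"
 have "EX z. Q e i z" if e: "e : E" "i : I" for e i
  unfolding Q_def
 proof (rule grid_system)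
  show "norm (t0 e i) = 1" using t0 e by blast
  fix x y and s :: complex assume s: "norm s = 1"
  show "norm (s * (cnj (A e i x y))\<^sup>2 * mob (ka e) (s * cnj (A e i x y))) = 1" if "x < N e" "y <= N e"
   using unimodD[OF uA e, of x y] that s mob_unit[of "s * cnj (A e i x y)" "ka e"] ka_bounds[OF e(1)]
   by (simp add: norm_mult norm_power)
  show "norm (s * mob (mu e) (b e i x y * s)) = 1" if "x <= N e" "y < N e"
   using unimodD[OF ub e, of x y] that s mob_unit[of "b e i x y * s" "mu e"] mu_bounds[OF e(1)]
   by (simp add: norm_mult)
  assume xy: "x < N e" "y < N e"
  have "A e i x (Suc y) = A e i x y * mob (ka e * mu e) (b e i x y * A e i x y)"
   "b e i (Suc x) y = b e i x y * A e i x y * A e i x (Suc y)"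
   using ds xy e unfolding dsys_def ka_mu by auto
  from square_identities(1)[OF _ _ s ka_bounds[OF e(1)] mu_bounds[OF e(1)] this refl refl]
  show "s * (cnj (A e i x y))\<^sup>2 * mob (ka e) (s * cnj (A e i x y)) * mob (mu e) (b e i (Suc x) y * (s * (cnj (A e i x y))\<^sup>2 * mob (ka e) (s * cnj (A e i x y)))) =
    s * mob (mu e) (b e i x y * s) * (cnj (A e i x (Suc y)))\<^sup>2 * mob (ka e) (s * mob (mu e) (b e i x y * s) * cnj (A e i x (Suc y)))"
   using unimodD[OF uA e, of x y] unimodD[OF ub e, of x y] xy by simp
 qed
 then obtain t where t: "!!e i. e : E ==> i : I ==> Q e i (t e i)" by metis
 then show ?thesis
  by (intro exI[of _ t]) (simp add: bsys_def unimod_def Q_def Suc_le_eq)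
qed

text \<open>Adding \<open>2 * dx \<theta>\<close> to \<open>a\<close> multiplies
  \<open>cis (e * a / 2)\<close> by \<open>cis\<close> of one increment of the angle, written here
  as \<open>t\<close> at the end of the edge times the conjugate of \<open>t\<close> at its
  start.\<close>

definition tA :: "('i, complex) family => ('i, complex) family => ('i, complex) family" where
 "tA A t e i x y = A e i x y * t e i (Suc x) y * cnj (t e i x y)"

definition tb :: "('i, complex) family => ('i, complex) family => ('i, complex) family" where
 "tb b t e i x y = b e i x y * t e i x y * t e i x (Suc y)"

text \<open>The second of the \<open>square_identities\<close> is the equation for
  \<open>tA\<close>; the equation for \<open>tb\<close> is then a cancellation of unimodular
  factors. Thus the transformation can be applied again to its own output.\<close>

lemma bsys_dsys:
 assumes ds: "dsys A b" and bs: "bsys A b t" shows "dsys (tA A t) (tb b t)"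
 unfolding dsys_def
proof (intro conjI ballI allI impI)
 have uA: "unimod 1 0 A" and ub: "unimod 0 1 b" and ut: "unimod 0 0 t" using ds bs by (simp_all add: dsys_def bsys_def)
 show "unimod 1 0 (tA A t)" "unimod 0 1 (tb b t)"
  using uA ub ut by (simp_all add: unimod_def tA_def tb_def norm_mult)
 fix e i x y assume *: "e : E" "i : I" "x + 1 <= N e" "y + 1 <= N e"
 have u: "norm (A e i x y) = 1" "norm (b e i x y) = 1" "norm (t e i x y) = 1" "norm (t e i x (Suc y)) = 1"
  "norm (t e i (Suc x) y) = 1"
  using unimodD[OF uA *(1,2), of x y] unimodD[OF ub *(1,2), of x y] unimodD[OF ut *(1,2), of x y] unimodD[OF ut *(1,2), of x "Suc y"]
   unimodD[OF ut *(1,2), of "Suc x" y] * by auto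
 have A1: "A e i x (Suc y) = A e i x y * mob (ka e * mu e) (b e i x y * A e i x y)"
  and b1: "b e i (Suc x) y = b e i x y * A e i x y * A e i x (Suc y)"
  using ds * unfolding dsys_def ka_mu by auto
 have tx: "t e i (Suc x) y = t e i x y * (cnj (A e i x y))\<^sup>2 * mob (ka e) (t e i x y * cnj (A e i x y))"
  and ty: "t e i x (Suc y) = t e i x y * mob (mu e) (b e i x y * t e i x y)"
  and txy: "t e i (Suc x) (Suc y) = t e i (Suc x) y * mob (mu e) (b e i (Suc x) y * t e i (Suc x) y)"
  using bs * unfolding bsys_def by auto
 note sq = square_identities(2)[OF u(1-3) ka_bounds[OF *(1)] mu_bounds[OF *(1)] A1 b1 tx ty, folded txy]
 show "tA A t e i x (Suc y) = tA A t e i x y * mob (e\<^sup>2 / 4) (tb b t e i x y * tA A t e i x y)"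
  using sq unfolding tA_def tb_def ka_mu by simp
 have "t e i x y * cnj (t e i x y) = 1" "t e i x (Suc y) * cnj (t e i x (Suc y)) = 1"
  using u cnj_unit by blast+
 then show "tb b t e i (Suc x) y = tb b t e i x y * tA A t e i x y * tA A t e i x (Suc y)"
  unfolding tb_def tA_def b1 by algebra
qed

end

context meshed begin

lemma bd0: "bd 0 p q u \<longleftrightarrow> bdd p q u" by simp

lemma near_one: "(!!e i x y. e <= rho e i x y) ==> near rho p q (%e i x y. c) (%i X Y. c)"
 by (rule near_param)

lemma near_param_e:
 assumes rho: "!!e i x y. e <= rho e i x y" and c: "!!e i. e : E ==> i : I ==> norm (c e i - d i) <= C * e"
 shows "near rho p q (%e i x y. c e i) (%i X Y. d i)"
proof (rule nearI[where C = "max C 0", OF rho])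
 fix e i x y assume *: "e : E" "i : I"
 have "norm (c e i - d i) <= max C 0 * e"
  using c[OF *] E_bounds(1)[OF *(1)] by (elim order_trans) (auto intro: mult_right_mono)
 also have "\<dots> <= max C 0 * rho e i x y" by (intro mult_left_mono rho) auto
 finally show "norm (c e i - d i) <= max C 0 * rho e i x y" .
qed

lemma near_A:
 assumes rho: "!!e i x y. e <= rho e i x y" and a: "bdd p q (al A)"
 shows "near rho p q A (%i X Y. 1)"
 by (rule near_cong[OF near_add_small[OF near_one[OF rho] a]]) (auto intro: al_A)

lemma near_inv1:
 assumes rho: "!!e i x y. e <= rho e i x y" and z: "unimod p q z"
  and k: "!!e. e : E ==> 0 <= kappa e" "!!e. e : E ==> kappa e <= c" "c < 1" "!!e. e : E ==> kappa e = e * d e" "!!e. e : E ==> \<bar>d e\<bar> <= C"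
 shows "near rho p q (inv1 kappa z) (%i X Y. 1)" "bdd p q (inv1 kappa z)"
proof -
 have bz: "bd 0 p q z" using unimod_bdd[OF z] by simp
 have bi: "bd 0 p q (inv1 kappa z)" by (rule bd_inv1[OF bz z k(1-3)])
 then show "bdd p q (inv1 kappa z)" by simp
 have "bd 0 p q (%e i x y. complex_of_real (d e) * (z e i x y * inv1 kappa z e i x y))"
  using k(5) by (intro bd_mult bz bi bd_param[of _ C]) auto
 then have b: "bdd p q (%e i x y. complex_of_real (d e) * (z e i x y * inv1 kappa z e i x y))" by simp
 show "near rho p q (inv1 kappa z) (%i X Y. 1)"
 proof (rule near_cong[OF near_add_small[OF near_one[OF rho] b]])
  fix e i x y assume *: "e : E" "i : I" "x + p <= N e" "y + q <= N e"
  have "1 - complex_of_real (kappa e) * z e i x y ~= 0"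
   using one_minus_nz[OF unimodD[OF z *] k(1)[OF *(1)]] k(2,3) *(1) by fastforce
  then show "inv1 kappa z e i x y = 1 + of_real e * (complex_of_real (d e) * (z e i x y * inv1 kappa z e i x y))"
   by (simp add: inv1_def k(4)[OF *(1)] field_simps)
 qed simp
qed

end

section \<open>Bounds and errors for one transformation step\<close>

context backlund begin

text \<open>The increment of \<open>t\<close> per step, with the factor \<open>e\<close> cancelled
  explicitly, so that only bounded families and an inverse denominator remain.\<close>

definition tdx :: "('i, complex) family => ('i, complex) family => ('i, complex) family" where
 "tdx A t e i x y = t e i x y * ((2 * cnj (al A e i x y) + of_real e * (cnj (al A e i x y) * cnj (al A e i x y))
   + of_real (\<beta> / 2) * (cnj (A e i x y) * (t e i x y - cnj (t e i x y)))) * inv1 ka (%e i x y. t e i x y * cnj (A e i x y)) e i x y)"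

definition tdy :: "('i, complex) family => ('i, complex) family => ('i, complex) family" where
 "tdy b t e i x y = t e i x y * (of_real (1 / (2 * \<beta>)) * ((b e i x y * t e i x y - cnj (b e i x y * t e i x y)) * inv1 mu (%e i x y. b e i x y * t e i x y) e i x y))"

lemma bsys_unimod:
 assumes "dsys A b" "bsys A b t"
 shows "unimod 1 0 (%e i x y. t e i x y * cnj (A e i x y))" "unimod 0 1 (%e i x y. b e i x y * t e i x y)"
 using assms unfolding dsys_def bsys_def by (auto intro!: unimod_mult unimod_cnj intro: unimod_mono)

lemma bsys_dx:
 assumes "dsys A b" "bsys A b t" and *: "e : E" "i : I" "x + 1 <= N e" "y <= N e"
 shows "dx t e i x y = tdx A t e i x y"
proof -
 let ?t = "t e i x y" and ?A = "A e i x y" and ?a = "al A e i x y"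
 have t1: "t e i (Suc x) y = ?t * (cnj ?A)\<^sup>2 * mob (ka e) (?t * cnj ?A)" using assms unfolding bsys_def by blast
 have e: "e ~= 0" using E_bounds * by auto
 have uz: "norm (?t * cnj ?A) = 1" using unimodD[OF bsys_unimod(1)[OF assms(1,2)] *(1,2,3)] * by simp
 have "norm ?A = 1" using assms(1) unimodD[of 1 0 A e i x y] * by (simp add: dsys_def)
 then have AA: "?A * cnj ?A = 1" by (rule cnj_unit)
 have "(cnj ?A)\<^sup>2 * mob (ka e) (?t * cnj ?A) - 1 =
   ((cnj ?A)\<^sup>2 - 1 + of_real (ka e) * (cnj ?A * (?t - cnj ?t))) * inverse (1 - of_real (ka e) * (?t * cnj ?A))"
  (is "_ = ?n * inverse ?d")
 proof -
  have d: "?d ~= 0" by (rule one_minus_nz[OF uz ka_bounds[OF *(1)]])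
  have "(cnj ?A)\<^sup>2 * (1 - of_real (ka e) * cnj (?t * cnj ?A)) - ?d = ?n"
   using AA by (simp add: power2_eq_square) algebra
  then show ?thesis unfolding mob_def using d by (simp add: field_simps)
 qed
 also have "(cnj ?A)\<^sup>2 - 1 = of_real e * (2 * cnj ?a + of_real e * (cnj ?a * cnj ?a))"
  by (subst al_A[OF *(1), of A]) (simp add: power2_eq_square algebra_simps)
 also have "of_real (ka e) = complex_of_real e * of_real (\<beta> / 2)" by (simp add: ka_def)
 finally have m: "(cnj ?A)\<^sup>2 * mob (ka e) (?t * cnj ?A) - 1 = of_real e * ((2 * cnj ?a + of_real e * (cnj ?a * cnj ?a) + of_real (\<beta> / 2) * (cnj ?A * (?t - cnj ?t))) * inv1 ka (%e i x y. t e i x y * cnj (A e i x y)) e i x y)"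
  by (simp add: inv1_def ka_def algebra_simps)
 have "t e i (Suc x) y - ?t = ?t * ((cnj ?A)\<^sup>2 * mob (ka e) (?t * cnj ?A) - 1)" by (simp add: t1 algebra_simps)
 then show ?thesis unfolding m dx_def tdx_def using e by (simp add: complex_scaleR)
qed

lemma bsys_dy:
 assumes "dsys A b" "bsys A b t" and *: "e : E" "i : I" "x <= N e" "y + 1 <= N e"
 shows "dy t e i x y = tdy b t e i x y"
proof -
 let ?t = "t e i x y" and ?z = "b e i x y * t e i x y"
 have t1: "t e i x (Suc y) = ?t * mob (mu e) ?z" using assms unfolding bsys_def by blast
 have e: "e ~= 0" using E_bounds * by auto
 have uz: "norm ?z = 1" using unimodD[OF bsys_unimod(2)[OF assms(1,2)] *(1,2)] * by simp
 have "t e i x (Suc y) - ?t = ?t * (mob (mu e) ?z - 1)" by (simp add: t1 algebra_simps)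
 moreover have "of_real (mu e) = complex_of_real e * of_real (1 / (2 * \<beta>))" by (simp add: mu_def)
 ultimately show ?thesis unfolding mob_minus_one[OF uz mu_bounds[OF *(1)]] dy_def tdy_def inv1_def
  using e by (simp add: complex_scaleR)
qed

text \<open>Both differences of \<open>t\<close> are algebraic in \<open>t\<close> and the data, so
  a bound of order \<open>k\<close> gives one of order \<open>k + 1\<close> without a Gronwall
  argument; unimodularity is the base case.\<close>

theorem bsys_bd:
 assumes ds: "dsys A b" and bs: "bsys A b t" and a: "!!k. bd k 1 0 (al A)" and b: "!!k. bd k 0 1 b"
 shows "bd k 0 0 t"
proof (induction k)
 case 0
 then show ?case using bs by (simp add: bsys_def unimod_bdd)
next
 case (Suc k)
 obtain c where c: "c < 1" "!!e. e : E ==> ka e <= c" "!!e. e : E ==> mu e <= c" using uniform_bounds by blast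
 note un = bsys_unimod[OF ds bs]
 have t: "bd k 1 0 t" "bd k 0 1 t" using Suc by (auto intro: bd_mono)
 have "bd k 1 0 (tdx A t)" unfolding tdx_def
  by (intro bd_mult bd_add bd_const bd_step bd_cnj bd_diff t a bd_A[OF a] bd_inv1[OF _ un(1) ka_bounds(1) c(2,1)])
 then have x: "bd k 1 0 (dx t)" by (rule bd_cong) (rule bsys_dx[OF ds bs], auto)
 have "bd k 0 1 (tdy b t)" unfolding tdy_def
  by (intro bd_mult bd_const bd_cnj bd_diff t b bd_inv1[OF _ un(2) mu_bounds(1) c(3,1)])
 then have y: "bd k 0 1 (dy t)" by (rule bd_cong) (rule bsys_dy[OF ds bs], auto)
 show ?case using x y Suc bd_bdd by auto
qed

text \<open>The weight is left open: \<open>bsys_near\<close> uses the Gronwall weight containing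
  the error of \<open>t\<close>, and afterwards \<open>bsys_tilde_near\<close> uses the plain
  step.\<close>

lemma bsys_near_d:
 assumes ds: "dsys A b" and bs: "bsys A b t"
  and a: "nearO 1 0 (al A) v" and b: "nearO 0 1 b z"
  and lip: "lip v" "lip z" "lip tau" and rho: "!!e i x y. e <= rho e i x y" and t: "near rho 0 0 t tau"
 shows "near rho 1 0 (dx t) (%i X Y. tau i X Y * (2 * cnj (v i X Y) + of_real (\<beta> / 2) * (tau i X Y - cnj (tau i X Y))))"
  "near rho 0 1 (dy t) (%i X Y. tau i X Y * (of_real (1 / (2 * \<beta>)) * (z i X Y * tau i X Y - cnj (z i X Y * tau i X Y))))"
proof -
 obtain c where c: "c < 1" "!!e. e : E ==> ka e <= c" "!!e. e : E ==> mu e <= c" using uniform_bounds by blast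
 note un = bsys_unimod[OF ds bs]
 have bt: "bdd 0 0 t" using bs by (simp add: bsys_def unimod_bdd)
 have bts: "bdd 1 0 t" "bdd 0 1 t" using bt bdd_mono by blast+
 have ba: "bdd 1 0 (al A)" by (rule near_bdd[OF a lip_cbd[OF lip(1)]])
 have bb: "bdd 0 1 b" using ds by (simp add: dsys_def unimod_bdd)
 have bA: "bdd 1 0 A" using ds by (simp add: dsys_def unimod_bdd)
 note na = near_weaken[OF a rho] and nb = near_weaken[OF b rho]
 have nt: "near rho 1 0 t tau" "near rho 0 1 t tau" using t by (auto intro: near_mono)
 note cs = lip_cbd[OF lip_const] lip_cbd[OF lip(1)] lip_cbd[OF lip(2)] lip_cbd[OF lip(3)]
 have ik: "near rho 1 0 (inv1 ka (%e i x y. t e i x y * cnj (A e i x y))) (%i X Y. 1)" "bdd 1 0 (inv1 ka (%e i x y. t e i x y * cnj (A e i x y)))"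
  by (rule near_inv1[where d = "%e. \<beta> / 2" and C = "\<beta> / 2" and c = c and rho = rho],
    rule rho, rule un(1), rule ka_bounds(1), assumption, rule c(2), assumption, rule c(1), simp add: ka_def, use beta in simp)+
 have im: "near rho 0 1 (inv1 mu (%e i x y. b e i x y * t e i x y)) (%i X Y. 1)" "bdd 0 1 (inv1 mu (%e i x y. b e i x y * t e i x y))"
  by (rule near_inv1[where d = "%e. 1 / (2 * \<beta>)" and C = "1 / (2 * \<beta>)" and c = c and rho = rho],
    rule rho, rule un(2), rule mu_bounds(1), assumption, rule c(3), assumption, rule c(1), simp add: mu_def, use beta in simp)+
 have nd: "near rho 1 0 (%e i x y. cnj (A e i x y) * (t e i x y - cnj (t e i x y))) (%i X Y. cnj 1 * (tau i X Y - cnj (tau i X Y)))"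
 proof (rule near_mult)
  show "bdd 1 0 (%e i x y. cnj (A e i x y))" using bd_cnj[of 0 1 0 A] bA by simp
 qed (intro near_cnj near_diff near_A rho ba nt lip_cbd lip_diff lip_cnj lip)+
 have sq: "bdd 1 0 (%e i x y. cnj (al A e i x y) * cnj (al A e i x y))"
  using bd_mult[OF bd_cnj bd_cnj, of 0 1 0 "al A" "al A"] ba by simp
 have n1: "near rho 1 0 (%e i x y. 2 * cnj (al A e i x y) + of_real e * (cnj (al A e i x y) * cnj (al A e i x y))
   + of_real (\<beta> / 2) * (cnj (A e i x y) * (t e i x y - cnj (t e i x y))))
  (%i X Y. 2 * cnj (v i X Y) + of_real (\<beta> / 2) * (cnj 1 * (tau i X Y - cnj (tau i X Y))))"
  by (intro near_add near_add_small near_mult near_one[OF rho] near_cnj na nd sq bd_const[of 0, unfolded bd.simps]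
   lip_cbd lip_mult lip_diff lip_cnj lip lip_const)
 have b1: "bdd 1 0 (%e i x y. 2 * cnj (al A e i x y) + of_real e * (cnj (al A e i x y) * cnj (al A e i x y))
   + of_real (\<beta> / 2) * (cnj (A e i x y) * (t e i x y - cnj (t e i x y))))"
  unfolding bd0[symmetric]
  by (intro bd_add bd_mult bd_const bd_step bd_cnj bd_diff) (use ba bA bts in simp_all)
 have "near rho 1 0 (tdx A t) (%i X Y. tau i X Y * ((2 * cnj (v i X Y) + of_real (\<beta> / 2) * (cnj 1 * (tau i X Y - cnj (tau i X Y)))) * 1))"
  unfolding tdx_def
  by (intro near_mult[OF nt(1) near_mult[OF n1 ik(1) b1]] bts cs lip_cbd lip_mult lip_add lip_diff lip_cnj lip lip_const)
 then show "near rho 1 0 (dx t) (%i X Y. tau i X Y * (2 * cnj (v i X Y) + of_real (\<beta> / 2) * (tau i X Y - cnj (tau i X Y))))"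
  by (rule near_cong) (auto intro: bsys_dx[OF ds bs])
 have n2: "near rho 0 1 (%e i x y. b e i x y * t e i x y) (%i X Y. z i X Y * tau i X Y)"
  by (intro near_mult nb nt bb cs)
 have b2: "bdd 0 1 (%e i x y. b e i x y * t e i x y - cnj (b e i x y * t e i x y))"
  unfolding bd0[symmetric] by (intro bd_diff bd_cnj bd_mult) (use bb bts in simp_all)
 have "near rho 0 1 (tdy b t) (%i X Y. tau i X Y * (of_real (1 / (2 * \<beta>)) * ((z i X Y * tau i X Y - cnj (z i X Y * tau i X Y)) * 1)))"
  unfolding tdy_def
  by (intro near_mult[OF nt(2) near_mult[OF near_one[OF rho] near_mult[OF near_diff[OF n2 near_cnj[OF n2]] im(1) b2]]]
    bts cs lip_cbd lip_mult lip_add lip_diff lip_cnj lip lip_const bd_const[of 0, unfolded bd.simps])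
 then show "near rho 0 1 (dy t) (%i X Y. tau i X Y * (of_real (1 / (2 * \<beta>)) * (z i X Y * tau i X Y - cnj (z i X Y * tau i X Y))))"
  by (rule near_cong) (auto intro: bsys_dy[OF ds bs])
qed

definition bsysc :: "('i, complex) field2 => ('i, complex) field2 => ('i, complex) field2 => bool" where
 "bsysc v z tau \<longleftrightarrow>
   hasx tau (%i X Y. tau i X Y * (2 * cnj (v i X Y) + of_real (\<beta> / 2) * (tau i X Y - cnj (tau i X Y)))) &
   hasy tau (%i X Y. tau i X Y * (of_real (1 / (2 * \<beta>)) * (z i X Y * tau i X Y - cnj (z i X Y * tau i X Y))))"

theorem bsys_near:
 assumes ds: "dsys A b" and bs: "bsys A b t"
  and a: "nearO 1 0 (al A) v" and b: "nearO 0 1 b z"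
  and lip: "lip v" "lip z" "lip tau" and h: "bsysc v z tau"
  and init: "!!e i. e : E ==> i : I ==> t e i 0 0 = tau i 0 0"
 shows "nearO 0 0 t tau"
proof -
 define rho where "rho = (%e i x y. e + norm (t e i x y - tau i (e *. x) (e *. y)))"
 have wt: "!!e i x y. e <= rho e i x y" by (simp add: rho_def)
 have nt: "near rho 0 0 t tau"
 proof (rule nearI[where C = 1, OF wt])
  fix e i x y assume "e : E"
  then show "norm (t e i x y - tau i (e *. x) (e *. y)) <= 1 * rho e i x y"
   using E_bounds(1)[of e] by (simp add: rho_def)
 qed
 note n = bsys_near_d[OF ds bs a b lip wt nt]
 show ?thesis
  by (rule rate_total[OF tayxI[OF h[unfolded bsysc_def, THEN conjunct1]] tayyI[OF h[unfolded bsysc_def, THEN conjunct2]] init rho_def n])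
   (intro lip_mult lip_add lip_diff lip_cnj lip lip_const)+
qed

lemma al_tA:
 assumes ds: "dsys A b" and bs: "bsys A b t" and *: "e : E" "i : I" "x + 1 <= N e" "y <= N e"
 shows "al (tA A t) e i x y = al A e i x y + A e i x y * (dx t e i x y * cnj (t e i x y))"
proof -
 have e: "e ~= 0" using E_bounds * by auto
 have "norm (t e i x y) = 1" using bs * unimodD[of 0 0 t e i x y] by (simp add: bsys_def)
 then have tt: "t e i x y * cnj (t e i x y) = 1" by (rule cnj_unit)
 have "t e i (Suc x) y = t e i x y + of_real e * dx t e i x y" using e by (simp add: dx_def complex_scaleR mult.assoc[symmetric])
 then have "tA A t e i x y = A e i x y * (t e i x y * cnj (t e i x y)) + of_real e * (A e i x y * (dx t e i x y * cnj (t e i x y)))"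
  by (simp add: tA_def algebra_simps)
 then show ?thesis using e unfolding tt by (simp add: al_def field_simps)
qed

lemma tb_eq:
 assumes "e : E"
 shows "tb b t e i x y = b e i x y * (t e i x y * t e i x y) + of_real e * (b e i x y * (t e i x y * dy t e i x y))"
proof -
 have "t e i x (Suc y) = t e i x y + of_real e * dy t e i x y"
  using E_bounds(4)[OF assms] by (simp add: dy_def complex_scaleR mult.assoc[symmetric])
 then show ?thesis by (simp add: tb_def algebra_simps)
qed

lemma bsys_tilde_bd:
 assumes ds: "dsys A b" and bs: "bsys A b t" and a: "!!k. bd k 1 0 (al A)" and b: "!!k. bd k 0 1 b"
 shows "bd k 1 0 (al (tA A t))" "bd k 0 1 (tb b t)"
proof -
 have t: "bd k 0 0 t" for k by (rule bsys_bd[OF ds bs a b])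
 have tx: "bd k 1 0 (dx t)" and ty: "bd k 0 1 (dy t)" using t[of "Suc k"] by simp_all
 have t': "bd k 1 0 t" "bd k 0 1 t" using t by (auto intro: bd_mono)
 have "bd k 1 0 (%e i x y. al A e i x y + A e i x y * (dx t e i x y * cnj (t e i x y)))"
  by (intro bd_add bd_mult a bd_A[OF a] tx bd_cnj t')
 then show "bd k 1 0 (al (tA A t))" by (rule bd_cong) (rule al_tA[OF ds bs], auto)
 have "bd k 0 1 (%e i x y. b e i x y * (t e i x y * t e i x y) + of_real e * (b e i x y * (t e i x y * dy t e i x y)))"
  by (intro bd_add bd_mult bd_step b ty t')
 then show "bd k 0 1 (tb b t)" by (rule bd_cong) (rule tb_eq)
qed

lemma bsys_tilde_near:
 assumes ds: "dsys A b" and bs: "bsys A b t"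
  and a: "nearO 1 0 (al A) v" and b: "nearO 0 1 b z"
  and lip: "lip v" "lip z" "lip tau" and t: "nearO 0 0 t tau"
 shows "nearO 1 0 (al (tA A t)) (%i X Y. v i X Y + tau i X Y * (2 * cnj (v i X Y) + of_real (\<beta> / 2) * (tau i X Y - cnj (tau i X Y))) * cnj (tau i X Y))"
  and "nearO 0 1 (tb b t) (%i X Y. z i X Y * (tau i X Y * tau i X Y))"
proof -
 have wt: "!!e i x y. (e::real) <= e" by simp
 note n = bsys_near_d[OF ds bs a b lip wt t]
 have bt: "bdd 0 0 t" using bs by (simp add: bsys_def unimod_bdd)
 have bts: "bdd 1 0 t" "bdd 0 1 t" using bt bdd_mono by blast+
 have ba: "bdd 1 0 (al A)" by (rule near_bdd[OF a lip_cbd[OF lip(1)]])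
 have bb: "bdd 0 1 b" using ds by (simp add: dsys_def unimod_bdd)
 have bA: "bdd 1 0 A" using ds by (simp add: dsys_def unimod_bdd)
 have nt: "nearO 1 0 t tau" "nearO 0 1 t tau" using t by (auto intro: near_mono)
 have lx: "lip (%i X Y. tau i X Y * (2 * cnj (v i X Y) + of_real (\<beta> / 2) * (tau i X Y - cnj (tau i X Y))))"
  and ly: "lip (%i X Y. tau i X Y * (of_real (1 / (2 * \<beta>)) * (z i X Y * tau i X Y - cnj (z i X Y * tau i X Y))))"
  by (intro lip_mult lip_add lip_diff lip_cnj lip lip_const)+
 have bx: "bdd 1 0 (dx t)" and "by": "bdd 0 1 (dy t)"
  by (rule near_bdd[OF n(1) lip_cbd[OF lx]]) (rule near_bdd[OF n(2) lip_cbd[OF ly]])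
 have "nearO 1 0 (%e i x y. al A e i x y + A e i x y * (dx t e i x y * cnj (t e i x y)))
  (%i X Y. v i X Y + 1 * (tau i X Y * (2 * cnj (v i X Y) + of_real (\<beta> / 2) * (tau i X Y - cnj (tau i X Y))) * cnj (tau i X Y)))"
  by (intro near_add a near_mult[OF near_A[OF wt ba] near_mult[OF n(1) near_cnj[OF nt(1)] bx]] bA lip_cbd lip_mult[OF lx] lip_cnj lip)
 then show "nearO 1 0 (al (tA A t)) (%i X Y. v i X Y + tau i X Y * (2 * cnj (v i X Y) + of_real (\<beta> / 2) * (tau i X Y - cnj (tau i X Y))) * cnj (tau i X Y))"
  by (rule near_cong) (auto intro: al_tA[OF ds bs])
 have "bd 0 0 1 (%e i x y. b e i x y * (t e i x y * dy t e i x y))"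
  by (intro bd_mult) (use bb bts "by" in simp_all)
 then have w: "bdd 0 1 (%e i x y. b e i x y * (t e i x y * dy t e i x y))" by simp
 have "nearO 0 1 (%e i x y. b e i x y * (t e i x y * t e i x y) + of_real e * (b e i x y * (t e i x y * dy t e i x y)))
  (%i X Y. z i X Y * (tau i X Y * tau i X Y))"
  by (intro near_add_small[OF _ w] near_mult[OF b near_mult[OF nt(2) nt(2)]] bb bts lip_cbd lip_mult lip)
 then show "nearO 0 1 (tb b t) (%i X Y. z i X Y * (tau i X Y * tau i X Y))"
  by (rule near_cong) (auto intro: tb_eq)
qed

end

section \<open>Frames and immersions on the grid\<close>

context meshed begin

lemma bd_mat2:
 assumes "bd k p q a" "bd k p q b" "bd k p q c" "bd k p q d"
 shows "bd k p q (%e i x y. mat2 (a e i x y) (b e i x y) (c e i x y) (d e i x y))"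
 by (subst mat2_split, intro bd_add bd_linear[OF bounded_linear_mat2(1)] bd_linear[OF bounded_linear_mat2(2)]
   bd_linear[OF bounded_linear_mat2(3)] bd_linear[OF bounded_linear_mat2(4)] assms)

lemma lip_mat2:
 assumes "lip a" "lip b" "lip c" "lip d"
 shows "lip (%i X Y. mat2 (a i X Y) (b i X Y) (c i X Y) (d i X Y))"
 by (subst mat2_split, intro lip_add lip_linear[OF bounded_linear_mat2(1)] lip_linear[OF bounded_linear_mat2(2)]
   lip_linear[OF bounded_linear_mat2(3)] lip_linear[OF bounded_linear_mat2(4)] assms)

lemma near_mat2:
 assumes "near rho p q a a'" "near rho p q b b'" "near rho p q c c'" "near rho p q d d'"
 shows "near rho p q (%e i x y. mat2 (a e i x y) (b e i x y) (c e i x y) (d e i x y)) (%i X Y. mat2 (a' i X Y) (b' i X Y) (c' i X Y) (d' i X Y))"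
 by (subst (1 2) mat2_split, intro near_add near_linear[OF bounded_linear_mat2(1)] near_linear[OF bounded_linear_mat2(2)]
   near_linear[OF bounded_linear_mat2(3)] near_linear[OF bounded_linear_mat2(4)] assms)

lemmas bd_matmult = bd_bilinear[OF bilinear_matmult]
lemmas lip_matmult = lip_bilinear[OF bilinear_matmult]
lemmas near_matmult = near_bilinear[OF bilinear_matmult]

lemma bd_Rot: "bd k p q G ==> bd k p q w ==> bd k p q (%e i x y. Rot (G e i x y) (w e i x y))"
 unfolding Rot_def
 by (intro bd_linear[OF bounded_linear_vec_of_su2] bd_matmult bd_linear[OF bounded_linear_adj] bd_linear[OF bounded_linear_su2_of_vec])

lemma lip_Rot: "lip G ==> lip w ==> lip (%i X Y. Rot (G i X Y) (w i X Y))"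
 unfolding Rot_def
 by (intro lip_linear[OF bounded_linear_vec_of_su2] lip_matmult lip_linear[OF bounded_linear_adj] lip_linear[OF bounded_linear_su2_of_vec])

lemma near_Rot:
 assumes "near rho p q G H" "near rho p q w v" "bdd p q G" "bdd p q w" "lip H" "lip v"
 shows "near rho p q (%e i x y. Rot (G e i x y) (w e i x y)) (%i X Y. Rot (H i X Y) (v i X Y))"
proof -
 have b: "bdd p q (%e i x y. adj (G e i x y))" by (rule bdd_linear[OF bounded_linear_adj assms(3)])
 have b2: "bdd p q (%e i x y. adj (G e i x y) ** su2_of_vec (w e i x y))"
  by (rule bdd_bilinear[OF bilinear_matmult b bdd_linear[OF bounded_linear_su2_of_vec assms(4)]])
 show ?thesis unfolding Rot_def
  by (intro near_linear[OF bounded_linear_vec_of_su2] near_matmult near_linear[OF bounded_linear_adj]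
   near_linear[OF bounded_linear_su2_of_vec] assms b b2 lip_cbd lip_linear[OF bounded_linear_su2_of_vec])
qed

lemma bdd_of_differences:
 fixes u :: "('i, 'a::real_normed_vector) family"
 assumes "bdd 1 0 (dx u)" "bdd 0 1 (dy u)" "!!e i. e : E ==> i : I ==> norm (u e i 0 0) <= M"
 shows "bdd 0 0 u"
proof -
 obtain C where C: "C > 0" "!!e i x y. e : E ==> i : I ==> x + 1 <= N e ==> y + 0 <= N e ==> norm (dx u e i x y) <= C" using assms(1) by (rule bddE) blast
 obtain D where D: "D > 0" "!!e i x y. e : E ==> i : I ==> x + 0 <= N e ==> y + 1 <= N e ==> norm (dy u e i x y) <= D" using assms(2) by (rule bddE) blast
 show ?thesis
 proof (rule bddI)
  fix e i x y assume *: "e : E" "i : I" "x + 0 <= N e" "y + 0 <= N e"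
  have "norm (u e i x y - u e i 0 0) <= C * \<bar>e *. x - e *. 0\<bar> + D * \<bar>e *. y - e *. 0\<bar>"
   by (rule grid_Lipschitz[where p = 0 and q = 0]) (use * C(2) D(2) in auto)
  also have "\<dots> <= C * r + D * r"
   using C(1) D(1) grid_in[OF *(1,3)] grid_in[OF *(1,4)] by (intro add_mono mult_left_mono) auto
  finally show "norm (u e i x y) <= M + (C * r + D * r)"
   using assms(3)[OF *(1,2)] norm_triangle_sub[of "u e i x y" "u e i 0 0"] by linarith
 qed
qed

end

lemma inv_sqrt_bounds:
 fixes s :: real
 shows "0 < 1 / sqrt (1 + s\<^sup>2)" "1 / sqrt (1 + s\<^sup>2) <= 1" "\<bar>1 / sqrt (1 + s\<^sup>2) - 1\<bar> <= s\<^sup>2"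
proof -
 define t where "t = 1 + s\<^sup>2"
 have t: "1 <= t" by (simp add: t_def)
 then have r: "1 <= sqrt t" "sqrt t <= t" using mult_left_mono[of 1 t t]
  by (simp, intro real_le_lsqrt) (auto simp: power2_eq_square)
 then show 1: "0 < 1 / sqrt (1 + s\<^sup>2)" "1 / sqrt (1 + s\<^sup>2) <= 1"
  unfolding t_def[symmetric] using t by (auto simp: divide_le_eq)
 have "1 - 1 / sqrt t = (sqrt t - 1) / sqrt t" using r t by (simp add: diff_divide_distrib)
 also have "\<dots> <= (t - 1) / 1" using r by (intro frac_le) auto
 finally show "\<bar>1 / sqrt (1 + s\<^sup>2) - 1\<bar> <= s\<^sup>2" using 1 by (simp add: t_def)
qed

text \<open>The index now carries the spectral parameter: a singleton gives one surface, an interval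
  the associated family with uniform constants. The bound on \<open>1 / lam\<close> is for the
  y-direction, where the parameter enters inversely.\<close>

locale framed = meshed r E I for r E and I :: "'i set" +
 fixes lam :: "'i => real" and Lam :: real
 assumes lam: "!!i. i : I ==> lam i ~= 0" "!!i. i : I ==> \<bar>lam i\<bar> <= Lam" "!!i. i : I ==> \<bar>1 / lam i\<bar> <= Lam"
begin

definition sU :: "real => 'i => real" where "sU e i = e * lam i / 2"
definition sV :: "real => 'i => real" where "sV e i = e / (2 * lam i)"

lemma s_bounds:
 assumes "e : E" "i : I"
 shows "\<bar>sU e i\<bar> <= e * Lam" "\<bar>sV e i\<bar> <= e * Lam" "(sU e i)\<^sup>2 <= e * Lam\<^sup>2" "(sV e i)\<^sup>2 <= e * Lam\<^sup>2"
proof -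
 note e = E_bounds(1)[OF assms(1)] E_bounds(3)[OF assms(1)]
 have L: "0 <= Lam" using lam(2)[OF assms(2)] by linarith
 have "\<bar>sU e i\<bar> = e * (\<bar>lam i\<bar> / 2)" "\<bar>sV e i\<bar> = e * (\<bar>1 / lam i\<bar> / 2)" using e by (simp_all add: sU_def sV_def abs_mult)
 moreover have "e * (\<bar>lam i\<bar> / 2) <= e * Lam" "e * (\<bar>1 / lam i\<bar> / 2) <= e * Lam"
  using e lam(2,3)[OF assms(2)] by (intro mult_left_mono; simp)+
 ultimately show 1: "\<bar>sU e i\<bar> <= e * Lam" "\<bar>sV e i\<bar> <= e * Lam" by simp_all
 have "(e * Lam)\<^sup>2 <= e * Lam\<^sup>2"
 proof -
  have "e * (e * Lam\<^sup>2) <= e * (1 * Lam\<^sup>2)" using e by (intro mult_left_mono mult_right_mono) auto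
  then show ?thesis by (simp add: power_mult_distrib power2_eq_square mult_ac)
 qed
 then show "(sU e i)\<^sup>2 <= e * Lam\<^sup>2" "(sV e i)\<^sup>2 <= e * Lam\<^sup>2"
  using power_mono[OF 1(1), of 2] power_mono[OF 1(2), of 2] by simp_all
qed

definition psys :: "('i, complex) family => ('i, complex) family => ('i, complex^2^2) family => bool" where
 "psys A b G \<longleftrightarrow> (ALL e:E. ALL i:I. G e i 0 0 = mat 1 &
   (ALL x y. x + 1 <= N e --> y <= N e --> G e i (Suc x) y = rotm (A e i x y) 1 (sU e i) ** G e i x y) &
   (ALL x y. x <= N e --> y + 1 <= N e --> G e i x (Suc y) = rotm 1 (- b e i x y) (sV e i) ** G e i x y))"

text \<open>The edge vectors of the immersion: the coefficients are \<open>2 * lam\<close> times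
  those of \<open>log_deriv_rotm\<close>, divided by the step. No derivative in the spectral
  parameter is left, so the immersion can be estimated like the other systems.\<close>

definition ssys :: "('i, complex) family => ('i, complex) family => ('i, complex^2^2) family => ('i, real^3) family => bool" where
 "ssys A b G F \<longleftrightarrow> (ALL e:E. ALL i:I. F e i 0 0 = 0 &
   (ALL x y. x + 1 <= N e --> y <= N e --> dx F e i x y = (lam i / (1 + (sU e i)\<^sup>2)) *\<^sub>R Rot (G e i x y) (hvec (cnj (A e i x y)))) &
   (ALL x y. x <= N e --> y + 1 <= N e --> dy F e i x y = (1 / lam i / (1 + (sV e i)\<^sup>2)) *\<^sub>R Rot (G e i x y) (hvec (b e i x y))))"

lemma psys_SU2:
 assumes ds: "dsys A b" and ps: "psys A b G" and *: "e : E" "i : I" "x <= N e" "y <= N e"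
 shows "G e i x y : SU2"
proof -
 have uA: "unimod 1 0 A" and ub: "unimod 0 1 b" using ds by (simp_all add: dsys_def)
 have base: "x <= N e ==> G e i x 0 : SU2" for x
 proof (induction x)
  case 0 then show ?case using ps * by (simp add: psys_def SU2_one)
 next
  case (Suc x)
  then have "G e i (Suc x) 0 = rotm (A e i x 0) 1 (sU e i) ** G e i x 0" using ps * by (simp add: psys_def)
  then show ?case using Suc unimodD[OF uA *(1,2), of x 0] by (auto intro!: SU2_mult rotm_SU2)
 qed
 have "y <= N e ==> G e i x y : SU2" for y
 proof (induction y)
  case 0 then show ?case using base * by simp
 next
  case (Suc y)
  then have "G e i x (Suc y) = rotm 1 (- b e i x y) (sV e i) ** G e i x y" using ps * by (simp add: psys_def)
  then show ?case using Suc unimodD[OF ub *(1,2), of x y] * by (auto intro!: SU2_mult rotm_SU2)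
 qed
 then show ?thesis using * by simp
qed

lemma psys_bdd: "dsys A b ==> psys A b G ==> bdd 0 0 G"
 by (rule bddI[of _ _ _ 4]) (auto intro!: norm_SU2 psys_SU2)

definition cf :: "(real => 'i => real) => real => 'i => real" where "cf s e i = 1 / sqrt (1 + (s e i)\<^sup>2)"
text \<open>The defect of the normalizing factor per step. It is itself of order \<open>e\<close>,
  so the normalization is absent from the limit frame equations.\<close>

definition gf :: "(real => 'i => real) => real => 'i => real" where "gf s e i = (cf s e i - 1) / e"

lemma cf_bounds:
 assumes "e : E" "i : I"
 shows "\<bar>cf sU e i\<bar> <= 1" "\<bar>cf sV e i\<bar> <= 1" "\<bar>cf sU e i - 1\<bar> <= Lam\<^sup>2 * e" "\<bar>cf sV e i - 1\<bar> <= Lam\<^sup>2 * e"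
  "\<bar>gf sU e i\<bar> <= Lam\<^sup>2 * e" "\<bar>gf sV e i\<bar> <= Lam\<^sup>2 * e"
proof -
 note e = E_bounds(1)[OF assms(1)]
 note b = s_bounds[OF assms]
 show "\<bar>cf sU e i\<bar> <= 1" "\<bar>cf sV e i\<bar> <= 1" using inv_sqrt_bounds(1,2)[of "sU e i"] inv_sqrt_bounds(1,2)[of "sV e i"] by (simp_all add: cf_def)
 show "\<bar>cf sU e i - 1\<bar> <= Lam\<^sup>2 * e" "\<bar>cf sV e i - 1\<bar> <= Lam\<^sup>2 * e"
  using inv_sqrt_bounds(3)[of "sU e i"] inv_sqrt_bounds(3)[of "sV e i"] b(3,4) by (simp_all add: cf_def mult.commute)
 have "\<bar>cf sU e i - 1\<bar> <= (e * Lam)\<^sup>2" "\<bar>cf sV e i - 1\<bar> <= (e * Lam)\<^sup>2"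
  using inv_sqrt_bounds(3)[of "sU e i"] inv_sqrt_bounds(3)[of "sV e i"] power_mono[OF b(1), of 2] power_mono[OF b(2), of 2] by (simp_all add: cf_def)
 then show "\<bar>gf sU e i\<bar> <= Lam\<^sup>2 * e" "\<bar>gf sV e i\<bar> <= Lam\<^sup>2 * e"
  using e by (simp_all add: gf_def field_simps power2_eq_square)
qed

definition uf :: "('i, complex) family => ('i, complex^2^2) family" where
 "uf A e i x y = mat2 (of_real (cf sU e i) * al A e i x y + of_real (gf sU e i)) (of_real (cf sU e i) * (- \<i> * of_real (lam i / 2)))
   (of_real (cf sU e i) * (- \<i> * of_real (lam i / 2))) (of_real (cf sU e i) * cnj (al A e i x y) + of_real (gf sU e i))"

definition vf :: "('i, complex) family => ('i, complex^2^2) family" where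
 "vf b e i x y = mat2 (of_real (gf sV e i)) (of_real (cf sV e i) * (\<i> * of_real (1 / lam i / 2)) * b e i x y)
   (of_real (cf sV e i) * (\<i> * of_real (1 / lam i / 2)) * cnj (b e i x y)) (of_real (gf sV e i))"

lemma rotm_uf: "e : E ==> rotm (A e i x y) 1 (sU e i) = mat 1 + e *\<^sub>R uf A e i x y"
 and rotm_vf: "e : E ==> rotm 1 (- b e i x y) (sV e i) = mat 1 + e *\<^sub>R vf b e i x y"
proof -
 assume e: "e : E"
 note e0 = E_bounds(4)[OF e]
 have g: "complex_of_real e * of_real (gf s e i) = of_real (cf s e i) - 1" for s
  using e0 by (simp add: gf_def)
 show "rotm (A e i x y) 1 (sU e i) = mat 1 + e *\<^sub>R uf A e i x y"
 proof -
  have A: "A e i x y = 1 + of_real e * al A e i x y" by (rule al_A[OF e])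
  then have "cnj (A e i x y) = 1 + of_real e * cnj (al A e i x y)" by (metis complex_cnj_add complex_cnj_complex_of_real complex_cnj_mult complex_cnj_one)
  with A show ?thesis unfolding rotm_def cf_def[symmetric] by (simp add: uf_def mat_1_mat2 distrib_left g sU_def mult_ac)
 qed
 show "rotm 1 (- b e i x y) (sV e i) = mat 1 + e *\<^sub>R vf b e i x y"
  unfolding rotm_def cf_def[symmetric]
  by (simp add: vf_def mat_1_mat2 distrib_left g sV_def mult_ac)
qed

lemma psys_dx:
 assumes "psys A b G" "e : E" "i : I" "x + 1 <= N e" "y <= N e"
 shows "dx G e i x y = uf A e i x y ** G e i x y"
proof -
 have "G e i (Suc x) y = G e i x y + e *\<^sub>R (uf A e i x y ** G e i x y)"
  using assms by (simp add: psys_def rotm_uf bounded_bilinear.add_left[OF bilinear_matmult] bounded_bilinear.scaleR_left[OF bilinear_matmult])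
 then show ?thesis using E_bounds(4)[OF assms(2)] by (simp add: dx_def)
qed

lemma psys_dy:
 assumes "psys A b G" "e : E" "i : I" "x <= N e" "y + 1 <= N e"
 shows "dy G e i x y = vf b e i x y ** G e i x y"
proof -
 have "G e i x (Suc y) = G e i x y + e *\<^sub>R (vf b e i x y ** G e i x y)"
  using assms by (simp add: psys_def rotm_vf bounded_bilinear.add_left[OF bilinear_matmult] bounded_bilinear.scaleR_left[OF bilinear_matmult])
 then show ?thesis using E_bounds(4)[OF assms(2)] by (simp add: dy_def)
qed

lemma gf_bounded: "e : E ==> i : I ==> \<bar>gf sU e i\<bar> <= Lam\<^sup>2" "e : E ==> i : I ==> \<bar>gf sV e i\<bar> <= Lam\<^sup>2"
proof -
 assume *: "e : E" "i : I"
 have "Lam\<^sup>2 * e <= Lam\<^sup>2 * 1" using E_bounds(3)[OF *(1)] by (intro mult_left_mono) auto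
 then show "\<bar>gf sU e i\<bar> <= Lam\<^sup>2" "\<bar>gf sV e i\<bar> <= Lam\<^sup>2" using cf_bounds(5,6)[OF *] by simp_all
qed

lemma param_norms:
 "e : E ==> i : I ==> norm (complex_of_real (cf sU e i)) <= 1" "e : E ==> i : I ==> norm (complex_of_real (cf sV e i)) <= 1"
 "e : E ==> i : I ==> norm (complex_of_real (gf sU e i)) <= Lam\<^sup>2" "e : E ==> i : I ==> norm (complex_of_real (gf sV e i)) <= Lam\<^sup>2"
 "i : I ==> norm (complex_of_real (lam i / 2)) <= Lam" "i : I ==> norm (complex_of_real (1 / lam i / 2)) <= Lam"
 unfolding norm_of_real using cf_bounds(1,2)[of e i] gf_bounded[of e i] lam(2,3)[of i] by simp_all

lemma bd_uf: "bd k p q (al A) ==> bd k p q (uf A)"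
 unfolding uf_def
 by (intro bd_mat2 bd_add bd_mult bd_cnj bd_const bd_param[of "%e i. complex_of_real (cf sU e i)" 1]
   bd_param[of "%e i. complex_of_real (gf sU e i)" "Lam\<^sup>2"] bd_param[of "%e i. complex_of_real (lam i / 2)" Lam])
  (assumption | rule param_norms)+

lemma bd_vf: "bd k p q b ==> bd k p q (vf b)"
 unfolding vf_def
 by (intro bd_mat2 bd_add bd_mult bd_cnj bd_const bd_param[of "%e i. complex_of_real (cf sV e i)" 1]
   bd_param[of "%e i. complex_of_real (gf sV e i)" "Lam\<^sup>2"] bd_param[of "%e i. complex_of_real (1 / lam i / 2)" Lam])
  (assumption | rule param_norms)+

theorem psys_bd:
 assumes ds: "dsys A b" and ps: "psys A b G" and a: "!!k. bd k 1 0 (al A)" and b: "!!k. bd k 0 1 b"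
 shows "bd k 0 0 G"
proof (induction k)
 case 0 then show ?case using psys_bdd[OF ds ps] by simp
next
 case (Suc k)
 have "bd k 1 0 (%e i x y. uf A e i x y ** G e i x y)" by (intro bd_matmult bd_uf a bd_mono[OF Suc]) auto
 then have x: "bd k 1 0 (dx G)" by (rule bd_cong) (rule psys_dx[OF ps], auto)
 have "bd k 0 1 (%e i x y. vf b e i x y ** G e i x y)" by (intro bd_matmult bd_vf b bd_mono[OF Suc]) auto
 then have y: "bd k 0 1 (dy G)" by (rule bd_cong) (rule psys_dy[OF ps], auto)
 show ?case using x y Suc bd_bdd by auto
qed

definition ucf :: "('i, complex) field2 => ('i, complex^2^2) field2" where
 "ucf v i X Y = mat2 (v i X Y) (- \<i> * of_real (lam i / 2)) (- \<i> * of_real (lam i / 2)) (cnj (v i X Y))"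

definition vcf :: "('i, complex) field2 => ('i, complex^2^2) field2" where
 "vcf z i X Y = mat2 0 ((\<i> * of_real (1 / lam i / 2)) * z i X Y) ((\<i> * of_real (1 / lam i / 2)) * cnj (z i X Y)) 0"

lemma lip_ucf: "lip v ==> lip (ucf v)"
 unfolding ucf_def
 by (intro lip_mat2 lip_mult lip_cnj lip_const lip_param[of "%i. complex_of_real (lam i / 2)" Lam])
  (assumption | rule param_norms)+

lemma lip_vcf: "lip z ==> lip (vcf z)"
 unfolding vcf_def
 by (intro lip_mat2 lip_mult lip_cnj lip_const lip_param[of "%i. complex_of_real (1 / lam i / 2)" Lam])
  (assumption | rule param_norms)+

lemma near_cf_gf:
 assumes rho: "!!e i x y. e <= rho e i x y"
 shows "near rho p q (%e i x y. complex_of_real (cf sU e i)) (%i X Y. 1)" "near rho p q (%e i x y. complex_of_real (gf sU e i)) (%i X Y. 0)"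
  "near rho p q (%e i x y. complex_of_real (cf sV e i)) (%i X Y. 1)" "near rho p q (%e i x y. complex_of_real (gf sV e i)) (%i X Y. 0)"
proof -
 have n: "norm (complex_of_real a - 1) = \<bar>a - 1\<bar>" for a
  by (metis norm_of_real of_real_1 of_real_diff)
 show "near rho p q (%e i x y. complex_of_real (cf sU e i)) (%i X Y. 1)"
  by (rule near_param_e[where C = "Lam\<^sup>2"], rule rho) (simp add: n cf_bounds)
 show "near rho p q (%e i x y. complex_of_real (cf sV e i)) (%i X Y. 1)"
  by (rule near_param_e[where C = "Lam\<^sup>2"], rule rho) (simp add: n cf_bounds)
 show "near rho p q (%e i x y. complex_of_real (gf sU e i)) (%i X Y. 0)"
  by (rule near_param_e[where C = "Lam\<^sup>2"], rule rho) (simp add: cf_bounds)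
 show "near rho p q (%e i x y. complex_of_real (gf sV e i)) (%i X Y. 0)"
  by (rule near_param_e[where C = "Lam\<^sup>2"], rule rho) (simp add: cf_bounds)
qed

lemma near_uf:
 assumes rho: "!!e i x y. e <= rho e i x y" and a: "near rho p q (al A) v" and v: "lip v"
 shows "near rho p q (uf A) (ucf v)"
proof -
 have bc: "bdd p q (%e i x y. complex_of_real (cf sU e i))"
  using bd_param[of "%e i. complex_of_real (cf sU e i)" 1 0] cf_bounds(1) by simp
 have cl: "cbd (%i X Y. - \<i> * complex_of_real (lam i / 2))"
  by (intro lip_cbd lip_mult lip_const lip_param[of "%i. complex_of_real (lam i / 2)" Lam]) (assumption | rule param_norms)+
 have "near rho p q (uf A) (%i X Y. mat2 (1 * v i X Y + 0) (1 * (- \<i> * of_real (lam i / 2))) (1 * (- \<i> * of_real (lam i / 2))) (1 * cnj (v i X Y) + 0))"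
  unfolding uf_def
  by (intro near_mat2 near_add near_mult near_cf_gf[OF rho] near_cnj near_param[OF rho] a bc cl lip_cbd lip_cnj v)
 then show ?thesis unfolding ucf_def[abs_def] by simp
qed

lemma near_vf:
 assumes rho: "!!e i x y. e <= rho e i x y" and b: "near rho p q b z" and z: "lip z"
 shows "near rho p q (vf b) (vcf z)"
proof -
 have bc: "bd 0 p q (%e i x y. complex_of_real (cf sV e i))"
  using cf_bounds(2) by (intro bd_param[of "%e i. complex_of_real (cf sV e i)" 1 0]) simp
 have bl: "bd 0 p q (%e i x y. \<i> * complex_of_real (1 / lam i / 2))"
  by (intro bd_mult bd_const bd_param[of "%e i. complex_of_real (1 / lam i / 2)" Lam]) (assumption | rule param_norms)+
 have bcl: "bdd p q (%e i x y. complex_of_real (cf sV e i) * (\<i> * complex_of_real (1 / lam i / 2)))" using bd_mult[OF bc bl] by simp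
 have cl: "cbd (%i X Y. \<i> * complex_of_real (1 / lam i / 2))"
  by (intro lip_cbd lip_mult lip_const lip_param[of "%i. complex_of_real (1 / lam i / 2)" Lam]) (assumption | rule param_norms)+
 have "near rho p q (vf b) (%i X Y. mat2 0 ((1 * (\<i> * of_real (1 / lam i / 2))) * z i X Y) ((1 * (\<i> * of_real (1 / lam i / 2))) * cnj (z i X Y)) 0)"
  unfolding vf_def
  by (intro near_mat2 near_add near_mult[OF near_mult] near_cf_gf[OF rho] near_cnj near_param[OF rho] b bc[unfolded bd0] bcl cl lip_cbd lip_cnj z)
 then show ?thesis unfolding vcf_def[abs_def] by simp
qed

theorem psys_near:
 assumes ds: "dsys A b" and ps: "psys A b G"
  and a: "nearO 1 0 (al A) v" and b: "nearO 0 1 b z"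
  and lip: "lip v" "lip z" "lip Phi"
  and h: "hasx Phi (%i X Y. ucf v i X Y ** Phi i X Y)" "hasy Phi (%i X Y. vcf z i X Y ** Phi i X Y)"
  and init: "!!i. i : I ==> Phi i 0 0 = mat 1"
 shows "nearO 0 0 G Phi"
proof -
 define rho where "rho = (%e i x y. e + norm (G e i x y - Phi i (e *. x) (e *. y)))"
 have wt: "!!e i x y. e <= rho e i x y" by (simp add: rho_def)
 have nG: "near rho 0 0 G Phi"
 proof (rule nearI[where C = 1, OF wt])
  fix e i x y assume "e : E"
  then show "norm (G e i x y - Phi i (e *. x) (e *. y)) <= 1 * rho e i x y"
   using E_bounds(1)[of e] by (simp add: rho_def)
 qed
 have ba: "bdd 1 0 (al A)" by (rule near_bdd[OF a lip_cbd[OF lip(1)]])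
 have bb: "bdd 0 1 b" using ds by (simp add: dsys_def unimod_bdd)
 have u: "near rho 1 0 (uf A) (ucf v)" by (rule near_uf[OF wt near_weaken[OF a wt] lip(1)])
 have w: "near rho 0 1 (vf b) (vcf z)" by (rule near_vf[OF wt near_weaken[OF b wt] lip(2)])
 have bu: "bdd 1 0 (uf A)" and bv: "bdd 0 1 (vf b)" using bd_uf[of 0 1 0 A] bd_vf[of 0 0 1 b] ba bb by simp_all
 have nx: "near rho 1 0 (dx G) (%i X Y. ucf v i X Y ** Phi i X Y)"
  by (rule near_cong[OF near_matmult[OF u near_mono[OF nG] bu lip_cbd[OF lip(3)]]]) (auto intro: psys_dx[OF ps])
 have ny: "near rho 0 1 (dy G) (%i X Y. vcf z i X Y ** Phi i X Y)"
  by (rule near_cong[OF near_matmult[OF w near_mono[OF nG] bv lip_cbd[OF lip(3)]]]) (auto intro: psys_dy[OF ps])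
 show ?thesis
 proof (rule rate_total[OF tayxI[OF h(1)] tayyI[OF h(2)] _ rho_def nx ny])
  show "G e i 0 0 = Phi i 0 0" if "e : E" "i : I" for e i using ps that init by (simp add: psys_def)
 qed (intro lip_matmult lip_ucf lip_vcf lip)+
qed

lemma den_bounds:
 fixes s :: real shows "\<bar>1 / (1 + s\<^sup>2)\<bar> <= 1" "\<bar>1 / (1 + s\<^sup>2) - 1\<bar> <= s\<^sup>2"
proof -
 have p: "0 < 1 + s\<^sup>2" by (rule add_pos_nonneg) auto
 then show "\<bar>1 / (1 + s\<^sup>2)\<bar> <= 1" by (simp add: field_simps)
 have "1 - 1 / (1 + s\<^sup>2) = s\<^sup>2 / (1 + s\<^sup>2)" using p by (simp add: field_simps)
 also have "\<dots> <= s\<^sup>2 / 1" by (intro frac_le) auto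
 finally show "\<bar>1 / (1 + s\<^sup>2) - 1\<bar> <= s\<^sup>2" using p by (simp add: field_simps)
qed

lemma coeff_bounds:
 assumes "e : E" "i : I"
 shows "\<bar>lam i / (1 + (sU e i)\<^sup>2)\<bar> <= Lam" "\<bar>1 / lam i / (1 + (sV e i)\<^sup>2)\<bar> <= Lam"
  "\<bar>lam i / (1 + (sU e i)\<^sup>2) - lam i\<bar> <= (Lam * Lam\<^sup>2) * e" "\<bar>1 / lam i / (1 + (sV e i)\<^sup>2) - 1 / lam i\<bar> <= (Lam * Lam\<^sup>2) * e"
proof -
 have *: "\<bar>l / (1 + s\<^sup>2)\<bar> <= Lam & \<bar>l / (1 + s\<^sup>2) - l\<bar> <= (Lam * Lam\<^sup>2) * e" if "\<bar>l\<bar> <= Lam" "s\<^sup>2 <= e * Lam\<^sup>2" for l s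
 proof
  have "\<bar>l / (1 + s\<^sup>2)\<bar> = \<bar>l\<bar> * \<bar>1 / (1 + s\<^sup>2)\<bar>" by (simp add: abs_mult)
  also have "\<dots> <= Lam * 1" using that den_bounds(1)[of s] by (intro mult_mono) auto
  finally show "\<bar>l / (1 + s\<^sup>2)\<bar> <= Lam" by simp
  have "l / (1 + s\<^sup>2) - l = l * (1 / (1 + s\<^sup>2) - 1)" by (simp add: algebra_simps)
  then have "\<bar>l / (1 + s\<^sup>2) - l\<bar> = \<bar>l\<bar> * \<bar>1 / (1 + s\<^sup>2) - 1\<bar>" by (simp only: abs_mult)
  also have "\<dots> <= Lam * (e * Lam\<^sup>2)" using that den_bounds(2)[of s] by (intro mult_mono) auto
  finally show "\<bar>l / (1 + s\<^sup>2) - l\<bar> <= (Lam * Lam\<^sup>2) * e" by (simp add: mult_ac)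
 qed
 show "\<bar>lam i / (1 + (sU e i)\<^sup>2)\<bar> <= Lam" "\<bar>1 / lam i / (1 + (sV e i)\<^sup>2)\<bar> <= Lam"
  "\<bar>lam i / (1 + (sU e i)\<^sup>2) - lam i\<bar> <= (Lam * Lam\<^sup>2) * e" "\<bar>1 / lam i / (1 + (sV e i)\<^sup>2) - 1 / lam i\<bar> <= (Lam * Lam\<^sup>2) * e"
  using *[OF lam(2)[OF assms(2)] s_bounds(3)[OF assms]] *[OF lam(3)[OF assms(2)] s_bounds(4)[OF assms]] by blast+
qed

text \<open>\<open>F\<close> does not occur on the right-hand sides, so all orders from one upwards
  come from bounds on the rotated edge vectors; only the bound on \<open>F\<close> itself needs a
  summation from the corner.\<close>

theorem ssys_bd:
 assumes ds: "dsys A b" and ps: "psys A b G" and ss: "ssys A b G F" and a: "!!k. bd k 1 0 (al A)" and b: "!!k. bd k 0 1 b"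
 shows "bd k 0 0 F"
proof -
 have G: "bd k 0 0 G" for k by (rule psys_bd[OF ds ps a b])
 have "bd k 1 0 (%e i x y. (lam i / (1 + (sU e i)\<^sup>2)) *\<^sub>R Rot (G e i x y) (hvec (cnj (A e i x y))))" for k
  by (intro bd_scaleR bd_Rot bd_linear[OF bounded_linear_hvec] bd_cnj bd_A[OF a] bd_mono[OF G] bd_param[of _ Lam])
   (use coeff_bounds in auto)
 then have x: "bd k 1 0 (dx F)" for k by (rule bd_cong) (use ss in \<open>auto simp: ssys_def\<close>)
 have "bd k 0 1 (%e i x y. (1 / lam i / (1 + (sV e i)\<^sup>2)) *\<^sub>R Rot (G e i x y) (hvec (b e i x y)))" for k
  by (intro bd_scaleR bd_Rot bd_linear[OF bounded_linear_hvec] b bd_mono[OF G] bd_param[of _ Lam])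
   (use coeff_bounds in auto)
 then have y: "bd k 0 1 (dy F)" for k by (rule bd_cong) (use ss in \<open>auto simp: ssys_def\<close>)
 have "bdd 0 0 F" using x[of 0] y[of 0] by (intro bdd_of_differences[where M = 0]) (use ss in \<open>auto simp: ssys_def\<close>)
 with x y show ?thesis by (cases k) auto
qed

definition ssysc :: "('i, complex) field2 => ('i, complex^2^2) field2 => ('i, real^3) field2 => bool" where
 "ssysc z Phi F \<longleftrightarrow> hasx F (%i X Y. lam i *\<^sub>R Rot (Phi i X Y) (hvec 1)) & hasy F (%i X Y. (1 / lam i) *\<^sub>R Rot (Phi i X Y) (hvec (z i X Y))) &
   (ALL i:I. F i 0 0 = 0)"

lemma ssys_dnear:
 assumes ds: "dsys A b" and ps: "psys A b G" and ss: "ssys A b G F"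
  and a: "bdd 1 0 (al A)" and b: "nearO 0 1 b z"
  and lip: "lip z" "lip Phi"
  and G: "nearO 0 0 G Phi"
 shows "nearO 1 0 (dx F) (%i X Y. lam i *\<^sub>R Rot (Phi i X Y) (hvec 1))"
  "nearO 0 1 (dy F) (%i X Y. (1 / lam i) *\<^sub>R Rot (Phi i X Y) (hvec (z i X Y)))"
  "lip (%i X Y. lam i *\<^sub>R Rot (Phi i X Y) (hvec 1))" "lip (%i X Y. (1 / lam i) *\<^sub>R Rot (Phi i X Y) (hvec (z i X Y)))"
proof -
 have we: "!!e i x y. (e::real) <= e" by simp
 have bG: "bdd 0 0 G" by (rule psys_bdd[OF ds ps])
 have bGs: "bdd 1 0 G" "bdd 0 1 G" using bG bdd_mono by blast+
 have bb: "bdd 0 1 b" using ds by (simp add: dsys_def unimod_bdd)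
 have bA: "bdd 1 0 A" using ds by (simp add: dsys_def unimod_bdd)
 have ll: "lip (%i X Y. lam i)" "lip (%i X Y. 1 / lam i)" using lam by (intro lip_param[of _ Lam]; simp)+
 have lx: "lip (%i X Y. Rot (Phi i X Y) (hvec (cnj 1)))" and ly: "lip (%i X Y. Rot (Phi i X Y) (hvec (z i X Y)))"
  by (intro lip_Rot lip lip_linear[OF bounded_linear_hvec] lip_const)+
 have bc: "bdd 1 0 (%e i x y. lam i / (1 + (sU e i)\<^sup>2))" "bdd 0 1 (%e i x y. 1 / lam i / (1 + (sV e i)\<^sup>2))"
  using coeff_bounds by (auto intro!: bddI[of _ _ _ Lam])
 have "nearO 1 0 (%e i x y. (lam i / (1 + (sU e i)\<^sup>2)) *\<^sub>R Rot (G e i x y) (hvec (cnj (A e i x y)))) (%i X Y. lam i *\<^sub>R Rot (Phi i X Y) (hvec (cnj 1)))"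
  by (intro near_bilinear[OF bounded_bilinear_scaleR] near_param_e[OF we, where C = "Lam * Lam\<^sup>2"] near_Rot near_linear[OF bounded_linear_hvec] near_cnj
   near_A[OF we a] near_mono[OF G] bc bGs bdd_linear[OF bounded_linear_hvec] bdd_linear[OF bounded_linear_cnj] bA lip lip_const lip_cbd[OF lx] lip_linear[OF bounded_linear_hvec])
   (use coeff_bounds in auto)
 then show "nearO 1 0 (dx F) (%i X Y. lam i *\<^sub>R Rot (Phi i X Y) (hvec 1))"
  by (elim near_cong) (use ss in \<open>auto simp: ssys_def\<close>)
 have "nearO 0 1 (%e i x y. (1 / lam i / (1 + (sV e i)\<^sup>2)) *\<^sub>R Rot (G e i x y) (hvec (b e i x y))) (%i X Y. (1 / lam i) *\<^sub>R Rot (Phi i X Y) (hvec (z i X Y)))"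
  by (intro near_bilinear[OF bounded_bilinear_scaleR] near_param_e[OF we, where C = "Lam * Lam\<^sup>2"] near_Rot near_linear[OF bounded_linear_hvec]
   b near_mono[OF G] bc bGs bdd_linear[OF bounded_linear_hvec] bb lip lip_cbd[OF ly] lip_linear[OF bounded_linear_hvec])
   (use coeff_bounds in auto)
 then show "nearO 0 1 (dy F) (%i X Y. (1 / lam i) *\<^sub>R Rot (Phi i X Y) (hvec (z i X Y)))"
  by (elim near_cong) (use ss in \<open>auto simp: ssys_def\<close>)
 show "lip (%i X Y. lam i *\<^sub>R Rot (Phi i X Y) (hvec 1))" using lip_bilinear[OF bounded_bilinear_scaleR ll(1) lx] by simp
 show "lip (%i X Y. (1 / lam i) *\<^sub>R Rot (Phi i X Y) (hvec (z i X Y)))" by (rule lip_bilinear[OF bounded_bilinear_scaleR ll(2) ly])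
qed

theorem ssys_near:
 assumes ds: "dsys A b" and ps: "psys A b G" and ss: "ssys A b G F"
  and a: "bdd 1 0 (al A)" and b: "nearO 0 1 b z"
  and lip: "lip z" "lip Phi"
  and G: "nearO 0 0 G Phi" and h: "ssysc z Phi H"
 shows "nearO 0 0 F H"
proof -
 define rho where "rho = (%e i x y. e + norm (F e i x y - H i (e *. x) (e *. y)))"
 have wt: "!!e i x y. e <= rho e i x y" by (simp add: rho_def)
 note n = ssys_dnear[OF ds ps ss a b lip G]
 show ?thesis
 proof (rule rate_total[OF tayxI[OF _ n(3)] tayyI[OF _ n(4)] _ rho_def near_weaken[OF n(1) wt] near_weaken[OF n(2) wt]])
  show "hasx H (%i X Y. lam i *\<^sub>R Rot (Phi i X Y) (hvec 1))" "hasy H (%i X Y. (1 / lam i) *\<^sub>R Rot (Phi i X Y) (hvec (z i X Y)))"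
   using h by (simp_all add: ssysc_def)
  show "F e i 0 0 = H i 0 0" if "e : E" "i : I" for e i using ss h that by (simp add: ssys_def ssysc_def)
 qed
qed

end

section \<open>Existence and uniqueness of frames\<close>

lemma closed_SU2: "closed SU2"
proof -
 have c: "continuous_on UNIV (%A::complex^2^2. A ** adj A)"
  by (intro bounded_bilinear.continuous_on[OF bilinear_matmult] continuous_on_id bounded_linear.continuous_on[OF bounded_linear_adj])
 have d: "continuous_on UNIV (%A::complex^2^2. det A)"
  unfolding det_2 by (intro continuous_intros)
 have eq: "SU2 = {A. A ** adj A = mat 1} \<inter> {A. det A = 1}" by (auto simp: SU2_def adj_def)
 show ?thesis
  unfolding eq by (intro closed_Int closed_Collect_eq c d continuous_on_const)
qed

lemma mean_bound:
 fixes f :: "real => 'a::real_normed_vector"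
 assumes "!!s. s : {0..r} ==> (f has_vector_derivative f' s) (at s within {0..r})"
  and B: "!!s. s : {0..r} ==> norm (f' s) <= B" and "X : {0..r}"
 shows "norm (f X - f 0) <= B * r"
proof -
 have "norm (f X - f 0) <= B * norm (X - 0)"
 proof (rule differentiable_bound[of "{0..r}" f "%s h. h *\<^sub>R f' s"])
  fix s assume s: "s : {0..r}"
  show "(f has_derivative (%h. h *\<^sub>R f' s)) (at s within {0..r})"
   using assms(1)[OF s] by (simp add: has_vector_derivative_def)
  show "onorm (%h. h *\<^sub>R f' s) <= B"
   by (rule onorm_le) (use B[OF s] in \<open>auto simp: mult.commute[of B] mult_left_mono\<close>)
 qed (use assms(3) in auto)
 also have "\<dots> <= B * r" using assms(3) order_trans[OF norm_ge_zero B[OF assms(3)]] by (intro mult_left_mono) auto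
 finally show ?thesis .
qed

context meshed begin

lemma limit_exists:
 fixes u :: "('i, 'a::euclidean_space) family"
 assumes bd: "!!k. bd k p q u" and i: "i : I"
 shows "EX es g. (ALL n. es n : E) & es \<longlonglongrightarrow> 0 & jet g &
  (ALL m n X Y. 0 <= X --> X < r --> 0 <= Y --> Y < r -->
    (along es i X Y (D m n u)) \<longlonglongrightarrow> g m n X Y)"
proof -
 have "EX C>0. ALL e:E. ALL x y. x + (p + m) <= N e --> y + (q + n) <= N e --> norm (D m n u e i x y) <= C" for m n
  using bd_D[OF bd[of "m + n"]] by (rule bddE) (use i in auto)
 then obtain B where B0: "!!m n. B m n > 0"
  and B: "!!m n e x y. e : E ==> x + (p + m) <= N e ==> y + (q + n) <= N e ==> norm (D m n u e i x y) <= B m n"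
  by metis
 obtain es where es: "!!n. es n : E" "es \<longlonglongrightarrow> 0" using E_null by blast
 have "EX kappa g. strict_mono (kappa :: nat => nat) & jet g & jet_bounds B g &
   (ALL m n X Y. 0 <= X --> X < r --> 0 <= Y --> Y < r -->
    (%j. D m n u (es (kappa j)) i (gidx (es (kappa j)) X) (gidx (es (kappa j)) Y)) \<longlonglongrightarrow> g m n X Y)"
  by (rule limit_jet[OF es i B0]) (rule B)
 then obtain kappa g where lim0: "strict_mono (kappa :: nat => nat) & jet g & jet_bounds B g &
   (ALL m n X Y. 0 <= X --> X < r --> 0 <= Y --> Y < r -->
    (%j. D m n u (es (kappa j)) i (gidx (es (kappa j)) X) (gidx (es (kappa j)) Y)) \<longlonglongrightarrow> g m n X Y)"
  by (elim exE) (rule that)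
 then have "(%j. es (kappa j)) \<longlonglongrightarrow> 0"
  using es LIMSEQ_subseq_LIMSEQ[of es 0 kappa] by (simp add: o_def)
 with lim0 es(1) show ?thesis by (intro exI[of _ "%j. es (kappa j)"] exI[of _ g]) simp
qed

lemma jet_cont: "jet g ==> cont2 (g m n)"
 by (simp add: jet_def)

lemma closed_by_limit:
 fixes v :: "real => real => 'a::real_normed_vector"
 assumes "cont2 v" "closed S"
  and "!!X Y. 0 <= X ==> X < r ==> 0 <= Y ==> Y < r ==> v X Y : S"
  and XY: "X : {0..r}" "Y : {0..r}"
 shows "v X Y : S"
proof -
 have cl: "closure ({0..<r} \<times> {0..<r}) = {0..r} \<times> {0..r}"
  using r_pos by (simp add: closure_Times)
 have "(%(x, y). v x y) ` closure ({0..<r} \<times> {0..<r}) \<subseteq> closure ((%(x, y). v x y) ` ({0..<r} \<times> {0..<r}))"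
  using assms(1) unfolding cl[symmetric] by (rule image_closure_subset[OF _ closed_closure closure_subset])
 also have "\<dots> \<subseteq> S" using assms(2,3) by (intro closure_minimal) auto
 finally have "(case (X, Y) of (x, y) => v x y) : S" using XY unfolding cl by blast
 then show ?thesis by simp
qed

text \<open>The hypotheses quantify over all sequences of steps because the convergent subsequence
  is chosen inside the proof. The equations are identified on the half-open square and extended by
  continuity; membership in \<open>S\<close> passes to the limit by closedness.\<close>

theorem limit_total:
 fixes u :: "('i, 'a::euclidean_space) family"
 assumes bd: "!!k. bd k 0 0 u" and i: "i : I"
  and lx: "!!es X Y w. (!!n. es n : E) ==> es \<longlonglongrightarrow> 0 ==> 0 <= X ==> X < r ==> 0 <= Y ==> Y < r ==>
    (along es i X Y u) \<longlonglongrightarrow> w ==>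
    (along es i X Y (dx u)) \<longlonglongrightarrow> fx X Y w"
  and ly: "!!es X Y w. (!!n. es n : E) ==> es \<longlonglongrightarrow> 0 ==> 0 <= X ==> X < r ==> 0 <= Y ==> Y < r ==>
    (along es i X Y u) \<longlonglongrightarrow> w ==>
    (along es i X Y (dy u)) \<longlonglongrightarrow> fy X Y w"
  and cx: "!!g. cont2 g ==> continuous_on ({0..r} \<times> {0..r}) (%(x, y). fx x y (g x y))"
  and cy: "!!g. cont2 g ==> continuous_on ({0..r} \<times> {0..r}) (%(x, y). fy x y (g x y))"
  and init: "!!e. e : E ==> u e i 0 0 = c"
  and S: "closed S" "!!e x y. e : E ==> x <= N e ==> y <= N e ==> u e i x y : S"
 shows "EX g. jet g & g 0 0 0 0 = c & (ALL X:{0..r}. ALL Y:{0..r}. g 0 0 X Y : S &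
   g 1 0 X Y = fx X Y (g 0 0 X Y) & g 0 1 X Y = fy X Y (g 0 0 X Y))"
proof -
 obtain es g where H: "(ALL n. es n : E) & es \<longlonglongrightarrow> 0 & jet g &
  (ALL m n X Y. 0 <= X --> X < r --> 0 <= Y --> Y < r -->
    (along es i X Y (D m n u)) \<longlonglongrightarrow> g m n X Y)"
  using limit_exists[OF bd i] by (elim exE) (rule that)
 then have es: "!!n. es n : E" "es \<longlonglongrightarrow> 0" and g: "jet g" by blast+
 have lim: "(along es i X Y (D m n u)) \<longlonglongrightarrow> g m n X Y"
  if "0 <= X" "X < r" "0 <= Y" "Y < r" for m n X Y using H that by blast
 have l0: "(along es i X Y u) \<longlonglongrightarrow> g 0 0 X Y"
  and l1: "(along es i X Y (dx u)) \<longlonglongrightarrow> g 1 0 X Y"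
  and l2: "(along es i X Y (dy u)) \<longlonglongrightarrow> g 0 1 X Y"
  if "0 <= X" "X < r" "0 <= Y" "Y < r" for X Y
  using lim[OF that, of 0 0] lim[OF that, of 1 0] lim[OF that, of 0 1] by simp_all
 show ?thesis
 proof (intro exI[of _ g] conjI ballI)
  show "jet g" by (rule g)
  have "(%j. u (es j) i (gidx (es j) 0) (gidx (es j) 0)) \<longlonglongrightarrow> g 0 0 0 0" using l0 r_pos by simp
  then have "(%j. c) \<longlonglongrightarrow> g 0 0 0 0" using init[OF es(1)] by (simp add: gidx_def)
  then show "g 0 0 0 0 = c" by (rule LIMSEQ_unique[OF _ tendsto_const])
  fix X Y assume XY: "X : {0..r}" "Y : {0..r}"
  show "g 1 0 X Y = fx X Y (g 0 0 X Y)"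
  proof (rule eq_by_limit[OF jet_cont[OF g] cx[OF jet_cont[OF g]] _ XY])
   fix X Y assume *: "0 <= X" "X < r" "0 <= Y" "Y < r"
   show "g 1 0 X Y = fx X Y (g 0 0 X Y)" by (rule LIMSEQ_unique[OF l1[OF *] lx[OF es * l0[OF *]]])
  qed
  show "g 0 1 X Y = fy X Y (g 0 0 X Y)"
  proof (rule eq_by_limit[OF jet_cont[OF g] cy[OF jet_cont[OF g]] _ XY])
   fix X Y assume *: "0 <= X" "X < r" "0 <= Y" "Y < r"
   show "g 0 1 X Y = fy X Y (g 0 0 X Y)" by (rule LIMSEQ_unique[OF l2[OF *] ly[OF es * l0[OF *]]])
  qed
  show "g 0 0 X Y : S"
  proof (rule closed_by_limit[OF jet_cont[OF g] S(1) _ XY])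
   fix X Y assume *: "0 <= X" "X < r" "0 <= Y" "Y < r"
   have "\<forall>\<^sub>F j in sequentially. u (es j) i (gidx (es j) X) (gidx (es j) Y) : S"
    using tidx_eventually[OF es *(1,2), of 0] tidx_eventually[OF es *(3,4), of 0]
    by eventually_elim (use S(2)[OF es(1)] in simp)
   then show "g 0 0 X Y : S" by (rule Lim_in_closed_set[OF S(1) _ sequentially_bot l0[OF *]])
  qed
 qed
qed

lemma eventually_idx:
 assumes "!!n. es n : E" "es \<longlonglongrightarrow> 0" "0 <= X" "X < r" "0 <= Y" "Y < r"
 shows "\<forall>\<^sub>F j in sequentially. gidx (es j) X + a <= N (es j) & gidx (es j) Y + b <= N (es j)"
 using tidx_eventually[OF assms(1-4), of a] tidx_eventually[OF assms(1,2,5,6), of b] by eventually_elim simp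

theorem Goursat_limit:
 assumes ds: "dsys A b" and i: "i : I"
  and a: "!!k. bd k 1 0 (al A)" and b: "!!k. bd k 0 1 b"
  and a0: "nearO 1 0 (%e i x y. al A e i x 0) (%i X Y. v0 i X)"
  and b0: "nearO 0 1 (%e i x y. b e i 0 y) (%i X Y. z0 i Y)"
  and cont: "continuous_on {0..r} (v0 i)" "continuous_on {0..r} (z0 i)"
 shows "EX g h. jet g & jet h & (ALL X:{0..r}. g 0 0 X 0 = v0 i X) & (ALL Y:{0..r}. h 0 0 0 Y = z0 i Y) &
  (ALL X:{0..r}. ALL Y:{0..r}. norm (h 0 0 X Y) = 1 & Re (g 0 0 X Y) = 0 &
   g 0 1 X Y = (1 / 4) * (h 0 0 X Y - cnj (h 0 0 X Y)) & h 1 0 X Y = h 0 0 X Y * (2 * g 0 0 X Y))"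
proof -
 \<comment> \<open>Pairing the unknowns yields a single subsequence along which both
   converge.\<close>
 define u where "u = (%e i x y. (al A e i x y, b e i x y))"
 have a1: "bd k 1 1 (al A)" and b1: "bd k 1 1 b" for k using a[of k] b[of k] by (auto intro: bd_mono)
 have "bd k 1 1 (%e i x y. (al A e i x y, 0) + (0, b e i x y))" for k
  by (intro bd_add bd_linear[OF bounded_linear_Pair[OF bounded_linear_ident bounded_linear_zero]]
     bd_linear[OF bounded_linear_Pair[OF bounded_linear_zero bounded_linear_ident]] a1 b1)
 then have u: "bd k 1 1 u" for k by (simp add: u_def)
 obtain es w where H: "(ALL n. es n : E) & es \<longlonglongrightarrow> 0 & jet w &
  (ALL m n X Y. 0 <= X --> X < r --> 0 <= Y --> Y < r -->
    (along es i X Y (D m n u)) \<longlonglongrightarrow> w m n X Y)"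
  using limit_exists[OF u i] by (elim exE) (rule that)
 then have es: "!!n. es n : E" "es \<longlonglongrightarrow> 0" and w: "jet w" by blast+
 define g where "g = (%m n X Y. fst (w m n X Y))"
 define h where "h = (%m n X Y. snd (w m n X Y))"
 have cj: "jet (%m n X Y. f (w m n X Y))" if "bounded_linear f" for f :: "complex \<times> complex => complex"
  unfolding jet_def
 proof (intro conjI allI ballI)
  fix m n
  show "continuous_on ({0..r} \<times> {0..r}) (%(x, y). f (w m n x y))"
   using bounded_linear.continuous_on[OF that jet_cont[OF w, of m n]] by (simp add: case_prod_beta)
  fix X Y assume "X : {0..r}" "Y : {0..r}"
  then show "((%s. f (w m n s Y)) has_vector_derivative f (w (Suc m) n X Y)) (at X within {0..r})"
   "((%s. f (w m n X s)) has_vector_derivative f (w m (Suc n) X Y)) (at Y within {0..r})"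
   using w by (auto simp: jet_def intro!: has_vector_derivative_linear[OF that])
 qed
 have jg: "jet g" and jh: "jet h" unfolding g_def h_def by (rule cj[OF bounded_linear_fst], rule cj[OF bounded_linear_snd])
 have lim: "(along es i X Y (D m n u)) \<longlonglongrightarrow> w m n X Y"
  if "0 <= X" "X < r" "0 <= Y" "Y < r" for m n X Y using H that by blast
 have la: "(along es i X Y (al A)) \<longlonglongrightarrow> g 0 0 X Y"
  and lb: "(along es i X Y b) \<longlonglongrightarrow> h 0 0 X Y"
  and lay: "(%j. dy (al A) (es j) i (gidx (es j) X) (gidx (es j) Y)) \<longlonglongrightarrow> g 0 1 X Y"
  and lbx: "(along es i X Y (dx b)) \<longlonglongrightarrow> h 1 0 X Y"
  if XY: "0 <= X" "X < r" "0 <= Y" "Y < r" for X Y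
  using tendsto_fst[OF lim[OF XY, of 0 0]] tendsto_snd[OF lim[OF XY, of 0 0]] tendsto_fst[OF lim[OF XY, of 0 1]] tendsto_snd[OF lim[OF XY, of 1 0]]
  by (simp_all add: u_def g_def h_def dx_def dy_def)
 have lA: "(along es i X Y A) \<longlonglongrightarrow> 1" if XY: "0 <= X" "X < r" "0 <= Y" "Y < r" for X Y
 proof -
  have "(%j. 1 + of_real (es j) * al A (es j) i (gidx (es j) X) (gidx (es j) Y)) \<longlonglongrightarrow> 1 + of_real 0 * g 0 0 X Y"
   by (intro tendsto_intros la[OF XY] es)
  then show ?thesis using al_A[OF es(1), of A] by simp
 qed
 have lf: "(along es i X Y (fdy A b)) \<longlonglongrightarrow> (1 / 4) * (h 0 0 X Y - cnj (h 0 0 X Y))"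
  if XY: "0 <= X" "X < r" "0 <= Y" "Y < r" for X Y
 proof -
  have "(along es i X Y (fdy A b)) \<longlonglongrightarrow>
   (1 / 4) * (1 * ((h 0 0 X Y * 1 - cnj (h 0 0 X Y * 1)) * inverse (1 - of_real (0\<^sup>2 / 4) * (h 0 0 X Y * 1))))"
   unfolding fdy_def inv1_def by (intro tendsto_intros lA[OF XY] lb[OF XY] es) simp_all
  then show ?thesis by simp
 qed
 have eqg: "g 0 1 X Y = (1 / 4) * (h 0 0 X Y - cnj (h 0 0 X Y))" if "0 <= X" "X < r" "0 <= Y" "Y < r" for X Y
 proof (rule LIMSEQ_unique[OF lay[OF that]])
  have "\<forall>\<^sub>F j in sequentially. fdy A b (es j) i (gidx (es j) X) (gidx (es j) Y) = dy (al A) (es j) i (gidx (es j) X) (gidx (es j) Y)"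
   using eventually_idx[OF es that, of 1 1] by eventually_elim (use dsys_dy[OF ds es(1) i] in auto)
  then show "(%j. dy (al A) (es j) i (gidx (es j) X) (gidx (es j) Y)) \<longlonglongrightarrow> (1 / 4) * (h 0 0 X Y - cnj (h 0 0 X Y))"
   by (rule Lim_transform_eventually[OF lf[OF that]])
 qed
 have eqh: "h 1 0 X Y = h 0 0 X Y * (2 * g 0 0 X Y)" if XY: "0 <= X" "X < r" "0 <= Y" "Y < r" for X Y
 proof (rule LIMSEQ_unique[OF lbx[OF that]])
  have "(%j. b (es j) i (gidx (es j) X) (gidx (es j) Y) * gdx A b (es j) i (gidx (es j) X) (gidx (es j) Y)) \<longlonglongrightarrow>
    h 0 0 X Y * (2 * g 0 0 X Y + (of_real 0 * g 0 0 X Y) * g 0 0 X Y + 1 * (of_real 0 * ((1 / 4) * (h 0 0 X Y - cnj (h 0 0 X Y)))))"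
   unfolding gdx_def by (intro tendsto_intros la[OF XY] lA[OF XY] lb[OF XY] lf[OF XY] es)
  then have l: "(%j. b (es j) i (gidx (es j) X) (gidx (es j) Y) * gdx A b (es j) i (gidx (es j) X) (gidx (es j) Y)) \<longlonglongrightarrow> h 0 0 X Y * (2 * g 0 0 X Y)" by simp
  have "\<forall>\<^sub>F j in sequentially. b (es j) i (gidx (es j) X) (gidx (es j) Y) * gdx A b (es j) i (gidx (es j) X) (gidx (es j) Y) = dx b (es j) i (gidx (es j) X) (gidx (es j) Y)"
   using eventually_idx[OF es that, of 1 1] by eventually_elim (use dsys_dx[OF ds es(1) i] in auto)
  then show "(along es i X Y (dx b)) \<longlonglongrightarrow> h 0 0 X Y * (2 * g 0 0 X Y)"
   by (rule Lim_transform_eventually[OF l])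
 qed
 have uA: "unimod 1 0 A" and ub: "unimod 0 1 b" using ds by (simp_all add: dsys_def)
 have nh: "norm (h 0 0 X Y) = 1" if "0 <= X" "X < r" "0 <= Y" "Y < r" for X Y
 proof (rule LIMSEQ_unique[OF tendsto_norm[OF lb[OF that]]])
  have "\<forall>\<^sub>F j in sequentially. 1 = norm (b (es j) i (gidx (es j) X) (gidx (es j) Y))"
   using eventually_idx[OF es that, of 0 1] by eventually_elim (use unimodD[OF ub es(1) i] in auto)
  then show "(%j. norm (b (es j) i (gidx (es j) X) (gidx (es j) Y))) \<longlonglongrightarrow> 1"
   by (rule Lim_transform_eventually[OF tendsto_const])
 qed
 have rg: "Re (g 0 0 X Y) = 0" if XY: "0 <= X" "X < r" "0 <= Y" "Y < r" for X Y
 proof (rule LIMSEQ_unique[OF tendsto_Re[OF la[OF that]]])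
  \<comment> \<open>\<open>1 + e \<alpha>\<close> is unimodular, hence \<open>2 Re \<alpha> = - e norm \<alpha> ^ 2\<close>\<close>
  have "(%j. - es j * (norm (al A (es j) i (gidx (es j) X) (gidx (es j) Y)))\<^sup>2 / 2) \<longlonglongrightarrow> - 0 * (norm (g 0 0 X Y))\<^sup>2 / 2"
   by (intro tendsto_intros la[OF XY] es) simp
  moreover have "\<forall>\<^sub>F j in sequentially. - es j * (norm (al A (es j) i (gidx (es j) X) (gidx (es j) Y)))\<^sup>2 / 2 = Re (al A (es j) i (gidx (es j) X) (gidx (es j) Y))"
   using eventually_idx[OF es that, of 1 0]
  proof eventually_elim
   case (elim j)
   let ?a = "al A (es j) i (gidx (es j) X) (gidx (es j) Y)"
   have "norm (1 + of_real (es j) * ?a) = 1" using unimodD[OF uA es(1) i] elim al_A[OF es(1), of A] by (metis add.right_neutral)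
   then have "(1 + es j * Re ?a)\<^sup>2 + (es j * Im ?a)\<^sup>2 = 1" by (simp add: cmod_def)
   then have "es j * (2 * Re ?a + es j * ((Re ?a)\<^sup>2 + (Im ?a)\<^sup>2)) = 0" by (simp add: power2_eq_square algebra_simps)
   then have "2 * Re ?a + es j * (norm ?a)\<^sup>2 = 0" using E_bounds(4)[OF es(1)] by (simp add: cmod_power2)
   then show ?case by simp
  qed
  ultimately show "(%j. Re (al A (es j) i (gidx (es j) X) (gidx (es j) Y))) \<longlonglongrightarrow> 0"
   by (simp add: Lim_transform_eventually)
 qed
 have ch: "continuous_on ({0..r} \<times> {0..r}) (%z. h m n (fst z) (snd z))" and cg: "continuous_on ({0..r} \<times> {0..r}) (%z. g m n (fst z) (snd z))" for m n
  using jet_cont[OF jg] jet_cont[OF jh] by (simp_all add: case_prod_beta)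
 have g0: "g 0 0 X 0 = v0 i X" if X: "X : {0..r}" for X
 proof (rule eq_by_limit[where v = "%X Y. g 0 0 X 0" and v' = "%X Y. v0 i X" and Y = 0])
  show "continuous_on ({0..r} \<times> {0..r}) (%(x, y). g 0 0 x 0)"
   unfolding case_prod_beta using r_pos
   by (intro continuous_on_compose2[OF cg[of 0 0], of _ "%z. (fst z, 0)", simplified] continuous_intros) auto
  show "continuous_on ({0..r} \<times> {0..r}) (%(x, y). v0 i x)"
   unfolding case_prod_beta by (intro continuous_on_compose2[OF cont(1)] continuous_intros) auto
  fix X Y assume *: "0 <= X" "X < r" "0 <= Y" "Y < r"
  have "(%j. al A (es j) i (gidx (es j) X) 0) \<longlonglongrightarrow> v0 i X"
   by (rule near_tendsto[OF es i a0 _ *(1,2) order_refl r_pos, simplified])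
    (unfold case_prod_beta, intro continuous_on_compose2[OF cont(1)] continuous_intros, auto)
  moreover have "(%j. al A (es j) i (gidx (es j) X) 0) \<longlonglongrightarrow> g 0 0 X 0"
   using la[OF *(1,2) order_refl r_pos] by (simp add: gidx_def)
  ultimately show "g 0 0 X 0 = v0 i X" by (rule LIMSEQ_unique[rotated])
 qed (use X r_pos in auto)
 have h0: "h 0 0 0 Y = z0 i Y" if Y: "Y : {0..r}" for Y
 proof (rule eq_by_limit[where v = "%X Y. h 0 0 0 Y" and v' = "%X Y. z0 i Y" and X = 0])
  show "continuous_on ({0..r} \<times> {0..r}) (%(x, y). h 0 0 0 y)"
   unfolding case_prod_beta using r_pos
   by (intro continuous_on_compose2[OF ch[of 0 0], of _ "%z. (0, snd z)", simplified] continuous_intros) auto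
  show "continuous_on ({0..r} \<times> {0..r}) (%(x, y). z0 i y)"
   unfolding case_prod_beta by (intro continuous_on_compose2[OF cont(2)] continuous_intros) auto
  fix X Y assume *: "0 <= X" "X < r" "0 <= Y" "Y < r"
  have "(%j. b (es j) i 0 (gidx (es j) Y)) \<longlonglongrightarrow> z0 i Y"
   by (rule near_tendsto[OF es i b0 _ order_refl r_pos *(3,4), simplified])
    (unfold case_prod_beta, intro continuous_on_compose2[OF cont(2)] continuous_intros, auto)
  moreover have "(%j. b (es j) i 0 (gidx (es j) Y)) \<longlonglongrightarrow> h 0 0 0 Y"
   using lb[OF order_refl r_pos *(3,4)] by (simp add: gidx_def)
  ultimately show "h 0 0 0 Y = z0 i Y" by (rule LIMSEQ_unique[rotated])
 qed (use Y r_pos in auto)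
 show ?thesis
 proof (rule exI[of _ g], rule exI[of _ h], intro conjI ballI jg jh g0 h0)
  fix X Y assume XY: "X : {0..r}" "Y : {0..r}"
  show "norm (h 0 0 X Y) = 1"
   by (rule eq_by_limit[where v = "%X Y. norm (h 0 0 X Y)" and v' = "%X Y. 1", OF _ _ nh XY])
    (unfold case_prod_beta, (intro continuous_intros ch)+)
  show "Re (g 0 0 X Y) = 0"
   by (rule eq_by_limit[where v = "%X Y. Re (g 0 0 X Y)" and v' = "%X Y. 0", OF _ _ rg XY])
    (unfold case_prod_beta, (intro continuous_intros cg)+)
  show "g 0 1 X Y = (1 / 4) * (h 0 0 X Y - cnj (h 0 0 X Y))"
   by (rule eq_by_limit[where v = "%X Y. g 0 1 X Y" and v' = "%X Y. (1 / 4) * (h 0 0 X Y - cnj (h 0 0 X Y))", OF _ _ eqg XY])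
    (unfold case_prod_beta, (intro continuous_intros ch cg)+)
  show "h 1 0 X Y = h 0 0 X Y * (2 * g 0 0 X Y)"
   by (rule eq_by_limit[where v = "%X Y. h 1 0 X Y" and v' = "%X Y. h 0 0 X Y * (2 * g 0 0 X Y)", OF _ _ eqh XY])
    (unfold case_prod_beta, (intro continuous_intros ch cg)+)
 qed
qed

end


section \<open>Differentiability of continuous frames in the spectral parameter\<close>

lemma mat2_minus_mat2: "mat2 p q u v - mat2 p' q' u' v' = mat2 (p - p') (q - q') (u - u') (v - v')"
 and mat2_minus: "- mat2 p q u v = mat2 (- p) (- q) (- u) (- v)"
 and mat2_scale: "c *\<^sub>R mat2 p q u v = mat2 (of_real c * p) (of_real c * q) (of_real c * u) (of_real c * v)"
 by (simp_all add: mat2_def vec_eq_iff forall_2 complex_scaleR)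

lemma U_mat_split: "U_mat a m - U_mat a l = ((m - l) / 2) *\<^sub>R su2_of_vec (hvec 1)" "adj (U_mat a l) = - U_mat a l"
 by (simp_all add: U_mat_def su2_of_vec_def hvec_def mat2_minus_mat2 mat2_minus mat2_scale diff_divide_distrib algebra_simps)

lemma V_mat_split: "V_mat b m - V_mat b l = ((1 / l - 1 / m) / 2) *\<^sub>R su2_of_vec (hvec b)" "adj (V_mat b l) = - V_mat b l"
 by (simp_all add: V_mat_def su2_of_vec_def hvec_def mat2_minus_mat2 mat2_minus mat2_scale mat2_eq_iff complex_eq_iff diff_divide_distrib algebra_simps)

context meshed begin

lemma lip_continuous:
 assumes "lip v" "i : I" shows "cont2 (v i)"
proof -
 obtain C where C: "C > 0" "!!i X Y X' Y'. i : I ==> X : {0..r} ==> Y : {0..r} ==> X' : {0..r} ==> Y' : {0..r} ==>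
   norm (v i X' Y' - v i X Y) <= C * (\<bar>X' - X\<bar> + \<bar>Y' - Y\<bar>)" using assms(1) by (rule lipE) blast
 have "(2 * C)-lipschitz_on ({0..r} \<times> {0..r}) (%(x, y). v i x y)"
 proof (rule lipschitz_onI)
  fix p q :: "real \<times> real" assume pq: "p : {0..r} \<times> {0..r}" "q : {0..r} \<times> {0..r}"
  have "dist (case p of (x, y) => v i x y) (case q of (x, y) => v i x y) <= C * (\<bar>fst p - fst q\<bar> + \<bar>snd p - snd q\<bar>)"
   unfolding case_prod_beta dist_norm by (rule C(2)[OF assms(2)]) (use pq in auto)
  also have "\<dots> <= C * (dist p q + dist p q)"
   using dist_fst_le[of p q] dist_snd_le[of p q] C(1) by (intro mult_left_mono add_mono) (auto simp: dist_real_def)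
  finally show "dist (case p of (x, y) => v i x y) (case q of (x, y) => v i x y) <= 2 * C * dist p q" by simp
 qed (use C in auto)
 then show ?thesis by (rule lipschitz_on_continuous_on)
qed

lemma mean_bound2:
 fixes f :: "real => real => 'a::real_normed_vector"
 assumes "!!X Y. X : {0..r} ==> Y : {0..r} ==> derx f (fx X Y) X Y"
  and "!!X Y. X : {0..r} ==> Y : {0..r} ==> dery f (fy X Y) X Y"
  and "!!X Y. X : {0..r} ==> Y : {0..r} ==> norm (fx X Y) <= B" "!!X Y. X : {0..r} ==> Y : {0..r} ==> norm (fy X Y) <= B"
  and "f 0 0 = 0" and XY: "X : {0..r}" "Y : {0..r}"
 shows "norm (f X Y) <= 2 * r * B"
proof -
 have 0: "0 : {0..r}" using r_pos by simp
 have "norm (f X Y - f X 0) <= B * r"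
  by (rule mean_bound[where f = "%s. f X s" and f' = "fy X"]) (use assms in blast)+
 moreover have "norm (f X 0 - f 0 0) <= B * r"
  by (rule mean_bound[where f = "%s. f s 0" and f' = "%s. fx s 0"]) (use assms 0 in blast)+
 ultimately show ?thesis using norm_triangle_ineq[of "f X Y - f X 0" "f X 0"] assms(5) by (simp add: mult_ac)
qed

text \<open>\<open>frame\<close> gives a solution for each parameter and no regularity in it. For
  \<open>D m = adj (Phi l) ** Phi m\<close> skewness of the connection matrices leaves only their
  difference, so the derivatives of \<open>D m\<close> are rotated horizontal vectors times
  \<open>D m\<close>, with coefficients of order \<open>m - l\<close>. Integrating once shows that
  \<open>D m\<close> is the identity up to order \<open>m - l\<close>; inserting this and
  integrating again identifies the first-order term as \<open>K\<close>, with a quadratic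
  remainder.\<close>

lemma frame_log_deriv:
 assumes fr: "frame r a b Phi" and l: "l ~= 0"
  and b: "!!X Y. X : {0..r} ==> Y : {0..r} ==> norm (b X Y) = 1"
  and Kx: "!!X Y. X : {0..r} ==> Y : {0..r} ==> derx K ((1 / 2) *\<^sub>R Rot (Phi X Y l) (hvec 1)) X Y"
  and Ky: "!!X Y. X : {0..r} ==> Y : {0..r} ==> dery K ((1 / (2 * l\<^sup>2)) *\<^sub>R Rot (Phi X Y l) (hvec (b X Y))) X Y"
  and K0: "K 0 0 = 0" and XY: "X : {0..r}" "Y : {0..r}"
 shows "log_deriv l (Phi X Y) (K X Y)"
proof -
 interpret mm: bounded_bilinear "(**) :: complex^2^2 => complex^2^2 => complex^2^2" by (rule bilinear_matmult)
 interpret su: bounded_linear su2_of_vec by (rule bounded_linear_su2_of_vec)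
 have S: "Phi X Y m : SU2" if "X : {0..r}" "Y : {0..r}" "m ~= 0" for X Y m using fr that by (simp add: frame_def)
 have dx: "((%s. Phi s Y m) has_vector_derivative U_mat (a X Y) m ** Phi X Y m) (at X within {0..r})"
  and dy: "((%s. Phi X s m) has_vector_derivative V_mat (b X Y) m ** Phi X Y m) (at Y within {0..r})"
  if "X : {0..r}" "Y : {0..r}" "m ~= 0" for X Y m using fr that by (simp_all add: frame_def)
 have Phi0: "Phi 0 0 m = mat 1" if "m ~= 0" for m using fr that by (simp add: frame_def)
 obtain Km where Km: "Km > 0" "!!(P :: complex^2^2) (Q :: complex^2^2). norm (P ** Q) <= norm P * norm Q * Km" using mm.pos_bounded by blast
 obtain Ks where Ks: "Ks > 0" "!!w. norm (su2_of_vec w) <= norm w * Ks" using su.pos_bounded by blast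
 define D where "D = (%m X Y. adj (Phi X Y l) ** Phi X Y m)"
 have prod: "((%s. adj (f s) ** g s) has_vector_derivative c *\<^sub>R (su2_of_vec (Rot (f s) w) ** (adj (f s) ** g s))) (at s within T)"
  if f: "(f has_vector_derivative M ** f s) (at s within T)" and g: "(g has_vector_derivative M' ** g s) (at s within T)"
   and M: "M' - M = c *\<^sub>R su2_of_vec w" "adj M = - M" and fs: "f s : SU2"
  for f g :: "real => complex^2^2" and s T M M' c w
 proof -
  have "((%s. adj (f s) ** g s) has_vector_derivative (adj (f s) ** (M' ** g s) + adj (M ** f s) ** g s)) (at s within T)"
   by (intro mm.has_vector_derivative has_vector_derivative_linear[OF bounded_linear_adj] f g)
  moreover have "adj (f s) ** (M' ** g s) + adj (M ** f s) ** g s = adj (f s) ** (M' - M) ** g s"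
   by (simp add: adj_mult M(2) mm.diff_left mm.diff_right mm.minus_left mm.minus_right matrix_mul_assoc)
  moreover have "\<dots> = c *\<^sub>R (su2_of_vec (Rot (f s) w) ** (adj (f s) ** g s))"
  proof -
   have "su2_of_vec (Rot (f s) w) ** (adj (f s) ** g s) = adj (f s) ** su2_of_vec w ** (f s ** adj (f s)) ** g s"
    by (simp add: su2_Rot[OF fs] matrix_mul_assoc)
   then show ?thesis by (simp add: M(1) SU2_mult_adj[OF fs] mm.scaleR_left mm.scaleR_right)
  qed
  ultimately show ?thesis by simp
 qed
 define c where "c = (%m. (1 / l - 1 / m) / 2)"
 let ?Q = "%X Y w. su2_of_vec (Rot (Phi X Y l) (hvec w))"
 let ?dx = "%m X Y. ((m - l) / 2) *\<^sub>R (?Q X Y 1 ** D m X Y)" and ?dy = "%m X Y. c m *\<^sub>R (?Q X Y (b X Y) ** D m X Y)"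
 have Dx: "derx (D m) (?dx m X Y) X Y"
  and Dy: "dery (D m) (?dy m X Y) X Y"
  if "X : {0..r}" "Y : {0..r}" "m ~= 0" for X Y m unfolding D_def c_def
  using prod[OF dx[OF that(1,2) l] dx[OF that] U_mat_split S[OF that(1,2) l]]
   prod[OF dy[OF that(1,2) l] dy[OF that] V_mat_split S[OF that(1,2) l]] by blast+
 define L where "L = \<bar>l\<bar>"
 have L: "L > 0" using l by (simp add: L_def)
 \<comment> \<open>The entry 1/2 serves the x-equation. For \<open>\<bar>m\<bar> >= L / 2\<close>
   the y-coefficient \<open>c m\<close> and its deviation from the linear part are controlled by
   \<open>1 / L\<^sup>2\<close> and \<open>1 / L ^ 3\<close>.\<close>
 define C where "C = max (1 / 2) (max (1 / L\<^sup>2) (1 / L ^ 3))"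
 have C: "C >= 1 / 2" "C >= 1 / L\<^sup>2" "C >= 1 / L ^ 3" "C > 0" by (auto simp: C_def less_max_iff_disj)
 have cb: "\<bar>c m\<bar> <= C * \<bar>m - l\<bar>" "\<bar>c m - (m - l) * (1 / (2 * l\<^sup>2))\<bar> <= C * (m - l)\<^sup>2" if m: "\<bar>m\<bar> >= L / 2" for m
 proof -
  have m0: "m ~= 0" using m L by auto
  have "c m = (m - l) * (1 / (2 * l * m))" using l m0 by (simp add: c_def field_simps)
  then have "\<bar>c m\<bar> = \<bar>m - l\<bar> * (1 / (2 * L * \<bar>m\<bar>))" by (simp add: abs_mult L_def)
  also have "\<dots> <= \<bar>m - l\<bar> * (1 / (2 * L * (L / 2)))" using L m by (intro mult_left_mono divide_left_mono) auto
  also have "\<dots> <= \<bar>m - l\<bar> * C" using C(2) by (intro mult_left_mono) (auto simp: power2_eq_square)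
  finally show "\<bar>c m\<bar> <= C * \<bar>m - l\<bar>" by (simp add: mult.commute)
  have "c m - (m - l) * (1 / (2 * l\<^sup>2)) = - ((m - l)\<^sup>2 * (1 / (2 * l\<^sup>2 * m)))"
   using l m0 by (simp add: c_def field_simps power2_eq_square)
  then have "\<bar>c m - (m - l) * (1 / (2 * l\<^sup>2))\<bar> = (m - l)\<^sup>2 * (1 / (2 * L\<^sup>2 * \<bar>m\<bar>))" by (simp add: abs_mult L_def)
  also have "\<dots> <= (m - l)\<^sup>2 * (1 / (2 * L\<^sup>2 * (L / 2)))" using L m by (intro mult_left_mono divide_left_mono) auto
  also have "\<dots> <= (m - l)\<^sup>2 * C" using C(3) by (intro mult_left_mono) (auto simp: power2_eq_square power3_eq_cube mult_ac)
  finally show "\<bar>c m - (m - l) * (1 / (2 * l\<^sup>2))\<bar> <= C * (m - l)\<^sup>2" by (simp add: mult.commute)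
 qed
 have sx: "norm (?Q X Y w) <= Ks" if "X : {0..r}" "Y : {0..r}" "norm w = 1" for X Y w
  using Ks(2)[of "Rot (Phi X Y l) (hvec w)"] norm_Rot[OF S[OF that(1,2) l]] that(3) by simp
 have adjb: "norm (adj P) <= 4" if "P : SU2" for P
 proof -
  have "adj P : SU2" using that unfolding SU2_iff
   by (elim exE conjE) (simp, metis add.commute complex_cnj_cnj complex_cnj_minus minus_minus minus_mult_minus mult.commute)
  then show ?thesis by (rule norm_SU2)
 qed
 have nD: "norm (D m X Y) <= 16 * Km" if "X : {0..r}" "Y : {0..r}" "m ~= 0" for X Y m
 proof -
  have "norm (D m X Y) <= norm (adj (Phi X Y l)) * norm (Phi X Y m) * Km" unfolding D_def by (rule Km)
  also have "\<dots> <= 4 * 4 * Km" using adjb[OF S[OF that(1,2) l]] norm_SU2[OF S[OF that]] Km(1)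
   by (intro mult_right_mono mult_mono) auto
  finally show ?thesis by simp
 qed
 \<comment> \<open>Constant of the first integration: a path of length at most \<open>2 * r\<close>,
   the coefficient bound \<open>C\<close>, and the norm of the product, where \<open>16 * Km\<close>
   bounds \<open>D m\<close> as a product of two matrices of norm at most 4.\<close>
 define B1 where "B1 = 2 * r * (C * (Ks * (16 * Km) * Km))"
 have D1: "norm (D m X Y - mat 1) <= B1 * \<bar>m - l\<bar>" if XY: "X : {0..r}" "Y : {0..r}" and m: "\<bar>m\<bar> >= L / 2" for X Y m
 proof -
  have m0: "m ~= 0" using m L by auto
  have bnd: "norm (k *\<^sub>R (?Q X Y w ** D m X Y)) <= (C * \<bar>m - l\<bar>) * (Ks * (16 * Km) * Km)"
   if "X : {0..r}" "Y : {0..r}" "norm w = 1" "\<bar>k\<bar> <= C * \<bar>m - l\<bar>" for X Y w k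
  proof -
   have "norm (?Q X Y w ** D m X Y) <= norm (?Q X Y w) * norm (D m X Y) * Km" by (rule Km)
   also have "\<dots> <= Ks * (16 * Km) * Km" using sx[OF that(1-3)] nD[OF that(1,2) m0] Km(1) Ks(1)
    by (intro mult_right_mono mult_mono) auto
   finally show ?thesis using that(4) C(4) unfolding norm_scaleR by (intro mult_mono) auto
  qed
  have "norm (D m X Y - mat 1) <= 2 * r * ((C * \<bar>m - l\<bar>) * (Ks * (16 * Km) * Km))"
  proof (rule mean_bound2[where f = "%X Y. D m X Y - mat 1", OF _ _ _ _ _ XY])
   fix X Y assume XY: "X : {0..r}" "Y : {0..r}"
   show "((%s. D m s Y - mat 1) has_vector_derivative ?dx m X Y) (at X within {0..r})"
    using has_vector_derivative_diff[OF Dx[OF XY m0] has_vector_derivative_const[of "mat 1"]] by simp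
   show "((%s. D m X s - mat 1) has_vector_derivative ?dy m X Y) (at Y within {0..r})"
    using has_vector_derivative_diff[OF Dy[OF XY m0] has_vector_derivative_const[of "mat 1"]] by simp
   have "(1 / 2) * \<bar>m - l\<bar> <= C * \<bar>m - l\<bar>" using C(1) by (intro mult_right_mono) auto
   then show "norm (?dx m X Y) <= (C * \<bar>m - l\<bar>) * (Ks * (16 * Km) * Km)"
    by (intro bnd XY) auto
   show "norm (?dy m X Y) <= (C * \<bar>m - l\<bar>) * (Ks * (16 * Km) * Km)"
    by (intro bnd XY b cb m)
  qed (simp add: D_def Phi0[OF l] Phi0[OF m0], simp add: mat_1_mat2)
  then show ?thesis by (simp add: B1_def mult_ac)
 qed
 \<comment> \<open>Constant of the second integration: the first summand comes from replacing
   \<open>D m\<close> by the identity at the cost \<open>B1\<close>, the second from replacing the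
   coefficient by its linear part.\<close>
 define B2 where "B2 = C * (Ks * B1 * Km) + C * Ks"
 have B1: "B1 >= 0" using C Ks Km r_pos by (simp add: B1_def)
 have E: "norm (D m X Y - mat 1 - (m - l) *\<^sub>R su2_of_vec (K X Y)) <= 2 * r * (B2 * (m - l)\<^sup>2)" if m: "\<bar>m\<bar> >= L / 2" for m
 proof -
  have m0: "m ~= 0" using m L by auto
  have bnd: "norm (k *\<^sub>R (?Q X Y w ** D m X Y) - (m - l) *\<^sub>R su2_of_vec (k' *\<^sub>R Rot (Phi X Y l) (hvec w))) <= B2 * (m - l)\<^sup>2"
   if "X : {0..r}" "Y : {0..r}" "norm w = 1" "\<bar>k\<bar> <= C * \<bar>m - l\<bar>" "\<bar>k - (m - l) * k'\<bar> <= C * (m - l)\<^sup>2" for X Y w k k'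
  proof -
   let ?S = "?Q X Y w"
   have "norm (?S ** (D m X Y - mat 1)) <= norm ?S * norm (D m X Y - mat 1) * Km" by (rule Km)
   also have "\<dots> <= Ks * (B1 * \<bar>m - l\<bar>) * Km" using sx[OF that(1-3)] D1[OF that(1,2) m] Km(1) Ks(1)
    by (intro mult_right_mono mult_mono) auto
   finally have "norm (k *\<^sub>R (?S ** (D m X Y - mat 1))) <= (C * \<bar>m - l\<bar>) * (Ks * (B1 * \<bar>m - l\<bar>) * Km)"
    using that(4) C(4) unfolding norm_scaleR by (intro mult_mono) auto
   also have "\<dots> = C * (Ks * B1 * Km) * (m - l)\<^sup>2" by (simp add: power2_eq_square abs_mult_self_eq)
   finally have 1: "norm (k *\<^sub>R (?S ** (D m X Y - mat 1))) <= C * (Ks * B1 * Km) * (m - l)\<^sup>2" .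
   have 2: "norm ((k - (m - l) * k') *\<^sub>R ?S) <= (C * (m - l)\<^sup>2) * Ks"
    using that(5) sx[OF that(1-3)] C(4) unfolding norm_scaleR by (intro mult_mono) auto
   have "k *\<^sub>R (?S ** D m X Y) - (m - l) *\<^sub>R su2_of_vec (k' *\<^sub>R Rot (Phi X Y l) (hvec w))
    = k *\<^sub>R (?S ** (D m X Y - mat 1)) + (k - (m - l) * k') *\<^sub>R ?S"
    unfolding su.scaleR mm.diff_right by (simp add: algebra_simps)
   then show ?thesis using order_trans[OF norm_triangle_mono[OF 1 2], of "B2 * (m - l)\<^sup>2"] by (simp only:) (simp add: B2_def algebra_simps)
  qed
  show ?thesis
  proof (rule mean_bound2[where f = "%X Y. D m X Y - mat 1 - (m - l) *\<^sub>R su2_of_vec (K X Y)", OF _ _ _ _ _ XY])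
   fix X Y assume XY: "X : {0..r}" "Y : {0..r}"
   show "((%s. D m s Y - mat 1 - (m - l) *\<^sub>R su2_of_vec (K s Y)) has_vector_derivative ?dx m X Y - (m - l) *\<^sub>R su2_of_vec ((1 / 2) *\<^sub>R Rot (Phi X Y l) (hvec 1))) (at X within {0..r})"
    using has_vector_derivative_diff[OF has_vector_derivative_diff[OF Dx[OF XY m0] has_vector_derivative_const[of "mat 1"]]
     has_vector_derivative_linear[OF bounded_linear_compose[OF bounded_linear_scaleR_right[of "m - l"] bounded_linear_su2_of_vec] Kx[OF XY]]] by simp
   show "((%s. D m X s - mat 1 - (m - l) *\<^sub>R su2_of_vec (K X s)) has_vector_derivative ?dy m X Y - (m - l) *\<^sub>R su2_of_vec ((1 / (2 * l\<^sup>2)) *\<^sub>R Rot (Phi X Y l) (hvec (b X Y)))) (at Y within {0..r})"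
    using has_vector_derivative_diff[OF has_vector_derivative_diff[OF Dy[OF XY m0] has_vector_derivative_const[of "mat 1"]]
     has_vector_derivative_linear[OF bounded_linear_compose[OF bounded_linear_scaleR_right[of "m - l"] bounded_linear_su2_of_vec] Ky[OF XY]]] by simp
   have "(1 / 2) * \<bar>m - l\<bar> <= C * \<bar>m - l\<bar>" using C(1) by (intro mult_right_mono) auto
   then show "norm (?dx m X Y - (m - l) *\<^sub>R su2_of_vec ((1 / 2) *\<^sub>R Rot (Phi X Y l) (hvec 1))) <= B2 * (m - l)\<^sup>2"
    using C(4) by (intro bnd XY) auto
   show "norm (?dy m X Y - (m - l) *\<^sub>R su2_of_vec ((1 / (2 * l\<^sup>2)) *\<^sub>R Rot (Phi X Y l) (hvec (b X Y)))) <= B2 * (m - l)\<^sup>2"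
    by (intro bnd XY b cb m)
  qed (simp add: D_def Phi0[OF l] Phi0[OF m0] K0, simp add: mat_1_mat2)
 qed
 have ball: "\<bar>m\<bar> >= L / 2" if "m : ball l (L / 2)" for m using that abs_triangle_ineq2[of l m] unfolding mem_ball dist_real_def L_def by linarith
 have "(Phi X Y has_vector_derivative Phi X Y l ** su2_of_vec (K X Y)) (at l within ball l (L / 2))"
 proof (rule Taylor_imp_derivative[where B = "4 * (2 * r * B2) * Km"])
  fix m assume "m : ball l (L / 2)"
  note m = ball[OF this]
  have "Phi X Y l ** (D m X Y - mat 1 - (m - l) *\<^sub>R su2_of_vec (K X Y)) = (Phi X Y l ** adj (Phi X Y l)) ** Phi X Y m - Phi X Y l - (m - l) *\<^sub>R (Phi X Y l ** su2_of_vec (K X Y))"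
   by (simp add: D_def mm.diff_right mm.scaleR_right matrix_mul_assoc)
  then have "norm (Phi X Y m - Phi X Y l - (m - l) *\<^sub>R (Phi X Y l ** su2_of_vec (K X Y))) = norm (Phi X Y l ** (D m X Y - mat 1 - (m - l) *\<^sub>R su2_of_vec (K X Y)))"
   by (simp add: SU2_mult_adj[OF S[OF XY l]])
  also have "\<dots> <= norm (Phi X Y l) * norm (D m X Y - mat 1 - (m - l) *\<^sub>R su2_of_vec (K X Y)) * Km" by (rule Km)
  also have "\<dots> <= 4 * (2 * r * (B2 * (m - l)\<^sup>2)) * Km" using norm_SU2[OF S[OF XY l]] E[OF m] Km(1)
   by (intro mult_right_mono mult_mono) auto
  finally show "norm (Phi X Y m - Phi X Y l - (m - l) *\<^sub>R (Phi X Y l ** su2_of_vec (K X Y))) <= 4 * (2 * r * B2) * Km * (m - l)\<^sup>2"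
   by (simp add: mult_ac)
 qed
 then have "(Phi X Y has_vector_derivative Phi X Y l ** su2_of_vec (K X Y)) (at l)"
  using at_within_open[of l "ball l (L / 2)"] L by simp
 moreover have "\<forall>\<^sub>F m in nhds l. Phi X Y m : SU2"
  using t1_space_nhds[OF l] by eventually_elim (rule S[OF XY])
 ultimately show ?thesis by (simp add: log_deriv_def)
qed

end

section \<open>Limits of frames, immersions and transformation angles\<close>

context framed begin

lemma frame_limit:
 assumes ds: "dsys A b" and ps: "psys A b G" and a: "!!k. bd k 1 0 (al A)" and b: "!!k. bd k 0 1 b"
  and na: "nearO 1 0 (al A) v" and nb: "nearO 0 1 b z" and lip: "lip v" "lip z" and i: "i : I"
 shows "EX g. jet g & g 0 0 0 0 = mat 1 & (ALL X:{0..r}. ALL Y:{0..r}. g 0 0 X Y : SU2 &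
   g 1 0 X Y = ucf v i X Y ** g 0 0 X Y & g 0 1 X Y = vcf z i X Y ** g 0 0 X Y)"
proof -
 interpret mm: bounded_bilinear "(**) :: complex^2^2 => complex^2^2 => complex^2^2" by (rule bilinear_matmult)
 have we: "!!e i x y. (e::real) <= e" by simp
 have u: "nearO 1 0 (uf A) (ucf v)" by (rule near_uf[OF we na lip(1)])
 have w: "nearO 0 1 (vf b) (vcf z)" by (rule near_vf[OF we nb lip(2)])
 note cu = lip_continuous[OF lip_ucf[OF lip(1)] i] and cv = lip_continuous[OF lip_vcf[OF lip(2)] i]
 show ?thesis
 proof (rule limit_total[where u = G and fx = "%X Y w. ucf v i X Y ** w" and fy = "%X Y w. vcf z i X Y ** w", OF psys_bd[OF ds ps a b] i])
  fix es X Y w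
  assume es: "!!n. es n : E" "es \<longlonglongrightarrow> 0" and XY: "0 <= X" "X < r" "0 <= Y" "Y < r"
   and l: "(along es i X Y G) \<longlonglongrightarrow> w"
  have "\<forall>\<^sub>F j in sequentially. uf A (es j) i (gidx (es j) X) (gidx (es j) Y) ** G (es j) i (gidx (es j) X) (gidx (es j) Y) = dx G (es j) i (gidx (es j) X) (gidx (es j) Y)"
   using eventually_idx[OF es XY, of 1 0] by eventually_elim (use psys_dx[OF ps es(1) i] in simp)
  then show "(along es i X Y (dx G)) \<longlonglongrightarrow> ucf v i X Y ** w"
   by (rule Lim_transform_eventually[OF mm.tendsto[OF near_tendsto[OF es i u cu XY] l]])
  have "\<forall>\<^sub>F j in sequentially. vf b (es j) i (gidx (es j) X) (gidx (es j) Y) ** G (es j) i (gidx (es j) X) (gidx (es j) Y) = dy G (es j) i (gidx (es j) X) (gidx (es j) Y)"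
   using eventually_idx[OF es XY, of 0 1] by eventually_elim (use psys_dy[OF ps es(1) i] in simp)
  then show "(along es i X Y (dy G)) \<longlonglongrightarrow> vcf z i X Y ** w"
   by (rule Lim_transform_eventually[OF mm.tendsto[OF near_tendsto[OF es i w cv XY] l]])
 next
  fix g assume g: "continuous_on ({0..r} \<times> {0..r}) (%(x, y). g x y :: complex^2^2)"
  show "continuous_on ({0..r} \<times> {0..r}) (%(x, y). ucf v i x y ** g x y)" "continuous_on ({0..r} \<times> {0..r}) (%(x, y). vcf z i x y ** g x y)"
   using mm.continuous_on[OF cu g] mm.continuous_on[OF cv g] by (simp_all add: case_prod_beta)
 next
  show "closed SU2" by (rule closed_SU2)
  show "G e i 0 0 = mat 1" if "e : E" for e using ps that i by (simp add: psys_def)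
  show "G e i x y : SU2" if "e : E" "x <= N e" "y <= N e" for e x y using psys_SU2[OF ds ps] that i by simp
 qed
qed

lemma surface_limit:
 assumes ds: "dsys A b" and ps: "psys A b G" and ss: "ssys A b G F" and a: "!!k. bd k 1 0 (al A)" and b: "!!k. bd k 0 1 b"
  and nb: "nearO 0 1 b z" and lip: "lip z" "lip Phi" and nG: "nearO 0 0 G Phi" and i: "i : I"
 shows "EX g. jet g & g 0 0 0 0 = 0 & (ALL X:{0..r}. ALL Y:{0..r}.
   g 1 0 X Y = lam i *\<^sub>R Rot (Phi i X Y) (hvec 1) & g 0 1 X Y = (1 / lam i) *\<^sub>R Rot (Phi i X Y) (hvec (z i X Y)))"
proof -
 have a0: "bdd 1 0 (al A)" using a[of 0] by simp
 note n = ssys_dnear[OF ds ps ss a0 nb lip nG]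
 note c = lip_continuous[OF n(3) i] lip_continuous[OF n(4) i]
 have "EX g. jet g & g 0 0 0 0 = 0 & (ALL X:{0..r}. ALL Y:{0..r}. g 0 0 X Y : UNIV &
   g 1 0 X Y = lam i *\<^sub>R Rot (Phi i X Y) (hvec 1) & g 0 1 X Y = (1 / lam i) *\<^sub>R Rot (Phi i X Y) (hvec (z i X Y)))"
  by (rule limit_total[where u = F and fx = "%X Y w. lam i *\<^sub>R Rot (Phi i X Y) (hvec 1)" and fy = "%X Y w. (1 / lam i) *\<^sub>R Rot (Phi i X Y) (hvec (z i X Y))", OF ssys_bd[OF ds ps ss a b] i])
   (use near_tendsto[OF _ _ i n(1) c(1)] near_tendsto[OF _ _ i n(2) c(2)] c ss i in \<open>auto simp: ssys_def\<close>)
 then show ?thesis by auto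
qed

end

context backlund begin

lemma theta_limit:
 assumes ds: "dsys A b" and bs: "bsys A b t" and a: "!!k. bd k 1 0 (al A)" and b: "!!k. bd k 0 1 b"
  and na: "nearO 1 0 (al A) v" and nb: "nearO 0 1 b z" and lip: "lip v" "lip z" and i: "i : I"
  and t0: "!!e. e : E ==> t e i 0 0 = c"
 shows "EX g. jet g & g 0 0 0 0 = c & (ALL X:{0..r}. ALL Y:{0..r}. norm (g 0 0 X Y) = 1 &
   g 1 0 X Y = g 0 0 X Y * (2 * cnj (v i X Y) + of_real (\<beta> / 2) * (g 0 0 X Y - cnj (g 0 0 X Y))) &
   g 0 1 X Y = g 0 0 X Y * (of_real (1 / (2 * \<beta>)) * (z i X Y * g 0 0 X Y - cnj (z i X Y * g 0 0 X Y))))"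
proof -
 note cv = lip_continuous[OF lip(1) i] and cz = lip_continuous[OF lip(2) i]
 have we: "!!e i x y. (e::real) <= e" by simp
 have nA: "nearO 1 0 A (%i X Y. 1)" using a[of 0] by (intro near_A[OF we]) simp
 have "EX g. jet g & g 0 0 0 0 = c & (ALL X:{0..r}. ALL Y:{0..r}. g 0 0 X Y : sphere 0 1 &
   g 1 0 X Y = g 0 0 X Y * (2 * cnj (v i X Y) + of_real (\<beta> / 2) * (g 0 0 X Y - cnj (g 0 0 X Y))) &
   g 0 1 X Y = g 0 0 X Y * (of_real (1 / (2 * \<beta>)) * (z i X Y * g 0 0 X Y - cnj (z i X Y * g 0 0 X Y))))"
 proof (rule limit_total[where u = t and fx = "%X Y w. w * (2 * cnj (v i X Y) + of_real (\<beta> / 2) * (w - cnj w))"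
   and fy = "%X Y w. w * (of_real (1 / (2 * \<beta>)) * (z i X Y * w - cnj (z i X Y * w)))", OF bsys_bd[OF ds bs a b] i])
  fix es X Y w
  assume es: "!!n. es n : E" "es \<longlonglongrightarrow> 0" and XY: "0 <= X" "X < r" "0 <= Y" "Y < r"
   and l: "(along es i X Y t) \<longlonglongrightarrow> w"
  note la = near_tendsto[OF es i na cv XY] and lb = near_tendsto[OF es i nb cz XY]
  have lA: "(along es i X Y A) \<longlonglongrightarrow> 1"
   using near_tendsto[OF es i nA _ XY] by (simp add: case_prod_beta)
  have lk: "(%j. ka (es j)) \<longlonglongrightarrow> 0" "(%j. mu (es j)) \<longlonglongrightarrow> 0"
   unfolding ka_def mu_def using tendsto_mult_right[OF es(2), of "\<beta> / 2"] tendsto_mult_right[OF es(2), of "1 / (2 * \<beta>)"] by simp_all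
  have "(along es i X Y (tdx A t)) \<longlonglongrightarrow>
   w * ((2 * cnj (v i X Y) + of_real 0 * (cnj (v i X Y) * cnj (v i X Y)) + of_real (\<beta> / 2) * (cnj 1 * (w - cnj w))) * inverse (1 - of_real 0 * (w * cnj 1)))"
   unfolding tdx_def inv1_def by (intro tendsto_intros la lA l es lk) simp_all
  then have l1: "(along es i X Y (tdx A t)) \<longlonglongrightarrow> w * (2 * cnj (v i X Y) + of_real (\<beta> / 2) * (w - cnj w))" by simp
  have "\<forall>\<^sub>F j in sequentially. tdx A t (es j) i (gidx (es j) X) (gidx (es j) Y) = dx t (es j) i (gidx (es j) X) (gidx (es j) Y)"
   using eventually_idx[OF es XY, of 1 0] by eventually_elim (use bsys_dx[OF ds bs es(1) i] in simp)
  then show "(along es i X Y (dx t)) \<longlonglongrightarrow> w * (2 * cnj (v i X Y) + of_real (\<beta> / 2) * (w - cnj w))"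
   by (rule Lim_transform_eventually[OF l1])
  have "(along es i X Y (tdy b t)) \<longlonglongrightarrow>
   w * (of_real (1 / (2 * \<beta>)) * ((z i X Y * w - cnj (z i X Y * w)) * inverse (1 - of_real 0 * (z i X Y * w))))"
   unfolding tdy_def inv1_def by (intro tendsto_intros lb l es lk) simp_all
  then have l2: "(along es i X Y (tdy b t)) \<longlonglongrightarrow> w * (of_real (1 / (2 * \<beta>)) * (z i X Y * w - cnj (z i X Y * w)))" by simp
  have "\<forall>\<^sub>F j in sequentially. tdy b t (es j) i (gidx (es j) X) (gidx (es j) Y) = dy t (es j) i (gidx (es j) X) (gidx (es j) Y)"
   using eventually_idx[OF es XY, of 0 1] by eventually_elim (use bsys_dy[OF ds bs es(1) i] in simp)
  then show "(along es i X Y (dy t)) \<longlonglongrightarrow> w * (of_real (1 / (2 * \<beta>)) * (z i X Y * w - cnj (z i X Y * w)))"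
   by (rule Lim_transform_eventually[OF l2])
 next
  fix g assume g: "continuous_on ({0..r} \<times> {0..r}) (%(x, y). g x y :: complex)"
  note c = g[unfolded case_prod_beta] cv[unfolded case_prod_beta] cz[unfolded case_prod_beta]
  show "continuous_on ({0..r} \<times> {0..r}) (%(x, y). g x y * (2 * cnj (v i x y) + of_real (\<beta> / 2) * (g x y - cnj (g x y))))"
   "continuous_on ({0..r} \<times> {0..r}) (%(x, y). g x y * (of_real (1 / (2 * \<beta>)) * (z i x y * g x y - cnj (z i x y * g x y))))"
   unfolding case_prod_beta by (intro continuous_intros c)+
 next
  show "t e i x y : sphere 0 1" if "e : E" "x <= N e" "y <= N e" for e x y
   using bs unimodD[of 0 0 t e i x y] that i by (simp add: bsys_def)
 qed (use t0 in auto)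
 then show ?thesis by simp
qed

end


section \<open>Solvability and geometry of the discrete equations\<close>

lemma dU_rotm: "dU_mat e a l = rotm (cis (e * a / 2)) 1 (e * l / 2)"
 and dV_rotm: "dV_mat e b l = rotm 1 (- b) (e / (2 * l))"
 and W_rotm: "\<alpha> > 0 ==> W_mat \<alpha> t l = rotm t 1 (l / \<alpha>)"
proof -
 show "dU_mat e a l = rotm (cis (e * a / 2)) 1 (e * l / 2)"
  by (simp add: dU_mat_def rotm_def cis_cnj power_mult_distrib power_divide)
 show "dV_mat e b l = rotm 1 (- b) (e / (2 * l))"
  by (simp add: dV_mat_def rotm_def power_mult_distrib power_divide)
 assume a: "\<alpha> > 0"
 have "sqrt (\<alpha>\<^sup>2 + l\<^sup>2) = \<alpha> * sqrt (1 + (l / \<alpha>)\<^sup>2)"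
 proof -
  have "\<alpha>\<^sup>2 + l\<^sup>2 = \<alpha>\<^sup>2 * (1 + (l / \<alpha>)\<^sup>2)" using a by (simp add: field_simps)
  then show ?thesis using a by (simp add: real_sqrt_mult)
 qed
 then show "W_mat \<alpha> t l = rotm t 1 (l / \<alpha>)"
  using a by (simp add: W_mat_def rotm_def mat2_scale)
qed

lemma Rot_mult: "Q : SU2 ==> P : SU2 ==> Rot (P ** Q) v = Rot Q (Rot P v)"
 by (subst (1 2) Rot_def) (simp add: su2_Rot adj_mult matrix_mul_assoc)

text \<open>The direction of an edge is horizontal with respect to the frames at both of its ends.
  Hence the edge lies in the planes attached to both vertices, which is the reason why a vertex and
  its neighbours are coplanar.\<close>

lemma Rot_rotm_hvec:
 assumes A: "norm A = 1" and B: "norm B = 1" shows "Rot (rotm A B s) (hvec (A * B)) = hvec (cnj A * B)"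
proof -
 define c where "c = 1 / sqrt (1 + s\<^sup>2)"
 have s: "1 + s\<^sup>2 > 0" by (rule add_pos_nonneg) auto
 have c: "c * c * (1 + s * s) = 1" using s by (simp add: c_def power2_eq_square real_sqrt_mult_self)
 then have c': "complex_of_real c * of_real c * (1 + of_real s * of_real s) = 1" by (metis of_real_1 of_real_add of_real_mult)
 have AB: "A * cnj A = 1" "B * cnj B = 1" using A B by (simp_all add: complex_norm_square[symmetric])
 have h: "su2_of_vec (hvec w) = mat2 0 (- \<i> * w) (- \<i> * cnj w) 0" for w
  by (simp add: su2_of_vec_def hvec_def complex_eq_iff)
 have r: "rotm A B s = c *\<^sub>R mat2 A (- \<i> * s * B) (- \<i> * s * cnj B) (cnj A)" by (simp add: rotm_def c_def)
 have e22: "(C * (- (- \<i>) * S * B') * 0 + C * A * (- \<i> * (A' * B'))) * (C * (- \<i> * S * B)) + (C * (- (- \<i>) * S * B') * (- \<i> * (A * B)) + C * A * 0) * (C * A') = 0"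
  for C S A' B' :: complex by (simp add: algebra_simps)
 have "su2_of_vec (Rot (rotm A B s) (hvec (A * B))) = su2_of_vec (hvec (cnj A * B))"
  unfolding su2_Rot[OF rotm_SU2[OF A B]] unfolding h r mat2_scale adj_mat2 mat2_mult mat2_eq_iff
   complex_cnj_mult complex_cnj_complex_of_real complex_cnj_minus complex_cnj_i complex_cnj_cnj
  using AB c' i_squared[unfolded power2_eq_square]
  apply (intro conjI)
    apply algebra
   apply algebra
  subgoal premises using e22[of "of_real c" "of_real s" "cnj B" "cnj A"] e22[of "of_real c" "of_real s" "cnj A" "cnj B"] by (simp add: algebra_simps)
  done
 then show ?thesis using inj_su2_of_vec by (simp add: inj_eq)
qed

lemma coplanar_Rot:
 assumes "!!p. p : S ==> EX w. p = F + Rot G (hvec w)" shows "coplanar S"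
 unfolding coplanar_def
proof (rule exI[of _ F], rule exI[of _ "F + Rot G (hvec 1)"], rule exI[of _ "F + Rot G (hvec \<i>)"], rule subsetI)
 interpret R: bounded_linear "Rot G" by (rule bounded_linear_Rot)
 fix p assume "p : S"
 then obtain w where w: "p = F + Rot G (hvec w)" using assms by blast
 have "hvec w = Re w *\<^sub>R hvec 1 + Im w *\<^sub>R hvec \<i>" by (simp add: hvec_def vec_eq_iff forall_3)
 then have "p = (1 - Re w - Im w) *\<^sub>R F + Re w *\<^sub>R (F + Rot G (hvec 1)) + Im w *\<^sub>R (F + Rot G (hvec \<i>))"
  by (simp add: w R.add R.scaleR algebra_simps)
 moreover have "(1 - Re w - Im w) + Re w + Im w = 1" by simp
 ultimately show "p : affine hull {F, F + Rot G (hvec 1), F + Rot G (hvec \<i>)}"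
  unfolding affine_hull_3 by blast
qed

text \<open>Of the two scalar parameters only the product \<open>s * t\<close> enters the data
  equations. For the discrete frame it equals \<open>e\<^sup>2 / 4\<close> whatever the spectral
  parameter, so one solution of the data equations serves all parameters.\<close>

lemma zero_curvature:
 assumes A: "norm A = 1" and b: "norm b = 1" and A1: "A1 = A * mob (s * t) (b * A)" and b1: "b1 = b * A * A1"
  and k: "0 <= s * t" "s * t < 1"
 shows "rotm 1 (- b1) t ** rotm A 1 s = rotm A1 1 s ** rotm 1 (- b) t"
proof -
 have bA: "norm (b * A) = 1" using A b by (simp add: norm_mult)
 note nz = one_minus_nz[OF bA k]
 have AA: "A * cnj A = 1" "b * cnj b = 1" using cnj_unit A b by auto
 have "norm A1 = 1" using A mob_unit[OF bA k] by (simp add: A1 norm_mult)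
 then have AA1: "A1 * cnj A1 = 1" by (rule cnj_unit)
 have m: "A1 * (1 - of_real (s * t) * (b * A)) = A * (1 - of_real (s * t) * cnj (b * A))"
  using nz by (simp add: A1 mob_def)
 then have 1: "A + of_real (s * t) * b1 = A1 + of_real (s * t) * cnj b"
  unfolding b1 complex_cnj_mult using AA by algebra
 then have 2: "cnj A + of_real (s * t) * cnj b1 = cnj A1 + of_real (s * t) * b"
  by (metis 1 complex_cnj_add complex_cnj_cnj complex_cnj_complex_of_real complex_cnj_mult)
 have 3: "b1 * cnj A = b * A1" "cnj b1 * A = cnj b * cnj A1" unfolding b1 complex_cnj_mult using AA by algebra+
 show ?thesis
  unfolding rotm_def mat2_scale mat2_mult mat2_eq_iff
  using 1 2 3 by (simp add: algebra_simps; intro conjI; algebra)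
qed

context meshed begin

lemma grid_step: "e *. x + e = e *. (Suc x)"
 by (simp add: algebra_simps)

lemma gidx_grid [simp]: "e > 0 ==> gidx e (e *. x) = x"
 by (simp add: gidx_def)

lemma grid_iff: "e : E ==> X : grid e r \<longleftrightarrow> (EX x. X = e *. x & x <= N e)"
proof
 assume e: "e : E"
 show "EX x. X = e *. x & x <= N e" if "X : grid e r"
  using grid_cases[OF e, of X 0] that by auto
 show "X : grid e r" if "EX x. X = e *. x & x <= N e"
  using grid_mem[OF e, of _ 0] that by auto
qed

lemma grid1_iff: "e : E ==> X : grid e (r - e) \<longleftrightarrow> (EX x. X = e *. x & x + 1 <= N e)"
proof
 assume e: "e : E"
 show "EX x. X = e *. x & x + 1 <= N e" if "X : grid e (r - e)"
  using grid_cases[OF e, of X 1] that by auto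
 show "X : grid e (r - e)" if "EX x. X = e *. x & x + 1 <= N e"
  using grid_mem[OF e, of _ 1] that by auto
qed

lemma grid_all: "e : E ==> (ALL X:grid e r. P X) \<longleftrightarrow> (ALL x. x <= N e --> P (e *. x))"
 and grid1_all: "e : E ==> (ALL X:grid e (r - e). P X) \<longleftrightarrow> (ALL x. x + 1 <= N e --> P (e *. x))"
 unfolding Ball_def by (simp_all only: grid_iff grid1_iff) blast+

definition upd :: "real => real => complex => real" where
 "upd e a b = a + 2 / e * Im (Ln (mob (e\<^sup>2 / 4) (b * cis (e * a / 2))))"

text \<open>The logarithm of a unimodular number is imaginary, so the complex equation amounts to a
  real one and determines the next value of \<open>a\<close> uniquely; after \<open>cis\<close> the
  choice of branch is invisible.\<close>

lemma upd_unit: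
 fixes e a a' :: real
 assumes e: "e : E" and b: "norm b = 1"
 shows "complex_of_real ((a' - a) / e) = 2 / (\<i> * (complex_of_real e)\<^sup>2) * Ln ((1 - (complex_of_real e)\<^sup>2 / 4 * cnj (b * cis (e * a / 2))) / (1 - (complex_of_real e)\<^sup>2 / 4 * (b * cis (e * a / 2)))) \<longleftrightarrow> a' = upd e a b"
  and "cis (e * upd e a b / 2) = cis (e * a / 2) * mob (e\<^sup>2 / 4) (b * cis (e * a / 2))"
proof -
 let ?z = "b * cis (e * a / 2)"
 have e0: "e > 0" using E_bounds e by auto
 have "norm ?z = 1" using b by (simp add: norm_mult)
 then have u: "norm (mob (e\<^sup>2 / 4) ?z) = 1" by (rule mob_unit[OF _ kap_bounds(1,3)[OF e]])
 define theta where "theta = Im (Ln (mob (e\<^sup>2 / 4) ?z))"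
 have Ln: "Ln (mob (e\<^sup>2 / 4) ?z) = \<i> * of_real theta" unfolding theta_def by (rule Ln_unit[OF u])
 have up: "upd e a b = a + 2 / e * theta" by (simp add: upd_def theta_def)
 have m: "(1 - (complex_of_real e)\<^sup>2 / 4 * cnj ?z) / (1 - (complex_of_real e)\<^sup>2 / 4 * ?z) = mob (e\<^sup>2 / 4) ?z" by (simp add: mob_def)
 have "2 / (\<i> * (complex_of_real e)\<^sup>2) * (\<i> * of_real theta) = complex_of_real (2 / e\<^sup>2 * theta)" by simp
 then have "complex_of_real ((a' - a) / e) = 2 / (\<i> * (complex_of_real e)\<^sup>2) * (\<i> * of_real theta) \<longleftrightarrow> (a' - a) / e = 2 / e\<^sup>2 * theta"
  by (simp only: of_real_eq_iff)
 also have "\<dots> \<longleftrightarrow> a' = a + 2 / e * theta"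
 proof
  assume "(a' - a) / e = 2 / e\<^sup>2 * theta"
  then have "(a' - a) / e * e = 2 / e\<^sup>2 * theta * e" by simp
  then show "a' = a + 2 / e * theta" using e0 by (simp add: power2_eq_square)
 qed (use e0 in \<open>simp add: power2_eq_square\<close>)
 finally show "complex_of_real ((a' - a) / e) = 2 / (\<i> * (complex_of_real e)\<^sup>2) * Ln ((1 - (complex_of_real e)\<^sup>2 / 4 * cnj ?z) / (1 - (complex_of_real e)\<^sup>2 / 4 * ?z)) \<longleftrightarrow> a' = upd e a b"
  unfolding m Ln up .
 have "e * upd e a b / 2 = e * a / 2 + theta" using e0 by (simp add: up field_simps)
 then show "cis (e * upd e a b / 2) = cis (e * a / 2) * mob (e\<^sup>2 / 4) ?z" by (simp only: cis_mult[symmetric] theta_def cis_Ln_unit[OF u])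
qed

lemma discrete_data_iff:
 assumes e: "e : E"
 shows "discrete_data e r a b \<longleftrightarrow>
  (ALL x y. x <= N e --> y + 1 <= N e --> norm (b (e *. x) (e *. y)) = 1) &
  (ALL x y. x + 1 <= N e --> y + 1 <= N e -->
    a (e *. x) (e *. (Suc y)) = upd e (a (e *. x) (e *. y)) (b (e *. x) (e *. y)) &
    b (e *. (Suc x)) (e *. y) = b (e *. x) (e *. y) * cis (e * (a (e *. x) (e *. y) + a (e *. x) (e *. (Suc y))) / 2))"
proof -
 have e0: "e > 0" using E_bounds e by auto
 have *: "complex_of_real (dqy e a (e *. x) (e *. y)) = 2 / (\<i> * (complex_of_real e)\<^sup>2) * Ln ((1 - (complex_of_real e)\<^sup>2 / 4 * cnj (b (e *. x) (e *. y) * cis (e * a (e *. x) (e *. y) / 2)))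
               / (1 - (complex_of_real e)\<^sup>2 / 4 * (b (e *. x) (e *. y) * cis (e * a (e *. x) (e *. y) / 2)))) &
    b (e *. x + e) (e *. y) = b (e *. x) (e *. y) * cis (e * (a (e *. x) (e *. y) + e / 2 * dqy e a (e *. x) (e *. y)))
   \<longleftrightarrow> a (e *. x) (e *. (Suc y)) = upd e (a (e *. x) (e *. y)) (b (e *. x) (e *. y)) &
    b (e *. (Suc x)) (e *. y) = b (e *. x) (e *. y) * cis (e * (a (e *. x) (e *. y) + a (e *. x) (e *. (Suc y))) / 2)"
  if "norm (b (e *. x) (e *. y)) = 1" for x y
 proof -
  have d: "dqy e a (e *. x) (e *. y) = (a (e *. x) (e *. (Suc y)) - a (e *. x) (e *. y)) / e"
   unfolding dqy_def grid_step by (simp add: field_simps)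
  have c: "e * (a1 + e / 2 * ((a2 - a1) / e)) = e * (a1 + a2) / 2" for a1 a2 using e0 by (simp add: field_simps)
  show ?thesis unfolding d c upd_unit(1)[OF e that] grid_step ..
 qed
 \<comment> \<open>The reformulation of the equations is valid only where \<open>b\<close> is
   unimodular; the first conjunct supplies this on a larger index set.\<close>
 have key: "(ALL x. P x --> (ALL y. Q y --> n x y)) & (ALL x. P' x --> (ALL y. Q y --> S x y)) \<longleftrightarrow> (ALL x y. P x --> Q y --> n x y) & (ALL x y. P' x --> Q y --> S' x y)"
  if "!!x. P' x ==> P x" "!!x y. n x y ==> S x y = S' x y" for P P' Q and n S S' :: "nat => nat => bool"
  using that by blast
 show ?thesis
  unfolding discrete_data_def grid_all[OF e] grid1_all[OF e]
  by (rule key, simp, rule *)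
qed

lemma discrete_frame_iff:
 assumes e: "e : E"
 shows "discrete_frame e r a b Psi \<longleftrightarrow> (ALL l. l ~= 0 --> Psi 0 0 l = mat 1 &
  (ALL x y. x + 1 <= N e --> y <= N e --> Psi (e *. (Suc x)) (e *. y) l = rotm (cis (e * a (e *. x) (e *. y) / 2)) 1 (e * l / 2) ** Psi (e *. x) (e *. y) l) &
  (ALL x y. x <= N e --> y + 1 <= N e --> Psi (e *. x) (e *. (Suc y)) l = rotm 1 (- b (e *. x) (e *. y)) (e / (2 * l)) ** Psi (e *. x) (e *. y) l))"
 unfolding discrete_frame_def grid_all[OF e] grid1_all[OF e] grid_step dU_rotm dV_rotm by blast

lemma discrete_data_exists:
 assumes e: "e : E" and b0: "ALL y:{0..r}. norm (b0 y) = 1"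
 shows "EX a b. discrete_data e r a b & discrete_boundary e r a0 b0 a b"
proof -
 have e0: "e > 0" using E_bounds e by auto
 \<comment> \<open>A nested recursion: given the column of \<open>b\<close> at \<open>x\<close>,
   \<open>ac\<close> fills the column of \<open>a\<close> upwards from the bottom edge; adjacent
   values of it then give the column of \<open>b\<close> at \<open>x + 1\<close>.\<close>
 define ac where "ac = (%x bc. rec_nat (a0 (e *. x)) (%y s. upd e s (bc y)))"
 define bc where "bc = rec_nat (%y. b0 (e *. y)) (%x c y. c y * cis (e * (ac x c y + ac x c (Suc y)) / 2))"
 define a where "a = (%X Y. ac (gidx e X) (bc (gidx e X)) (gidx e Y))"
 define b where "b = (%X Y. bc (gidx e X) (gidx e Y))"
 have a: "a (e *. x) (e *. y) = ac x (bc x) y" and b: "b (e *. x) (e *. y) = bc x y" for x y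
  unfolding a_def b_def gidx_grid[OF e0] by simp_all
 have ac: "ac x c 0 = a0 (e *. x)" "ac x c (Suc y) = upd e (ac x c y) (c y)" for x c y by (simp_all add: ac_def)
 have bc: "bc 0 y = b0 (e *. y)" "bc (Suc x) y = bc x y * cis (e * (ac x (bc x) y + ac x (bc x) (Suc y)) / 2)" for x y by (simp_all add: bc_def)
 have n: "norm (bc x y) = 1" if "y + 1 <= N e" for x y
  using b0 grid_in[OF e that] by (induction x) (auto simp: bc norm_mult)
 show ?thesis
 proof (rule exI[of _ a], rule exI[of _ b], rule conjI)
  show "discrete_data e r a b"
   unfolding discrete_data_iff[OF e] a b using n by (simp add: ac bc del: of_nat_Suc)
  have "a (e *. x) 0 = a0 (e *. x)" "b 0 (e *. y) = b0 (e *. y)" for x y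
   using a[of x 0] b[of 0 y] ac(1) bc(1) by simp_all
  then show "discrete_boundary e r a0 b0 a b"
   unfolding discrete_boundary_def grid1_all[OF e] by blast
 qed
qed

lemma discrete_data_unique:
 assumes e: "e : E" and d: "discrete_data e r a b" "discrete_boundary e r a0 b0 a b" and d': "discrete_data e r a' b'" "discrete_boundary e r a0 b0 a' b'"
 shows "(x + 1 <= N e --> y <= N e --> a (e *. x) (e *. y) = a' (e *. x) (e *. y)) &
  (x <= N e --> y + 1 <= N e --> b (e *. x) (e *. y) = b' (e *. x) (e *. y))"
proof -
 note dd = d(1)[unfolded discrete_data_iff[OF e]] d'(1)[unfolded discrete_data_iff[OF e]]
 note bb = d(2)[unfolded discrete_boundary_def grid1_all[OF e]] d'(2)[unfolded discrete_boundary_def grid1_all[OF e]]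
 have A: "a (e *. x) (e *. y) = a' (e *. x) (e *. y)"
  if x: "x + 1 <= N e" and b: "!!y. y + 1 <= N e ==> b (e *. x) (e *. y) = b' (e *. x) (e *. y)" and y: "y <= N e" for x y
  using y
 proof (induction y)
  case 0 then show ?case using bb x by simp
 next
  case (Suc y)
  then show ?case using dd x b[of y] by simp
 qed
 have B: "b (e *. x) (e *. y) = b' (e *. x) (e *. y)" if "x <= N e" "y + 1 <= N e" for x y
  using that
 proof (induction x arbitrary: y)
  case 0 then show ?case using bb by simp
 next
  case (Suc x)
  have x: "x + 1 <= N e" using Suc by simp
  have "a (e *. x) (e *. y) = a' (e *. x) (e *. y)" "a (e *. x) (e *. (Suc y)) = a' (e *. x) (e *. (Suc y))"
   using Suc by (intro A x; simp)+
  then show ?case using dd x Suc(1)[of y] Suc(2,3) by simp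
 qed
 show ?thesis using A B by auto
qed

lemma discrete_frame_exists:
 assumes e: "e : E" and d: "discrete_data e r a b"
 shows "EX Psi. discrete_frame e r a b Psi"
proof -
 have e0: "e > 0" using E_bounds e by auto
 note dd = d[unfolded discrete_data_iff[OF e]]
 let ?A = "%x y. cis (e * a (e *. x) (e *. y) / 2)" let ?b = "%x y. b (e *. x) (e *. y)"
 have "EX z. z 0 0 = mat 1 & (ALL x<=N e. ALL y<=N e. True) &
   (ALL x<N e. ALL y<=N e. z (Suc x) y = rotm (?A x y) 1 (e * l / 2) ** z x y) & (ALL x<=N e. ALL y<N e. z x (Suc y) = rotm 1 (- ?b x y) (e / (2 * l)) ** z x y)" if l: "l ~= 0" for l
 proof (rule grid_system)
  fix x y and s :: "complex^2^2" assume xy: "x < N e" "y < N e"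
  have nb: "norm (?b x y) = 1" using dd xy by simp
  have st: "e * l / 2 * (e / (2 * l)) = e\<^sup>2 / 4" using l by (simp add: power2_eq_square)
  have A1: "?A x (Suc y) = ?A x y * mob (e * l / 2 * (e / (2 * l))) (?b x y * ?A x y)"
   unfolding st using upd_unit(2)[OF e nb] dd xy by (simp del: of_nat_Suc)
  have c: "cis (e * (u + v) / 2) = cis (e * u / 2) * cis (e * v / 2)" for u v
   by (simp add: cis_mult distrib_left add_divide_distrib)
  have b1: "?b (Suc x) y = ?b x y * ?A x y * ?A x (Suc y)"
   using dd[THEN conjunct2, rule_format, of x y, THEN conjunct2] xy unfolding c by (simp add: mult.assoc del: of_nat_Suc)
  have "rotm 1 (- ?b (Suc x) y) (e / (2 * l)) ** rotm (?A x y) 1 (e * l / 2) = rotm (?A x (Suc y)) 1 (e * l / 2) ** rotm 1 (- ?b x y) (e / (2 * l))"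
   by (rule zero_curvature[OF _ nb A1 b1]) (use st kap_bounds[OF e] in simp_all)
  then show "rotm 1 (- ?b (Suc x) y) (e / (2 * l)) ** (rotm (?A x y) 1 (e * l / 2) ** s) = rotm (?A x (Suc y)) 1 (e * l / 2) ** (rotm 1 (- ?b x y) (e / (2 * l)) ** s)"
   by (simp add: matrix_mul_assoc)
 qed auto
 then obtain z where z: "!!l. l ~= 0 ==> z l 0 0 = mat 1 &
   (ALL x<N e. ALL y<=N e. z l (Suc x) y = rotm (?A x y) 1 (e * l / 2) ** z l x y) & (ALL x<=N e. ALL y<N e. z l x (Suc y) = rotm 1 (- ?b x y) (e / (2 * l)) ** z l x y)"
  by metis
 define Psi where "Psi = (%X Y l. z l (gidx e X) (gidx e Y))"
 have Psi: "Psi (e *. x) (e *. y) = (%l. z l x y)" for x y unfolding Psi_def gidx_grid[OF e0] ..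
 have "Psi 0 0 l = z l 0 0" for l using Psi[of 0 0] by (simp add: fun_eq_iff)
 then have "discrete_frame e r a b Psi"
  unfolding discrete_frame_iff[OF e] Psi using z by (simp add: Suc_le_eq)
 then show ?thesis by (intro exI[of _ Psi])
qed

text \<open>On the grid, differentiability in the spectral parameter propagates by the product rule,
  since the transfer matrices depend on it explicitly.\<close>

lemma discrete_log_deriv:
 assumes e: "e : E" and d: "discrete_data e r a b" and f: "discrete_frame e r a b Psi" and l: "l ~= 0"
 shows "x <= N e ==> y <= N e ==> EX K. log_deriv l (Psi (e *. x) (e *. y)) K"
  and "immersion l (Psi 0 0) = 0"
  and "x + 1 <= N e ==> y <= N e ==> immersion l (Psi (e *. (Suc x)) (e *. y)) = immersion l (Psi (e *. x) (e *. y))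
    + (e * (l / (1 + (e * l / 2)\<^sup>2))) *\<^sub>R Rot (Psi (e *. x) (e *. y) l) (hvec (cnj (cis (e * a (e *. x) (e *. y) / 2))))"
  and "x <= N e ==> y + 1 <= N e ==> immersion l (Psi (e *. x) (e *. (Suc y))) = immersion l (Psi (e *. x) (e *. y))
    + (e * (1 / l / (1 + (e / (2 * l))\<^sup>2))) *\<^sub>R Rot (Psi (e *. x) (e *. y) l) (hvec (b (e *. x) (e *. y)))"
proof -
 note dd = d[unfolded discrete_data_iff[OF e]]
 note ff = f[unfolded discrete_frame_iff[OF e], rule_format]
 let ?P = "%x y. Psi (e *. x) (e *. y)"
 let ?A = "%x y. cis (e * a (e *. x) (e *. y) / 2)" let ?b = "%x y. b (e *. x) (e *. y)"
 have 00: "log_deriv l (Psi 0 0) 0"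
 proof (rule log_deriv_cong[OF _ l])
  show "log_deriv l (%m. mat 1) 0"
   using SU2_one by (simp add: log_deriv_def linear_0[OF bounded_linear.linear[OF bounded_linear_su2_of_vec]] bounded_bilinear.zero_right[OF bilinear_matmult])
 qed (use ff in auto)
 have X: "log_deriv l (?P (Suc x) y) (Rot (?P x y l) (((e / 2) / (1 + (e * l / 2)\<^sup>2)) *\<^sub>R hvec (cnj (?A x y) * 1)) + K)"
  if "x + 1 <= N e" "y <= N e" "log_deriv l (?P x y) K" for x y K
  by (rule log_deriv_cong[OF log_deriv_mult[OF log_deriv_rotm[where s = "%m. e * m / 2"] that(3)] l])
   (use ff that in \<open>auto intro!: derivative_eq_intros\<close>)
 have Y: "log_deriv l (?P x (Suc y)) (Rot (?P x y l) (((- (e / (2 * l\<^sup>2))) / (1 + (e / (2 * l))\<^sup>2)) *\<^sub>R hvec (cnj 1 * (- ?b x y))) + K)"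
  if "x <= N e" "y + 1 <= N e" "log_deriv l (?P x y) K" for x y K
  by (rule log_deriv_cong[OF log_deriv_mult[OF log_deriv_rotm[where s = "%m. e / (2 * m)"] that(3)] l])
   (use ff dd that l in \<open>auto intro!: derivative_eq_intros simp: power2_eq_square field_simps\<close>)
 have x0: "EX K. log_deriv l (?P x 0) K" if "x <= N e" for x
  using that
 proof (induction x)
  case 0 then show ?case using 00 by auto
 next
  case (Suc x) then show ?case using X[of x 0] by fastforce
 qed
 show ex: "EX K. log_deriv l (?P x y) K" if "x <= N e" "y <= N e" for x y
  using that
 proof (induction y)
  case 0 then show ?case using x0 by auto
 next
  case (Suc y) then show ?case using Y[of x y] by fastforce
 qed
 show "immersion l (Psi 0 0) = 0" using immersion_eq[OF 00] by simp
 interpret R: bounded_linear "Rot M" for M by (rule bounded_linear_Rot)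
 interpret h: bounded_linear hvec by (rule bounded_linear_hvec)
 show "immersion l (?P (Suc x) y) = immersion l (?P x y) + (e * (l / (1 + (e * l / 2)\<^sup>2))) *\<^sub>R Rot (?P x y l) (hvec (cnj (?A x y)))"
  if xy: "x + 1 <= N e" "y <= N e" for x y
 proof -
  obtain K where K: "log_deriv l (?P x y) K" using ex[of x y] xy by auto
  have c: "2 * l * (e / 2 / q) = e * (l / q)" for q by simp
  show ?thesis unfolding immersion_eq[OF K] immersion_eq[OF X[OF xy K]] c[symmetric] by (simp add: R.scaleR scaleR_add_right)
 qed
 show "immersion l (?P x (Suc y)) = immersion l (?P x y) + (e * (1 / l / (1 + (e / (2 * l))\<^sup>2))) *\<^sub>R Rot (?P x y l) (hvec (?b x y))"
  if xy: "x <= N e" "y + 1 <= N e" for x y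
 proof -
  obtain K where K: "log_deriv l (?P x y) K" using ex[of x y] xy by auto
  have c: "2 * l * (e / (2 * l\<^sup>2) / q) = e * (1 / l / q)" for q using l by (simp add: power2_eq_square)
  show ?thesis unfolding immersion_eq[OF K] immersion_eq[OF Y[OF xy K]] c[symmetric]
   by (simp add: R.scaleR h.neg R.neg scaleR_add_right)
 qed
qed

lemma discrete_frame_SU2:
 assumes e: "e : E" and d: "discrete_data e r a b" and f: "discrete_frame e r a b Psi" and l: "l ~= 0" and "x <= N e" "y <= N e"
 shows "Psi (e *. x) (e *. y) l : SU2"
 using discrete_log_deriv(1)[OF assms] log_deriv_SU2 by blast

lemma discrete_surface_asymptotic:
 assumes e: "e : E" and d: "discrete_data e r a b" and f: "discrete_frame e r a b Psi"
 shows "asymptotic_discrete_K_surface e r (%x y. immersion 1 (Psi x y))"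
proof -
 have e0: "e > 0" using E_bounds e by auto
 note dd = d[unfolded discrete_data_iff[OF e]]
 note ff = f[unfolded discrete_frame_iff[OF e], rule_format, of 1, simplified]
 let ?A = "%x y. cis (e * a (e *. x) (e *. y) / 2)" let ?b = "%x y. b (e *. x) (e *. y)"
 define G where "G = (%x y. Psi (e *. x) (e *. y) 1)"
 define F where "F = (%x y. immersion 1 (Psi (e *. x) (e *. y)))"
 define c where "c = e * (1 / (1 + (e / 2)\<^sup>2))"
 note ld = discrete_log_deriv(3,4)[OF e d f one_neq_zero]
 have Feq: "immersion 1 (Psi (e *. x) (e *. y)) = F x y" for x y by (simp add: F_def)
 have G: "G x y : SU2" if "x <= N e" "y <= N e" for x y unfolding G_def by (rule discrete_frame_SU2[OF e d f _ that]) simp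
 have Fx: "F (Suc x) y = F x y + c *\<^sub>R Rot (G x y) (hvec (cnj (?A x y)))" if "x + 1 <= N e" "y <= N e" for x y
  using ld(1)[OF that] by (simp add: F_def G_def c_def)
 have Fy: "F x (Suc y) = F x y + c *\<^sub>R Rot (G x y) (hvec (?b x y))" if "x <= N e" "y + 1 <= N e" for x y
  using ld(2)[OF that] by (simp add: F_def G_def c_def)
 have Gx: "G (Suc x) y = rotm (?A x y) 1 (e / 2) ** G x y" if "x + 1 <= N e" "y <= N e" for x y
  using ff that unfolding G_def by simp
 have Gy: "G x (Suc y) = rotm 1 (- ?b x y) (e / 2) ** G x y" if "x <= N e" "y + 1 <= N e" for x y
  using ff that unfolding G_def by simp
 have nb: "norm (?b x y) = 1" if "x <= N e" "y + 1 <= N e" for x y using dd that by simp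
 interpret R: bounded_linear "Rot M" for M by (rule bounded_linear_Rot)
 interpret h: bounded_linear hvec by (rule bounded_linear_hvec)
 \<comment> \<open>The edge seen from its far end: it is horizontal for the frame there as well, so
   a left neighbour lies in the plane at the vertex.\<close>
 have Bx: "F x y = F (Suc x) y + Rot (G (Suc x) y) (hvec (- c *\<^sub>R ?A x y))" if xy: "x + 1 <= N e" "y <= N e" for x y
 proof -
  have "Rot (G (Suc x) y) (hvec (?A x y)) = Rot (G x y) (hvec (cnj (?A x y)))"
   using Rot_rotm_hvec[of "?A x y" 1 "e / 2"] G[of x y] rotm_SU2[of "?A x y" 1 "e / 2"] xy by (simp add: Gx[OF xy] Rot_mult)
  then show ?thesis using Fx[OF xy] by (simp add: h.scaleR R.scaleR h.neg R.neg)
 qed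
 have By: "F x y = F x (Suc y) + Rot (G x (Suc y)) (hvec (- c *\<^sub>R ?b x y))" if xy: "x <= N e" "y + 1 <= N e" for x y
 proof -
  have "Rot (G x (Suc y)) (hvec (?b x y)) = Rot (G x y) (hvec (?b x y))"
   using Rot_rotm_hvec[of 1 "- ?b x y" "e / 2"] G[of x y] rotm_SU2[of 1 "- ?b x y" "e / 2"] xy nb[OF xy] by (simp add: Gy[OF xy] Rot_mult h.neg R.neg)
  then show ?thesis using Fy[OF xy] by (simp add: h.scaleR R.scaleR h.neg R.neg)
 qed
 have c: "c = e / (1 + e\<^sup>2 / 4)" "c > 0"
 proof -
  show "c = e / (1 + e\<^sup>2 / 4)" by (simp add: c_def power2_eq_square)
  have "1 + (e / 2)\<^sup>2 > 0" by (rule add_pos_nonneg) auto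
  then show "c > 0" using e0 by (simp add: c_def)
 qed
 have nRot: "norm (Rot (G x y) v) = norm v" if "x <= N e" "y <= N e" for x y v by (rule norm_Rot[OF G[OF that]])
 show ?thesis
  unfolding asymptotic_discrete_K_surface_def
 proof (intro conjI)
  show "ALL x:grid e (r - e). ALL y:grid e r. dist (immersion 1 (Psi x y)) (immersion 1 (Psi (x + e) y)) = e / (1 + e\<^sup>2 / 4)"
   unfolding grid_all[OF e] grid1_all[OF e] grid_step Feq using c(2) nRot by (auto simp: dist_norm Fx c(1)[symmetric])
  show "ALL x:grid e r. ALL y:grid e (r - e). dist (immersion 1 (Psi x y)) (immersion 1 (Psi x (y + e))) = e / (1 + e\<^sup>2 / 4)"
   unfolding grid_all[OF e] grid1_all[OF e] grid_step Feq using c(2) nRot nb by (auto simp: dist_norm Fy c(1)[symmetric])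
  show "ALL x:grid e r. ALL y:grid e r. coplanar ((%(s, t). immersion 1 (Psi s t)) `
     ({(x, y), (x + e, y), (x - e, y), (x, y + e), (x, y - e)} \<inter> grid e r \<times> grid e r))"
   unfolding grid_all[OF e]
  proof (intro allI impI, rule coplanar_Rot)
   fix x y p assume xy: "x <= N e" "y <= N e" and p: "p : (%(s, t). immersion 1 (Psi s t)) `
     ({(e *. x, e *. y), (e *. x + e, e *. y), (e *. x - e, e *. y), (e *. x, e *. y + e), (e *. x, e *. y - e)} \<inter> grid e r \<times> grid e r)"
   then obtain s t where st: "p = F s t" "s <= N e" "t <= N e" and
    "(e *. s, e *. t) : {(e *. x, e *. y), (e *. x + e, e *. y), (e *. x - e, e *. y), (e *. x, e *. y + e), (e *. x, e *. y - e)}"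
    unfolding F_def using grid_iff[OF e] by auto
   moreover have "e *. s = e *. x + e \<longleftrightarrow> s = Suc x" "e *. s = e *. x - e \<longleftrightarrow> x = Suc s" "e *. s = e *. x \<longleftrightarrow> s = x" for s x
   proof -
    have "e *. s = e *. x - e \<longleftrightarrow> e *. x = e *. s + e" by auto
    then show "e *. s = e *. x + e \<longleftrightarrow> s = Suc x" "e *. s = e *. x - e \<longleftrightarrow> x = Suc s" "e *. s = e *. x \<longleftrightarrow> s = x"
     unfolding grid_step using e0 by (simp_all del: of_nat_Suc)
   qed
   ultimately consider "s = x" "t = y" | "s = Suc x" "t = y" | "x = Suc s" "t = y" | "s = x" "t = Suc y" | "s = x" "y = Suc t" by auto
   then show "EX w. p = F x y + Rot (G x y) (hvec w)"
   proof cases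
    case 1 then show ?thesis using st by (intro exI[of _ 0]) (simp add: h.zero R.zero)
   next
    case 2 then show ?thesis using st xy Fx[of x y] by (intro exI[of _ "c *\<^sub>R cnj (?A x y)"]) (simp add: h.scaleR R.scaleR)
   next
    case 3 then show ?thesis using st xy Bx[of s t] by (metis Suc_eq_plus1)
   next
    case 4 then show ?thesis using st xy Fy[of x y] by (intro exI[of _ "c *\<^sub>R ?b x y"]) (simp add: h.scaleR R.scaleR)
   next
    case 5 then show ?thesis using st xy By[of s t] by (metis Suc_eq_plus1)
   qed
  qed
 qed
qed

lemma discrete_angle_exists:
 assumes e: "e : E" and d: "discrete_data e r a b"
 shows "EX phi. discrete_angle e r a b phi"
proof -
 have e0: "e > 0" using E_bounds e by auto
 note dd = d[unfolded discrete_data_iff[OF e]]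
 let ?a = "%x y. a (e *. x) (e *. y)" let ?b = "%x y. b (e *. x) (e *. y)"
 \<comment> \<open>On the left edge the mean of consecutive values is made equal to
   \<open>Arg\<close> of \<open>b\<close>; the starting value 0 is a free choice. Values further
   right are sums of \<open>a\<close>, and the relation with \<open>b\<close> propagates by
   induction on \<open>x\<close>.\<close>
 define p0 where "p0 = rec_nat 0 (%y s. 2 * Arg (?b 0 y) - s)"
 define p where "p = (%x y. p0 y + e * (\<Sum>k<x. ?a k y))"
 have b: "?b x y = cis ((p x (Suc y) + p x y) / 2)" if "x <= N e" "y + 1 <= N e" for x y
  using that
 proof (induction x)
  case 0
  then have n: "norm (?b 0 y) = 1" using dd by blast
  have "cis (Arg (?b 0 y)) = ?b 0 y" using n by (subst cis_Arg) (auto simp: sgn_div_norm)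
  then show ?case by (simp add: p_def p0_def)
 next
  case (Suc x)
  have "?b (Suc x) y = ?b x y * cis (e * (?a x y + ?a x (Suc y)) / 2)" using dd Suc by auto
  also have "?b x y = cis ((p x (Suc y) + p x y) / 2)" using Suc by simp
  finally show ?case by (simp add: cis_mult p_def add_divide_distrib algebra_simps del: of_nat_Suc)
 qed
 define phi where "phi = (%X Y. p (gidx e X) (gidx e Y))"
 have phi: "phi (e *. x) (e *. y) = p x y" for x y unfolding phi_def gidx_grid[OF e0] ..
 have "discrete_angle e r a b phi"
  unfolding discrete_angle_def grid_all[OF e] grid1_all[OF e] dqx_def grid_step phi using b e0
  by (simp add: p_def algebra_simps del: of_nat_Suc)
 then show ?thesis by (intro exI[of _ phi])
qed

lemma discrete_angle_boundary:
 assumes e: "e : E" and "discrete_boundary e r a0 b0 a b" "discrete_angle e r a b phi"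
 shows "ALL x:grid e (r - e). phi (x + e) 0 - phi x 0 = e * a0 x" "ALL y:grid e (r - e). cis (phi 0 (y + e) + phi 0 y) = (b0 y)\<^sup>2"
proof -
 have e0: "e > 0" using E_bounds e by auto
 have 0: "0 : grid e r" using grid_iff[OF e, of 0] by auto
 show "ALL x:grid e (r - e). phi (x + e) 0 - phi x 0 = e * a0 x"
 proof
  fix x assume x: "x : grid e (r - e)"
  have "a0 x = dqx e phi x 0" using assms(2,3) x 0 by (auto simp: discrete_boundary_def discrete_angle_def)
  then show "phi (x + e) 0 - phi x 0 = e * a0 x" using e0 by (simp add: dqx_def)
 qed
 show "ALL y:grid e (r - e). cis (phi 0 (y + e) + phi 0 y) = (b0 y)\<^sup>2"
 proof
  fix y assume y: "y : grid e (r - e)"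
  have "b0 y = cis ((phi 0 (y + e) + phi 0 y) / 2)" using assms(2,3) y 0 by (auto simp: discrete_boundary_def discrete_angle_def)
  then show "cis (phi 0 (y + e) + phi 0 y) = (b0 y)\<^sup>2" by (simp add: power2_eq_square cis_mult)
 qed
qed

lemma discrete_surface_unique:
 assumes e: "e : E" and d: "discrete_data e r a b" "discrete_boundary e r a0 b0 a b" "discrete_frame e r a b Psi"
  and d': "discrete_data e r a' b'" "discrete_boundary e r a0 b0 a' b'" "discrete_frame e r a' b' Psi'"
  and xy: "x <= N e" "y <= N e" and l: "l ~= 0"
 shows "immersion l (Psi' (e *. x) (e *. y)) = immersion l (Psi (e *. x) (e *. y))"
proof -
 note eq = discrete_data_unique[OF e d(1,2) d'(1,2), THEN conjunct1, rule_format] discrete_data_unique[OF e d(1,2) d'(1,2), THEN conjunct2, rule_format]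
 note f = d(3)[unfolded discrete_frame_iff[OF e], rule_format] d'(3)[unfolded discrete_frame_iff[OF e], rule_format]
 have x0: "Psi' (e *. x) 0 m = Psi (e *. x) 0 m" if "m ~= 0" "x <= N e" for x m
  using that(2)
 proof (induction x)
  case (Suc x)
  show ?case using f(1)[OF that(1), THEN conjunct2, THEN conjunct1, rule_format, of x 0] f(2)[OF that(1), THEN conjunct2, THEN conjunct1, rule_format, of x 0]
    eq(1)[of x 0] Suc by simp
 qed (use f that in auto)
 have "Psi' (e *. x) (e *. y) m = Psi (e *. x) (e *. y) m" if "m ~= 0" for m
  using xy(2)
 proof (induction y)
  case (Suc y)
  show ?case using f(1)[OF that(1), THEN conjunct2, THEN conjunct2, rule_format, of x y] f(2)[OF that(1), THEN conjunct2, THEN conjunct2, rule_format, of x y]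
    eq(2)[of x y] Suc xy by simp
 qed (use x0[OF that xy(1)] in simp)
 then have c: "!!m. m ~= 0 ==> Psi' (e *. x) (e *. y) m = Psi (e *. x) (e *. y) m" .
 obtain K where K: "log_deriv l (Psi (e *. x) (e *. y)) K" using discrete_log_deriv(1)[OF e d(1,3) l xy] by blast
 show ?thesis unfolding immersion_eq[OF K] by (rule immersion_eq[OF log_deriv_cong[OF K l c]])
qed

end

section \<open>Smooth initial data\<close>

lemma cis_bound: "norm (cis t - 1) <= \<bar>t\<bar>"
proof -
 have "norm (cis t - 1) = 2 * \<bar>sin (t / 2)\<bar>" using dist_exp_i_1[of t] by (simp add: cis_conv_exp)
 also have "\<dots> <= 2 * \<bar>t / 2\<bar>" by (intro mult_left_mono abs_sin_x_le_abs_x) auto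
 finally show ?thesis by simp
qed

lemma cis_bound2: "norm (cis t - 1 - \<i> * of_real t) <= t\<^sup>2"
proof -
 let ?f = "%s. cis s - 1 - \<i> * of_real s"
 have "norm (?f t - ?f 0) <= \<bar>t\<bar> * norm (t - 0)"
 proof (rule differentiable_bound[of "closed_segment 0 t" ?f "%s h. h *\<^sub>R (\<i> * (cis s - 1))"])
  fix s assume s: "s : closed_segment 0 t"
  have "((%s. exp (s *\<^sub>R \<i>) - 1 - s *\<^sub>R \<i>) has_vector_derivative (exp (s *\<^sub>R \<i>) * \<i> - 0 - 1 *\<^sub>R \<i>)) (at s within closed_segment 0 t)"
   by (intro has_vector_derivative_diff has_vector_derivative_const has_vector_derivative_scaleR exp_scaleR_has_vector_derivative_right has_vector_derivative_eq_rhs[OF has_vector_derivative_scaleR[OF DERIV_ident has_vector_derivative_const]]) simp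
  then have "(?f has_vector_derivative (\<i> * cis s - 0 - \<i> * 1)) (at s within closed_segment 0 t)"
   by (simp add: cis_conv_exp scaleR_conv_of_real[where 'a = complex] mult.commute)
  then show "(?f has_derivative (%h. h *\<^sub>R (\<i> * (cis s - 1)))) (at s within closed_segment 0 t)"
   by (simp add: has_vector_derivative_def algebra_simps)
  have "norm (\<i> * (cis s - 1)) <= \<bar>t\<bar>" using cis_bound[of s] s by (auto simp: norm_mult closed_segment_eq_real_ivl split: if_splits)
  then show "onorm (%h. h *\<^sub>R (\<i> * (cis s - 1))) <= \<bar>t\<bar>"
   by (intro onorm_le) (auto simp: mult.commute[of "\<bar>t\<bar>"] intro!: mult_left_mono)
 qed auto
 then show ?thesis by (simp add: power2_eq_square abs_mult_self_eq)
qed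

definition Dq :: "real => (real => 'a::real_vector) => real => 'a" where
 "Dq e f t = (f (t + e) - f t) /\<^sub>R e"

text \<open>A difference quotient of \<open>g n\<close> is differentiable, its derivative being the
  same quotient of \<open>g (Suc n)\<close>. The mean value estimate therefore trades each
  difference for one derivative, on an interval shortened by one step.\<close>

lemma Dq_bound:
 fixes g :: "nat => real => 'a::real_normed_vector"
 assumes g: "ALL n. ALL t:{0..r}. (g n has_vector_derivative g (Suc n) t) (at t within {0..r})"
  and C: "ALL n. ALL t:{0..r}. norm (g n t) <= C n" and e: "e > 0"
 shows "(ALL n. ALL t:{0..r - real k * e}. ((Dq e ^^ k) (g n) has_vector_derivative (Dq e ^^ k) (g (Suc n)) t) (at t within {0..r - real k * e}))
  & (ALL n. ALL t:{0..r - real k * e}. norm ((Dq e ^^ k) (g n) t) <= C (n + k))"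
proof (induction k)
 case 0 then show ?case using g C by simp
next
 case (Suc k)
 let ?T = "{0..r - real k * e}" and ?S = "{0..r - real (Suc k) * e}"
 let ?f = "%n. (Dq e ^^ k) (g n)"
 have sub: "t : ?T" "t + e : ?T" if "t : ?S" for t using that e by (auto simp: algebra_simps)
 have d: "(?f n has_vector_derivative ?f (Suc n) t) (at t within ?T)" if "t : ?T" for n t using Suc that by blast
 have sh: "((%t. ?f n (t + e)) has_vector_derivative ?f (Suc n) (t + e)) (at t within ?S)" if "t : ?S" for n t
 proof -
  have "(((?f n) \<circ> (%t. t + e)) has_vector_derivative (1 *\<^sub>R ?f (Suc n) (t + e))) (at t within ?S)"
  proof (rule vector_diff_chain_within)
   show "((%t. t + e) has_vector_derivative 1) (at t within ?S)" by (auto intro!: derivative_eq_intros)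
   show "(?f n has_vector_derivative ?f (Suc n) (t + e)) (at (t + e) within (%t. t + e) ` ?S)"
    by (rule has_vector_derivative_within_subset[OF d]) (use that sub in blast)+
  qed
  then show ?thesis by (simp add: o_def)
 qed
 show ?case
 proof (intro conjI allI ballI)
  fix n t assume t: "t : ?S"
  have S: "?S \<subseteq> ?T" using sub by blast
  have "((%t. (1 / e) *\<^sub>R (?f n (t + e) - ?f n t)) has_vector_derivative (1 / e) *\<^sub>R (?f (Suc n) (t + e) - ?f (Suc n) t)) (at t within ?S)"
   by (intro has_vector_derivative_linear[OF bounded_linear_scaleR_right] has_vector_derivative_diff sh t
     has_vector_derivative_within_subset[OF d S] sub)
  then show "((Dq e ^^ Suc k) (g n) has_vector_derivative (Dq e ^^ Suc k) (g (Suc n)) t) (at t within ?S)"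
   by (simp add: Dq_def[abs_def] divide_inverse del: of_nat_Suc)
  have seg: "{t..t + e} \<subseteq> ?T" using sub[OF t] by auto
  have "norm (?f n (t + e) - ?f n t) <= C (Suc n + k) * norm (t + e - t)"
  proof (rule differentiable_bound[of "{t..t + e}" "?f n" "%s h. h *\<^sub>R ?f (Suc n) s"])
   fix s assume s: "s : {t..t + e}"
   have "(?f n has_vector_derivative ?f (Suc n) s) (at s within {t..t + e})"
    using seg s by (intro has_vector_derivative_within_subset[OF d seg]) auto
   then show "(?f n has_derivative (%h. h *\<^sub>R ?f (Suc n) s)) (at s within {t..t + e})" by (simp add: has_vector_derivative_def)
   have "norm (?f (Suc n) s) <= C (Suc n + k)" using Suc seg s by blast
   then show "onorm (%h. h *\<^sub>R ?f (Suc n) s) <= C (Suc n + k)"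
    by (intro onorm_le) (auto simp: mult.commute[of "C _"] intro!: mult_left_mono)
  qed (use e in auto)
  then have "norm (?f n (t + e) - ?f n t) <= C (n + Suc k) * e" using e by simp
  then show "norm ((Dq e ^^ Suc k) (g n) t) <= C (n + Suc k)"
   unfolding funpow.simps o_def Dq_def norm_scaleR using e by (simp add: field_simps)
 qed
qed

context meshed begin

lemma dx_Dq: "(dx ^^ m) (%e i x y. h (e *. x)) e i x y = (Dq e ^^ m) h (e *. x)"
 by (induction m arbitrary: x) (simp_all add: dx_def Dq_def grid_step del: of_nat_Suc)

lemma bd_sample:
 fixes h :: "real => 'a::real_normed_vector"
 assumes "smooth_on_interval r h" shows "bd k p q (%e i x y. h (e *. x))"
proof -
 obtain g where g0: "!!t. t : {0..r} ==> g 0 t = h t"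
  and g: "ALL n. ALL t:{0..r}. (g n has_vector_derivative g (Suc n) t) (at t within {0..r})"
  using assms unfolding smooth_on_interval_def by blast
 have "EX C. ALL t:{0..r}. norm (g n t) <= C" for n
 proof -
  have "continuous_on {0..r} (g n)"
   using g by (auto simp: continuous_on_eq_continuous_within intro: has_vector_derivative_continuous)
  then have "compact (g n ` {0..r})" by (intro compact_continuous_image) auto
  then show ?thesis by (auto dest!: compact_imp_bounded simp: bounded_iff)
 qed
 then obtain C where C: "ALL n. ALL t:{0..r}. norm (g n t) <= C n" by metis
 let ?u = "%e (i::'i) x (y::nat). g 0 (e *. x)"
 have b: "bdd m n ((dx ^^ m) ?u)" for m n
 proof (rule bddI[where C = "C (0 + m)"])
  fix e i x y assume *: "e : E" "x + m <= N e"
  have "e *. x : {0..r - real m * e}" using grid_mem[OF *] by (auto simp: grid_def)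
  then show "norm ((dx ^^ m) ?u e i x y) <= C (0 + m)"
   unfolding dx_Dq using Dq_bound[OF g C E_bounds(1)[OF *(1)], THEN conjunct2, rule_format] by blast
 qed
 have y0: "dy ((dx ^^ m) ?u) = (%e i x y. 0)" for m
  by (simp add: dy_def fun_eq_iff dx_Dq)
 have "bd k m n ((dx ^^ m) ?u)" for m n
 proof (induction k arbitrary: m)
  case (Suc k)
  have "bd k (Suc m) n ((dx ^^ Suc m) ?u)" by (rule Suc.IH)
  then show ?case using b[of m n] by (simp add: y0 bd_const)
 qed (use b in simp)
 from this[of 0 q] have "bd k 0 q ?u" by simp
 then have "bd k p q ?u" by (rule bd_mono) auto
 then show ?thesis by (rule bd_cong) (use g0 grid_in in auto)
qed

lemma bd_sample_y:
 fixes h :: "real => 'a::real_normed_vector"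
 assumes "smooth_on_interval r h" shows "bd k p q (%e i x y. h (e *. y))"
 using bd_transp[OF bd_sample[OF assms, of k q p]] by (simp add: transp_def[abs_def])

text \<open>Induction on \<open>k\<close>: the difference quotient of \<open>cis (\<tau> d / 2)\<close> over a step \<open>e\<close> has the same form, with
 \<open>\<tau> e\<close> in place of \<open>\<tau>\<close> and the difference quotient of \<open>d\<close> in place of \<open>d\<close>; hence the arbitrary \<open>\<tau>\<close>.\<close>

lemma bd_cis:
 assumes "bd k p q d" "!!e. e : E ==> 0 < tau e & tau e <= 1"
 shows "bd k p q (%e i x y. (cis (tau e * d e i x y / 2) - 1) / of_real (tau e))"
 using assms
proof (induction k arbitrary: p q d tau)
 case 0
 then obtain C where C: "!!e i x y. e : E ==> i : I ==> x + p <= N e ==> y + q <= N e ==> norm (d e i x y) <= C"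
  unfolding bd.simps by - (rule bddE, assumption, blast)
 have "bdd p q (%e i x y. (cis (tau e * d e i x y / 2) - 1) / of_real (tau e))"
 proof (rule bddI[where C = C])
  fix e i x y assume *: "e : E" "i : I" "x + p <= N e" "y + q <= N e"
  have t: "tau e > 0" using 0 * by auto
  have "norm (cis (tau e * d e i x y / 2) - 1) <= \<bar>tau e * d e i x y / 2\<bar>" by (rule cis_bound)
  also have "\<dots> <= tau e * C" using C[OF *] t by (simp add: abs_mult)
  finally show "norm ((cis (tau e * d e i x y / 2) - 1) / of_real (tau e)) <= C" using t by (simp add: norm_divide field_simps)
 qed
 then show ?case by simp
next
 case (Suc k)
 let ?E = "%tau d. (%e (i::'i) (x::nat) (y::nat). (cis (tau e * d e i x y / 2) - 1) / complex_of_real (tau e))"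
 have dk: "bd k p q d" "bd k (Suc p) q (dx d)" "bd k p (Suc q) (dy d)" using Suc.prems(1) by (auto dest: bd_Suc_D simp del: bd.simps) (simp_all)
 have t2: "0 < tau e * e & tau e * e <= 1" if "e : E" for e
  using Suc.prems(2)[OF that] E_bounds(1,3)[OF that] by (auto intro: mult_le_one)
 have E0: "bd k p q (?E tau d)" by (rule Suc.IH[OF dk(1) Suc.prems(2)])
 have tp: "bd k p' q' (%e i x y. complex_of_real (tau e))" for p' q' using Suc.prems(2) by (intro bd_param[of _ 1]) fastforce
 have step: "(cis (t * (u + e * v) / 2) - 1) / complex_of_real t - (cis (t * u / 2) - 1) / of_real t
   = of_real e * ((1 + of_real t * ((cis (t * u / 2) - 1) / of_real t)) * ((cis (t * e * v / 2) - 1) / of_real (t * e)))"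
  if "t > 0" "e > 0" for t u e v :: real
 proof -
  have "cis (t * (u + e * v) / 2) = cis (t * u / 2) * cis (t * e * v / 2)" by (simp add: cis_mult algebra_simps add_divide_distrib)
  then show ?thesis using that by (simp add: field_simps)
 qed
 have ex: "dx (?E tau d) e i x y = (1 + of_real (tau e) * ?E tau d e i x y) * ?E (%e. tau e * e) (dx d) e i x y"
  and ey: "dy (?E tau d) e i x y = (1 + of_real (tau e) * ?E tau d e i x y) * ?E (%e. tau e * e) (dy d) e i x y" if e: "e : E" for e i x y
 proof -
  have t: "tau e > 0" "e > 0" using Suc.prems(2) E_bounds(1) e by auto
  have "d e i (Suc x) y = d e i x y + e * dx d e i x y" "d e i x (Suc y) = d e i x y + e * dy d e i x y" using t by (simp_all add: dx_def dy_def mult.assoc[symmetric])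
  moreover have "(of_real e * Z) /\<^sub>R e = Z" for Z :: complex using t by (simp add: complex_scaleR)
  ultimately show "dx (?E tau d) e i x y = (1 + of_real (tau e) * ?E tau d e i x y) * ?E (%e. tau e * e) (dx d) e i x y"
   "dy (?E tau d) e i x y = (1 + of_real (tau e) * ?E tau d e i x y) * ?E (%e. tau e * e) (dy d) e i x y"
   unfolding dx_def[of "?E tau d"] dy_def[of "?E tau d"] by (simp_all only: step[OF t])
 qed
 have "bd k (Suc p) q (%e i x y. (1 + of_real (tau e) * ?E tau d e i x y) * ?E (%e. tau e * e) (dx d) e i x y)"
  by (intro bd_mult bd_add bd_const tp bd_mono[OF E0] Suc.IH[OF dk(2) t2]) auto
 then have 1: "bd k (Suc p) q (dx (?E tau d))" by (rule bd_cong) (rule ex)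
 have "bd k p (Suc q) (%e i x y. (1 + of_real (tau e) * ?E tau d e i x y) * ?E (%e. tau e * e) (dy d) e i x y)"
  by (intro bd_mult bd_add bd_const tp bd_mono[OF E0] Suc.IH[OF dk(3) t2]) auto
 then have 2: "bd k p (Suc q) (dy (?E tau d))" by (rule bd_cong) (rule ey)
 show ?case using 1 2 bd_bdd[OF E0] by simp
qed

lemma jet_lip:
 assumes "jet g" shows "lip (%i. g m n)"
proof -
 have c: "cbd (%i. g m n)" for m n
 proof -
  have "compact ((%(x, y). g m n x y) ` ({0..r} \<times> {0..r}))"
   by (intro compact_continuous_image jet_cont[OF assms] compact_Times compact_Icc)
  then obtain C where "ALL w:(%(x, y). g m n x y) ` ({0..r} \<times> {0..r}). norm w <= C"
   using compact_imp_bounded bounded_iff by blast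
  then show ?thesis unfolding cbd_def by (intro exI[of _ C]) auto
 qed
 show ?thesis by (rule lip_of_derivs[OF _ _ c c[of "Suc m" n] c[of m "Suc n"]]) (use assms in \<open>auto simp: hasx_def hasy_def jet_def\<close>)
qed

text \<open>The limit of \<open>al (Af a)\<close> for discrete data belonging to a surface with
  angle \<open>phi\<close>.\<close>

definition vv :: "(real => real => complex) => ('i, complex) field2" where
 "vv phi i X Y = \<i> / 2 * of_real (angle_pdx r phi X Y)"

text \<open>\<open>\<partial>\<^sub>x \<partial>\<^sub>y \<phi> = \<partial>\<^sub>y \<partial>\<^sub>x \<phi>\<close>, expressed by the derivatives of \<open>e\<^sup>i\<^sup>\<phi>\<close>.\<close>

lemma unit_derivative:
 fixes f :: "real => complex"
 assumes "(f has_vector_derivative f') (at s within {0..r})" "s : {0..r}" "!!t. t : {0..r} ==> norm (f t) = 1"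
 shows "f' = f s * (\<i> * of_real (Im (cnj (f s) * f')))"
proof -
 have "((%t. f t * cnj (f t)) has_vector_derivative (f s * cnj f' + f' * cnj (f s))) (at s within {0..r})"
  by (intro has_vector_derivative_mult assms has_vector_derivative_linear[OF bounded_linear_cnj])
 then have "((%t. 1 :: complex) has_vector_derivative (f s * cnj f' + f' * cnj (f s))) (at s within {0..r})"
  by (rule has_vector_derivative_transform[rotated 2]) (use assms in \<open>auto simp: cnj_unit\<close>)
 moreover have "((%t. 1 :: complex) has_vector_derivative 0) (at s within {0..r})" by (rule has_vector_derivative_const)
 ultimately have "f s * cnj f' + f' * cnj (f s) = 0"
  by (rule vector_derivative_unique_within_closed_interval[OF r_pos, unfolded box_real, OF assms(2)])
 then have "Re (cnj (f s) * f') = 0" by (auto simp: complex_eq_iff mult_ac)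
 then have "\<i> * of_real (Im (cnj (f s) * f')) = cnj (f s) * f'" by (simp add: complex_eq_iff)
 moreover have "f s * (cnj (f s) * f') = f'" using cnj_unit[OF assms(3)[OF assms(2)]] by (simp add: mult.assoc[symmetric])
 ultimately show ?thesis by simp
qed

lemma angle_jet:
 assumes g: "jet g" and phi: "ALL X:{0..r}. ALL Y:{0..r}. g 0 0 X Y = phi X Y" "ALL X:{0..r}. ALL Y:{0..r}. norm (phi X Y) = 1"
  and XY: "X : {0..r}" "Y : {0..r}"
 shows "angle_pdx r phi X Y = Im (cnj (g 0 0 X Y) * g 1 0 X Y)" "angle_pdy r phi X Y = Im (cnj (g 0 0 X Y) * g 0 1 X Y)"
  and "g 1 0 X Y = phi X Y * (\<i> * of_real (angle_pdx r phi X Y))" "g 0 1 X Y = phi X Y * (\<i> * of_real (angle_pdy r phi X Y))"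
proof -
 have p: "pdx r phi X Y = g 1 0 X Y" "pdy r phi X Y = g 0 1 X Y"
  using jet_pd[OF g _ XY, of phi 1 0] jet_pd[OF g _ XY, of phi 0 1] phi(1) by simp_all
 show 1: "angle_pdx r phi X Y = Im (cnj (g 0 0 X Y) * g 1 0 X Y)" "angle_pdy r phi X Y = Im (cnj (g 0 0 X Y) * g 0 1 X Y)"
  unfolding angle_pdx_def angle_pdy_def p using phi(1) XY by simp_all
 have d: "derx (g 0 0) (g 1 0 X Y) X Y" "dery (g 0 0) (g 0 1 X Y) X Y"
  using g XY by (auto simp: jet_def)
 show "g 1 0 X Y = phi X Y * (\<i> * of_real (angle_pdx r phi X Y))" "g 0 1 X Y = phi X Y * (\<i> * of_real (angle_pdy r phi X Y))"
  unfolding 1 using unit_derivative[OF d(1)] unit_derivative[OF d(2)] XY phi by auto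
qed

text \<open>Both first derivatives of \<open>phi\<close> are real multiples of
  \<open>\<i> * phi\<close>, so the term with two first derivatives is real and drops out of the
  imaginary part. The two mixed derivatives of the angle thus reduce to the same expression, which
  moves the sine-Gordon equation from one order of differentiation to the other.\<close>

lemma angle_mixed:
 assumes g: "jet g" and phi: "ALL X:{0..r}. ALL Y:{0..r}. g 0 0 X Y = phi X Y" "ALL X:{0..r}. ALL Y:{0..r}. norm (phi X Y) = 1"
  and XY: "X : {0..r}" "Y : {0..r}"
 shows "dery (angle_pdx r phi) (Im (cnj (g 0 0 X Y) * g 1 1 X Y)) X Y"
  and "derx (angle_pdy r phi) (Im (cnj (g 0 0 X Y) * g 1 1 X Y)) X Y"
  and "derx (angle_pdx r phi) (Im (cnj (g 1 0 X Y) * g 1 0 X Y + cnj (g 0 0 X Y) * g 2 0 X Y)) X Y"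
proof -
 note a = angle_jet[OF g phi]
 note j = g[unfolded jet_def, THEN conjunct2, rule_format, OF XY]
 have d: "((%s. Im (cnj (p s) * q s)) has_vector_derivative Im (cnj (p s) * q' + cnj p' * q s)) (at s within S)"
  if "(p has_vector_derivative p') (at s within S)" "(q has_vector_derivative q') (at s within S)" for p q :: "real => complex" and p' q' s S
  by (intro has_vector_derivative_linear[OF bounded_linear_Im] has_vector_derivative_mult has_vector_derivative_linear[OF bounded_linear_cnj] that)
 have u: "cnj (phi X Y) * phi X Y = 1" using cnj_unit[of "phi X Y"] phi(2) XY by (simp add: mult.commute)
 have z: "Im (cnj (phi X Y * (\<i> * of_real s)) * (phi X Y * (\<i> * of_real t))) = 0" for s t
 proof -
  have "cnj (phi X Y * (\<i> * of_real s)) * (phi X Y * (\<i> * of_real t)) = of_real (s * t) * (cnj (phi X Y) * phi X Y)" by (simp add: mult_ac)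
  then show ?thesis unfolding u by simp
 qed
 have "((%s. Im (cnj (g 0 0 X s) * g 1 0 X s)) has_vector_derivative Im (cnj (g 0 0 X Y) * g 1 1 X Y)) (at Y within {0..r})"
  using d[OF j(1)[of 0 0, THEN conjunct2] j(1)[of 1 0, THEN conjunct2]] z[of "angle_pdy r phi X Y" "angle_pdx r phi X Y"] a(3,4)[OF XY] by simp
 then show "dery (angle_pdx r phi) (Im (cnj (g 0 0 X Y) * g 1 1 X Y)) X Y"
  by (rule has_vector_derivative_transform[rotated 2]) (use a(1) XY in auto)
 have "((%s. Im (cnj (g 0 0 s Y) * g 0 1 s Y)) has_vector_derivative Im (cnj (g 0 0 X Y) * g 1 1 X Y)) (at X within {0..r})"
  using d[OF j(1)[of 0 0, THEN conjunct1] j(1)[of 0 1, THEN conjunct1]] z[of "angle_pdx r phi X Y" "angle_pdy r phi X Y"] a(3,4)[OF XY] by simp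
 then show "derx (angle_pdy r phi) (Im (cnj (g 0 0 X Y) * g 1 1 X Y)) X Y"
  by (rule has_vector_derivative_transform[rotated 2]) (use a(2) XY in auto)
 have "((%s. Im (cnj (g 0 0 s Y) * g 1 0 s Y)) has_vector_derivative Im (cnj (g 1 0 X Y) * g 1 0 X Y + cnj (g 0 0 X Y) * g 2 0 X Y)) (at X within {0..r})"
  using d[OF j(1)[of 0 0, THEN conjunct1] j(1)[of 1 0, THEN conjunct1]] by (simp add: numeral_2_eq_2 add.commute)
 then show "derx (angle_pdx r phi) (Im (cnj (g 1 0 X Y) * g 1 0 X Y + cnj (g 0 0 X Y) * g 2 0 X Y)) X Y"
  by (rule has_vector_derivative_transform[rotated 2]) (use a(1) XY in auto)
qed

lemma sine_Gordon_sys: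
 assumes "sine_Gordon r phi"
 shows "hasy (vv phi) (%i X Y. (1 / 4) * (phi X Y - cnj (phi X Y)))" "hasx (%i. phi) (%i X Y. phi X Y * (2 * vv phi i X Y))"
  "lip (vv phi)" "lip (%i. phi)"
proof -
 have sm: "smooth_on_square r phi" and n: "ALL X:{0..r}. ALL Y:{0..r}. norm (phi X Y) = 1"
  and sg: "!!X Y. X : {0..r} ==> Y : {0..r} ==> pdx r (angle_pdy r phi) X Y = Im (phi X Y)"
  using assms by (auto simp: sine_Gordon_def smooth_angle_def)
 obtain g where g: "jet g" and g0: "ALL X:{0..r}. ALL Y:{0..r}. g 0 0 X Y = phi X Y"
  using smooth_imp_jet[OF sm] by metis
 note a = angle_jet[OF g g0 n] and m = angle_mixed[OF g g0 n]
 have im: "Im (cnj (g 0 0 X Y) * g 1 1 X Y) = Im (phi X Y)" if "X : {0..r}" "Y : {0..r}" for X Y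
  using pdx_eq[where g = "angle_pdy r phi" and f = "angle_pdy r phi", OF m(2)[OF that] that(1)] sg[OF that] by simp
 have q: "\<i> / 2 * of_real (Im w) = (1 / 4) * (w - cnj w)" for w by (simp add: complex_eq_iff)
 show "hasy (vv phi) (%i X Y. (1 / 4) * (phi X Y - cnj (phi X Y)))"
  unfolding hasy_def vv_def q[symmetric]
 proof (intro ballI)
  fix X Y assume XY: "X : {0..r}" "Y : {0..r}"
  show "((%s. \<i> / 2 * complex_of_real (angle_pdx r phi X s)) has_vector_derivative \<i> / 2 * complex_of_real (Im (phi X Y))) (at Y within {0..r})"
   using has_vector_derivative_linear[OF bounded_linear_compose[OF bounded_linear_mult_right[of "\<i> / 2"] bounded_linear_of_real] m(1)[OF XY]]
   unfolding im[OF XY] .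
 qed
 show "hasx (%i. phi) (%i X Y. phi X Y * (2 * vv phi i X Y))"
  unfolding hasx_def
 proof (intro ballI)
  fix X Y assume XY: "X : {0..r}" "Y : {0..r}"
  have "derx (g 0 0) (g 1 0 X Y) X Y" using g XY by (auto simp: jet_def)
  then have "derx phi (g 1 0 X Y) X Y"
   by (rule has_vector_derivative_transform[rotated 2]) (use g0 XY in auto)
  then show "derx phi (phi X Y * (2 * vv phi i X Y)) X Y" for i
   unfolding a(3)[OF XY] by (simp add: vv_def)
 qed
 show "lip (%i. phi)" by (rule lip_cong[OF jet_lip[OF g, of 0 0]]) (simp add: g0)
 have "lip (%i X Y. \<i> / 2 * of_real (Im (cnj (g 0 0 X Y) * g 1 0 X Y)))"
  by (intro lip_mult lip_const lip_linear[OF bounded_linear_compose[OF bounded_linear_of_real bounded_linear_Im]] lip_cnj jet_lip[OF g])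
 then show "lip (vv phi)" by (rule lip_cong) (simp add: vv_def a(1))
qed

end

section \<open>Goursat problem and convergence\<close>

context meshed begin

definition Af :: "(real => real => real => real) => ('i, complex) family" where
 "Af a e i x y = cis (e * a e (e *. x) (e *. y) / 2)"
definition bf :: "(real => real => real => complex) => ('i, complex) family" where
 "bf b e i x y = b e (e *. x) (e *. y)"

lemma cis_half: "cis (e * (u + v) / 2) = cis (e * u / 2) * cis (e * v / 2)"
 by (simp add: cis_mult distrib_left add_divide_distrib)

lemma data_dsys:
 assumes "!!e. e : E ==> discrete_data e r (a e) (b e)" shows "dsys (Af a) (bf b)"
 unfolding dsys_def
proof (intro conjI ballI allI impI)
 have dd: "!!e. e : E ==> discrete_data e r (a e) (b e)" by fact
 show "unimod 1 0 (Af a)" by (simp add: unimod_def Af_def)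
 show "unimod 0 1 (bf b)" unfolding unimod_def bf_def using dd discrete_data_iff by simp
 fix e i x y assume e: "e : E" and xy: "x + 1 <= N e" "y + 1 <= N e"
 note d = dd[OF e, unfolded discrete_data_iff[OF e]]
 have nb: "norm (b e (e *. x) (e *. y)) = 1" using d xy by simp
 have a1: "a e (e *. x) (e *. (Suc y)) = upd e (a e (e *. x) (e *. y)) (b e (e *. x) (e *. y))"
  and b1: "b e (e *. (Suc x)) (e *. y) = b e (e *. x) (e *. y) * cis (e * (a e (e *. x) (e *. y) + a e (e *. x) (e *. (Suc y))) / 2)"
  using d[THEN conjunct2, rule_format, OF xy] by blast+
 show "Af a e i x (Suc y) = Af a e i x y * mob (e\<^sup>2 / 4) (bf b e i x y * Af a e i x y)"
  unfolding Af_def bf_def a1 by (rule upd_unit(2)[OF e nb])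
 show "bf b e i (Suc x) y = bf b e i x y * Af a e i x y * Af a e i x (Suc y)"
  unfolding Af_def bf_def b1 cis_half by (simp add: mult.assoc)
qed

lemma data_bd:
 assumes sm: "smooth_on_interval r a0" "smooth_on_interval r b0"
  and D: "!!e. e : E ==> discrete_data e r (a e) (b e)" "!!e. e : E ==> discrete_boundary e r a0 b0 (a e) (b e)"
 shows "bd k 1 0 (al (Af a))" "bd k 0 1 (bf b)"
  "nearO 1 0 (%e i x y. al (Af a) e i x 0) (%i X Y. \<i> / 2 * of_real (a0 X))"
  "nearO 0 1 (%e i x y. bf b e i 0 y) (%i X Y. b0 Y)"
proof -
 have a: "al (Af a) e i x 0 = (cis (e * a0 (e *. x) / 2) - 1) / of_real e" if "e : E" "x + 1 <= N e" for e i x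
  using D(2)[OF that(1)] that by (simp add: discrete_boundary_def grid1_all al_def Af_def)
 have b: "bf b e i 0 y = b0 (e *. y)" if "e : E" "y + 1 <= N e" for e i y
  using D(2)[OF that(1)] that by (simp add: discrete_boundary_def grid1_all bf_def)
 have A0: "bd k 1 0 (%e i x y. al (Af a) e i x 0)" for k
  by (rule bd_cong[OF bd_cis[where tau = "%e. e", OF bd_sample[OF sm(1)]]]) (use a E_bounds in auto)
 have B0: "bd k 0 1 (%e i x y. bf b e i 0 y)" for k
  by (rule bd_cong[OF bd_sample_y[OF sm(2)]]) (use b in auto)
 have ds: "dsys (Af a) (bf b)" by (rule data_dsys[OF D(1)])
 show "bd k 1 0 (al (Af a))" "bd k 0 1 (bf b)" using dsys_bd[OF ds A0 B0] by blast+
 have "bdd 1 0 (%e i x y. a0 (e *. x))" using bd_sample[OF sm(1), of 0 1 0] by simp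
 then obtain C where C: "C > 0" "!!e (i::'i) x (y::nat). e : E ==> i : I ==> x + 1 <= N e ==> y + 0 <= N e ==> norm (a0 (e *. x)) <= C" by (rule bddE) blast
 show "nearO 1 0 (%e i x y. al (Af a) e i x 0) (%i X Y. \<i> / 2 * of_real (a0 X))"
 proof (rule nearI[where C = "(C / 2)\<^sup>2"])
  fix e i x y assume *: "e : E" "i : I" "x + 1 <= N e" "y + 0 <= N e"
  have e: "e > 0" using E_bounds * by auto
  let ?t = "e * a0 (e *. x) / 2"
  have "al (Af a) e i x 0 - \<i> / 2 * of_real (a0 (e *. x)) = (cis ?t - 1 - \<i> * of_real ?t) / of_real e"
   using e by (simp add: a[OF *(1,3)] field_simps)
  then have "norm (al (Af a) e i x 0 - \<i> / 2 * of_real (a0 (e *. x))) = norm (cis ?t - 1 - \<i> * of_real ?t) / e"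
   using e by (simp add: norm_divide del: of_real_mult of_real_divide)
  also have "\<dots> <= ?t\<^sup>2 / e" using e by (intro divide_right_mono cis_bound2) auto
  also have "\<dots> = (a0 (e *. x) / 2)\<^sup>2 * e" using e by (simp add: power2_eq_square)
  also have "\<dots> <= (C / 2)\<^sup>2 * e" using C(2)[OF *] e
   by (intro mult_right_mono abs_le_square_iff[THEN iffD1]) auto
  finally show "norm (al (Af a) e i x 0 - \<i> / 2 * of_real (a0 (e *. x))) <= (C / 2)\<^sup>2 * e" .
 qed simp
 show "nearO 0 1 (%e i x y. bf b e i 0 y) (%i X Y. b0 Y)"
  by (rule nearI[where C = 0]) (use b E_bounds in auto)
qed

lemma data_near:
 assumes sm: "smooth_on_interval r a0" "smooth_on_interval r b0"
  and D: "!!e. e : E ==> discrete_data e r (a e) (b e)" "!!e. e : E ==> discrete_boundary e r a0 b0 (a e) (b e)"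
  and SG: "sine_Gordon r phi" and GD: "Goursat_data r a0 b0 phi"
 shows "nearO 1 0 (al (Af a)) (vv phi)" "nearO 0 1 (bf b) (%i. phi)"
proof -
 note B = data_bd[OF sm D]
 have b0: "bdd 1 0 (al (Af a))" using B(1)[of 0] by simp
 have 1: "nearO 1 0 (%e i x y. al (Af a) e i x 0) (%i X Y. vv phi i X 0)"
  by (rule near_cong[OF B(3)]) (use GD in \<open>auto simp: vv_def Goursat_data_def\<close>)
 have 2: "nearO 0 1 (%e i x y. bf b e i 0 y) (%i X Y. phi 0 Y)"
  by (rule near_cong[OF B(4)]) (use GD in \<open>auto simp: Goursat_data_def\<close>)
 show "nearO 1 0 (al (Af a)) (vv phi)" "nearO 0 1 (bf b) (%i. phi)"
  by (rule dsys_near[OF data_dsys[OF D(1)] b0 sine_Gordon_sys[OF SG] 1 2], assumption)+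
qed

text \<open>Differencing never mixes step sizes, so the step inside \<open>Fe e\<close> may be
  frozen. This connects \<open>dq_D\<close>, where the sampled function is fixed, with a family
  whose function varies with the step.\<close>

lemma D_local: "(!!x y. u e i x y = u' e i x y) ==> D m n u e i x y = D m n u' e i x y"
proof -
 assume u: "!!x y. u e i x y = u' e i x y"
 have "(dy ^^ n) u e i x y = (dy ^^ n) u' e i x y" for x y by (induction n arbitrary: x y) (simp_all add: u dy_def)
 then show ?thesis by (induction m arbitrary: x) (simp_all add: dx_def)
qed

lemma approximatesI:
 fixes Fe :: "real => ('i, real^3) field2"
 assumes bd: "!!k. bd k 0 0 (%e i x y. Fe e i (e *. x) (e *. y))"
  and near: "nearO 0 0 (%e i x y. Fe e i (e *. x) (e *. y)) F"
  and cont: "!!i. i : I ==> cont2 (F i)"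
 shows "approximates r E I Fe F"
 unfolding approximates_def
proof (intro conjI allI impI)
 obtain C where C: "C > 0" "!!e i x y. e : E ==> i : I ==> x + 0 <= N e ==> y + 0 <= N e ==>
    norm (Fe e i (e *. x) (e *. y) - F i (e *. x) (e *. y)) <= C * e" using near by (rule nearE) blast
 show "EX C. ALL e:E. ALL i:I. ALL x:grid e r. ALL y:grid e r. norm (Fe e i x y - F i x y) <= C * e"
  using C(2) by (intro exI[of _ C] ballI) (auto simp: grid_iff)
 have "EX g. (ALL i:I. jet (g i)) & (ALL i:I. ALL X:{0..r}. ALL Y:{0..r}. g i 0 0 X Y = F i X Y) &
  (ALL m n. uclose m n (%e i x y. Fe e i (e *. x) (e *. y)) g)"
 proof (rule smooth_approximation[OF bd near cont], assumption)
  fix g assume g: "!!i. i : I ==> jet (g i)"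
   "!!i X Y. i : I ==> X : {0..r} ==> Y : {0..r} ==> g i 0 0 X Y = F i X Y"
   "!!m n. uclose m n (%e i x y. Fe e i (e *. x) (e *. y)) g"
  show ?thesis
  proof (rule exI[of _ g], intro conjI ballI allI)
   show "jet (g i)" if "i : I" for i by (rule g(1)[OF that])
   show "g i 0 0 X Y = F i X Y" if "i : I" "X : {0..r}" "Y : {0..r}" for i X Y by (rule g(2)[OF that])
   show "uclose m n (%e i x y. Fe e i (e *. x) (e *. y)) g" for m n by (rule g(3))
  qed
 qed
 then obtain g where gg: "(ALL i:I. jet (g i)) & (ALL i:I. ALL X:{0..r}. ALL Y:{0..r}. g i 0 0 X Y = F i X Y) &
  (ALL m n. uclose m n (%e i x y. Fe e i (e *. x) (e *. y)) g)" by (elim exE) (rule that)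
 note g = gg[THEN conjunct1] gg[THEN conjunct2, THEN conjunct1] gg[THEN conjunct2, THEN conjunct2]
 fix m n and eta :: real assume "eta > 0"
 then have "EX e0>0. ALL e:E. e < e0 --> (ALL i:I. ALL x y. x + m <= N e --> y + n <= N e -->
   norm (D m n (%e i x y. Fe e i (e *. x) (e *. y)) e i x y - g i m n (e *. x) (e *. y)) <= eta)"
  by (rule g(3)[unfolded uclose_def, rule_format])
 then obtain e0 where e0: "e0 > 0" "ALL e:E. e < e0 --> (ALL i:I. ALL x y. x + m <= N e --> y + n <= N e -->
   norm (D m n (%e i x y. Fe e i (e *. x) (e *. y)) e i x y - g i m n (e *. x) (e *. y)) <= eta)"
  by (elim exE conjE) (rule that)
 show "EX e0>0. ALL e:E. e < e0 --> (ALL i:I. ALL x:grid e (r - real (m + n) * e). ALL y:grid e (r - real (m + n) * e).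
   norm ((dqx e ^^ m) ((dqy e ^^ n) (Fe e i)) x y - (pdx r ^^ m) ((pdy r ^^ n) (F i)) x y) <= eta)"
 proof (intro exI[of _ e0] conjI ballI impI e0(1))
  fix e i X Y assume e: "e : E" "e < e0" and i: "i : I" and XY: "X : grid e (r - real (m + n) * e)" "Y : grid e (r - real (m + n) * e)"
  obtain x where x: "X = e *. x" "x + (m + n) <= N e" using grid_cases[OF e(1) XY(1)] by blast
  obtain y where y: "Y = e *. y" "y + (m + n) <= N e" using grid_cases[OF e(1) XY(2)] by blast
  have sq: "X : {0..r}" "Y : {0..r}" using grid_in[OF e(1) x(2)] grid_in[OF e(1) y(2)] x y by auto
  have "(dqx e ^^ m) ((dqy e ^^ n) (Fe e i)) X Y = D m n (%e' i' x y. Fe e i (e' *. x) (e' *. y)) e i x y"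
   unfolding x(1) y(1) by (rule dq_D[OF E_bounds(1)[OF e(1)]])
  also have "\<dots> = D m n (%e i x y. Fe e i (e *. x) (e *. y)) e i x y" by (rule D_local) simp
  finally show "norm ((dqx e ^^ m) ((dqy e ^^ n) (Fe e i)) X Y - (pdx r ^^ m) ((pdy r ^^ n) (F i)) X Y) <= eta"
   using e0(2)[rule_format, OF e i, of x y] x y jet_pd[OF g(1)[rule_format, OF i] g(2)[rule_format, OF i, symmetric] sq, of m n] by simp
 qed
qed

text \<open>Limits of the same discrete family coincide; this takes the place of a uniqueness
  theorem for the Goursat problem.\<close>

lemma near_unique:
 assumes "nearO 0 0 u v" "nearO 0 0 u v'" and i: "i : I"
  and c: "cont2 (v i)" "cont2 (v' i)"
  and XY: "X : {0..r}" "Y : {0..r}"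
 shows "v i X Y = v' i X Y"
proof (rule eq_by_limit[OF c _ XY])
 fix X Y assume *: "0 <= X" "X < r" "0 <= Y" "Y < r"
 obtain es where es: "!!n. es n : E" "es \<longlonglongrightarrow> 0" using E_null by blast
 show "v i X Y = v' i X Y" by (rule LIMSEQ_unique[OF near_tendsto[OF es i assms(1) c(1) *] near_tendsto[OF es i assms(2) c(2) *]])
qed

end

context framed begin

definition Gf :: "(real => real => real => real => complex^2^2) => ('i, complex^2^2) family" where
 "Gf Psi e i x y = Psi e (e *. x) (e *. y) (lam i)"
definition Ff :: "(real => real => real => real => complex^2^2) => ('i, real^3) family" where
 "Ff Psi e i x y = immersion (lam i) (Psi e (e *. x) (e *. y))"

lemma frame_sys:
 assumes D: "!!e. e : E ==> discrete_data e r (a e) (b e)" "!!e. e : E ==> discrete_frame e r (a e) (b e) (Psi e)"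
 shows "psys (Af a) (bf b) (Gf Psi)" "ssys (Af a) (bf b) (Gf Psi) (Ff Psi)"
proof -
 show "psys (Af a) (bf b) (Gf Psi)"
  unfolding psys_def
 proof (intro ballI)
  fix e i assume *: "e : E" "i : I"
  note f = D(2)[OF *(1), unfolded discrete_frame_iff[OF *(1)], rule_format, OF lam(1)[OF *(2)]]
  show "Gf Psi e i 0 0 = mat 1 & (ALL x y. x + 1 <= N e --> y <= N e --> Gf Psi e i (Suc x) y = rotm (Af a e i x y) 1 (sU e i) ** Gf Psi e i x y) &
   (ALL x y. x <= N e --> y + 1 <= N e --> Gf Psi e i x (Suc y) = rotm 1 (- bf b e i x y) (sV e i) ** Gf Psi e i x y)"
   unfolding Gf_def Af_def bf_def sU_def sV_def using f by simp
 qed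
 show "ssys (Af a) (bf b) (Gf Psi) (Ff Psi)"
  unfolding ssys_def
 proof (intro ballI conjI allI impI)
  fix e i assume *: "e : E" "i : I"
  note f = discrete_log_deriv[OF *(1) D(1)[OF *(1)] D(2)[OF *(1)] lam(1)[OF *(2)]]
  have e: "e ~= 0" using E_bounds * by auto
  show "Ff Psi e i 0 0 = 0" using f(2) by (simp add: Ff_def)
  show "dx (Ff Psi) e i x y = (lam i / (1 + (sU e i)\<^sup>2)) *\<^sub>R Rot (Gf Psi e i x y) (hvec (cnj (Af a e i x y)))" if "x + 1 <= N e" "y <= N e" for x y
   unfolding dx_def Ff_def f(3)[OF that] Gf_def Af_def sU_def using e by simp
  show "dy (Ff Psi) e i x y = (1 / lam i / (1 + (sV e i)\<^sup>2)) *\<^sub>R Rot (Gf Psi e i x y) (hvec (bf b e i x y))" if "x <= N e" "y + 1 <= N e" for x y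
   unfolding dy_def Ff_def f(4)[OF that] Gf_def bf_def sV_def using e by simp
 qed
qed

lemma frame_cont:
 assumes fr: "frame r (angle_pdx r phi) phi Phi" and SG: "sine_Gordon r phi"
 shows "hasx (%i X Y. Phi X Y (lam i)) (%i X Y. ucf (vv phi) i X Y ** Phi X Y (lam i))"
  "hasy (%i X Y. Phi X Y (lam i)) (%i X Y. vcf (%i. phi) i X Y ** Phi X Y (lam i))"
  "lip (%i X Y. Phi X Y (lam i))"
  "!!i X Y. i : I ==> X : {0..r} ==> Y : {0..r} ==> Phi X Y (lam i) : SU2"
  "!!i. i : I ==> Phi 0 0 (lam i) = mat 1"
proof -
 note f = fr[unfolded frame_def, rule_format]
 have u: "ucf (vv phi) i X Y = U_mat (angle_pdx r phi X Y) (lam i)" for i X Y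
  by (simp add: ucf_def vv_def U_mat_def)
 have w: "vcf (%i. phi) i X Y = V_mat (phi X Y) (lam i)" for i X Y
  by (simp add: vcf_def V_mat_def)
 show x: "hasx (%i X Y. Phi X Y (lam i)) (%i X Y. ucf (vv phi) i X Y ** Phi X Y (lam i))"
  and y: "hasy (%i X Y. Phi X Y (lam i)) (%i X Y. vcf (%i. phi) i X Y ** Phi X Y (lam i))"
  unfolding hasx_def hasy_def u w using f lam(1) by blast+
 show S: "!!i X Y. i : I ==> X : {0..r} ==> Y : {0..r} ==> Phi X Y (lam i) : SU2"
  and "!!i. i : I ==> Phi 0 0 (lam i) = mat 1" using f lam(1) by blast+
 note sg = sine_Gordon_sys[OF SG]
 have c: "cbd (%i X Y. Phi X Y (lam i))" unfolding cbd_def using norm_SU2[OF S] by blast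
 show "lip (%i X Y. Phi X Y (lam i))"
  by (rule lip_of_derivs[OF x y c cbd_bilinear[OF bilinear_matmult lip_cbd[OF lip_ucf[OF sg(3)]] c] cbd_bilinear[OF bilinear_matmult lip_cbd[OF lip_vcf[OF sg(4)]] c]])
qed

text \<open>The immersion of the continuous frame is identified indirectly: the discrete immersions
  have a limit with the correct first derivatives, and half of it divided by the parameter satisfies
  the hypotheses of \<open>frame_log_deriv\<close>, hence is the logarithmic derivative of the
  frame.\<close>

theorem core:
 assumes sm: "smooth_on_interval r a0" "smooth_on_interval r b0"
  and D: "!!e. e : E ==> discrete_data e r (a e) (b e)" "!!e. e : E ==> discrete_boundary e r a0 b0 (a e) (b e)"
   "!!e. e : E ==> discrete_frame e r (a e) (b e) (Psi e)"
  and SG: "sine_Gordon r phi" and GD: "Goursat_data r a0 b0 phi" and fr: "frame r (angle_pdx r phi) phi Phi"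
 shows "!!k. bd k 0 0 (Gf Psi)" "!!k. bd k 0 0 (Ff Psi)"
  "nearO 0 0 (Gf Psi) (%i X Y. Phi X Y (lam i))"
  "nearO 0 0 (Ff Psi) (%i X Y. immersion (lam i) (Phi X Y))"
  "ssysc (%i. phi) (%i X Y. Phi X Y (lam i)) (%i X Y. immersion (lam i) (Phi X Y))"
  "!!i X Y. i : I ==> X : {0..r} ==> Y : {0..r} ==> EX K. log_deriv (lam i) (Phi X Y) K"
  "!!i. i : I ==> continuous_on ({0..r} \<times> {0..r}) (%(X, Y). immersion (lam i) (Phi X Y))"
proof -
 note ds = data_dsys[OF D(1)] and bds = data_bd[OF sm D(1,2)] and nr = data_near[OF sm D(1,2) SG GD]
 note ps = frame_sys(1)[OF D(1,3)] and ss = frame_sys(2)[OF D(1,3)]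
 note sg = sine_Gordon_sys[OF SG] and fc = frame_cont[OF fr SG]
 show "bd k 0 0 (Gf Psi)" "bd k 0 0 (Ff Psi)" for k
  by (rule psys_bd[OF ds ps bds(1,2)], assumption+) (rule ssys_bd[OF ds ps ss bds(1,2)], assumption+)
 show nG: "nearO 0 0 (Gf Psi) (%i X Y. Phi X Y (lam i))"
  by (rule psys_near[OF ds ps nr sg(3,4) fc(3,1,2,5)]) assumption+
 have sl: "EX g. jet g & g 0 0 0 0 = 0 & (ALL X:{0..r}. ALL Y:{0..r}.
   g 1 0 X Y = lam i *\<^sub>R Rot (Phi X Y (lam i)) (hvec 1) & g 0 1 X Y = (1 / lam i) *\<^sub>R Rot (Phi X Y (lam i)) (hvec (phi X Y)))" if "i : I" for i
  by (rule surface_limit[OF ds ps ss bds(1,2) nr(2) sg(4) fc(3) nG that]) assumption+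
 have ld: "EX g. jet g & g 0 0 0 0 = 0 & (ALL X:{0..r}. ALL Y:{0..r}.
   g 1 0 X Y = lam i *\<^sub>R Rot (Phi X Y (lam i)) (hvec 1) & g 0 1 X Y = (1 / lam i) *\<^sub>R Rot (Phi X Y (lam i)) (hvec (phi X Y))
   & log_deriv (lam i) (Phi X Y) ((1 / (2 * lam i)) *\<^sub>R g 0 0 X Y) & immersion (lam i) (Phi X Y) = g 0 0 X Y)" if i: "i : I" for i
 proof -
  obtain g where g: "jet g" "g 0 0 0 0 = 0" "!!X Y. X : {0..r} ==> Y : {0..r} ==> g 1 0 X Y = lam i *\<^sub>R Rot (Phi X Y (lam i)) (hvec 1)"
   "!!X Y. X : {0..r} ==> Y : {0..r} ==> g 0 1 X Y = (1 / lam i) *\<^sub>R Rot (Phi X Y (lam i)) (hvec (phi X Y))"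
   using sl[OF i] by blast
  note l = lam(1)[OF i]
  have lg: "log_deriv (lam i) (Phi X Y) ((1 / (2 * lam i)) *\<^sub>R g 0 0 X Y)" if "X : {0..r}" "Y : {0..r}" for X Y
  proof (rule frame_log_deriv[OF fr l _ _ _ _ that])
   fix X Y assume XY: "X : {0..r}" "Y : {0..r}"
   show "norm (phi X Y) = 1" using SG XY by (auto simp: sine_Gordon_def smooth_angle_def)
   have d: "derx (g 0 0) (g 1 0 X Y) X Y" "dery (g 0 0) (g 0 1 X Y) X Y"
    using g(1) XY by (auto simp: jet_def)
   note d' = d[THEN has_vector_derivative_linear[OF bounded_linear_scaleR_right[of "1 / (2 * lam i)"]]]
   show "((%s. (1 / (2 * lam i)) *\<^sub>R g 0 0 s Y) has_vector_derivative (1 / 2) *\<^sub>R Rot (Phi X Y (lam i)) (hvec 1)) (at X within {0..r})"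
    using d'(1) l unfolding g(3)[OF XY] by simp
   show "((%s. (1 / (2 * lam i)) *\<^sub>R g 0 0 X s) has_vector_derivative (1 / (2 * (lam i)\<^sup>2)) *\<^sub>R Rot (Phi X Y (lam i)) (hvec (phi X Y))) (at Y within {0..r})"
    using d'(2) l unfolding g(4)[OF XY] by (simp add: power2_eq_square mult.assoc)
  qed (simp add: g(2))
  then have "immersion (lam i) (Phi X Y) = g 0 0 X Y" if "X : {0..r}" "Y : {0..r}" for X Y
   using immersion_eq[OF lg[OF that]] l by simp
  with g lg show ?thesis by (intro exI[of _ g]) simp
 qed
 show "!!i X Y. i : I ==> X : {0..r} ==> Y : {0..r} ==> EX K. log_deriv (lam i) (Phi X Y) K" using ld by blast
 have hx: "((%s. immersion (lam i) (Phi s Y)) has_vector_derivative lam i *\<^sub>R Rot (Phi X Y (lam i)) (hvec 1)) (at X within {0..r}) &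
   ((%s. immersion (lam i) (Phi X s)) has_vector_derivative (1 / lam i) *\<^sub>R Rot (Phi X Y (lam i)) (hvec (phi X Y))) (at Y within {0..r}) &
   immersion (lam i) (Phi 0 0) = 0 & continuous_on ({0..r} \<times> {0..r}) (%(X, Y). immersion (lam i) (Phi X Y))"
  if i: "i : I" and XY: "X : {0..r}" "Y : {0..r}" for i X Y
 proof -
  obtain g where g: "jet g" "g 0 0 0 0 = 0" "!!X Y. X : {0..r} ==> Y : {0..r} ==> g 1 0 X Y = lam i *\<^sub>R Rot (Phi X Y (lam i)) (hvec 1)"
   "!!X Y. X : {0..r} ==> Y : {0..r} ==> g 0 1 X Y = (1 / lam i) *\<^sub>R Rot (Phi X Y (lam i)) (hvec (phi X Y))"
   "!!X Y. X : {0..r} ==> Y : {0..r} ==> immersion (lam i) (Phi X Y) = g 0 0 X Y"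
   using ld[OF i] by blast
  have d: "derx (g 0 0) (g 1 0 X Y) X Y" "dery (g 0 0) (g 0 1 X Y) X Y"
   using g(1) XY by (auto simp: jet_def)
  have "continuous_on ({0..r} \<times> {0..r}) (%(X, Y). immersion (lam i) (Phi X Y))"
   by (rule continuous_on_eq[OF jet_cont[OF g(1)]]) (use g(5) in auto)
  then show ?thesis unfolding g(3,4)[OF XY, symmetric]
   using has_vector_derivative_transform[OF XY(1) _ d(1), of "%s. immersion (lam i) (Phi s Y)"]
    has_vector_derivative_transform[OF XY(2) _ d(2), of "%s. immersion (lam i) (Phi X s)"] g(2,5) XY r_pos by simp
 qed
 have 0: "0 : {0..r}" using r_pos by simp
 show sc: "ssysc (%i. phi) (%i X Y. Phi X Y (lam i)) (%i X Y. immersion (lam i) (Phi X Y))"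
  unfolding ssysc_def hasx_def hasy_def using hx hx[OF _ 0 0] by blast
 show "!!i. i : I ==> continuous_on ({0..r} \<times> {0..r}) (%(X, Y). immersion (lam i) (Phi X Y))" using hx[OF _ 0 0] by blast
 have a0: "bdd 1 0 (al (Af a))" using bds(1)[of 0] by simp
 show "nearO 0 0 (Ff Psi) (%i X Y. immersion (lam i) (Phi X Y))"
  by (rule ssys_near[OF ds ps ss a0 nr(2) sg(4) fc(3) nG sc]) assumption+
qed

end

text \<open>Differentiating the conjugation produces the commutator with the connection matrix, and
  under \<open>su2_of_vec\<close> a commutator is twice a cross product.\<close>

lemma Rot_derivative:
 assumes f: "(f has_vector_derivative su2_of_vec u ** f s) (at s within T)" and w: "(w has_vector_derivative w') (at s within T)"
 shows "((%s. Rot (f s) (w s)) has_vector_derivative Rot (f s) (w' + 2 *\<^sub>R cross3 (w s) u)) (at s within T)"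
proof -
 interpret mm: bounded_bilinear "(**) :: complex^2^2 => complex^2^2 => complex^2^2" by (rule bilinear_matmult)
 interpret su: bounded_linear su2_of_vec by (rule bounded_linear_su2_of_vec)
 have adj: "adj (su2_of_vec u) = - su2_of_vec u" by (simp add: su2_of_vec_def mat2_minus complex_eq_iff)
 have cr: "su2_of_vec (w' + 2 *\<^sub>R cross3 (w s) u) = su2_of_vec w' + (su2_of_vec (w s) ** su2_of_vec u - su2_of_vec u ** su2_of_vec (w s))"
  unfolding su2_mult su.add su.scaleR cross_skew[of u] su.neg by (simp add: inner_commute scaleR_2)
 have "((%s. Rot (f s) (w s)) has_vector_derivative vec_of_su2 (adj (f s) ** su2_of_vec (w s) ** (su2_of_vec u ** f s) +
   (adj (f s) ** su2_of_vec w' + adj (su2_of_vec u ** f s) ** su2_of_vec (w s)) ** f s)) (at s within T)"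
  unfolding Rot_def
  by (intro has_vector_derivative_linear[OF bounded_linear_vec_of_su2] mm.has_vector_derivative f w
    has_vector_derivative_linear[OF bounded_linear_adj] has_vector_derivative_linear[OF bounded_linear_su2_of_vec])
 moreover have "adj (f s) ** su2_of_vec (w s) ** (su2_of_vec u ** f s) +
   (adj (f s) ** su2_of_vec w' + adj (su2_of_vec u ** f s) ** su2_of_vec (w s)) ** f s
  = adj (f s) ** su2_of_vec (w' + 2 *\<^sub>R cross3 (w s) u) ** f s"
  unfolding cr by (simp add: adj_mult adj mm.add_left mm.add_right mm.diff_left mm.diff_right mm.minus_left mm.minus_right matrix_mul_assoc)
 ultimately show ?thesis by (simp add: Rot_def)
qed


lemma smooth_interval_continuous: "smooth_on_interval r h ==> continuous_on {0..r} h"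
proof -
 assume "smooth_on_interval r h"
 then obtain g where g: "ALL t:{0..r}. g 0 t = h t" "!!n t. t : {0..r} ==> (g n has_vector_derivative g (Suc n) t) (at t within {0..r})"
  unfolding smooth_on_interval_def by blast
 have "continuous_on {0..r} (g 0)"
  unfolding continuous_on_eq_continuous_within using g(2) has_vector_derivative_continuous by blast
 then show ?thesis by (rule continuous_on_eq) (use g(1) in auto)
qed

context meshed begin

lemma discrete_families:
 assumes "ALL y:{0..r}. norm (b0 y) = 1"
 shows "EX a b Psi. ALL e:E. discrete_data e r (a e) (b e) & discrete_boundary e r a0 b0 (a e) (b e) & discrete_frame e r (a e) (b e) (Psi e)"
proof -
 have "ALL e:E. EX a b Psi. discrete_data e r a b & discrete_boundary e r a0 b0 a b & discrete_frame e r a b Psi"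
  using discrete_data_exists[OF _ assms, of _ a0] discrete_frame_exists by meson
 then show ?thesis by metis
qed

lemma Goursat_exists:
 assumes sm: "smooth_on_interval r a0" "smooth_on_interval r b0" and b0: "ALL y:{0..r}. norm (b0 y) = 1" and i: "i : I"
 shows "EX phi. sine_Gordon r phi & Goursat_data r a0 b0 phi"
proof -
 obtain a b where D: "!!e. e : E ==> discrete_data e r (a e) (b e)" "!!e. e : E ==> discrete_boundary e r a0 b0 (a e) (b e)"
  using discrete_data_exists[OF _ b0, of _ a0] by metis
 note B = data_bd[OF sm D]
 have "EX g h. jet g & jet h & (ALL X:{0..r}. g 0 0 X 0 = \<i> / 2 * of_real (a0 X)) & (ALL Y:{0..r}. h 0 0 0 Y = b0 Y) &
  (ALL X:{0..r}. ALL Y:{0..r}. norm (h 0 0 X Y) = 1 & Re (g 0 0 X Y) = 0 &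
   g 0 1 X Y = (1 / 4) * (h 0 0 X Y - cnj (h 0 0 X Y)) & h 1 0 X Y = h 0 0 X Y * (2 * g 0 0 X Y))"
  by (rule Goursat_limit[where ?v0.0 = "%i X. \<i> / 2 * of_real (a0 X)" and ?z0.0 = "%i. b0", OF data_dsys[OF D(1)] i B(1,2,3,4)])
   (assumption | intro continuous_intros smooth_interval_continuous sm)+
 then obtain g h where g: "jet g" and h: "jet h" and bc: "ALL X:{0..r}. g 0 0 X 0 = \<i> / 2 * of_real (a0 X)" "ALL Y:{0..r}. h 0 0 0 Y = b0 Y"
  and n: "ALL X:{0..r}. ALL Y:{0..r}. norm (h 0 0 X Y) = 1"
  and eq: "!!X Y. X : {0..r} ==> Y : {0..r} ==> Re (g 0 0 X Y) = 0 & g 0 1 X Y = (1 / 4) * (h 0 0 X Y - cnj (h 0 0 X Y)) & h 1 0 X Y = h 0 0 X Y * (2 * g 0 0 X Y)"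
  by blast
 define phi where "phi = h 0 0"
 have h0: "ALL X:{0..r}. ALL Y:{0..r}. h 0 0 X Y = phi X Y" and n': "ALL X:{0..r}. ALL Y:{0..r}. norm (phi X Y) = 1" using n by (simp_all add: phi_def)
 note aj = angle_jet[OF h h0 n'] and am = angle_mixed[OF h h0 n']
 have a: "angle_pdx r phi X Y = 2 * Im (g 0 0 X Y)" if XY: "X : {0..r}" "Y : {0..r}" for X Y
 proof -
  have "cnj (h 0 0 X Y) * h 1 0 X Y = (h 0 0 X Y * cnj (h 0 0 X Y)) * (2 * g 0 0 X Y)"
   unfolding eq[OF XY, THEN conjunct2, THEN conjunct2] by (simp only: mult_ac)
  also have "h 0 0 X Y * cnj (h 0 0 X Y) = 1" using n XY by (intro cnj_unit) blast
  finally have "cnj (h 0 0 X Y) * h 1 0 X Y = 2 * g 0 0 X Y" by simp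
  then show ?thesis unfolding aj(1)[OF XY] by simp
 qed
 \<comment> \<open>The limit system controls the y-derivative of \<open>angle_pdx\<close>; symmetry
   of the mixed derivatives converts this to the order used in \<open>sine_Gordon\<close>.\<close>
 have sg: "pdx r (angle_pdy r phi) X Y = Im (phi X Y)" if XY: "X : {0..r}" "Y : {0..r}" for X Y
 proof -
  have "dery (g 0 0) (g 0 1 X Y) X Y" using g XY by (auto simp: jet_def)
  then have "((%s. 2 * Im (g 0 0 X s)) has_vector_derivative 2 * Im (g 0 1 X Y)) (at Y within {0..r})"
   by (rule has_vector_derivative_linear[OF bounded_linear_compose[OF bounded_linear_mult_right[of 2] bounded_linear_Im]])
  then have "pdy r (angle_pdx r phi) X Y = 2 * Im (g 0 1 X Y)"
   by (rule pdy_eq[where g = "%X s. 2 * Im (g 0 0 X s)"]) (use XY a in auto)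
  moreover have "pdy r (angle_pdx r phi) X Y = Im (cnj (h 0 0 X Y) * h 1 1 X Y)"
   by (rule pdy_eq[where g = "angle_pdx r phi", OF am(1)[OF XY] XY(2)]) simp
  moreover have "pdx r (angle_pdy r phi) X Y = Im (cnj (h 0 0 X Y) * h 1 1 X Y)"
   by (rule pdx_eq[where g = "angle_pdy r phi", OF am(2)[OF XY] XY(1)]) simp
  moreover have "g 0 1 X Y = (1 / 4) * (h 0 0 X Y - cnj (h 0 0 X Y))" using eq[OF XY] by blast
  then have "2 * Im (g 0 1 X Y) = Im (phi X Y)" by (simp only: phi_def) simp
  ultimately show ?thesis by simp
 qed
 have "sine_Gordon r phi"
  unfolding sine_Gordon_def smooth_angle_def using jet_imp_smooth[OF h, of phi] n' sg by (auto simp: phi_def)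
 moreover have "Goursat_data r a0 b0 phi"
  unfolding Goursat_data_def
 proof (intro conjI ballI)
  fix x assume x: "x : {0..r}"
  have "g 0 0 x 0 = \<i> / 2 * of_real (a0 x)" using bc(1) x by blast
  then have "2 * Im (g 0 0 x 0) = a0 x" by (simp only:) simp
  then show "angle_pdx r phi x 0 = a0 x" using r_pos a[OF x, of 0] by simp
 qed (use bc(2) in \<open>auto simp: phi_def\<close>)
 ultimately show ?thesis by blast
qed

end

context framed begin

lemma frame_exists:
 assumes sm: "smooth_on_interval r a0" "smooth_on_interval r b0" and b0: "ALL y:{0..r}. norm (b0 y) = 1" and i: "i : I"
  and SG: "sine_Gordon r phi" and GD: "Goursat_data r a0 b0 phi"
 shows "EX G. G 0 0 = mat 1 & (ALL x:{0..r}. ALL y:{0..r}. G x y : SU2 &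
   derx G (U_mat (angle_pdx r phi x y) (lam i) ** G x y) x y &
   dery G (V_mat (phi x y) (lam i) ** G x y) x y)"
proof -
 obtain a b Psi where D: "!!e. e : E ==> discrete_data e r (a e) (b e)" "!!e. e : E ==> discrete_boundary e r a0 b0 (a e) (b e)"
  and D3: "!!e. e : E ==> discrete_frame e r (a e) (b e) (Psi e)"
  using discrete_families[OF b0, of a0] by metis
 note sg = sine_Gordon_sys[OF SG] and B = data_bd[OF sm D] and nr = data_near[OF sm D SG GD]
 have "EX g. jet g & g 0 0 0 0 = mat 1 & (ALL X:{0..r}. ALL Y:{0..r}. g 0 0 X Y : SU2 &
   g 1 0 X Y = ucf (vv phi) i X Y ** g 0 0 X Y & g 0 1 X Y = vcf (%i. phi) i X Y ** g 0 0 X Y)"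
  by (rule frame_limit[OF data_dsys[OF D(1)] frame_sys(1)[OF D(1) D3] B(1,2) nr sg(3,4) i]) assumption+
 then obtain g where g: "jet g" "g 0 0 0 0 = mat 1" "!!X Y. X : {0..r} ==> Y : {0..r} ==> g 0 0 X Y : SU2 &
   g 1 0 X Y = ucf (vv phi) i X Y ** g 0 0 X Y & g 0 1 X Y = vcf (%i. phi) i X Y ** g 0 0 X Y" by blast
 have u: "ucf (vv phi) i X Y = U_mat (angle_pdx r phi X Y) (lam i)" and w: "vcf (%i. phi) i X Y = V_mat (phi X Y) (lam i)" for X Y
  by (simp_all add: ucf_def vv_def U_mat_def vcf_def V_mat_def)
 show ?thesis
 proof (intro exI[of _ "g 0 0"] conjI ballI g(2))
  fix x y assume xy: "x : {0..r}" "y : {0..r}"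
  show "g 0 0 x y : SU2" using g(3)[OF xy] by blast
  have "derx (g 0 0) (g 1 0 x y) x y" "dery (g 0 0) (g 0 1 x y) x y"
   using g(1) xy by (auto simp: jet_def)
  then show "derx (g 0 0) (U_mat (angle_pdx r phi x y) (lam i) ** g 0 0 x y) x y"
   "dery (g 0 0) (V_mat (phi x y) (lam i) ** g 0 0 x y) x y"
   using g(3)[OF xy] unfolding u w by metis+
 qed
qed

lemma U_mat_su2: "U_mat a 1 = su2_of_vec (vector [1 / 2, 0, - a / 2])"
 and V_mat_su2: "V_mat b 1 = su2_of_vec (hvec (- b / 2))"
 by (simp_all add: U_mat_def V_mat_def su2_of_vec_def hvec_def complex_eq_iff)

lemma surface_asymptotic:
 assumes sm: "smooth_on_interval r a0" "smooth_on_interval r b0" and b0: "ALL y:{0..r}. norm (b0 y) = 1"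
  and i: "i : I" "lam i = 1"
  and SG: "sine_Gordon r phi" and GD: "Goursat_data r a0 b0 phi" and fr: "frame r (angle_pdx r phi) phi Phi"
 shows "asymptotic_K_surface r phi (%X Y. immersion 1 (Phi X Y))"
proof -
 obtain a b Psi where D: "!!e. e : E ==> discrete_data e r (a e) (b e)" "!!e. e : E ==> discrete_boundary e r a0 b0 (a e) (b e)"
  "!!e. e : E ==> discrete_frame e r (a e) (b e) (Psi e)"
  using discrete_families[OF b0, of a0] by metis
 note co = core[OF sm D SG GD fr] and fc = frame_cont[OF fr SG]
 \<comment> \<open>The negative third axis, because \<open>hvec\<close> contains a conjugation: with
   this sign \<open>cross3 (hvec 1) (hvec w)\<close> is \<open>Im w\<close> times
   \<open>n3\<close>.\<close>
 define n3 :: "real^3" where "n3 = vector [0, 0, -1]"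
 let ?F = "%X Y. immersion 1 (Phi X Y)" let ?N = "%X Y. Rot (Phi X Y 1) n3" let ?P = "%X Y. Phi X Y 1"
 \<comment> \<open>\<open>frame\<close> provides first derivatives only; smoothness of the surface
   is inherited from the discrete family that approximates it. The normal field below is treated in
   the same way.\<close>
 have sF: "smooth_on_square r ?F"
 proof (rule smooth_approximation[OF co(2,4,7)], assumption)
  fix g assume g: "!!i. i : I ==> jet (g i)" "!!i X Y. i : I ==> X : {0..r} ==> Y : {0..r} ==> g i 0 0 X Y = immersion (lam i) (Phi X Y)"
  show ?thesis by (rule jet_imp_smooth[OF g(1)[OF i(1)]]) (simp add: g(2)[OF i(1)] i(2))
 qed
 have lN: "lip (%i X Y. Rot (Phi X Y (lam i)) n3)" by (intro lip_Rot fc(3) lip_const)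
 have bG: "bdd 0 0 (Gf Psi)" using co(1)[of 0] by simp
 have we: "!!e i x y. (e::real) <= e" by simp
 have bN: "bd k 0 0 (%e i x y. Rot (Gf Psi e i x y) n3)" for k by (intro bd_Rot co(1) bd_const)
 have b3: "bdd 0 0 (%e i x y. n3)" by (rule bddI[of _ _ _ "norm n3"]) simp
 have nN: "nearO 0 0 (%e i x y. Rot (Gf Psi e i x y) n3) (%i X Y. Rot (Phi X Y (lam i)) n3)"
  by (intro near_Rot co(3) near_one[OF we] bG b3 fc(3) lip_const)
 have sN: "smooth_on_square r ?N"
 proof (rule smooth_approximation[OF bN nN lip_continuous[OF lN]], assumption)
  fix g assume g: "!!i. i : I ==> jet (g i)" "!!i X Y. i : I ==> X : {0..r} ==> Y : {0..r} ==> g i 0 0 X Y = Rot (Phi X Y (lam i)) n3"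
  show ?thesis by (rule jet_imp_smooth[OF g(1)[OF i(1)]]) (simp add: g(2)[OF i(1)] i(2))
 qed
 have S: "?P X Y : SU2" if "X : {0..r}" "Y : {0..r}" for X Y using fc(4)[OF i(1) that] i(2) by simp
 have sc: "derx ?F (Rot (?P X Y) (hvec 1)) X Y"
  "dery ?F (Rot (?P X Y) (hvec (phi X Y))) X Y" if "X : {0..r}" "Y : {0..r}" for X Y
  using co(5) i that unfolding ssysc_def hasx_def hasy_def by (auto dest!: bspec[of _ _ i])
 have px: "pdx r ?F X Y = Rot (?P X Y) (hvec 1)" if "X : {0..r}" "Y : {0..r}" for X Y
  by (rule pdx_eq[where g = ?F, OF sc(1)[OF that] that(1)]) simp
 have py: "pdy r ?F X Y = Rot (?P X Y) (hvec (phi X Y))" if "X : {0..r}" "Y : {0..r}" for X Y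
  by (rule pdy_eq[where g = ?F, OF sc(2)[OF that] that(2)]) simp
 obtain h where h: "jet h" "!!X Y. X : {0..r} ==> Y : {0..r} ==> h 0 0 X Y = phi X Y"
  by (rule smooth_imp_jet[of phi]) (use SG in \<open>auto simp: sine_Gordon_def smooth_angle_def\<close>)
 have hd: "((%s. hvec (phi s Y)) has_vector_derivative hvec (h 1 0 X Y)) (at X within {0..r})"
  "((%s. hvec (phi X s)) has_vector_derivative hvec (h 0 1 X Y)) (at Y within {0..r})" if XY: "X : {0..r}" "Y : {0..r}" for X Y
 proof -
  have "derx (h 0 0) (h 1 0 X Y) X Y" "dery (h 0 0) (h 0 1 X Y) X Y"
   using h(1) XY by (auto simp: jet_def)
  then have d: "derx phi (h 1 0 X Y) X Y" "dery phi (h 0 1 X Y) X Y"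
   using XY h(2) by (auto intro: has_vector_derivative_transform[rotated 2])
  show "((%s. hvec (phi s Y)) has_vector_derivative hvec (h 1 0 X Y)) (at X within {0..r})"
   "((%s. hvec (phi X s)) has_vector_derivative hvec (h 0 1 X Y)) (at Y within {0..r})"
   by (rule has_vector_derivative_linear[OF bounded_linear_hvec d(1)], rule has_vector_derivative_linear[OF bounded_linear_hvec d(2)])
 qed
 have fx: "derx ?P (su2_of_vec (vector [1 / 2, 0, - angle_pdx r phi X Y / 2]) ** ?P X Y) X Y"
  and fy: "dery ?P (su2_of_vec (hvec (- phi X Y / 2)) ** ?P X Y) X Y" if "X : {0..r}" "Y : {0..r}" for X Y
  using fr that unfolding frame_def U_mat_su2[symmetric] V_mat_su2[symmetric] by (auto dest!: spec[of _ "1::real"])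
 show ?thesis
  unfolding asymptotic_K_surface_def
 proof (intro conjI sF exI[of _ ?N] sN ballI impI)
  fix X Y assume XY: "X : {0..r}" "Y : {0..r}"
  note S = S[OF XY]
  have n: "norm (phi X Y) = 1" using SG XY by (auto simp: sine_Gordon_def smooth_angle_def)
  have cs: "(Re (phi X Y))\<^sup>2 + (Im (phi X Y))\<^sup>2 = 1" using n by (simp add: cmod_def)
  note simps = inner_vec_def sum_3 hvec_def n3_def cross3_def
  show nx: "norm (pdx r ?F X Y) = 1" "norm (pdy r ?F X Y) = 1" by (simp_all add: px[OF XY] py[OF XY] norm_Rot[OF S] n)
  have "norm n3 = 1" by (simp add: norm_eq_sqrt_inner simps)
  then show "norm (?N X Y) = 1" by (simp add: norm_Rot[OF S])
  show "?N X Y \<bullet> pdx r ?F X Y = 0" "?N X Y \<bullet> pdy r ?F X Y = 0" "pdx r ?F X Y \<bullet> pdy r ?F X Y = Re (phi X Y)"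
   unfolding px[OF XY] py[OF XY] inner_Rot[OF S] by (simp_all add: simps)
  have "cross3 (hvec 1) (hvec (phi X Y)) = Im (phi X Y) *\<^sub>R n3" by (simp add: simps vec_eq_iff forall_3)
  then show "cross3 (pdx r ?F X Y) (pdy r ?F X Y) = Im (phi X Y) *\<^sub>R ?N X Y"
   by (simp add: px[OF XY] py[OF XY] cross_Rot[OF S] bounded_linear.linear[OF bounded_linear_Rot, THEN linear_scale])
  have pxx: "pdx r (pdx r ?F) X Y = Rot (?P X Y) (0 + 2 *\<^sub>R cross3 (hvec 1) (vector [1 / 2, 0, - angle_pdx r phi X Y / 2]))"
   by (rule pdx_eq[where g = "%X Y. Rot (?P X Y) (hvec 1)", OF Rot_derivative[OF fx[OF XY] has_vector_derivative_const] XY(1)])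
    (use XY px in auto)
  have pyy: "pdy r (pdy r ?F) X Y = Rot (?P X Y) (hvec (h 0 1 X Y) + 2 *\<^sub>R cross3 (hvec (phi X Y)) (hvec (- phi X Y / 2)))"
   by (rule pdy_eq[where g = "%X Y. Rot (?P X Y) (hvec (phi X Y))", OF Rot_derivative[OF fy[OF XY] hd(2)[OF XY]] XY(2)])
    (use XY py in auto)
  have pxy: "pdx r (pdy r ?F) X Y = Rot (?P X Y) (hvec (h 1 0 X Y) + 2 *\<^sub>R cross3 (hvec (phi X Y)) (vector [1 / 2, 0, - angle_pdx r phi X Y / 2]))"
   by (rule pdx_eq[where g = "%X Y. Rot (?P X Y) (hvec (phi X Y))", OF Rot_derivative[OF fx[OF XY] hd(1)[OF XY]] XY(1)])
    (use XY py in auto)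
  show 1: "pdx r (pdx r ?F) X Y \<bullet> ?N X Y = 0" and 2: "pdy r (pdy r ?F) X Y \<bullet> ?N X Y = 0"
   unfolding pxx pyy inner_Rot[OF S] by (simp_all add: simps)
  have 3: "pdx r (pdy r ?F) X Y \<bullet> ?N X Y = - Im (phi X Y)"
   unfolding pxy inner_Rot[OF S] by (simp add: simps)
  have 4: "pdx r ?F X Y \<bullet> pdx r ?F X Y = 1" "pdy r ?F X Y \<bullet> pdy r ?F X Y = 1" using nx by (simp_all add: norm_eq_1)
  have 5: "pdx r ?F X Y \<bullet> pdy r ?F X Y = Re (phi X Y)" unfolding px[OF XY] py[OF XY] inner_Rot[OF S] by (simp add: simps)
  assume "Im (phi X Y) ~= 0"
  moreover have "1 - (Re (phi X Y))\<^sup>2 = (Im (phi X Y))\<^sup>2" using cs by linarith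
  ultimately show "Gauss_curvature r ?F ?N X Y = -1"
   unfolding Gauss_curvature_def 1 2 3 4 5 by simp
 qed
qed

end

section \<open>The continuous surface: existence and uniqueness\<close>

lemma mesh_null: "EX es. (ALL n. es n : mesh_sizes) & es \<longlonglongrightarrow> 0"
proof (intro exI[of _ "%n. (1 / 2) ^ Suc n"] conjI allI)
 show "(1 / 2) ^ Suc n : mesh_sizes" for n unfolding mesh_sizes_def by (rule CollectI, rule exI[of _ "Suc n"]) simp
 show "(%n. (1 / 2) ^ Suc n) \<longlonglongrightarrow> (0::real)" by (rule LIMSEQ_Suc, rule LIMSEQ_realpow_zero) auto
qed

lemma framed_const: "0 < r ==> l ~= 0 ==> framed r mesh_sizes {()} (%_. l) (max \<bar>l\<bar> \<bar>1 / l\<bar>)"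
 using mesh_null by unfold_locales auto

lemma framed_interval: "0 < r ==> 1 < Lam ==> framed r mesh_sizes {1 / Lam..Lam} (%l. l) Lam"
proof (unfold_locales)
 assume L: "1 < Lam"
 fix l assume l: "l : {1 / Lam..Lam}"
 then have "0 < 1 / Lam" "1 / Lam <= l" using L by auto
 then have "0 < l" by linarith
 then show l0: "l ~= 0" "\<bar>l\<bar> <= Lam" "\<bar>1 / l\<bar> <= Lam" using l L by (auto simp: field_simps)
qed (use mesh_null in auto)

theorem K_surface_exists:
 assumes r: "0 < r" and sm: "smooth_on_interval r a0" "smooth_on_interval r b0" and b0: "ALL y:{0..r}. norm (b0 y) = 1"
 shows "EX phi Phi. sine_Gordon r phi & Goursat_data r a0 b0 phi & frame r (angle_pdx r phi) phi Phi & K_surface r phi (%x y. immersion 1 (Phi x y))"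
proof -
 interpret f1: framed r mesh_sizes "{()}" "%_. 1" "max \<bar>1\<bar> \<bar>1 / 1\<bar>" by (rule framed_const[OF r]) simp
 obtain phi where SG: "sine_Gordon r phi" and GD: "Goursat_data r a0 b0 phi" using f1.Goursat_exists[OF sm b0] by blast
 \<comment> \<open>\<open>frame\<close> imposes no relation between different spectral parameters,
   so a limit frame is constructed for each \<open>l\<close> separately and then chosen.\<close>
 have "EX G. G 0 0 = mat 1 & (ALL x:{0..r}. ALL y:{0..r}. G x y : SU2 &
   ((%s. G s y) has_vector_derivative U_mat (angle_pdx r phi x y) l ** G x y) (at x within {0..r}) &
   ((%s. G x s) has_vector_derivative V_mat (phi x y) l ** G x y) (at y within {0..r}))" if "l ~= 0" for l
  using framed.frame_exists[OF framed_const[OF r that] sm b0 _ SG GD] by blast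
 then obtain G where G: "!!l. l ~= 0 ==> G l 0 0 = mat 1 & (ALL x:{0..r}. ALL y:{0..r}. G l x y : SU2 &
   ((%s. G l s y) has_vector_derivative U_mat (angle_pdx r phi x y) l ** G l x y) (at x within {0..r}) &
   ((%s. G l x s) has_vector_derivative V_mat (phi x y) l ** G l x y) (at y within {0..r}))"
  by metis
 define Phi where "Phi = (%x y l. G l x y)"
 have fr: "frame r (angle_pdx r phi) phi Phi" unfolding frame_def Phi_def using G by blast
 have "asymptotic_K_surface r phi (%x y. immersion 1 (Phi x y))"
  by (rule f1.surface_asymptotic[OF sm b0 _ _ SG GD fr]) auto
 then show ?thesis using SG GD fr unfolding K_surface_def by blast
qed

text \<open>One discrete family with the given data is fixed, and both surfaces are its limit; their
  angles and frames are never compared.\<close>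

theorem K_surface_unique:
 assumes r: "0 < r" and sm: "smooth_on_interval r a0" "smooth_on_interval r b0" and b0: "ALL y:{0..r}. norm (b0 y) = 1"
  and K: "K_surface r phi F" "Goursat_data r a0 b0 phi" and K': "K_surface r phi' F'" "Goursat_data r a0 b0 phi'"
  and xy: "x : {0..r}" "y : {0..r}"
 shows "F' x y = F x y"
proof -
 interpret f1: framed r mesh_sizes "{()}" "%_. 1" "max \<bar>1\<bar> \<bar>1 / 1\<bar>" by (rule framed_const[OF r]) simp
 obtain a b Psi where D: "!!e. e : mesh_sizes ==> discrete_data e r (a e) (b e)" "!!e. e : mesh_sizes ==> discrete_boundary e r a0 b0 (a e) (b e)"
  "!!e. e : mesh_sizes ==> discrete_frame e r (a e) (b e) (Psi e)"
  using f1.discrete_families[OF b0, of a0] by metis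
 obtain Phi where P: "sine_Gordon r phi" "frame r (angle_pdx r phi) phi Phi" "!!x y. x : {0..r} ==> y : {0..r} ==> F x y = immersion 1 (Phi x y)"
  using K(1) unfolding K_surface_def by blast
 obtain Phi' where P': "sine_Gordon r phi'" "frame r (angle_pdx r phi') phi' Phi'" "!!x y. x : {0..r} ==> y : {0..r} ==> F' x y = immersion 1 (Phi' x y)"
  using K'(1) unfolding K_surface_def by blast
 note c = f1.core(4,7)[OF sm D P(1) K(2) P(2)] f1.core(4,7)[OF sm D P'(1) K'(2) P'(2)]
 have "immersion 1 (Phi' x y) = immersion 1 (Phi x y)"
  by (rule f1.near_unique[OF c(3,1) _ c(4,2) xy]) auto
 then show ?thesis using P(3) P'(3) xy by simp
qed

section \<open>Iterated transformations\<close>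

lemma Backlund_log_deriv:
 assumes \<beta>: "\<beta> > 0" and theta: "norm theta = 1" and K: "log_deriv 1 Q K" and Q': "!!l. Q' l = W_mat \<beta> theta l ** Q l"
 shows "EX K'. log_deriv 1 Q' K'"
  and "immersion 1 Q' = immersion 1 Q + (2 / \<beta> / (1 + (1 / \<beta>)\<^sup>2)) *\<^sub>R Rot (Q 1) (hvec (cnj theta))"
proof -
 have eq: "Q' = (%l. rotm theta 1 (l / \<beta>) ** Q l)" by (rule ext) (simp add: Q' W_rotm[OF \<beta>])
 have "log_deriv 1 (%l. rotm theta 1 (l / \<beta>)) ((1 / \<beta> / (1 + (1 / \<beta>)\<^sup>2)) *\<^sub>R hvec (cnj theta * 1))"
  by (rule log_deriv_rotm[OF theta]) (use \<beta> in \<open>auto intro!: derivative_eq_intros\<close>)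
 note ld = log_deriv_mult[OF this K]
 show "EX K'. log_deriv 1 Q' K'" unfolding eq using ld by blast
 show "immersion 1 Q' = immersion 1 Q + (2 / \<beta> / (1 + (1 / \<beta>)\<^sup>2)) *\<^sub>R Rot (Q 1) (hvec (cnj theta))"
  unfolding eq immersion_eq[OF ld] immersion_eq[OF K]
  by (simp add: linear_scale[OF bounded_linear.linear[OF bounded_linear_Rot]] scaleR_add_right)
qed

text \<open>\<open>W_mat\<close> is real-affine in its angle argument, and this is its linear part;
  the transformed frame thereby comes under the rules for linear images and products.\<close>

definition Wlin :: "real => complex => complex^2^2" where
 "Wlin s w = (1 / sqrt (1 + s\<^sup>2)) *\<^sub>R mat2 w 0 0 (cnj w)"

lemma bounded_linear_Wlin: "bounded_linear (Wlin s)"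
 unfolding linear_conv_bounded_linear[symmetric] Wlin_def mat2_scale
 by (rule linearI) (simp_all add: mat2_scale complex_scaleR add_divide_distrib algebra_simps)

lemma W_split: "\<beta> > 0 ==> W_mat \<beta> w l = Wlin (l / \<beta>) w + (1 / sqrt (1 + (l / \<beta>)\<^sup>2)) *\<^sub>R mat2 0 (- \<i> * (l / \<beta>)) (- \<i> * (l / \<beta>)) 0"
 by (simp add: W_rotm rotm_def Wlin_def scaleR_add_right[symmetric])

context backlund begin

lemma Ln_mob:
 assumes z: "norm z = 1" and k: "0 <= k" "k < 1"
 shows "1 / (\<i> * complex_of_real e) * Ln (mob k z) = of_real (Im (Ln (mob k z)) / e)" "cis (Im (Ln (mob k z))) = mob k z"
proof -
 have u: "norm (mob k z) = 1" by (rule mob_unit[OF z k])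
 show "cis (Im (Ln (mob k z))) = mob k z" by (rule cis_Ln_unit[OF u])
 define w where "w = Im (Ln (mob k z))"
 have "Ln (mob k z) = \<i> * of_real w" unfolding w_def by (rule Ln_unit[OF u])
 then show "1 / (\<i> * complex_of_real e) * Ln (mob k z) = of_real (Im (Ln (mob k z)) / e)" by simp
qed

text \<open>The real increments solving the logarithmic equations of the transformation, as
  \<open>upd\<close> does for the data.\<close>

definition px :: "real => real => complex => real" where
 "px e a theta = - a + Im (Ln (mob (ka e) (theta * cnj (cis (e * a / 2))))) / e"
definition qy :: "real => complex => complex => real" where
 "qy e b theta = Im (Ln (mob (mu e) (b * theta))) / e"

lemma px:
 assumes e: "e : E" and theta: "norm theta = 1"
 shows "complex_of_real p = - complex_of_real a + 1 / (\<i> * complex_of_real e) * Ln ((1 - complex_of_real e * complex_of_real \<beta> / 2 * (cnj theta * cis (e * a / 2)))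
   / (1 - complex_of_real e * complex_of_real \<beta> / 2 * (theta * cis (- (e * a / 2))))) \<longleftrightarrow> p = px e a theta"
  and "cis (e * px e a theta) = (cnj (cis (e * a / 2)))\<^sup>2 * mob (ka e) (theta * cnj (cis (e * a / 2)))"
proof -
 let ?z = "theta * cnj (cis (e * a / 2))"
 have z: "norm ?z = 1" using theta by (simp add: norm_mult)
 have e0: "e ~= 0" using E_bounds e by auto
 have m: "(1 - complex_of_real e * complex_of_real \<beta> / 2 * (cnj theta * cis (e * a / 2))) / (1 - complex_of_real e * complex_of_real \<beta> / 2 * (theta * cis (- (e * a / 2)))) = mob (ka e) ?z"
  by (simp add: mob_def ka_def cis_cnj)
 show "complex_of_real p = - complex_of_real a + 1 / (\<i> * complex_of_real e) * Ln ((1 - complex_of_real e * complex_of_real \<beta> / 2 * (cnj theta * cis (e * a / 2)))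
   / (1 - complex_of_real e * complex_of_real \<beta> / 2 * (theta * cis (- (e * a / 2))))) \<longleftrightarrow> p = px e a theta"
  unfolding m Ln_mob(1)[OF z ka_bounds[OF e]] px_def of_real_minus[symmetric] of_real_add[symmetric] of_real_eq_iff ..
 have "e * px e a theta = - (e * a / 2) + - (e * a / 2) + Im (Ln (mob (ka e) ?z))" using e0 by (simp add: px_def field_simps)
 then have "cis (e * px e a theta) = cis (- (e * a / 2)) * cis (- (e * a / 2)) * cis (Im (Ln (mob (ka e) ?z)))" by (simp only: cis_mult)
 then show "cis (e * px e a theta) = (cnj (cis (e * a / 2)))\<^sup>2 * mob (ka e) ?z"
  unfolding Ln_mob(2)[OF z ka_bounds[OF e]] by (simp only: power2_eq_square cis_cnj)
qed

lemma qy: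
 assumes e: "e : E" and theta: "norm theta = 1" "norm b = 1"
 shows "complex_of_real q = 1 / (\<i> * complex_of_real e) * Ln ((1 - complex_of_real e / (2 * complex_of_real \<beta>) * cnj (b * theta))
   / (1 - complex_of_real e / (2 * complex_of_real \<beta>) * (b * theta))) \<longleftrightarrow> q = qy e b theta"
  and "cis (e * qy e b theta) = mob (mu e) (b * theta)"
proof -
 have z: "norm (b * theta) = 1" using theta by (simp add: norm_mult)
 have e0: "e ~= 0" using E_bounds e by auto
 have m: "(1 - complex_of_real e / (2 * complex_of_real \<beta>) * cnj (b * theta)) / (1 - complex_of_real e / (2 * complex_of_real \<beta>) * (b * theta)) = mob (mu e) (b * theta)"
  by (simp add: mob_def mu_def)
 show "complex_of_real q = 1 / (\<i> * complex_of_real e) * Ln ((1 - complex_of_real e / (2 * complex_of_real \<beta>) * cnj (b * theta))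
   / (1 - complex_of_real e / (2 * complex_of_real \<beta>) * (b * theta))) \<longleftrightarrow> q = qy e b theta"
  unfolding m Ln_mob(1)[OF z mu_bounds[OF e]] qy_def of_real_eq_iff ..
 have "e * qy e b theta = Im (Ln (mob (mu e) (b * theta)))" using e0 by (simp add: qy_def)
 then show "cis (e * qy e b theta) = mob (mu e) (b * theta)" by (simp only: Ln_mob(2)[OF z mu_bounds[OF e]])
qed

text \<open>In terms of \<open>A = cis (e a / 2)\<close> the discrete transformation is the rational system \<open>bsys\<close>.\<close>

lemma discrete_Backlund_iff:
 assumes e: "e : E" and b: "ALL x y. x <= N e --> y + 1 <= N e --> norm (b (e *. x) (e *. y)) = 1"
 shows "discrete_Backlund e r \<beta> t0 (a, b, Psi) (a', b', Psi') \<longleftrightarrow>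
  (EX theta p q. theta 0 0 = t0 &
   (ALL x y. x + 1 <= N e --> y <= N e --> p (e *. x) (e *. y) = px e (a (e *. x) (e *. y)) (theta (e *. x) (e *. y)) &
     theta (e *. (Suc x)) (e *. y) = theta (e *. x) (e *. y) * cis (e * p (e *. x) (e *. y)) &
     a' (e *. x) (e *. y) = a (e *. x) (e *. y) + 2 * p (e *. x) (e *. y)) &
   (ALL x y. x <= N e --> y + 1 <= N e --> q (e *. x) (e *. y) = qy e (b (e *. x) (e *. y)) (theta (e *. x) (e *. y)) &
     theta (e *. x) (e *. (Suc y)) = theta (e *. x) (e *. y) * cis (e * q (e *. x) (e *. y)) &
     b' (e *. x) (e *. y) = b (e *. x) (e *. y) * (theta (e *. x) (e *. y))\<^sup>2 * cis (e * q (e *. x) (e *. y))) &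
   (ALL x y. x <= N e --> y <= N e --> norm (theta (e *. x) (e *. y)) = 1 & (ALL l. Psi' (e *. x) (e *. y) l = W_mat \<beta> (theta (e *. x) (e *. y)) l ** Psi (e *. x) (e *. y) l)))"
proof -
 \<comment> \<open>The equivalences for the two edge equations hold only where the angle is
   unimodular, and that is asserted in the third block; the case distinction makes it available to
   the first two.\<close>
 have key: "(ALL x. P' x --> (ALL y. P y --> S x y)) & (ALL x. P x --> (ALL y. P' y --> T x y)) & (ALL x. P x --> (ALL y. P y --> n x y & w x y)) \<longleftrightarrow>
   (ALL x y. P' x --> P y --> S' x y) & (ALL x y. P x --> P' y --> T' x y) & (ALL x y. P x --> P y --> n x y & w x y)"
  if "!!x. P' x ==> P x" "!!x y. n x y ==> S x y = S' x y" "!!x y. P x ==> P' y ==> n x y ==> T x y = T' x y"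
  for P P' and n w S S' T T' :: "nat => nat => bool"
 proof (cases "ALL x y. P x --> P y --> n x y")
  case True
  then have "!!x y. P' x ==> P y ==> S x y = S' x y" "!!x y. P x ==> P' y ==> T x y = T' x y" using that by blast+
  then show ?thesis by simp
 qed blast
 show ?thesis
  unfolding discrete_Backlund.simps grid_all[OF e] grid1_all[OF e] grid_step
 proof ((rule ex_cong1)+, rule conj_cong, rule refl, rule key)
  show "x <= N e" if "x + 1 <= N e" for x using that by simp
 qed (simp_all only: px(1)[OF e] qy(1)[OF e _ b[rule_format]])
qed

lemma discrete_Backlund_bsys:
 assumes b: "!!e. e : E ==> ALL x y. x <= N e --> y + 1 <= N e --> norm (b e (e *. x) (e *. y)) = 1"
  and B: "!!e. e : E ==> discrete_Backlund e r \<beta> t0 (a e, b e, Psi e) (a' e, b' e, Psi' e)"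
 shows "EX t. bsys (Af a) (bf b) t & (ALL e:E. ALL i. t e i 0 0 = t0 &
   (ALL x y. x + 1 <= N e --> y <= N e --> Af a' e i x y = tA (Af a) t e i x y) &
   (ALL x y. x <= N e --> y + 1 <= N e --> bf b' e i x y = tb (bf b) t e i x y) &
   (ALL x y l. x <= N e --> y <= N e --> Psi' e (e *. x) (e *. y) l = W_mat \<beta> (t e i x y) l ** Psi e (e *. x) (e *. y) l))"
proof -
 have "EX t. t 0 0 = t0 &
   (ALL x y. x + 1 <= N e --> y <= N e --> t (Suc x) y = t x y * (cnj (Af a e i x y))\<^sup>2 * mob (ka e) (t x y * cnj (Af a e i x y)) &
     Af a' e i x y = Af a e i x y * t (Suc x) y * cnj (t x y)) &
   (ALL x y. x <= N e --> y + 1 <= N e --> t x (Suc y) = t x y * mob (mu e) (bf b e i x y * t x y) &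
     bf b' e i x y = bf b e i x y * t x y * t x (Suc y)) &
   (ALL x y. x <= N e --> y <= N e --> norm (t x y) = 1 & (ALL l. Psi' e (e *. x) (e *. y) l = W_mat \<beta> (t x y) l ** Psi e (e *. x) (e *. y) l))"
  if e: "e : E" for e and i :: 'i
 proof -
  obtain theta p q where theta0: "theta 0 0 = t0" and
   X: "!!x y. x + 1 <= N e ==> y <= N e ==> p (e *. x) (e *. y) = px e (a e (e *. x) (e *. y)) (theta (e *. x) (e *. y)) &
     theta (e *. (Suc x)) (e *. y) = theta (e *. x) (e *. y) * cis (e * p (e *. x) (e *. y)) &
     a' e (e *. x) (e *. y) = a e (e *. x) (e *. y) + 2 * p (e *. x) (e *. y)" and
   Y: "!!x y. x <= N e ==> y + 1 <= N e ==> q (e *. x) (e *. y) = qy e (b e (e *. x) (e *. y)) (theta (e *. x) (e *. y)) &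
     theta (e *. x) (e *. (Suc y)) = theta (e *. x) (e *. y) * cis (e * q (e *. x) (e *. y)) &
     b' e (e *. x) (e *. y) = b e (e *. x) (e *. y) * (theta (e *. x) (e *. y))\<^sup>2 * cis (e * q (e *. x) (e *. y))" and
   Z: "!!x y. x <= N e ==> y <= N e ==> norm (theta (e *. x) (e *. y)) = 1 & (ALL l. Psi' e (e *. x) (e *. y) l = W_mat \<beta> (theta (e *. x) (e *. y)) l ** Psi e (e *. x) (e *. y) l)"
   using B[OF e, unfolded discrete_Backlund_iff[where b = "b e", OF e b[OF e]]] by blast
  define t where "t = (%x y :: nat. theta (e *. x) (e *. y))"
  show ?thesis
  proof (intro exI[of _ t] conjI allI impI)
   show "t 0 0 = t0" using theta0 by (simp add: t_def)
   fix x y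
   { assume xy: "x + 1 <= N e" "y <= N e"
    have n: "norm (t x y) = 1" using Z[of x y] xy by (simp add: t_def)
    have c: "cis (e * p (e *. x) (e *. y)) = (cnj (Af a e i x y))\<^sup>2 * mob (ka e) (t x y * cnj (Af a e i x y))"
     unfolding X[OF xy, THEN conjunct1] Af_def t_def by (rule px(2)[OF e n[unfolded t_def]])
    have s: "t (Suc x) y = t x y * cis (e * p (e *. x) (e *. y))"
     using X[OF xy] by (simp only: t_def)
    show "t (Suc x) y = t x y * (cnj (Af a e i x y))\<^sup>2 * mob (ka e) (t x y * cnj (Af a e i x y))" unfolding s c by (simp add: mult.assoc)
    have "Af a' e i x y = Af a e i x y * cis (e * p (e *. x) (e *. y))"
     unfolding Af_def X[OF xy, THEN conjunct2, THEN conjunct2] by (simp add: cis_mult algebra_simps add_divide_distrib)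
    also have "\<dots> = Af a e i x y * t (Suc x) y * cnj (t x y)" unfolding s using cnj_unit[OF n] by (simp add: mult_ac)
    finally show "Af a' e i x y = Af a e i x y * t (Suc x) y * cnj (t x y)" . }
   { assume xy: "x <= N e" "y + 1 <= N e"
    have n: "norm (t x y) = 1" using Z[of x y] xy by (simp add: t_def)
    have c: "cis (e * q (e *. x) (e *. y)) = mob (mu e) (bf b e i x y * t x y)"
     unfolding Y[OF xy, THEN conjunct1] bf_def t_def by (rule qy(2)[OF e n[unfolded t_def] b[OF e, rule_format, OF xy]])
    have s: "t x (Suc y) = t x y * cis (e * q (e *. x) (e *. y))"
     using Y[OF xy] by (simp only: t_def)
    show "t x (Suc y) = t x y * mob (mu e) (bf b e i x y * t x y)" unfolding s c ..
    show "bf b' e i x y = bf b e i x y * t x y * t x (Suc y)"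
     unfolding s unfolding bf_def Y[OF xy, THEN conjunct2, THEN conjunct2] t_def by (simp add: power2_eq_square mult.assoc) }
   { assume xy: "x <= N e" "y <= N e"
    show "norm (t x y) = 1" "Psi' e (e *. x) (e *. y) l = W_mat \<beta> (t x y) l ** Psi e (e *. x) (e *. y) l" for l
     using Z[OF xy] by (simp_all add: t_def) }
  qed
 qed
 then obtain t where t: "!!e i. e : E ==> t e i 0 0 = t0 &
   (ALL x y. x + 1 <= N e --> y <= N e --> t e i (Suc x) y = t e i x y * (cnj (Af a e i x y))\<^sup>2 * mob (ka e) (t e i x y * cnj (Af a e i x y)) &
     Af a' e i x y = Af a e i x y * t e i (Suc x) y * cnj (t e i x y)) &
   (ALL x y. x <= N e --> y + 1 <= N e --> t e i x (Suc y) = t e i x y * mob (mu e) (bf b e i x y * t e i x y) &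
     bf b' e i x y = bf b e i x y * t e i x y * t e i x (Suc y)) &
   (ALL x y. x <= N e --> y <= N e --> norm (t e i x y) = 1 & (ALL l. Psi' e (e *. x) (e *. y) l = W_mat \<beta> (t e i x y) l ** Psi e (e *. x) (e *. y) l))"
  by metis
 show ?thesis
  by (intro exI[of _ t]) (use t in \<open>simp add: bsys_def unimod_def tA_def tb_def\<close>)
qed

lemma discrete_Backlund_exists:
 assumes e: "e : E" and i: "i : I" and ds: "dsys (Af a) (bf b)" and t0: "norm t0 = 1"
 shows "EX a' b' Psi'. discrete_Backlund e r \<beta> t0 (a e, b e, Psi) (a', b', Psi')"
proof -
 have e0: "e > 0" using E_bounds e by auto
 obtain t where bs: "bsys (Af a) (bf b) t" and ti: "t e i 0 0 = t0"
  using bsys_exists[OF ds, of "%_ _. t0"] t0 e i by blast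
 have nb: "norm (b e (e *. x) (e *. y)) = 1" if "x <= N e" "y + 1 <= N e" for x y
  using ds unimodD[of 0 1 "bf b" e i x y] that e i by (simp add: dsys_def bf_def)
 then have nb': "ALL x y. x <= N e --> y + 1 <= N e --> norm (b e (e *. x) (e *. y)) = 1" by blast
 have nt: "norm (t e i x y) = 1" if "x <= N e" "y <= N e" for x y
  using bs unimodD[of 0 0 t e i x y] that e i by (simp add: bsys_def)
 define theta where "theta = (%X Y. t e i (gidx e X) (gidx e Y))"
 define p where "p = (%X Y. px e (a e X Y) (theta X Y))"
 define q where "q = (%X Y. qy e (b e X Y) (theta X Y))"
 have theta: "theta (e *. x) (e *. y) = t e i x y" for x y unfolding theta_def gidx_grid[OF e0] ..
 have 00: "theta 0 0 = t0" using theta[of 0 0] ti by simp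
 define a' where "a' = (%X Y. a e X Y + 2 * p X Y)"
 define b' where "b' = (%X Y. b e X Y * (theta X Y)\<^sup>2 * cis (e * q X Y))"
 define Psi' where "Psi' = (%X Y l. W_mat \<beta> (theta X Y) l ** Psi X Y l)"
 have X: "t e i (Suc x) y = t e i x y * cis (e * p (e *. x) (e *. y))" if xy: "x + 1 <= N e" "y <= N e" for x y
 proof -
  have n: "norm (t e i x y) = 1" using nt xy by simp
  show ?thesis using bs e i xy unfolding bsys_def p_def theta px(2)[OF e n] by (simp add: Af_def mult.assoc)
 qed
 have Y: "t e i x (Suc y) = t e i x y * cis (e * q (e *. x) (e *. y))" if xy: "x <= N e" "y + 1 <= N e" for x y
 proof -
  have n: "norm (t e i x y) = 1" using nt xy by simp
  show ?thesis using bs e i xy unfolding bsys_def q_def theta qy(2)[OF e n nb[OF xy]] by (simp add: bf_def)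
 qed
 have "discrete_Backlund e r \<beta> t0 (a e, b e, Psi) (a', b', Psi')"
  unfolding discrete_Backlund_iff[where b = "b e", OF e nb']
  by (rule exI[of _ theta], rule exI[of _ p], rule exI[of _ q])
   (use 00 X Y nt in \<open>simp add: theta a'_def b'_def Psi'_def p_def[THEN fun_cong, THEN fun_cong] q_def[THEN fun_cong, THEN fun_cong] del: of_nat_Suc\<close>)
 then show ?thesis by blast
qed

end

context meshed begin

lemma dsys_cong:
 assumes "dsys A b"
  and A: "!!e i x y. e : E ==> i : I ==> x + 1 <= N e ==> y <= N e ==> A' e i x y = A e i x y"
  and b: "!!e i x y. e : E ==> i : I ==> x <= N e ==> y + 1 <= N e ==> b' e i x y = b e i x y"
 shows "dsys A' b'"
 using assms(1) unfolding dsys_def unimod_def by (simp add: A b)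

end

context backlund begin

definition G1 :: "(real => real => real => real => complex^2^2) => ('i, complex^2^2) family" where
 "G1 Psi e i x y = Psi e (e *. x) (e *. y) 1"
definition F1 :: "(real => real => real => real => complex^2^2) => ('i, real^3) family" where
 "F1 Psi e i x y = immersion 1 (Psi e (e *. x) (e *. y))"
definition va :: "(real => real => real) => ('i, complex) field2" where
 "va a i X Y = \<i> / 2 * of_real (a X Y)"

text \<open>What is preserved by simultaneous transformations of discrete and continuous framed data.\<close>

fun tracks :: "(real => framed_data) => framed_data => bool" where
 "tracks Se (a, b, Phi) \<longleftrightarrow> (EX ae be Psi. Se = (%e. (ae e, be e, Psi e)) &
   dsys (Af ae) (bf be) & (ALL k. bd k 1 0 (al (Af ae))) & (ALL k. bd k 0 1 (bf be)) & (ALL k. bd k 0 0 (G1 Psi)) & (ALL k. bd k 0 0 (F1 Psi)) &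
   (ALL e:E. ALL x y. x <= N e --> y <= N e --> (EX K. log_deriv 1 (Psi e (e *. x) (e *. y)) K)) &
   nearO 1 0 (al (Af ae)) (va a) & nearO 0 1 (bf be) (%i. b) &
   nearO 0 0 (G1 Psi) (%i X Y. Phi X Y 1) & nearO 0 0 (F1 Psi) (%i X Y. immersion 1 (Phi X Y)) &
   lip (va a) & lip (%i. b) & lip (%i X Y. Phi X Y 1) &
   (ALL i:I. continuous_on ({0..r} \<times> {0..r}) (%(X, Y). immersion 1 (Phi X Y))) &
   (ALL X:{0..r}. ALL Y:{0..r}. EX K. log_deriv 1 (Phi X Y) K))"

lemma tracks_step:
 assumes tr: "tracks Se S" and I: "I ~= {}" and B: "Backlund r \<beta> t0 S S'" and Be: "ALL e:E. discrete_Backlund e r \<beta> t0 (Se e) (Se' e)"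
 shows "tracks Se' S'"
proof -
 obtain a b Phi where S: "S = (a, b, Phi)" by (cases S)
 obtain a' b' Phi' where S': "S' = (a', b', Phi')" by (cases S')
 obtain ae be Psi where Se: "Se = (%e. (ae e, be e, Psi e))" and ds: "dsys (Af ae) (bf be)"
  and bds: "!!k. bd k 1 0 (al (Af ae))" "!!k. bd k 0 1 (bf be)" "!!k. bd k 0 0 (G1 Psi)" "!!k. bd k 0 0 (F1 Psi)"
  and ld: "!!e x y. e : E ==> x <= N e ==> y <= N e ==> EX K. log_deriv 1 (Psi e (e *. x) (e *. y)) K"
  and nr: "nearO 1 0 (al (Af ae)) (va a)" "nearO 0 1 (bf be) (%i. b)"
   "nearO 0 0 (G1 Psi) (%i X Y. Phi X Y 1)" "nearO 0 0 (F1 Psi) (%i X Y. immersion 1 (Phi X Y))"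
  and lp: "lip (va a)" "lip (%i. b)" "lip (%i X Y. Phi X Y 1)"
  and cont: "ALL i:I. continuous_on ({0..r} \<times> {0..r}) (%(X, Y). immersion 1 (Phi X Y))"
  and ldc: "!!X Y. X : {0..r} ==> Y : {0..r} ==> EX K. log_deriv 1 (Phi X Y) K"
  using tr unfolding S tracks.simps by (elim exE conjE) (rule that; simp)
 define ae' where "ae' = (%e. fst (Se' e))"
 define be' where "be' = (%e. fst (snd (Se' e)))"
 define Psi' where "Psi' = (%e. snd (snd (Se' e)))"
 have Se': "Se' = (%e. (ae' e, be' e, Psi' e))" by (simp add: ae'_def be'_def Psi'_def)
 have Be': "!!e. e : E ==> discrete_Backlund e r \<beta> t0 (ae e, be e, Psi e) (ae' e, be' e, Psi' e)" using Be unfolding Se Se' by blast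
 obtain i0 where i0: "i0 : I" using I by blast
 have nbe: "ALL x y. x <= N e --> y + 1 <= N e --> norm (be e (e *. x) (e *. y)) = 1" if "e : E" for e
  using ds i0 that unfolding dsys_def unimod_def bf_def by auto
 obtain t where bs: "bsys (Af ae) (bf be) t" and T: "!!e i. e : E ==> t e i 0 0 = t0 &
   (ALL x y. x + 1 <= N e --> y <= N e --> Af ae' e i x y = tA (Af ae) t e i x y) &
   (ALL x y. x <= N e --> y + 1 <= N e --> bf be' e i x y = tb (bf be) t e i x y) &
   (ALL x y l. x <= N e --> y <= N e --> Psi' e (e *. x) (e *. y) l = W_mat \<beta> (t e i x y) l ** Psi e (e *. x) (e *. y) l)"
  using discrete_Backlund_bsys[OF nbe Be'] by blast
 note T1 = T[THEN conjunct2, THEN conjunct1, rule_format] and T2 = T[THEN conjunct2, THEN conjunct2, THEN conjunct1, rule_format]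
  and T3 = T[THEN conjunct2, THEN conjunct2, THEN conjunct2, rule_format]
 obtain theta where sm: "smooth_angle r theta" and theta0: "theta 0 0 = t0" and
  th: "!!x y. x : {0..r} ==> y : {0..r} ==> angle_pdx r theta x y = - a x y + \<beta> * Im (theta x y) & angle_pdy r theta x y = 1 / \<beta> * Im (b x y * theta x y) &
      a' x y = a x y + 2 * angle_pdx r theta x y & b' x y = b x y * (theta x y)\<^sup>2 & (ALL l. Phi' x y l = W_mat \<beta> (theta x y) l ** Phi x y l)"
  using B unfolding S S' Backlund.simps by blast
 have ntheta: "ALL X:{0..r}. ALL Y:{0..r}. norm (theta X Y) = 1" using sm by (simp add: smooth_angle_def)
 obtain g where g: "jet g" and g0: "ALL X:{0..r}. ALL Y:{0..r}. g 0 0 X Y = theta X Y"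
  using smooth_imp_jet[of theta] sm unfolding smooth_angle_def by metis
 have ltheta: "lip (%i. theta)" by (rule lip_cong[OF jet_lip[OF g, of 0 0]]) (use g0 in simp)
 note aj = angle_jet[OF g g0 ntheta]
 have gd: "derx theta (g 1 0 X Y) X Y" "dery theta (g 0 1 X Y) X Y"
  if XY: "X : {0..r}" "Y : {0..r}" for X Y
 proof -
  have "derx (g 0 0) (g 1 0 X Y) X Y" "dery (g 0 0) (g 0 1 X Y) X Y"
   using g XY by (auto simp: jet_def)
  then show "derx theta (g 1 0 X Y) X Y" "dery theta (g 0 1 X Y) X Y"
   using XY g0 by (auto intro: has_vector_derivative_transform[rotated 2])
 qed
 have im: "w - cnj w = 2 * \<i> * of_real (Im w)" for w by (simp add: complex_eq_iff)
 have e1: "2 * cnj (va a i X Y) + of_real (\<beta> / 2) * (theta X Y - cnj (theta X Y)) = \<i> * of_real (angle_pdx r theta X Y)"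
  and e2: "of_real (1 / (2 * \<beta>)) * (b X Y * theta X Y - cnj (b X Y * theta X Y)) = \<i> * of_real (angle_pdy r theta X Y)" if XY: "X : {0..r}" "Y : {0..r}" for X Y i
  unfolding im th[OF XY, THEN conjunct1] th[OF XY, THEN conjunct2, THEN conjunct1] va_def by (simp_all add: algebra_simps)
 have gx: "g 1 0 X Y = theta X Y * (2 * cnj (va a i X Y) + of_real (\<beta> / 2) * (theta X Y - cnj (theta X Y)))"
  and gy: "g 0 1 X Y = theta X Y * (of_real (1 / (2 * \<beta>)) * (b X Y * theta X Y - cnj (b X Y * theta X Y)))" if XY: "X : {0..r}" "Y : {0..r}" for X Y i
  unfolding e1[OF XY] e2[OF XY] by (rule aj(3)[OF XY], rule aj(4)[OF XY])
 have bc: "bsysc (va a) (%i. b) (%i. theta)"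
  unfolding bsysc_def hasx_def hasy_def by (intro conjI ballI) (simp_all only: gx[symmetric] gy[symmetric] gd)
 have nt: "nearO 0 0 t (%i. theta)"
  by (rule bsys_near[OF ds bs nr(1,2) lp(1,2) ltheta bc]) (simp add: T theta0)
 have bt: "bd k 0 0 t" for k by (rule bsys_bd[OF ds bs bds(1,2)])
 note tn = bsys_tilde_near[OF ds bs nr(1,2) lp(1,2) ltheta nt] and tbd = bsys_tilde_bd[OF ds bs bds(1,2)]
 define cc where "cc = 2 / \<beta> / (1 + (1 / \<beta>)\<^sup>2)"
 define M0 where "M0 = (1 / sqrt (1 + (1 / \<beta>)\<^sup>2)) *\<^sub>R mat2 0 (- \<i> * (1 / \<beta>)) (- \<i> * (1 / \<beta>)) 0"
 have W1: "W_mat \<beta> w 1 = Wlin (1 / \<beta>) w + M0" for w unfolding M0_def by (subst W_split[OF beta]) simp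
 have nte: "norm (t e i x y) = 1" if "e : E" "i : I" "x <= N e" "y <= N e" for e i x y
  using bs unimodD[of 0 0 t e i x y] that by (simp add: bsys_def)
 have Gd: "G1 Psi' e i x y = (Wlin (1 / \<beta>) (t e i x y) + M0) ** G1 Psi e i x y" if "e : E" "i : I" "x + 0 <= N e" "y + 0 <= N e" for e i x y
  unfolding G1_def W1[symmetric] using T3[OF that(1), of x y 1 i] that by simp
 have Fd: "F1 Psi' e i x y = F1 Psi e i x y + cc *\<^sub>R Rot (G1 Psi e i x y) (hvec (cnj (t e i x y)))"
  and ld': "EX K. log_deriv 1 (Psi' e (e *. x) (e *. y)) K" if *: "e : E" "i : I" "x + 0 <= N e" "y + 0 <= N e" for e i x y
 proof -
  obtain K where K: "log_deriv 1 (Psi e (e *. x) (e *. y)) K" using ld[of e x y] * by auto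
  have eq: "!!l. Psi' e (e *. x) (e *. y) l = W_mat \<beta> (t e i x y) l ** Psi e (e *. x) (e *. y) l" using T3[OF *(1), of x y _ i] * by simp
  have n: "norm (t e i x y) = 1" using nte * by simp
  show "F1 Psi' e i x y = F1 Psi e i x y + cc *\<^sub>R Rot (G1 Psi e i x y) (hvec (cnj (t e i x y)))"
   unfolding F1_def G1_def cc_def by (rule Backlund_log_deriv(2)[OF beta n K eq])
  show "EX K. log_deriv 1 (Psi' e (e *. x) (e *. y)) K" by (rule Backlund_log_deriv(1)[OF beta n K eq])
 qed
 have Fc: "immersion 1 (Phi' X Y) = immersion 1 (Phi X Y) + cc *\<^sub>R Rot (Phi X Y 1) (hvec (cnj (theta X Y)))"
  and ldc': "EX K. log_deriv 1 (Phi' X Y) K" if XY: "X : {0..r}" "Y : {0..r}" for X Y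
 proof -
  obtain K where K: "log_deriv 1 (Phi X Y) K" using ldc[OF XY] by blast
  have eq: "!!l. Phi' X Y l = W_mat \<beta> (theta X Y) l ** Phi X Y l" using th[OF XY] by blast
  have n: "norm (theta X Y) = 1" using ntheta XY by blast
  show "immersion 1 (Phi' X Y) = immersion 1 (Phi X Y) + cc *\<^sub>R Rot (Phi X Y 1) (hvec (cnj (theta X Y)))"
   unfolding cc_def by (rule Backlund_log_deriv(2)[OF beta n K eq])
  show "EX K. log_deriv 1 (Phi' X Y) K" by (rule Backlund_log_deriv(1)[OF beta n K eq])
 qed
 have G'c: "Phi' X Y 1 = (Wlin (1 / \<beta>) (theta X Y) + M0) ** Phi X Y 1" if XY: "X : {0..r}" "Y : {0..r}" for X Y
  unfolding W1[symmetric] using th[OF XY] by blast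
 \<comment> \<open>The transformed \<open>a\<close> in the form delivered by
   \<open>bsys_tilde_near\<close>; the phases \<open>theta\<close> and \<open>cnj theta\<close>
   cancel by unimodularity.\<close>
 have va': "va a' i X Y = va a i X Y + theta X Y * (2 * cnj (va a i X Y) + of_real (\<beta> / 2) * (theta X Y - cnj (theta X Y))) * cnj (theta X Y)"
  if XY: "X : {0..r}" "Y : {0..r}" for X Y i
 proof -
  have u: "theta X Y * cnj (theta X Y) = 1" using ntheta XY by (intro cnj_unit) blast
  have "theta X Y * q * cnj (theta X Y) = (theta X Y * cnj (theta X Y)) * q" for q by (simp add: mult_ac)
  then have q: "theta X Y * q * cnj (theta X Y) = q" for q unfolding u by simp
  show ?thesis unfolding e1[OF XY] q unfolding va_def th[OF XY, THEN conjunct2, THEN conjunct2, THEN conjunct1] by (simp add: algebra_simps)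
 qed
 have we: "!!e i x y. (e::real) <= e" by simp
 have bdd: "bdd 0 0 (G1 Psi)" "bdd 0 0 t" using bds(3)[of 0] bt[of 0] by simp_all
 have lW: "lip (%i X Y. Wlin (1 / \<beta>) (theta X Y) + M0)" by (intro lip_add lip_linear[OF bounded_linear_Wlin] ltheta lip_const)
 have nW: "nearO 0 0 (%e i x y. Wlin (1 / \<beta>) (t e i x y) + M0) (%i X Y. Wlin (1 / \<beta>) (theta X Y) + M0)"
  by (intro near_add near_linear[OF bounded_linear_Wlin] nt near_one[OF we])
 have bW: "bd k 0 0 (%e i x y. Wlin (1 / \<beta>) (t e i x y) + M0)" for k by (intro bd_add bd_linear[OF bounded_linear_Wlin] bt bd_const)
 have nG: "nearO 0 0 (G1 Psi') (%i X Y. Phi' X Y 1)"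
  by (rule near_cong[OF near_matmult[OF nW nr(3) bW[of 0, unfolded bd0] lip_cbd[OF lp(3)]]]) (simp_all only: Gd G'c)
 have bG: "bd k 0 0 (G1 Psi')" for k by (rule bd_cong[OF bd_matmult[OF bW bds(3)]]) (rule Gd)
 have lG: "lip (%i X Y. Phi' X Y 1)" by (rule lip_cong[OF lip_matmult[OF lW lp(3)]]) (rule G'c)
 have bh: "bdd 0 0 (%e i x y. hvec (cnj (t e i x y)))" by (intro bdd_linear[OF bounded_linear_hvec] bdd_linear[OF bounded_linear_cnj] bdd)
 have lh: "lip (%i X Y. hvec (cnj (theta X Y)))" by (intro lip_linear[OF bounded_linear_hvec] lip_cnj ltheta)
 have lF: "lip (%i X Y. cc *\<^sub>R Rot (Phi X Y 1) (hvec (cnj (theta X Y))))"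
  by (intro lip_linear[OF bounded_linear_scaleR_right] lip_Rot lp lh)
 have nh: "nearO 0 0 (%e i x y. cc *\<^sub>R Rot (G1 Psi e i x y) (hvec (cnj (t e i x y)))) (%i X Y. cc *\<^sub>R Rot (Phi X Y 1) (hvec (cnj (theta X Y))))"
  by (intro near_linear[OF bounded_linear_scaleR_right] near_Rot nr near_linear[OF bounded_linear_hvec] near_cnj nt bdd bh lp lh)
 have nF: "nearO 0 0 (F1 Psi') (%i X Y. immersion 1 (Phi' X Y))"
  by (rule near_cong[OF near_add[OF nr(4) nh]]) (simp_all only: Fd Fc)
 have bF: "bd k 0 0 (F1 Psi')" for k
 proof (rule bd_cong[OF _ Fd])
  show "bd k 0 0 (%e i x y. F1 Psi e i x y + cc *\<^sub>R Rot (G1 Psi e i x y) (hvec (cnj (t e i x y))))"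
   by (intro bd_add bds bd_linear[OF bounded_linear_scaleR_right] bd_Rot bd_linear[OF bounded_linear_hvec] bd_cnj bt)
 qed
 have cF: "continuous_on ({0..r} \<times> {0..r}) (%(X, Y). immersion 1 (Phi' X Y))" if "i : I" for i
 proof (rule continuous_on_eq)
  show "continuous_on ({0..r} \<times> {0..r}) (%p. (case p of (X, Y) => immersion 1 (Phi X Y)) + (case p of (X, Y) => cc *\<^sub>R Rot (Phi X Y 1) (hvec (cnj (theta X Y)))))"
   by (intro continuous_on_add lip_continuous[OF lF that]) (use cont that in blast)
 qed (use Fc in auto)
 have nA: "nearO 1 0 (al (Af ae')) (va a')"
  by (rule near_cong[OF tn(1)]) (auto simp: al_def T1 va')
 have nb: "nearO 0 1 (bf be') (%i. b')"
  by (rule near_cong[OF tn(2)]) (use th in \<open>auto simp: T2 power2_eq_square\<close>)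
 have bA: "bd k 1 0 (al (Af ae'))" for k by (rule bd_cong[OF tbd(1)]) (auto simp: al_def T1)
 have bb: "bd k 0 1 (bf be')" for k by (rule bd_cong[OF tbd(2)]) (auto simp: T2)
 have lA: "lip (va a')"
  by (rule lip_cong[OF lip_add[OF lp(1) lip_mult[OF lip_mult[OF ltheta lip_add[OF lip_mult[OF lip_const lip_cnj[OF lp(1)]] lip_mult[OF lip_const lip_diff[OF ltheta lip_cnj[OF ltheta]]]]] lip_cnj[OF ltheta]]]]) (rule va')
 have lb: "lip (%i. b')"
  by (rule lip_cong[OF lip_mult[OF lp(2) lip_mult[OF ltheta ltheta]]]) (use th in \<open>simp add: power2_eq_square\<close>)
 have ds': "dsys (Af ae') (bf be')"
  by (rule dsys_cong[OF bsys_dsys[OF ds bs]]) (auto simp: T1 T2)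
 show ?thesis
  unfolding S' tracks.simps
  by (rule exI[of _ ae'], rule exI[of _ be'], rule exI[of _ Psi'])
   (intro conjI allI ballI impI Se' ds' bA bb bG bF nA nb nG nF lA lb lG cF ldc' ld'[OF _ i0]; simp)
qed

lemma tracks_exists:
 assumes tr: "tracks Se S" and I: "I ~= {}" and t0: "norm t0 = 1"
 shows "EX S'. Backlund r \<beta> t0 S S'" "ALL e:E. EX Se'. discrete_Backlund e r \<beta> t0 (Se e) Se'"
proof -
 obtain a b Phi where S: "S = (a, b, Phi)" by (cases S)
 obtain ae be Psi where Se: "Se = (%e. (ae e, be e, Psi e))" and ds: "dsys (Af ae) (bf be)"
  and bds: "!!k. bd k 1 0 (al (Af ae))" "!!k. bd k 0 1 (bf be)"
  and nr: "nearO 1 0 (al (Af ae)) (va a)" "nearO 0 1 (bf be) (%i. b)"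
  and lp: "lip (va a)" "lip (%i. b)"
  using tr unfolding S tracks.simps by (elim exE conjE) (rule that; simp)
 obtain i where i: "i : I" using I by blast
 show "ALL e:E. EX Se'. discrete_Backlund e r \<beta> t0 (Se e) Se'"
  unfolding Se using discrete_Backlund_exists[OF _ i ds t0] by fast
 obtain t where bs: "bsys (Af ae) (bf be) t" and ti: "!!e. e : E ==> t e i 0 0 = t0"
  using bsys_exists[OF ds, of "%_ _. t0"] t0 i by blast
 have "EX g. jet g & g 0 0 0 0 = t0 & (ALL X:{0..r}. ALL Y:{0..r}. norm (g 0 0 X Y) = 1 &
   g 1 0 X Y = g 0 0 X Y * (2 * cnj (va a i X Y) + of_real (\<beta> / 2) * (g 0 0 X Y - cnj (g 0 0 X Y))) &
   g 0 1 X Y = g 0 0 X Y * (of_real (1 / (2 * \<beta>)) * (b X Y * g 0 0 X Y - cnj (b X Y * g 0 0 X Y))))"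
  by (rule theta_limit[OF ds bs bds nr lp i ti]) assumption+
 then obtain g where g: "jet g" "g 0 0 0 0 = t0" and G: "!!X Y. X : {0..r} ==> Y : {0..r} ==> norm (g 0 0 X Y) = 1 &
   g 1 0 X Y = g 0 0 X Y * (2 * cnj (va a i X Y) + of_real (\<beta> / 2) * (g 0 0 X Y - cnj (g 0 0 X Y))) &
   g 0 1 X Y = g 0 0 X Y * (of_real (1 / (2 * \<beta>)) * (b X Y * g 0 0 X Y - cnj (b X Y * g 0 0 X Y)))" by blast
 define theta where "theta = g 0 0"
 have n: "ALL X:{0..r}. ALL Y:{0..r}. norm (theta X Y) = 1" and g0: "ALL X:{0..r}. ALL Y:{0..r}. g 0 0 X Y = theta X Y" using G by (simp_all add: theta_def)
 note aj = angle_jet[OF g(1) g0 n]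
 have im: "w - cnj w = 2 * \<i> * of_real (Im w)" for w by (simp add: complex_eq_iff)
 have ang: "angle_pdx r theta X Y = - a X Y + \<beta> * Im (theta X Y)" "angle_pdy r theta X Y = 1 / \<beta> * Im (b X Y * theta X Y)" if XY: "X : {0..r}" "Y : {0..r}" for X Y
 proof -
  have u: "cnj (theta X Y) * theta X Y = 1" using n XY cnj_unit[of "theta X Y"] by (simp add: mult.commute)
  have 1: "cnj (theta X Y) * g 1 0 X Y = \<i> * of_real (- a X Y + \<beta> * Im (theta X Y))"
  proof -
   have "cnj (theta X Y) * g 1 0 X Y = (cnj (theta X Y) * theta X Y) * (2 * cnj (va a i X Y) + of_real (\<beta> / 2) * (theta X Y - cnj (theta X Y)))"
    using G[OF XY] by (simp add: theta_def mult_ac)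
   then show ?thesis unfolding u im va_def by (simp add: algebra_simps)
  qed
  have 2: "cnj (theta X Y) * g 0 1 X Y = \<i> * of_real (1 / \<beta> * Im (b X Y * theta X Y))"
  proof -
   have "cnj (theta X Y) * g 0 1 X Y = (cnj (theta X Y) * theta X Y) * (of_real (1 / (2 * \<beta>)) * (b X Y * theta X Y - cnj (b X Y * theta X Y)))"
    using G[OF XY] by (simp only: theta_def mult_ac)
   moreover have "of_real (1 / (2 * \<beta>)) * (2 * \<i> * of_real w) = \<i> * of_real (1 / \<beta> * w)" for w by simp
   ultimately show ?thesis by (simp only: u im mult_1)
  qed
  show "angle_pdx r theta X Y = - a X Y + \<beta> * Im (theta X Y)" "angle_pdy r theta X Y = 1 / \<beta> * Im (b X Y * theta X Y)"
   unfolding aj(1,2)[OF XY] using 1 2 by (simp_all add: theta_def)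
 qed
 have "smooth_angle r theta" unfolding smooth_angle_def using jet_imp_smooth[OF g(1), of theta] n by (simp add: theta_def)
 then have "Backlund r \<beta> t0 (a, b, Phi) (%x y. a x y + 2 * angle_pdx r theta x y, %x y. b x y * (theta x y)\<^sup>2, %x y l. W_mat \<beta> (theta x y) l ** Phi x y l)"
  unfolding Backlund.simps by (intro exI[of _ theta]) (use g(2) ang in \<open>simp add: theta_def\<close>)
 then show "EX S'. Backlund r \<beta> t0 S S'" unfolding S by blast
qed

text \<open>The three claims are proved together because the intermediate states of an iteration are
  existential and each must again be tracked. The given discrete results are constrained only for
  steps in \<open>E\<close>, so they are replaced by a tracked family that agrees with them
  there.\<close>

theorem tracks_iterated:
 assumes "tracks Se S" "I ~= {}" "ALL t:set ts. norm t = 1"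
 shows "(EX S'. iterated (Backlund r \<beta>) ts S S') & (ALL e:E. EX Se'. iterated (discrete_Backlund e r \<beta>) ts (Se e) Se') &
  (ALL S' Se'. iterated (Backlund r \<beta>) ts S S' & (ALL e:E. iterated (discrete_Backlund e r \<beta>) ts (Se e) (Se' e)) -->
   (EX Se''. (ALL e:E. Se'' e = Se' e) & tracks Se'' S'))"
 using assms(1,3)
proof (induction ts arbitrary: S Se)
 case Nil
 then show ?case by (intro conjI allI impI exI[of _ Se]) auto
next
 case (Cons t ts)
 have t: "norm t = 1" and ts: "ALL t:set ts. norm t = 1" using Cons.prems by auto
 obtain U where U: "Backlund r \<beta> t S U" using tracks_exists(1)[OF Cons.prems(1) assms(2) t] by blast
 obtain Ue where Ue: "ALL e:E. discrete_Backlund e r \<beta> t (Se e) (Ue e)" using tracks_exists(2)[OF Cons.prems(1) assms(2) t] by metis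
 note IH = Cons.IH[OF tracks_step[OF Cons.prems(1) assms(2) U Ue] ts]
 show ?case
 proof (intro conjI allI impI)
  show "EX S'. iterated (Backlund r \<beta>) (t # ts) S S'" unfolding iterated.simps using IH[THEN conjunct1] U by blast
  show "ALL e:E. EX Se'. iterated (discrete_Backlund e r \<beta>) (t # ts) (Se e) Se'" unfolding iterated.simps using IH[THEN conjunct2, THEN conjunct1] Ue by blast
  fix S' Se' assume *: "iterated (Backlund r \<beta>) (t # ts) S S' & (ALL e:E. iterated (discrete_Backlund e r \<beta>) (t # ts) (Se e) (Se' e))"
  then obtain V where V: "Backlund r \<beta> t S V" "iterated (Backlund r \<beta>) ts V S'" by auto
  have "ALL e:E. EX v. discrete_Backlund e r \<beta> t (Se e) v & iterated (discrete_Backlund e r \<beta>) ts v (Se' e)" using * by simp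
  then obtain Ve where Ve: "ALL e:E. discrete_Backlund e r \<beta> t (Se e) (Ve e)" "ALL e:E. iterated (discrete_Backlund e r \<beta>) ts (Ve e) (Se' e)" by metis
  show "EX Se''. (ALL e:E. Se'' e = Se' e) & tracks Se'' S'"
   using Cons.IH[OF tracks_step[OF Cons.prems(1) assms(2) V(1) Ve(1)] ts] V(2) Ve(2) by blast
 qed
qed

end


lemma backlund_mesh: "0 < r ==> 0 < \<alpha> ==> backlund r (Backlund_mesh_sizes \<alpha>) \<alpha>"
proof (unfold_locales)
 assume \<alpha>: "0 < \<alpha>"
 obtain es where es: "!!n. es n : mesh_sizes" "es \<longlonglongrightarrow> 0" using mesh_null by blast
 have "0 < min (2 / \<alpha>) (2 * \<alpha>)" using \<alpha> by simp
 then have "\<forall>\<^sub>F n in sequentially. es n < min (2 / \<alpha>) (2 * \<alpha>)" by (rule order_tendstoD(2)[OF es(2)])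
 then obtain k where k: "!!n. n >= k ==> es n < min (2 / \<alpha>) (2 * \<alpha>)" unfolding eventually_sequentially by blast
 have "es (n + k) : Backlund_mesh_sizes \<alpha>" for n
  using k[of "n + k"] es(1) \<alpha> by (auto simp: Backlund_mesh_sizes_def field_simps)
 then show "EX es. (ALL n. es n : Backlund_mesh_sizes \<alpha>) & es \<longlonglongrightarrow> 0"
  using LIMSEQ_ignore_initial_segment[OF es(2), of k] by (intro exI[of _ "%n. es (n + k)"]) simp
qed (auto simp: Backlund_mesh_sizes_def)

theorem theorem4:
  fixes r :: real and a0 :: "real \<Rightarrow> real" and b0 :: "real \<Rightarrow> complex"
  assumes "r > 0"
    and "smooth_on_interval r a0"
    and "smooth_on_interval r b0" and "\<forall>y\<in>{0..r}. norm (b0 y) = 1"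
  shows
    "(\<exists>F. (\<exists>\<phi>. K_surface r \<phi> F \<and> Goursat_data r a0 b0 \<phi>) \<and>
        (\<forall>F'. (\<exists>\<phi>. K_surface r \<phi> F' \<and> Goursat_data r a0 b0 \<phi>) \<longrightarrow>
           (\<forall>x\<in>{0..r}. \<forall>y\<in>{0..r}. F' x y = F x y))) \<and>
     (\<forall>e\<in>mesh_sizes.
       (\<exists>F. (\<exists>a b. discrete_K_surface e r a b F \<and> discrete_boundary e r a0 b0 a b) \<and>
          (\<forall>F'. (\<exists>a b. discrete_K_surface e r a b F' \<and> discrete_boundary e r a0 b0 a b) \<longrightarrow>
             (\<forall>x\<in>grid e r. \<forall>y\<in>grid e r. F' x y = F x y))) \<and>
       (\<forall>a b. discrete_data e r a b \<and> discrete_boundary e r a0 b0 a b \<longrightarrow>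
          (\<exists>\<phi>. discrete_angle e r a b \<phi>) \<and>
          (\<forall>\<phi>. discrete_angle e r a b \<phi> \<longrightarrow>
             (\<forall>x\<in>grid e (r - e). \<phi> (x + e) 0 - \<phi> x 0 = e * a0 x) \<and>
             (\<forall>y\<in>grid e (r - e). cis (\<phi> 0 (y + e) + \<phi> 0 y) = (b0 y)\<^sup>2)))) \<and>
     (\<forall>\<phi> F A B Fe.
       K_surface r \<phi> F \<and> Goursat_data r a0 b0 \<phi> \<and>
       (\<forall>e\<in>mesh_sizes. discrete_K_surface e r (A e) (B e) (Fe e) \<and>
          discrete_boundary e r a0 b0 (A e) (B e)) \<longrightarrow>
       approximates r mesh_sizes {()} (\<lambda>e _. Fe e) (\<lambda>_. F)) \<and>
     (\<forall>\<phi> \<Phi> A B \<Psi>.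
       sine_Gordon r \<phi> \<and> Goursat_data r a0 b0 \<phi> \<and> frame r (angle_pdx r \<phi>) \<phi> \<Phi> \<and>
       (\<forall>e\<in>mesh_sizes. discrete_data e r (A e) (B e) \<and> discrete_boundary e r a0 b0 (A e) (B e) \<and>
          discrete_frame e r (A e) (B e) (\<Psi> e)) \<longrightarrow>
       (\<forall>\<Lambda>>1. approximates r mesh_sizes {1 / \<Lambda>..\<Lambda>}
          (\<lambda>e l x y. immersion l (\<Psi> e x y)) (\<lambda>l x y. immersion l (\<Phi> x y)))) \<and>
     (\<forall>\<phi> \<Phi> A B \<Psi>.
       sine_Gordon r \<phi> \<and> Goursat_data r a0 b0 \<phi> \<and> frame r (angle_pdx r \<phi>) \<phi> \<Phi> \<and>
       (\<forall>e\<in>mesh_sizes. discrete_data e r (A e) (B e) \<and> discrete_boundary e r a0 b0 (A e) (B e) \<and>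
          discrete_frame e r (A e) (B e) (\<Psi> e)) \<longrightarrow>
       (\<forall>\<alpha>>0. \<forall>\<theta>s. (\<forall>\<theta>\<in>set \<theta>s. norm \<theta> = 1) \<longrightarrow>
          (\<exists>D. iterated (Backlund r \<alpha>) \<theta>s (angle_pdx r \<phi>, \<phi>, \<Phi>) D) \<and>
          (\<forall>e\<in>Backlund_mesh_sizes \<alpha>.
             \<exists>De. iterated (discrete_Backlund e r \<alpha>) \<theta>s (A e, B e, \<Psi> e) De) \<and>
          (\<forall>D De.
             iterated (Backlund r \<alpha>) \<theta>s (angle_pdx r \<phi>, \<phi>, \<Phi>) D \<and>
             (\<forall>e\<in>Backlund_mesh_sizes \<alpha>.
                iterated (discrete_Backlund e r \<alpha>) \<theta>s (A e, B e, \<Psi> e) (De e)) \<longrightarrow>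
             approximates r (Backlund_mesh_sizes \<alpha>) {()}
               (\<lambda>e _. surface_of 1 (De e)) (\<lambda>_. surface_of 1 D))))"
proof (intro conjI)
 note r = assms(1) and sm = assms(2,3) and b0 = assms(4)
 \<comment> \<open>A single surface corresponds to a one-point index set with spectral parameter
   1.\<close>
 interpret f1: framed r mesh_sizes "{()}" "%_. 1" "max \<bar>1\<bar> \<bar>1 / 1\<bar>" by (rule framed_const[OF r]) simp
 obtain phi Phi where K: "K_surface r phi (%x y. immersion 1 (Phi x y))" "Goursat_data r a0 b0 phi"
  using K_surface_exists[OF r sm b0] by blast
 show "EX F. (EX phi. K_surface r phi F & Goursat_data r a0 b0 phi) &
    (ALL F'. (EX phi. K_surface r phi F' & Goursat_data r a0 b0 phi) --> (ALL x:{0..r}. ALL y:{0..r}. F' x y = F x y))"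
  by (rule exI[of _ "%x y. immersion 1 (Phi x y)"]) (use K K_surface_unique[OF r sm b0 K] in blast)
 show "ALL e:mesh_sizes.
    (EX F. (EX a b. discrete_K_surface e r a b F & discrete_boundary e r a0 b0 a b) &
     (ALL F'. (EX a b. discrete_K_surface e r a b F' & discrete_boundary e r a0 b0 a b) -->
       (ALL x:grid e r. ALL y:grid e r. F' x y = F x y))) &
    (ALL a b. discrete_data e r a b & discrete_boundary e r a0 b0 a b -->
     (EX phi. discrete_angle e r a b phi) &
     (ALL phi. discrete_angle e r a b phi -->
       (ALL x:grid e (r - e). phi (x + e) 0 - phi x 0 = e * a0 x) &
       (ALL y:grid e (r - e). cis (phi 0 (y + e) + phi 0 y) = (b0 y)\<^sup>2)))"
 proof (intro ballI conjI allI impI)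
  fix e assume e: "e : mesh_sizes"
  obtain a b where D: "discrete_data e r a b" "discrete_boundary e r a0 b0 a b" using f1.discrete_data_exists[OF e b0] by blast
  obtain Psi where P: "discrete_frame e r a b Psi" using f1.discrete_frame_exists[OF e D(1)] by blast
  have uniq: "F' x y = immersion 1 (Psi x y)"
   if dK: "discrete_K_surface e r a' b' F'" and dB: "discrete_boundary e r a0 b0 a' b'" and xy: "x : grid e r" "y : grid e r" for F' a' b' x y
  proof -
   obtain Psi' where d': "discrete_data e r a' b'" "discrete_frame e r a' b' Psi'" and F': "F' x y = immersion 1 (Psi' x y)"
    using dK xy unfolding discrete_K_surface_def by blast
   obtain k l where "x = e *. k" "k <= steps r e" "y = e *. l" "l <= steps r e" using xy f1.grid_iff[OF e] by auto
   then show ?thesis using f1.discrete_surface_unique[OF e D P d'(1) dB d'(2), of k l 1] F' by simp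
  qed
  have "discrete_K_surface e r a b (%x y. immersion 1 (Psi x y))"
   unfolding discrete_K_surface_def using D(1) P f1.discrete_surface_asymptotic[OF e D(1) P] by blast
  then show "EX F. (EX a b. discrete_K_surface e r a b F & discrete_boundary e r a0 b0 a b) &
     (ALL F'. (EX a b. discrete_K_surface e r a b F' & discrete_boundary e r a0 b0 a b) -->
       (ALL x:grid e r. ALL y:grid e r. F' x y = F x y))"
   by (intro exI[of _ "%x y. immersion 1 (Psi x y)"]) (use D(2) uniq in blast)
  fix a b assume d: "discrete_data e r a b & discrete_boundary e r a0 b0 a b"
  show "EX phi. discrete_angle e r a b phi" using f1.discrete_angle_exists[OF e] d by blast
  fix phi assume p: "discrete_angle e r a b phi"
  note A = f1.discrete_angle_boundary[OF e conjunct2[OF d] p]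
  show "phi (x + e) 0 - phi x 0 = e * a0 x" if "x : grid e (r - e)" for x using A(1) that by blast
  show "cis (phi 0 (y + e) + phi 0 y) = (b0 y)\<^sup>2" if "y : grid e (r - e)" for y using A(2) that by blast
 qed
 show "ALL phi F A B Fe.
    K_surface r phi F & Goursat_data r a0 b0 phi &
    (ALL e:mesh_sizes. discrete_K_surface e r (A e) (B e) (Fe e) & discrete_boundary e r a0 b0 (A e) (B e)) -->
    approximates r mesh_sizes {()} (%e _. Fe e) (%_. F)"
 proof (intro allI impI, elim conjE)
  fix phi F A B Fe
  assume F: "K_surface r phi F" and GD: "Goursat_data r a0 b0 phi"
   and D: "ALL e:mesh_sizes. discrete_K_surface e r (A e) (B e) (Fe e) & discrete_boundary e r a0 b0 (A e) (B e)"
  obtain Phi where SG: "sine_Gordon r phi" and fr: "frame r (angle_pdx r phi) phi Phi" and FPhi: "ALL x:{0..r}. ALL y:{0..r}. F x y = immersion 1 (Phi x y)"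
   using F unfolding K_surface_def by blast
  have "ALL e:mesh_sizes. EX Psi. discrete_frame e r (A e) (B e) Psi & (ALL x:grid e r. ALL y:grid e r. Fe e x y = immersion 1 (Psi x y))"
   using D unfolding discrete_K_surface_def by blast
  then obtain Psi where P: "ALL e:mesh_sizes. discrete_frame e r (A e) (B e) (Psi e) & (ALL x:grid e r. ALL y:grid e r. Fe e x y = immersion 1 (Psi e x y))"
   by metis
  have D': "!!e. e : mesh_sizes ==> discrete_data e r (A e) (B e)" "!!e. e : mesh_sizes ==> discrete_boundary e r a0 b0 (A e) (B e)"
   "!!e. e : mesh_sizes ==> discrete_frame e r (A e) (B e) (Psi e)" using D P unfolding discrete_K_surface_def by blast+
  note c = f1.core[OF sm D' SG GD fr]
  have g: "e *. x : grid e r" if "e : mesh_sizes" "x + 0 <= steps r e" for e x using f1.grid_iff[OF that(1)] that(2) by auto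
  have Fe: "Fe e (e *. x) (e *. y) = f1.Ff Psi e i x y" if "e : mesh_sizes" "x + 0 <= steps r e" "y + 0 <= steps r e" for e i x y
   unfolding f1.Ff_def using P g[OF that(1,2)] g[OF that(1,3)] that(1) by blast
  show "approximates r mesh_sizes {()} (%e _. Fe e) (%_. F)"
  proof (rule f1.approximatesI)
   show "f1.bd k 0 0 (%e i x y. Fe e (e *. x) (e *. y))" for k
    by (rule f1.bd_cong[OF c(2)]) (assumption | (rule Fe, assumption+))+
   show "f1.nearO 0 0 (%e i x y. Fe e (e *. x) (e *. y)) (%_. F)"
    by (rule f1.near_cong[OF c(4)]) (assumption | (rule Fe, assumption+) | (use FPhi in simp))+
   show "continuous_on ({0..r} \<times> {0..r}) (%(x, y). F x y)" if "i : {()}" for i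
    by (rule continuous_on_eq[OF c(7)]) (use FPhi in auto)
  qed
 qed
 show "ALL phi Phi A B Psi.
    sine_Gordon r phi & Goursat_data r a0 b0 phi & frame r (angle_pdx r phi) phi Phi &
    (ALL e:mesh_sizes. discrete_data e r (A e) (B e) & discrete_boundary e r a0 b0 (A e) (B e) &
     discrete_frame e r (A e) (B e) (Psi e)) -->
    (ALL Lam>1. approximates r mesh_sizes {1 / Lam..Lam}
     (%e l x y. immersion l (Psi e x y)) (%l x y. immersion l (Phi x y)))"
 proof (intro allI impI, elim conjE)
  fix phi Phi A B Psi and Lam :: real
  assume SG: "sine_Gordon r phi" and GD: "Goursat_data r a0 b0 phi" and fr: "frame r (angle_pdx r phi) phi Phi"
   and D: "ALL e:mesh_sizes. discrete_data e r (A e) (B e) & discrete_boundary e r a0 b0 (A e) (B e) & discrete_frame e r (A e) (B e) (Psi e)"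
   and L: "1 < Lam"
  \<comment> \<open>Here the index is the spectral parameter itself, which makes the constants
    uniform on the interval.\<close>
  interpret fL: framed r mesh_sizes "{1 / Lam..Lam}" "%l. l" Lam by (rule framed_interval[OF r L])
  have D': "!!e. e : mesh_sizes ==> discrete_data e r (A e) (B e)" "!!e. e : mesh_sizes ==> discrete_boundary e r a0 b0 (A e) (B e)"
   "!!e. e : mesh_sizes ==> discrete_frame e r (A e) (B e) (Psi e)" using D by blast+
  note c = fL.core[OF sm D' SG GD fr]
  show "approximates r mesh_sizes {1 / Lam..Lam} (%e l x y. immersion l (Psi e x y)) (%l x y. immersion l (Phi x y))"
   by (rule fL.approximatesI[OF c(2)[unfolded fL.Ff_def[abs_def]] c(4)[unfolded fL.Ff_def[abs_def]] c(7)])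
 qed
 show "ALL phi Phi A B Psi.
    sine_Gordon r phi & Goursat_data r a0 b0 phi & frame r (angle_pdx r phi) phi Phi &
    (ALL e:mesh_sizes. discrete_data e r (A e) (B e) & discrete_boundary e r a0 b0 (A e) (B e) &
     discrete_frame e r (A e) (B e) (Psi e)) -->
    (ALL \<alpha>>0. ALL thetas. (ALL theta:set thetas. norm theta = 1) -->
     (EX D. iterated (Backlund r \<alpha>) thetas (angle_pdx r phi, phi, Phi) D) &
     (ALL e:Backlund_mesh_sizes \<alpha>.
       EX De. iterated (discrete_Backlund e r \<alpha>) thetas (A e, B e, Psi e) De) &
     (ALL D De.
       iterated (Backlund r \<alpha>) thetas (angle_pdx r phi, phi, Phi) D &
       (ALL e:Backlund_mesh_sizes \<alpha>.
        iterated (discrete_Backlund e r \<alpha>) thetas (A e, B e, Psi e) (De e)) -->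
       approximates r (Backlund_mesh_sizes \<alpha>) {()}
        (%e _. surface_of 1 (De e)) (%_. surface_of 1 D)))"
 proof (intro allI impI, elim conjE)
  fix phi Phi A B Psi and \<alpha> :: real and thetas :: "complex list"
  assume SG: "sine_Gordon r phi" and GD: "Goursat_data r a0 b0 phi" and fr: "frame r (angle_pdx r phi) phi Phi"
   and D: "ALL e:mesh_sizes. discrete_data e r (A e) (B e) & discrete_boundary e r a0 b0 (A e) (B e) & discrete_frame e r (A e) (B e) (Psi e)"
   and \<alpha>: "0 < \<alpha>" and ts: "ALL theta:set thetas. norm theta = 1"
  let ?E = "Backlund_mesh_sizes \<alpha>"
  have sub: "?E \<subseteq> mesh_sizes" by (auto simp: Backlund_mesh_sizes_def)
  interpret bk: backlund r ?E "{()}" \<alpha> by (rule backlund_mesh[OF r \<alpha>])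
  \<comment> \<open>The untransformed estimates are instantiated over the restricted steps, so that
    they share the step set of the transformation.\<close>
  interpret fB: framed r ?E "{()}" "%_. 1" 1 by unfold_locales auto
  have D': "!!e. e : ?E ==> discrete_data e r (A e) (B e)" "!!e. e : ?E ==> discrete_boundary e r a0 b0 (A e) (B e)"
   "!!e. e : ?E ==> discrete_frame e r (A e) (B e) (Psi e)" using D sub by blast+
  have tr: "bk.tracks (%e. (A e, B e, Psi e)) (angle_pdx r phi, phi, Phi)"
  proof -
   note c = fB.core[OF sm D' SG GD fr]
   note s = bk.sine_Gordon_sys[OF SG] and n = bk.data_near[OF sm D'(1,2) SG GD] and b = bk.data_bd[OF sm D'(1,2)]
   have G: "bk.G1 Psi = fB.Gf Psi" "bk.F1 Psi = fB.Ff Psi" "bk.va (angle_pdx r phi) = bk.vv phi"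
    by (simp_all add: fun_eq_iff bk.G1_def bk.F1_def fB.Gf_def fB.Ff_def bk.va_def bk.vv_def)
   have ld: "EX K. log_deriv 1 (Psi e (e *. x) (e *. y)) K" if "e : ?E" "x <= steps r e" "y <= steps r e" for e x y
    by (rule bk.discrete_log_deriv(1)[OF that(1) D'(1)[OF that(1)] D'(3)[OF that(1)] _ that(2,3)]) simp
   show ?thesis unfolding bk.tracks.simps
    by (rule exI[of _ A], rule exI[of _ B], rule exI[of _ Psi], unfold G)
     (intro conjI allI ballI impI refl bk.data_dsys[OF D'(1)] b(1,2) c(1-4) n s(3,4) fB.frame_cont(3)[OF fr SG] c(6,7) ld; simp)
  qed
  note it = bk.tracks_iterated[OF tr insert_not_empty ts]
  show "(EX D. iterated (Backlund r \<alpha>) thetas (angle_pdx r phi, phi, Phi) D) &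
     (ALL e:?E. EX De. iterated (discrete_Backlund e r \<alpha>) thetas (A e, B e, Psi e) De) &
     (ALL D De. iterated (Backlund r \<alpha>) thetas (angle_pdx r phi, phi, Phi) D &
       (ALL e:?E. iterated (discrete_Backlund e r \<alpha>) thetas (A e, B e, Psi e) (De e)) -->
       approximates r ?E {()} (%e _. surface_of 1 (De e)) (%_. surface_of 1 D))"
  proof (intro conjI allI impI)
   show "EX D. iterated (Backlund r \<alpha>) thetas (angle_pdx r phi, phi, Phi) D" by (rule it[THEN conjunct1])
   show "ALL e:?E. EX De. iterated (discrete_Backlund e r \<alpha>) thetas (A e, B e, Psi e) De" by (rule it[THEN conjunct2, THEN conjunct1])
   fix S Se assume *: "iterated (Backlund r \<alpha>) thetas (angle_pdx r phi, phi, Phi) S & (ALL e:?E. iterated (discrete_Backlund e r \<alpha>) thetas (A e, B e, Psi e) (Se e))"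
   obtain Se' where Se': "ALL e:?E. Se' e = Se e" and tr': "bk.tracks Se' S"
    using it[THEN conjunct2, THEN conjunct2, rule_format, OF *] by blast
   obtain a b Phi' where S: "S = (a, b, Phi')" by (cases S)
   obtain Psi' where Se: "!!e. EX u w. Se' e = (u, w, Psi' e)" and bF: "!!k. bk.bd k 0 0 (bk.F1 Psi')"
    and nF: "bk.nearO 0 0 (bk.F1 Psi') (%i X Y. immersion 1 (Phi' X Y))"
    and cF: "ALL i:{()}. continuous_on ({0..r} \<times> {0..r}) (%(X, Y). immersion 1 (Phi' X Y))"
    using tr' unfolding S bk.tracks.simps by (elim exE conjE) (rule that; simp)
   have sf: "surface_of 1 (Se e) = (%x y. immersion 1 (Psi' e x y))" if "e : ?E" for e
    using Se[of e] Se' that by fastforce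
   show "approximates r ?E {()} (%e _. surface_of 1 (Se e)) (%_. surface_of 1 S)"
   proof (rule bk.approximatesI)
    show "bk.bd k 0 0 (%e i x y. surface_of 1 (Se e) (e *. x) (e *. y))" for k
     by (rule bk.bd_cong[OF bF]) (simp add: sf bk.F1_def)
    show "bk.nearO 0 0 (%e i x y. surface_of 1 (Se e) (e *. x) (e *. y)) (%_. surface_of 1 S)"
     by (rule bk.near_cong[OF nF]) (simp_all add: sf bk.F1_def S)
    show "continuous_on ({0..r} \<times> {0..r}) (%(x, y). surface_of 1 S x y)" if "i : {()}" for i
     using cF by (simp add: S)
   qed
  qed
 qed
qed

end
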